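(* Let $k\ge1$ and suppose $\mathcal H/C_k$ is finite-dimensional. Let $\mathbf v\in X$ and let $U\subset X$ be a simply connected neighborhood of $\mathbf v$. Then any $\eta\in A_{\mathbf v}^*=(\mathcal H/O_{\mathbf v})^*$ may be uniquely extended to a section $\tilde\eta\in\Gamma(U,A^* )$ (so $\tilde\eta(\mathbf v)=\eta$) such that for any $\chi\in\mathcal H$, all $i\in\{1,\dots,k\}$ and all $\mathbf u\in U$, $$\tilde\eta(\mathbf u)\big(L^i(\mathbf u)\chi\big)=\frac{\partial}{\partial u_i}\,\tilde\eta(\mathbf u)(\chi).$$
   Context: **Chiral theory.** $\mathbb P=\mathbb C\cup\{\infty\}$ is the Riemann sphere; $\oint$ denotes a contour integral normalized by $1/(2\pi i)$. Fix a chiral bosonic conformal field theory on $\mathbb P$ in the sense of Gaberdiel and Goddard. It is given by a graded complex vector space $V=\bigoplus_{h=0}^\infty V^h$ with each $V^h$ finite-dimensional, together with amplitudes $\langle\prod_{a=1}^l V(\psi_a,z_a)\rangle$ for homogeneous $\psi_a\in V^{h_a}$. The amplitudes are multilinear in the $\psi_a$, invariant under permutations of the pairs $(\psi_a,z_a)$, and such that $\langle\prod_a V(\psi_a,z_a)\rangle\prod_a dz_a^{\otimes h_a}$ is meromorphic on $\mathbb P^l$ with poles only at $z_a=z_b$, and Möbius invariant. They are nondegenerate (a $\psi$ all of whose amplitudes vanish is $0$) and satisfy cluster decomposition: $\lambda^{\sum_j h_j}\langle\prod_i V(\phi_i,\zeta_i)\prod_j V(\psi_j,\lambda z_j)\rangle\to\langle\prod_i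 V(\phi_i,\zeta_i)\rangle\langle\prod_j V(\psi_j,z_j)\rangle$ as $\lambda\to0$. The modes are $V_n(\psi)=\oint_0 z^{n+h_\psi-1}V(\psi,z)\,dz$, i.e. $V(\psi,z)=\sum_n V_n(\psi)z^{-n-h_\psi}$. The Fock space at $0$, $\mathcal H$, is spanned by $V_{n_1}(\psi_1)\cdots V_{n_r}(\psi_r)\Omega$ ($\psi_i\in V$, $\Omega$ the vacuum; contours $|z_1|>\dots>|z_r|$), where two linear combinations are identified iff they agree in all amplitudes with vertex operators inserted away from $0$. It is graded by conformal weight $h\ge0$, $V_n(\psi)$ lowers weight by $n$, and $V\subset\mathcal H$ via $\psi=V_{-h_\psi}(\psi)\Omega$. Vertex operators $V(\chi,z)=\sum_nV_n(\chi)z^{-n-h_\chi}$ are defined for all homogeneous $\chi\in\mathcal H$, with $V(\phi,z)V(\chi,w)=\sum_n (z-w)^nV(V_{-n-h_\phi}(\phi)\chi,w)$ inside amplitudes. There is a Virasoro field $L(z)=\sum_n L_nz^{-n-2}$, the vertex operator of a state in $V^2$, whose modes satisfy the Virasoro algebra; $L_0$ gives the grading, and $V(L_{-1}\chi,z)=\partial_zV(\chi,z)$. $V$ is the space of all quasiprimary states ($L_1\psi=0$) in $\mathcal H$, and $\mathcal H$ is spanned by the $L_{-1}^n\psi$, $\psi\in V$. **Divisors.** For a meromorphic function $f$ and $m\in\mathbb Z$, the divisor of $f\,dz^{\otimes m}$ is $\mathrm{div}(f\,dz^{\otimes m})=\sum_{P}\nu_P(f)[P]-2m[\infty]$, $\nu_P$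 being order of vanishing; the coefficient at $P$ is written $\nu_P(f\,dz^{\otimes m})$. $D\ge D'$ means all coefficients of $D-D'$ are $\ge0$. **The subspaces $O_{\mathbf u}$ and $C_k$.** For $\mathbf u\in(\mathbb P\setminus\{0\})^k$, $$O_{\mathbf u}=\mathrm{Span}\Big\{\oint_0dz\,g(z)V(\psi,z)\chi\ \Big|\ \chi\in\mathcal H,\ \psi\in V\text{ homogeneous},\ \mathrm{div}\big(g\,dz^{\otimes(1-h_\psi)}\big)\ge -N[0]+\sum_{i=1}^kh_\psi[u_i]\text{ for some }N\Big\}\subset\mathcal H,$$ with $g$ meromorphic on $\mathbb P$. At $\mathbf u=(\infty,\dots,\infty)$ this is $$C_k=\mathrm{Span}\{V_{-N-(k-1)h}(\psi)\chi\mid\chi\in\mathcal H,\ \psi\in V^h,\ h\ge 0,\ N\ge1\}.$$ **Sheaves.** $X=\{\mathbf u\in\mathbb P^k: u_i\ne u_j\ \forall i\ne j,\ u_i\ne0\ \forall i\}$. $B=X\times\mathcal H$; for open $U\subset X$, $\Gamma(U,B)$ is the space of holomorphic sections of $B$ over $U$ (holomorphic sections of some finite-dimensional subbundle, i.e. holomorphic maps into a finite-dimensional subspace of $\mathcal H$). $\Gamma(U,O)=\{s\in\Gamma(U,B): s(\mathbf u)\in O_{\mathbf u}\ \forall\mathbf u\in U\}$ and $\Gamma(U,A)=\Gamma(U,B)/\Gamma(U,O)$; $A_{\mathbf u}=\mathcal H/O_{\mathbf u}$. A section of the dual sheaf $A^*$ over $U$ assigns to each $\mathbf u\in U$ a linear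 functional $\tilde\eta(\mathbf u)$ on $\mathcal H$ vanishing on $O_{\mathbf u}$, such that $\mathbf u\mapsto\tilde\eta(\mathbf u)(\chi)$ is holomorphic for each $\chi\in\mathcal H$. **The operators $L^i(\mathbf u)$.** For $i\in\{1,\dots,k\}$ and $\mathbf u\in X$, $L^i(\mathbf u):\mathcal H\to\mathcal H$ is $$L^i(\mathbf u)=-\oint_0dz\,L(z)f^i_{\mathbf u}(z),$$ where $f^i_{\mathbf u}$ is a meromorphic function on $\mathbb P$ such that $f^i_{\mathbf u}\,dz^{\otimes -1}$ is holomorphic on $\mathbb P\setminus\{0\}$ and $\nu_{u_j}\big((f^i_{\mathbf u}-\delta^{ij})\,dz^{\otimes-1}\big)\ge2$ for all $j$ (so $f^i_{\mathbf u}-1$ has a double zero at $u_i$ and $f^i_{\mathbf u}$ a double zero at $u_j$, $j\ne i$, when these points are finite). Different choices of $f^i_{\mathbf u}$ change $L^i(\mathbf u)$ only by maps $\mathcal H\to O_{\mathbf u}$, so $\tilde\eta(\mathbf u)\circ L^i(\mathbf u)$ does not depend on the choice.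
   Formalization: All points of U are required to have finite coordinates u_i; if U may contain points with u_i = ∞, then ∂/∂u_i is not a coordinate derivative there and the extension can fail to exist through monodromy around u_i = ∞ (e.g. level-1 su(2), k = 2). *)

theory Defs
  imports
    "HOL-Library.FuncSet"
    "HOL-Library.Multiset"
    "HOL-Analysis.Analysis"
    "HOL-Complex_Analysis.Complex_Analysis"
begin

section \<open>The Riemann sphere\<close>

datatype rsphere = Pt complex | Infty

instantiation rsphere :: topological_space
begin

definition open_rsphere :: "rsphere set \<Rightarrow> bool" where
  "open_rsphere S \<longleftrightarrow> open {z. Pt z \<in> S} \<and> (Infty \<in> S \<longrightarrow> compact {z. Pt z \<notin> S})"

instance
proof
  show "open (UNIV :: rsphere set)"
    by (simp add: open_rsphere_def)
next
  fix S T :: "rsphere set"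
  assume "open S" "open T"
  moreover have "{z. Pt z \<in> S \<inter> T} = {z. Pt z \<in> S} \<inter> {z. Pt z \<in> T}"
    and "{z. Pt z \<notin> S \<inter> T} = {z. Pt z \<notin> S} \<union> {z. Pt z \<notin> T}"
    by auto
  ultimately show "open (S \<inter> T)"
    unfolding open_rsphere_def by (auto simp del: Int_iff)
next
  fix K :: "rsphere set set"
  assume K: "\<forall>S\<in>K. open S"
  have op: "open {z. Pt z \<in> \<Union>K}"
  proof -
    have "{z. Pt z \<in> \<Union>K} = (\<Union>S\<in>K. {z. Pt z \<in> S})" by auto
    then show ?thesis using K by (auto simp: open_rsphere_def)
  qed
  moreover have "compact {z. Pt z \<notin> \<Union>K}" if "Infty \<in> \<Union>K"
  proof -
    from that obtain S where S: "S \<in> K" "Infty \<in> S" by auto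
    have "closed {z. Pt z \<notin> \<Union>K}"
    proof -
      have "- {z. Pt z \<notin> \<Union>K} = {z. Pt z \<in> \<Union>K}" by auto
      then show ?thesis using op unfolding closed_def by simp
    qed
    moreover have "compact {z. Pt z \<notin> S}"
      using K S by (auto simp: open_rsphere_def)
    moreover have "{z. Pt z \<notin> \<Union>K} = {z. Pt z \<notin> S} \<inter> {z. Pt z \<notin> \<Union>K}"
      using S by auto
    ultimately show ?thesis by (metis compact_Int_closed)
  qed
  ultimately show "open (\<Union>K)"
    unfolding open_rsphere_def by blast
qed

end

text \<open>
  A local coordinate \<open>w\<close> centred at a point of the sphere.
\<close>

fun chart :: "rsphere \<Rightarrow> complex \<Rightarrow> rsphere" where
  "chart (Pt c) w = Pt (c + w)"
| "chart Infty w = (if w = 0 then Infty else Pt (1 / w))"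

text \<open>
  Holomorphic functions of several variables, on open subsets of \<open>\<complex>\<^sup>I\<close> and of \<open>\<P>\<^sup>I\<close>:
  continuous, and holomorphic in each variable separately (by Osgood's lemma this is
  joint holomorphy).  Function types carry the product topology.
\<close>

definition holo_several :: "('i \<Rightarrow> complex) set \<Rightarrow> (('i \<Rightarrow> complex) \<Rightarrow> complex) \<Rightarrow> bool" where
  "holo_several S F \<longleftrightarrow> continuous_on S F \<and>
     (\<forall>z\<in>S. \<forall>i. (\<lambda>w. F (z(i := w))) field_differentiable (at (z i)))"

definition holo_sphere :: "('i \<Rightarrow> rsphere) set \<Rightarrow> (('i \<Rightarrow> rsphere) \<Rightarrow> complex) \<Rightarrow> bool" where
  "holo_sphere U F \<longleftrightarrow> continuous_on U F \<and>
     (\<forall>u\<in>U. \<forall>i. (\<lambda>w. F (u(i := chart (u i) w))) field_differentiable (at 0))"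

text \<open>
  Meromorphic functions on the sphere are represented by functions on \<open>\<complex>\<close>; as usual for
  \<^const>\<open>meromorphic_on\<close>, values at isolated points are irrelevant.
\<close>

definition meromorphic_sphere :: "(complex \<Rightarrow> complex) \<Rightarrow> bool" where
  "meromorphic_sphere f \<longleftrightarrow>
     f meromorphic_on UNIV \<and> (\<lambda>w. f (1 / w)) meromorphic_on {0}"

text \<open>
  \<open>diff_order_ge f m P n\<close> says \<open>\<nu>\<^sub>P(f dz\<^sup>m) \<ge> n\<close>.  The zero function has order infinity
  everywhere, which \<^const>\<open>zorder\<close> does not provide.
\<close>

fun diff_order_ge :: "(complex \<Rightarrow> complex) \<Rightarrow> int \<Rightarrow> rsphere \<Rightarrow> int \<Rightarrow> bool" where
  "diff_order_ge f m (Pt p) n \<longleftrightarrow>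
     (\<forall>\<^sub>F z in at p. f z = 0) \<or> zorder f p \<ge> n"
| "diff_order_ge f m Infty n \<longleftrightarrow>
     (\<forall>\<^sub>F w in at 0. f (1 / w) = 0) \<or> zorder (\<lambda>w. f (1 / w)) 0 - 2 * m \<ge> n"


section \<open>Chiral conformal field theory\<close>

text \<open>
  The type \<open>'h\<close> is the Fock space \<open>\<H>\<close>; the generating space \<open>V\<close> is regarded as a subspace
  of it.  For homogeneous \<open>\<xi>\<close>, \<open>mode T \<xi> n\<close> is \<open>V\<^sub>n(\<xi>)\<close>.  The value of \<open>amp T\<close> on the list
  \<open>[(\<xi>\<^sub>1, z\<^sub>1), \<dots>, (\<xi>\<^sub>l, z\<^sub>l)]\<close> is the amplitude of the product of the \<open>V(\<xi>\<^sub>a, z\<^sub>a)\<close>; it is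
  meaningful only for pairwise distinct \<open>z\<^sub>a\<close>.
\<close>

record 'h chiral_data =
  smult :: "complex \<Rightarrow> 'h \<Rightarrow> 'h"
  gen :: "nat \<Rightarrow> 'h set"
  amp :: "('h \<times> complex) list \<Rightarrow> complex"
  vac :: 'h
  mode :: "'h \<Rightarrow> int \<Rightarrow> 'h \<Rightarrow> 'h"
  vir :: 'h
  charge :: complex

abbreviation Lmode :: "('h, 'b) chiral_data_scheme \<Rightarrow> int \<Rightarrow> 'h \<Rightarrow> 'h" where
  "Lmode T n \<equiv> mode T (vir T) n"

definition weight_space :: "('h, 'b) chiral_data_scheme \<Rightarrow> int \<Rightarrow> 'h set" where
  "weight_space T j = {\<xi>. Lmode T 0 \<xi> = smult T (of_int j) \<xi>}"

text \<open>
  Lists of insertions \<open>(h, \<psi>, z)\<close> of homogeneous generating states \<open>\<psi> \<in> V\<^sup>h\<close> at distinct points.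
\<close>

definition insertions :: "('h, 'b) chiral_data_scheme \<Rightarrow> (nat \<times> 'h \<times> complex) list \<Rightarrow> bool" where
  "insertions T xs \<longleftrightarrow>
     (\<forall>(h, \<psi>, z)\<in>set xs. \<psi> \<in> gen T h) \<and> distinct (map (\<lambda>(h, \<psi>, z). z) xs)"

definition amp_gen :: "('h, 'b) chiral_data_scheme \<Rightarrow> (nat \<times> 'h \<times> complex) list \<Rightarrow> complex" where
  "amp_gen T xs = amp T (map (\<lambda>(h, \<psi>, z). (\<psi>, z)) xs)"

text \<open>
  The amplitudes of the generating states.  Amplitudes are used at finite points only: the
  behaviour of \<open>\<langle>\<dots>\<rangle> \<Prod> dz\<^sub>a\<^sup>h\<close> near points of \<open>\<P>\<^sup>l\<close> with infinite coordinates is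
  determined by the assumptions \<open>meromorphic\<close> and \<open>moebius\<close>, because a Moebius transformation
  carries any finite set of points of the sphere into \<open>\<complex>\<close>.  In \<open>cluster\<close>, the points carrying
  the first group have to be nonzero, since otherwise they may collide with the second group.
\<close>

locale chiral_amplitudes =
  fixes T :: "('h::ab_group_add, 'b) chiral_data_scheme"
  assumes vector_space: "vector_space (smult T)"
    and gen_fin_dim: "\<And>h. \<exists>B. finite B \<and> gen T h = module.span (smult T) B"
    and gen_direct: "\<And>I \<psi>. finite I \<Longrightarrow> (\<And>h. h \<in> I \<Longrightarrow> \<psi> h \<in> gen T h) \<Longrightarrow>
           (\<Sum>h\<in>I. \<psi> h) = 0 \<Longrightarrow> (\<forall>h\<in>I. \<psi> h = 0)"
    and amp_gen_add: "\<And>h \<psi> \<psi>' z xs. insertions T ((h, \<psi>, z) # xs) \<Longrightarrow> \<psi>' \<in> gen T h \<Longrightarrow>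
           amp_gen T ((h, \<psi> + \<psi>', z) # xs)
             = amp_gen T ((h, \<psi>, z) # xs) + amp_gen T ((h, \<psi>', z) # xs)"
    and amp_gen_scale: "\<And>h \<psi> z xs a. insertions T ((h, \<psi>, z) # xs) \<Longrightarrow>
           amp_gen T ((h, smult T a \<psi>, z) # xs) = a * amp_gen T ((h, \<psi>, z) # xs)"
    and amp_gen_perm: "\<And>xs ys. insertions T xs \<Longrightarrow> mset xs = mset ys \<Longrightarrow>
           amp_gen T xs = amp_gen T ys"
    and meromorphic: "\<And>\<psi>s. set \<psi>s \<subseteq> (\<Union>h. gen T h) \<Longrightarrow>
           \<exists>N::nat. \<exists>G. holo_several UNIV G \<and>
             (\<forall>z :: nat \<Rightarrow> complex. inj_on z {..<length \<psi>s} \<longrightarrow>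
                amp T (zip \<psi>s (map z [0..<length \<psi>s]))
                  * (\<Prod>b<length \<psi>s. \<Prod>a<b. (z a - z b) ^ N) = G z)"
    and moebius: "\<And>a b c d xs. a * d - b * c \<noteq> 0 \<Longrightarrow> insertions T xs \<Longrightarrow>
           (\<forall>(h, \<psi>, z)\<in>set xs. c * z + d \<noteq> 0) \<Longrightarrow>
           amp_gen T xs
             = prod_list (map (\<lambda>(h, \<psi>, z). ((a * d - b * c) / (c * z + d)\<^sup>2) ^ h) xs)
               * amp_gen T (map (\<lambda>(h, \<psi>, z). (h, \<psi>, (a * z + b) / (c * z + d))) xs)"
    and gen_nondegenerate: "\<And>h \<psi>. \<psi> \<in> gen T h \<Longrightarrow>
           (\<And>z xs. insertions T ((h, \<psi>, z) # xs) \<Longrightarrow> amp_gen T ((h, \<psi>, z) # xs) = 0) \<Longrightarrow> \<psi> = 0"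
    and cluster: "\<And>xs ys. insertions T xs \<Longrightarrow> insertions T ys \<Longrightarrow>
           (\<forall>(h, \<phi>, \<zeta>)\<in>set xs. \<zeta> \<noteq> 0) \<Longrightarrow>
           ((\<lambda>l. l ^ sum_list (map fst ys)
                  * amp_gen T (xs @ map (\<lambda>(h, \<psi>, z). (h, \<psi>, l * z)) ys))
             \<longlongrightarrow> amp_gen T xs * amp_gen T ys) (at 0)"

inductive_set fock_words :: "('h, 'b) chiral_data_scheme \<Rightarrow> 'h set" for T where
  "vac T \<in> fock_words T"
| "\<xi> \<in> fock_words T \<Longrightarrow> \<psi> \<in> gen T h \<Longrightarrow> mode T \<psi> n \<xi> \<in> fock_words T"

text \<open>
  The Fock space, and amplitudes of arbitrary states in it.  The assumption \<open>ope\<close> is the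
  expansion \<open>V(\<phi>, z) V(\<xi>, w) = \<Sum>\<^sub>n (z - w)\<^sup>n V(V\<^bsub>-n-h\<^esub>(\<phi>) \<xi>, w)\<close> inside amplitudes.  Reading off
  Laurent coefficients at \<open>w = 0\<close>, it expresses an amplitude with a state
  \<open>V\<^sub>n\<^sub>1(\<psi>\<^sub>1) \<cdots> V\<^sub>n\<^sub>r(\<psi>\<^sub>r) \<Omega>\<close> at \<open>0\<close> as the iterated contour integral, with
  \<open>|z\<^sub>1| > \<dots> > |z\<^sub>r|\<close>, of amplitudes of generating states; \<open>separating\<close> then is the
  identification of linear combinations that agree in all amplitudes with generating vertex
  operators inserted away from \<open>0\<close>.
\<close>

locale chiral_theory = chiral_amplitudes +
  assumes amp_add: "\<And>\<xi> \<xi>' z xs. distinct (z # map snd xs) \<Longrightarrow>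
           amp T ((\<xi> + \<xi>', z) # xs) = amp T ((\<xi>, z) # xs) + amp T ((\<xi>', z) # xs)"
    and amp_scale: "\<And>a \<xi> z xs. distinct (z # map snd xs) \<Longrightarrow>
           amp T ((smult T a \<xi>, z) # xs) = a * amp T ((\<xi>, z) # xs)"
    and amp_perm: "\<And>xs ys. distinct (map snd xs) \<Longrightarrow> mset xs = mset ys \<Longrightarrow> amp T xs = amp T ys"
    and amp_vac: "\<And>z xs. distinct (z # map snd xs) \<Longrightarrow> amp T ((vac T, z) # xs) = amp T xs"
    and ope: "\<And>h \<phi> z \<xi> w xs. \<phi> \<in> weight_space T h \<Longrightarrow> distinct (z # w # map snd xs) \<Longrightarrow>
           (\<forall>x\<in>snd ` set xs. cmod (z - w) < cmod (x - w)) \<Longrightarrow>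
           ((\<lambda>n. (z - w) powi n * amp T ((mode T \<phi> (- n - h) \<xi>, w) # xs))
              has_sum amp T ((\<phi>, z) # (\<xi>, w) # xs)) UNIV"
    and separating: "\<And>\<xi>. (\<And>xs. insertions T xs \<Longrightarrow> (\<forall>(h, \<psi>, z)\<in>set xs. z \<noteq> 0) \<Longrightarrow>
           amp T ((\<xi>, 0) # map (\<lambda>(h, \<psi>, z). (\<psi>, z)) xs) = 0) \<Longrightarrow> \<xi> = 0"
    and mode_linear: "\<And>h \<phi> n. \<phi> \<in> weight_space T h \<Longrightarrow>
           Vector_Spaces.linear (smult T) (smult T) (mode T \<phi> n)"
    and fock_span: "module.span (smult T) (fock_words T) = UNIV"
    and state_of_gen: "\<And>h \<psi>. \<psi> \<in> gen T h \<Longrightarrow> mode T \<psi> (- int h) (vac T) = \<psi>"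
    and vir_gen: "vir T \<in> gen T 2"
    and virasoro: "\<And>m n \<xi>. Lmode T m (Lmode T n \<xi>) - Lmode T n (Lmode T m \<xi>)
           = smult T (of_int (m - n)) (Lmode T (m + n) \<xi>)
             + (if m + n = 0 then smult T (charge T / 12 * of_int (m ^ 3 - m)) \<xi> else 0)"
    and weight_graded: "module.span (smult T) (\<Union>j::nat. weight_space T (int j)) = UNIV"
    and mode_weight: "\<And>h \<phi> n j \<xi>. \<phi> \<in> weight_space T h \<Longrightarrow> \<xi> \<in> weight_space T j \<Longrightarrow>
           mode T \<phi> n \<xi> \<in> weight_space T (j - n)"
    and translation: "\<And>h \<xi> z xs. \<xi> \<in> weight_space T h \<Longrightarrow> distinct (z # map snd xs) \<Longrightarrow>
           ((\<lambda>x. amp T ((\<xi>, x) # xs)) has_field_derivative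
              amp T ((Lmode T (-1) \<xi>, z) # xs)) (at z)"
    and gen_quasiprimary: "\<And>h. gen T h = {\<xi> \<in> weight_space T (int h). Lmode T 1 \<xi> = 0}"
    and quasiprimary_span: "module.span (smult T)
           {(Lmode T (-1) ^^ n) \<psi> | n \<psi> h. \<psi> \<in> gen T h} = UNIV"


section \<open>The subspaces \<open>O\<^sub>u\<close> and \<open>C\<^sub>k\<close>\<close>

text \<open>
  \<open>contour T h \<psi> g \<xi>\<close> is \<open>\<oint>\<^sub>0 dz g(z) V(\<psi>, z) \<xi>\<close>, i.e. the sum over \<open>n\<close> of \<open>V\<^sub>n(\<psi>) \<xi>\<close> times
  the residue of \<open>g(z) z\<^bsup>-n-h\<^esup>\<close>.  For \<open>g\<close> meromorphic at \<open>0\<close> only finitely many terms are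
  nonzero: the residue vanishes for \<open>n\<close> sufficiently negative, and \<open>V\<^sub>n(\<psi>) \<xi>\<close> for \<open>n\<close>
  sufficiently positive.
\<close>

definition contour :: "('h::ab_group_add, 'b) chiral_data_scheme \<Rightarrow> nat \<Rightarrow> 'h \<Rightarrow>
    (complex \<Rightarrow> complex) \<Rightarrow> 'h \<Rightarrow> 'h" where
  "contour T h \<psi> g \<xi> =
     (\<Sum>n | residue (\<lambda>z. g z * z powi (- n - int h)) 0 \<noteq> 0 \<and> mode T \<psi> n \<xi> \<noteq> 0.
        smult T (residue (\<lambda>z. g z * z powi (- n - int h)) 0) (mode T \<psi> n \<xi>))"

definition O_space :: "('h::ab_group_add, 'b) chiral_data_scheme \<Rightarrow> ('k::finite \<Rightarrow> rsphere) \<Rightarrow> 'h set"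
  where
  "O_space T u = module.span (smult T)
     {contour T h \<psi> g \<xi> | h \<psi> g \<xi>. \<psi> \<in> gen T h \<and> meromorphic_sphere g \<and>
        (\<exists>N::nat. \<forall>P. diff_order_ge g (1 - int h) P
           ((if P = Pt 0 then - int N else 0) + int h * int (card {i. u i = P})))}"

definition C_space :: "('h::ab_group_add, 'b) chiral_data_scheme \<Rightarrow> nat \<Rightarrow> 'h set" where
  "C_space T k = module.span (smult T)
     {mode T \<psi> (- int N - (int k - 1) * int h) \<xi> | N h \<psi> \<xi>. \<psi> \<in> gen T h \<and> N \<ge> 1}"

definition finite_codim :: "('h::ab_group_add, 'b) chiral_data_scheme \<Rightarrow> 'h set \<Rightarrow> bool" where
  "finite_codim T S \<longleftrightarrow> (\<exists>B. finite B \<and> module.span (smult T) (S \<union> B) = UNIV)"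


section \<open>The dual sheaf and the operators \<open>L\<^sup>i(u)\<close>\<close>

definition config_space :: "('k::finite \<Rightarrow> rsphere) set" where
  "config_space = {u. inj u \<and> (\<forall>i. u i \<noteq> Pt 0)}"

text \<open>
  The dual of \<open>\<H> / O\<^sub>u\<close>, as the functionals on \<open>\<H>\<close> that vanish on \<open>O\<^sub>u\<close>.
\<close>

definition dual_fibre :: "('h::ab_group_add, 'b) chiral_data_scheme \<Rightarrow> ('k::finite \<Rightarrow> rsphere) \<Rightarrow>
    ('h \<Rightarrow> complex) set" where
  "dual_fibre T u =
     {\<eta>. Vector_Spaces.linear (smult T) (*) \<eta> \<and> (\<forall>\<xi>\<in>O_space T u. \<eta> \<xi> = 0)}"

text \<open>
  Sections over \<open>U\<close>; membership in \<^const>\<open>extensional\<close> makes equality of sections mean equality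
  on \<open>U\<close>.
\<close>

definition dual_sections :: "('h::ab_group_add, 'b) chiral_data_scheme \<Rightarrow>
    ('k::finite \<Rightarrow> rsphere) set \<Rightarrow> (('k \<Rightarrow> rsphere) \<Rightarrow> 'h \<Rightarrow> complex) set" where
  "dual_sections T U =
     {s \<in> extensional U. (\<forall>u\<in>U. s u \<in> dual_fibre T u) \<and> (\<forall>\<xi>. holo_sphere U (\<lambda>u. s u \<xi>))}"

text \<open>
  The conditions on \<open>f = f\<^sup>i\<^sub>u\<close>.  The vector field \<open>\<partial>/\<partial>u\<^sub>i\<close> vanishes to second order at
  \<open>u\<^sub>i = \<infinity>\<close>, where \<open>f = 0\<close> becomes admissible, so \<open>\<partial>/\<partial>u\<^sub>i \<eta>(u) = \<eta>(u) \<circ> L\<^sup>i(u)\<close> is a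
  nondegenerate system only where all \<open>u\<^sub>i\<close> are finite: near \<open>u\<^sub>i = \<infinity>\<close> its solutions behave
  like \<open>u\<^sub>i\<^bsup>-2h\<^esup>\<close> for conformal weights \<open>h\<close> of representations at \<open>u\<^sub>i\<close>.
\<close>

definition connection_fun :: "('k::finite \<Rightarrow> rsphere) \<Rightarrow> 'k \<Rightarrow> (complex \<Rightarrow> complex) \<Rightarrow> bool" where
  "connection_fun u i f \<longleftrightarrow> meromorphic_sphere f \<and>
     (\<forall>P. P \<noteq> Pt 0 \<longrightarrow> diff_order_ge f (-1) P 0) \<and>
     (\<forall>j. diff_order_ge (\<lambda>z. f z - (if i = j then 1 else 0)) (-1) (u j) 2)"

definition L_op :: "('h::ab_group_add, 'b) chiral_data_scheme \<Rightarrow> (complex \<Rightarrow> complex) \<Rightarrow> 'h \<Rightarrow> 'h" where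
  "L_op T f \<xi> = - contour T 2 (vir T) f \<xi>"

end

theory Submission
  imports Defs
begin

text \<open>
  While all \<open>u\<^sub>i\<close> are finite, the functions \<open>f\<^sup>i\<^sub>u\<close> can be chosen as Laurent polynomials in \<open>z\<close> with
  coefficients that are rational in \<open>u\<close>.  The condition on \<open>\<eta>(u)\<close> then says that
  \<open>\<partial>\<^sub>i (\<eta>(s)) = \<eta>(\<nabla>\<^sub>i s)\<close> for sections \<open>s\<close> of \<open>\<H>\<close>, where \<open>\<nabla>\<^sub>i = \<partial>\<^sub>i + L\<^sup>i(u)\<close>.  By the commutator formula
  for modes, \<open>\<nabla>\<close> maps sections of \<open>O\<close> to sections of \<open>O\<close>, and its curvature takes values in \<open>O\<close>.
  Hence two solutions that agree at a point have the same derivatives there, which gives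
  uniqueness; and a solution near \<open>w\<close> must be the series
  \<open>\<eta>(w + x)(\<xi>) = \<Sum>\<^sub>n \<eta>(w)(\<nabla>\<^sub>x\<^sup>n \<xi>) / n!\<close>.

  Since \<open>\<H> / C\<^sub>k\<close> is finite-dimensional, finitely many states span \<open>\<H>\<close> modulo \<open>O\<^sub>u\<close> with coefficients
  rational in \<open>u\<close> (by induction on the weight, because the modes in the definition of \<open>C\<^sub>k\<close> are congruent
  modulo \<open>O\<^sub>u\<close> to modes that lead to lower weights).  In this finite system \<open>\<nabla>\<^sub>x\<close> is an ordinary
  differential operator with holomorphic coefficients, and Cauchy estimates show that the series
  converges for \<open>x\<close> in a polydisc whose size is locally uniform in \<open>w\<close>.  Transporting \<open>\<eta>\<close> along
  paths by short steps of this kind is invariant under homotopy, so it is well defined on a simply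
  connected \<open>U\<close>.
\<close>

section \<open>States, modes and weights\<close>

text \<open>The dimension of \<open>\<H> / O_u\<close> is not known to be locally constant, and the
  finitely many spanning states may be dependent modulo \<open>O_u\<close>. A connection matrix in
  them is a mere choice, and solving its differential equation need not give functionals on the
  quotient. So the series is formed on all of \<open>\<H>\<close>, free of choices, and the spanning
  states serve only to bound its terms. A vector known to lie in one \<open>O_u\<close> cannot be
  differentiated in \<open>u\<close>. The divisor condition is therefore imposed on families of
  Laurent polynomials for all \<open>u\<close> at once. Nothing is lost: a function \<open>g\<close>
  admissible at one \<open>u\<close>, divided by the product of the \<open>(z - u_i)^h\<close>, is a
  Laurent polynomial, and keeping this quotient fixed while \<open>u\<close> moves gives a family
  through \<open>g\<close>. The commutator formula is not an axiom. It results from moving contours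
  in amplitudes, where exchanging two integrals requires joint continuity. This is available for
  generating states, passes to their \<open>L_(-1)\<close> descendants by Cauchy's formula, and
  those span \<open>\<H>\<close>.\<close>

context chiral_theory
begin

sublocale vs: vector_space "smult T"
  by (rule vector_space)

abbreviation scl (infixr "\<cdot>" 75) where "a \<cdot> x \<equiv> smult T a x"

lemma vir_weight: "vir T \<in> weight_space T 2"
  using vir_gen gen_quasiprimary[of 2] by auto

lemma gen_weight: "\<psi> \<in> gen T h \<Longrightarrow> \<psi> \<in> weight_space T (int h)"
  using gen_quasiprimary[of h] by auto

lemma mode_add: "\<phi> \<in> weight_space T h \<Longrightarrow> mode T \<phi> n (x + y) = mode T \<phi> n x + mode T \<phi> n y"
  using mode_linear[of \<phi> h n] by (simp add: Vector_Spaces.linear_iff)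

lemma mode_scale: "\<phi> \<in> weight_space T h \<Longrightarrow> mode T \<phi> n (c \<cdot> x) = c \<cdot> mode T \<phi> n x"
  using mode_linear[of \<phi> h n] by (simp add: Vector_Spaces.linear_iff)

lemma mode_0: "\<phi> \<in> weight_space T h \<Longrightarrow> mode T \<phi> n 0 = 0"
  using mode_scale[of \<phi> h n 0 0] by simp

lemma mode_sum: "\<phi> \<in> weight_space T h \<Longrightarrow> mode T \<phi> n (\<Sum>i\<in>I. f i) = (\<Sum>i\<in>I. mode T \<phi> n (f i))"
  by (induction I rule: infinite_finite_induct) (auto simp: mode_0 mode_add)

lemmas L_add = mode_add[OF vir_weight] and L_scale = mode_scale[OF vir_weight]
  and L_0 = mode_0[OF vir_weight] and L_sum = mode_sum[OF vir_weight]

lemma subspace_weight: "vs.subspace (weight_space T j)"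
  by (auto simp: vs.subspace_def weight_space_def L_0 L_add L_scale vs.scale_right_distrib mult.commute)

lemmas weight_add = vs.subspace_add[OF subspace_weight]
  and weight_scale = vs.subspace_scale[OF subspace_weight]
  and weight_0 = vs.subspace_0[OF subspace_weight]
  and weight_sum = vs.subspace_sum[OF subspace_weight]
  and weight_diff = vs.subspace_diff[OF subspace_weight]

lemma L_weight: "\<xi> \<in> weight_space T j \<Longrightarrow> Lmode T n \<xi> \<in> weight_space T (j - n)"
  using mode_weight[OF vir_weight] .

text \<open>Weights are eigenvalues of \<open>L_0\<close>: subtracting \<open>a\<close> times the
  relation from its image under \<open>L_0\<close> removes the component of weight \<open>a\<close>
  and multiplies the others by nonzero numbers.\<close>

lemma weight_indep:
  assumes "finite J" "\<And>j. j \<in> J \<Longrightarrow> \<xi> j \<in> weight_space T j" "(\<Sum>j\<in>J. \<xi> j) = 0" "j \<in> J"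
  shows "\<xi> j = 0"
  using assms
proof (induction J arbitrary: \<xi> j rule: finite_induct)
  case (insert a J)
  define \<zeta> where "\<zeta> i = (of_int i - of_int a :: complex) \<cdot> \<xi> i" for i
  have "0 = Lmode T 0 (\<Sum>j\<in>insert a J. \<xi> j) - of_int a \<cdot> (\<Sum>j\<in>insert a J. \<xi> j)"
    using insert.prems by (simp add: L_0)
  also have "\<dots> = (\<Sum>j\<in>insert a J. Lmode T 0 (\<xi> j)) - (\<Sum>j\<in>insert a J. of_int a \<cdot> \<xi> j)"
    by (simp only: L_sum vs.scale_sum_right)
  also have "\<dots> = (\<Sum>j\<in>insert a J. \<zeta> j)"
    unfolding sum_subtractf[symmetric]
    by (rule sum.cong) (use insert.prems(1) in \<open>auto simp: \<zeta>_def weight_space_def vs.scale_left_diff_distrib\<close>)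
  also have "\<dots> = (\<Sum>j\<in>J. \<zeta> j)"
    using insert.hyps by (simp add: \<zeta>_def)
  finally have "(\<Sum>j\<in>J. \<zeta> j) = 0" by simp
  moreover have "\<zeta> i \<in> weight_space T i" if "i \<in> J" for i
    unfolding \<zeta>_def using insert.prems(1) that by (intro weight_scale) auto
  ultimately have \<zeta>0: "\<zeta> i = 0" if "i \<in> J" for i
    using insert.IH that by blast
  have z: "\<xi> i = 0" if "i \<in> J" for i
  proof -
    have "(of_int i - of_int a :: complex) \<noteq> 0"
      using that insert.hyps(2) by auto
    then show ?thesis using \<zeta>0[OF that] unfolding \<zeta>_def by simp
  qed
  then have "\<xi> a = 0"
    using insert.prems(2) insert.hyps by (simp add: sum.neutral)
  then show ?case using z insert.prems(3) by auto
qed simp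

lemma weight_decomp:
  "\<exists>f. (\<forall>j. f j \<in> weight_space T j) \<and> finite {j. f j \<noteq> 0} \<and> (\<forall>j<0. f j = 0) \<and> \<xi> = (\<Sum>j | f j \<noteq> 0. f j)"
proof -
  let ?P = "\<lambda>\<xi> f. (\<forall>j. f j \<in> weight_space T j) \<and> finite {j. f j \<noteq> 0} \<and> (\<forall>j<0. f j = 0)
     \<and> \<xi> = (\<Sum>j | f j \<noteq> 0. f j)"
  have "\<xi> \<in> vs.span (\<Union>j::nat. weight_space T (int j))" using weight_graded by auto
  then have "\<exists>f. ?P \<xi> f"
  proof (induction rule: vs.span_induct_alt)
    case base
    show ?case by (rule exI[of _ "\<lambda>_. 0"]) (auto simp: weight_0)
  next
    case (step c x y)
    then obtain n f where n: "x \<in> weight_space T (int n)" and f: "?P y f" by auto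
    define g where "g = (\<lambda>j. f j + (if j = int n then c \<cdot> x else 0))"
    let ?S = "insert (int n) {j. f j \<noteq> 0}"
    have fin: "finite ?S" using f by auto
    have sub: "{j. g j \<noteq> 0} \<subseteq> ?S" by (auto simp: g_def)
    have "(\<Sum>j | g j \<noteq> 0. g j) = (\<Sum>j\<in>?S. g j)"
      by (rule sum.mono_neutral_left) (use fin sub in auto)
    also have "\<dots> = (\<Sum>j\<in>?S. f j) + (\<Sum>j\<in>?S. (if j = int n then c \<cdot> x else 0))"
      unfolding g_def by (rule sum.distrib)
    also have "(\<Sum>j\<in>?S. f j) = y"
      using f by (subst sum.mono_neutral_right[of ?S "{j. f j \<noteq> 0}"]) (use fin in auto)
    also have "(\<Sum>j\<in>?S. (if j = int n then c \<cdot> x else 0)) = c \<cdot> x"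
      using fin by (subst sum.delta) auto
    finally have "?P (c \<cdot> x + y) g"
      using f n finite_subset[OF sub fin]
      by (auto simp: g_def intro!: weight_add weight_scale)
    then show ?case by blast
  qed
  then show ?thesis .
qed

lemma weight_decomp_unique:
  assumes f: "\<And>j. f j \<in> weight_space T j" "finite {j. f j \<noteq> 0}"
    and g: "\<And>j. g j \<in> weight_space T j" "finite {j. g j \<noteq> 0}"
    and eq: "(\<Sum>j | f j \<noteq> 0. f j) = (\<Sum>j | g j \<noteq> 0. g j)"
  shows "f = g"
proof
  fix j
  let ?S = "{j. f j \<noteq> 0} \<union> {j. g j \<noteq> 0} \<union> {j}"
  have "(\<Sum>j\<in>?S. f j) = (\<Sum>j | f j \<noteq> 0. f j)" "(\<Sum>j\<in>?S. g j) = (\<Sum>j | g j \<noteq> 0. g j)"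
    by (rule sum.mono_neutral_right; use f g in auto)+
  then have "(\<Sum>j\<in>?S. f j - g j) = 0" using eq by (simp add: sum_subtractf)
  then have "f j - g j = 0"
    by (rule weight_indep[rotated 2]) (use f g in \<open>auto intro: weight_diff\<close>)
  then show "f j = g j" by simp
qed

text \<open>The projection to weight \<open>j\<close>. By \<open>weight_decomp_unique\<close> the
  choice made by \<open>SOME\<close> is forced.\<close>

definition weight_part :: "int \<Rightarrow> 'a \<Rightarrow> 'a" where
  "weight_part j \<xi> = (SOME f. (\<forall>j. f j \<in> weight_space T j) \<and> finite {j. f j \<noteq> 0} \<and> (\<forall>j<0. f j = 0)
     \<and> \<xi> = (\<Sum>j | f j \<noteq> 0. f j)) j"

lemma
  shows weight_part_weight: "weight_part j \<xi> \<in> weight_space T j"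
    and weight_part_finite: "finite {j. weight_part j \<xi> \<noteq> 0}"
    and weight_part_neg: "j < 0 \<Longrightarrow> weight_part j \<xi> = 0"
    and weight_part_sum: "(\<Sum>j | weight_part j \<xi> \<noteq> 0. weight_part j \<xi>) = \<xi>"
  using someI_ex[OF weight_decomp[of \<xi>]] unfolding weight_part_def by auto

lemma weight_part_sum':
  "finite J \<Longrightarrow> {j. weight_part j \<xi> \<noteq> 0} \<subseteq> J \<Longrightarrow> (\<Sum>j\<in>J. weight_part j \<xi>) = \<xi>"
  by (subst (2) weight_part_sum[symmetric]) (rule sum.mono_neutral_right, auto)

lemma weight_part_unique:
  assumes "\<And>j. f j \<in> weight_space T j" "finite J" "\<And>j. j \<notin> J \<Longrightarrow> f j = 0" "\<xi> = (\<Sum>j\<in>J. f j)"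
  shows "weight_part j \<xi> = f j"
proof -
  have *: "{j. f j \<noteq> 0} \<subseteq> J" using assms by auto
  have "(\<Sum>j | weight_part j \<xi> \<noteq> 0. weight_part j \<xi>) = (\<Sum>j | f j \<noteq> 0. f j)"
    unfolding weight_part_sum assms(4) using * assms(2) by (intro sum.mono_neutral_right) auto
  then have "(\<lambda>j. weight_part j \<xi>) = f"
    using assms finite_subset[OF * assms(2)]
    by (intro weight_decomp_unique) (auto simp: weight_part_weight weight_part_finite)
  then show ?thesis by metis
qed

lemma weight_part_homogeneous:
  assumes "\<xi> \<in> weight_space T i"
  shows "weight_part j \<xi> = (if j = i then \<xi> else 0)"
  by (rule weight_part_unique[of "\<lambda>j. if j = i then \<xi> else 0" "{i}"]) (use assms in \<open>auto simp: weight_0\<close>)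

lemma weight_neg: "\<xi> \<in> weight_space T j \<Longrightarrow> j < 0 \<Longrightarrow> \<xi> = 0"
  using weight_part_homogeneous[of \<xi> j j] weight_part_neg[of j \<xi>] by simp

lemma weight_part_add: "weight_part j (x + y) = weight_part j x + weight_part j y"
proof (rule weight_part_unique)
  let ?J = "{j. weight_part j x \<noteq> 0} \<union> {j. weight_part j y \<noteq> 0}"
  show "finite ?J" by (auto simp: weight_part_finite)
  show "x + y = (\<Sum>j\<in>?J. weight_part j x + weight_part j y)"
    unfolding sum.distrib by (subst (1 2) weight_part_sum') (auto simp: weight_part_finite)
qed (auto intro: weight_add weight_part_weight)

lemma weight_part_scale: "weight_part j (c \<cdot> x) = c \<cdot> weight_part j x"
proof (rule weight_part_unique)
  let ?J = "{j. weight_part j x \<noteq> 0}"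
  show "finite ?J" by (auto simp: weight_part_finite)
  show "c \<cdot> x = (\<Sum>j\<in>?J. c \<cdot> weight_part j x)"
    unfolding vs.scale_sum_right[symmetric] by (simp add: weight_part_sum)
qed (auto intro: weight_scale weight_part_weight)

lemma weight_part_0: "weight_part j 0 = 0"
  using weight_part_scale[of j 0 0] by simp

text \<open>Refines a spanning statement about the whole space to a single weight, because the
  projection of a combination is the combination of the projections.\<close>

lemma weight_part_in_span:
  assumes "x \<in> vs.span S" "\<And>s. s \<in> S \<Longrightarrow> weight_part j s \<in> vs.span R"
  shows "weight_part j x \<in> vs.span R"
  using assms(1)
proof (induction rule: vs.span_induct_alt)
  case base show ?case by (simp add: weight_part_0 vs.span_zero)
next
  case (step c x y) then show ?case
    by (auto simp: weight_part_add weight_part_scale intro: vs.span_add vs.span_scale assms(2))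
qed

lemma L_power_weight: "\<xi> \<in> weight_space T j \<Longrightarrow> (Lmode T (-1) ^^ n) \<xi> \<in> weight_space T (j + int n)"
proof (induction n)
  case (Suc n)
  then show ?case using L_weight[of "(Lmode T (-1) ^^ n) \<xi>" "j + int n" "-1"] by (simp add: algebra_simps)
qed simp

lemma weight_space_span_quasiprimary:
  assumes "\<xi> \<in> weight_space T w"
  shows "\<xi> \<in> vs.span {(Lmode T (-1) ^^ n) \<psi> | n \<psi> h. \<psi> \<in> gen T h \<and> int h + int n = w}"
proof -
  have "weight_part w \<xi> \<in> vs.span {(Lmode T (-1) ^^ n) \<psi> | n \<psi> h. \<psi> \<in> gen T h \<and> int h + int n = w}"
  proof (rule weight_part_in_span)
    show "\<xi> \<in> vs.span {(Lmode T (-1) ^^ n) \<psi> | n \<psi> h. \<psi> \<in> gen T h}" using quasiprimary_span by auto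
    fix s assume "s \<in> {(Lmode T (-1) ^^ n) \<psi> | n \<psi> h. \<psi> \<in> gen T h}"
    then obtain n \<psi> h where s: "s = (Lmode T (-1) ^^ n) \<psi>" "\<psi> \<in> gen T h" by auto
    have "s \<in> weight_space T (int h + int n)" unfolding s(1) by (intro L_power_weight gen_weight s)
    then have "weight_part w s = (if w = int h + int n then s else 0)" by (rule weight_part_homogeneous)
    then show "weight_part w s \<in> vs.span {(Lmode T (-1) ^^ n) \<psi> | n \<psi> h. \<psi> \<in> gen T h \<and> int h + int n = w}"
      using s by (auto intro!: vs.span_base vs.span_zero)
  qed
  then show ?thesis using weight_part_homogeneous[OF assms, of w] by simp
qed

text \<open>The Fock space carries no topology, so sections are differentiated only after applying a
  linear functional. Enough functionals exist because a nonzero vector can be completed to a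
  basis.\<close>

lemma linear_functional_separates:
  assumes "x \<noteq> 0" shows "\<exists>f. Vector_Spaces.linear (smult T) (*) f \<and> f x \<noteq> (0::complex)"
proof -
  interpret vp: vector_space_pair "smult T" "(*) :: complex \<Rightarrow> complex \<Rightarrow> complex"
    by unfold_locales (auto simp: algebra_simps)
  have "vs.independent {x}" using assms by simp
  from vp.linear_independent_extend[OF this, of "\<lambda>_. 1"] obtain f where
    "Vector_Spaces.linear (smult T) (*) f" "f x = 1" by auto
  then show ?thesis by (intro exI[of _ f]) auto
qed

end

section \<open>Contour integrals and parameters\<close>

text \<open>On the circle every \<open>(z - c) powi n\<close> has modulus \<open>r powi n\<close>.
  Convergence at one point is absolute and thus gives a majorant for Weierstrass's test on the whole
  circle, so the series may be integrated term by term.\<close>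

lemma contour_integral_circlepath_has_sum:
  fixes a :: "int \<Rightarrow> complex"
  assumes r: "r > 0"
    and A: "\<And>z. cmod (z - c) = r \<Longrightarrow> ((\<lambda>n. (z - c) powi n * a n) has_sum A z) UNIV"
    and P: "continuous_on (sphere c r) P"
  shows "((\<lambda>n. a n * contour_integral (circlepath c r) (\<lambda>z. (z - c) powi n * P z)) has_sum
            contour_integral (circlepath c r) (\<lambda>z. A z * P z)) UNIV"
proof -
  let ?f = "\<lambda>X z. \<Sum>n\<in>X. (z - c) powi n * a n * P z"
  have nz: "z - c \<noteq> 0" if "z \<in> sphere c r" for z using that r by auto
  have pint: "(\<lambda>z. (z - c) powi n * P z) contour_integrable_on circlepath c r" for n
    by (rule contour_integrable_continuous_circlepath)
       (use r nz in \<open>auto intro!: continuous_intros P\<close>)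
  have fint: "(\<lambda>z. (z - c) powi n * a n * P z) contour_integrable_on circlepath c r" for n
    using contour_integrable_rmul[OF pint[of n], of "a n"] by (simp add: mult_ac)
  have "compact (P ` sphere c r)" using P by (intro compact_continuous_image) auto
  from compact_imp_bounded[OF this] obtain K where "\<forall>x\<in>P ` sphere c r. norm x \<le> K"
    unfolding bounded_iff ..
  then have K: "\<And>z. z \<in> sphere c r \<Longrightarrow> norm (P z) \<le> K" by blast
  have "((\<lambda>n. (c + of_real r - c) powi n * a n) has_sum A (c + of_real r)) UNIV"
    by (rule A) (use r in auto)
  then have "(\<lambda>n. (of_real r) powi n * a n) summable_on UNIV"
    by (auto simp: summable_on_def)
  then have s1: "(\<lambda>n. norm ((of_real r) powi n * a n)) summable_on UNIV"
    by (simp add: summable_on_iff_abs_summable_on_complex)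
  then have s: "(\<lambda>n. norm (a n) * r powi n * K) summable_on UNIV"
    using summable_on_cmult_left[OF s1, of K] r by (simp add: norm_mult norm_power_int mult_ac)
  have "uniform_limit (sphere c r) ?f (\<lambda>z. A z * P z) (finite_subsets_at_top UNIV)"
  proof (rule Weierstrass_m_test_general'[OF _ _ s])
    fix n z assume z: "z \<in> sphere c r"
    have "norm ((z - c) powi n * a n * P z) = norm (a n) * r powi n * norm (P z)"
      using z by (simp add: norm_mult norm_power_int dist_norm norm_minus_commute mult_ac)
    also have "\<dots> \<le> norm (a n) * r powi n * K"
      by (intro mult_left_mono K z mult_nonneg_nonneg) (use r in auto)
    finally show "norm ((z - c) powi n * a n * P z) \<le> norm (a n) * r powi n * K" .
  next
    fix z assume z: "z \<in> sphere c r"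
    then have "cmod (z - c) = r" by (simp add: dist_norm norm_minus_commute)
    from A[OF this] show "((\<lambda>n. (z - c) powi n * a n * P z) has_sum A z * P z) UNIV"
      by (rule has_sum_cmult_left)
  qed
  then have lim: "((\<lambda>X. contour_integral (circlepath c r) (?f X)) \<longlongrightarrow>
       contour_integral (circlepath c r) (\<lambda>z. A z * P z)) (finite_subsets_at_top UNIV)"
    by (intro contour_integral_uniform_limit_circlepath(2) r
          eventually_finite_subsets_at_top_weakI contour_integrable_sum fint) auto
  have fin: "contour_integral (circlepath c r) (?f X) =
      (\<Sum>n\<in>X. a n * contour_integral (circlepath c r) (\<lambda>z. (z - c) powi n * P z))" if "finite X" for X
  proof -
    have "contour_integral (circlepath c r) (?f X) = (\<Sum>n\<in>X. contour_integral (circlepath c r) (\<lambda>z. (z - c) powi n * a n * P z))"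
      by (rule contour_integral_sum) (use that fint in auto)
    also have "\<dots> = (\<Sum>n\<in>X. a n * contour_integral (circlepath c r) (\<lambda>z. (z - c) powi n * P z))"
    proof (rule sum.cong[OF refl])
      fix n
      show "contour_integral (circlepath c r) (\<lambda>z. (z - c) powi n * a n * P z)
          = a n * contour_integral (circlepath c r) (\<lambda>z. (z - c) powi n * P z)"
        unfolding contour_integral_lmul[OF pint, symmetric] by (simp only: mult_ac)
    qed
    finally show ?thesis .
  qed
  show ?thesis
    unfolding has_sum_def
    by (rule Lim_transform_eventually[OF lim eventually_finite_subsets_at_top_weakI]) (rule fin)
qed

lemma contour_integral_power_int:
  assumes r: "r > 0"
  shows "contour_integral (circlepath c r) (\<lambda>z. (z - c) powi n) = (if n = -1 then 2 * of_real pi * \<i> else 0)"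
proof (cases "n = -1")
  case True
  have "contour_integral (circlepath c r) (\<lambda>z. 1 / (z - c) ^ Suc 0) = 2 * of_real pi * \<i>"
    using Cauchy_integral_circlepath_simple[of "\<lambda>_. 1" c r c] r
    by (auto intro!: contour_integral_unique)
  then show ?thesis using True by (simp add: field_simps power_int_minus)
next
  case False
  have "((\<lambda>z. (z - c) powi n) has_contour_integral 0) (circlepath c r)"
  proof (rule Cauchy_theorem_primitive[where S = "-{c}" and f = "\<lambda>z. (z - c) powi (n + 1) / of_int (n + 1)"])
    fix x assume "x \<in> -{c}"
    moreover have "of_int n + 1 \<noteq> (0::complex)" using False by (metis add.inverse_inverse add_eq_0_iff of_int_1 of_int_eq_iff of_int_minus)
    ultimately show "((\<lambda>z. (z - c) powi (n + 1) / of_int (n + 1)) has_field_derivative (x - c) powi n) (at x within - {c})"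
      by (auto intro!: derivative_eq_intros)
  qed (use r in auto)
  then show ?thesis using False by (simp add: contour_integral_unique)
qed

lemma laurent_coefficient:
  fixes a :: "int \<Rightarrow> complex"
  assumes r: "r > 0"
    and A: "\<And>z. cmod (z - c) = r \<Longrightarrow> ((\<lambda>n. (z - c) powi n * a n) has_sum A z) UNIV"
  shows "contour_integral (circlepath c r) (\<lambda>z. A z * (z - c) powi (- m - 1)) = 2 * of_real pi * \<i> * a m"
proof -
  have nz: "z - c \<noteq> 0" if "z \<in> sphere c r" for z using that r by auto
  have "continuous_on (sphere c r) (\<lambda>z. (z - c) powi (- m - 1))"
    using nz by (auto intro!: continuous_intros)
  from contour_integral_circlepath_has_sum[OF r A this]
  have 1: "((\<lambda>n. a n * contour_integral (circlepath c r) (\<lambda>z. (z - c) powi n * (z - c) powi (- m - 1))) has_sum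
            contour_integral (circlepath c r) (\<lambda>z. A z * (z - c) powi (- m - 1))) UNIV" .
  have 2: "contour_integral (circlepath c r) (\<lambda>z. (z - c) powi n * (z - c) powi (- m - 1))
      = (if n = m then 2 * of_real pi * \<i> else 0)" for n
  proof -
    have "contour_integral (circlepath c r) (\<lambda>z. (z - c) powi n * (z - c) powi (- m - 1))
      = contour_integral (circlepath c r) (\<lambda>z. (z - c) powi (n - m - 1))"
      by (rule contour_integral_eq) (use r nz in \<open>auto simp: power_int_add[symmetric] algebra_simps\<close>)
    also have "\<dots> = (if n = m then 2 * of_real pi * \<i> else 0)"
      by (subst contour_integral_power_int[OF r]) auto
    finally show ?thesis .
  qed
  have "((\<lambda>n. a n * (if n = m then 2 * of_real pi * \<i> else 0)) has_sum 2 * of_real pi * \<i> * a m) UNIV"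
    by (rule has_sum_finite_neutralI[of "{m}"]) auto
  with 1 show ?thesis unfolding 2 using has_sum_unique by blast
qed

lemma higher_deriv_power_int:
  assumes "z \<noteq> 0"
  shows "(deriv ^^ i) (\<lambda>z::complex. z powi k) z = fact i * (of_int k gchoose i) * z powi (k - int i)"
  using assms
proof (induction i arbitrary: z)
  case (Suc i)
  have "(deriv ^^ Suc i) (\<lambda>z::complex. z powi k) z = deriv ((deriv ^^ i) (\<lambda>z::complex. z powi k)) z" by simp
  also have "\<dots> = deriv (\<lambda>z. fact i * (of_int k gchoose i) * z powi (k - int i)) z"
  proof (rule deriv_cong_ev)
    show "\<forall>\<^sub>F z in nhds z. (deriv ^^ i) (\<lambda>z. z powi k) z = fact i * (of_int k gchoose i) * z powi (k - int i)"
    proof (rule eventually_mono)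
      show "\<forall>\<^sub>F x in nhds z. x \<in> -{0}" by (rule eventually_nhds_in_open) (use Suc.prems in auto)
      show "(deriv ^^ i) (\<lambda>z. z powi k) x = fact i * (of_int k gchoose i) * x powi (k - int i)" if "x \<in> -{0}" for x :: complex
        by (rule Suc.IH) (use that in simp)
    qed
  qed simp
  also have "\<dots> = fact i * (of_int k gchoose i) * (of_int (k - int i) * z powi (k - int i - 1))"
    by (rule DERIV_imp_deriv) (use Suc.prems in \<open>auto intro!: derivative_eq_intros\<close>)
  also have "\<dots> = fact (Suc i) * (of_int k gchoose Suc i) * z powi (k - int (Suc i))"
  proof -
    have "fact i * ((of_int k :: complex) gchoose i) * (of_int k - of_nat i) = fact (Suc i) * (of_int k gchoose Suc i)"
      using of_nat_neq_0[of i, where ?'a = complex] by (simp add: gbinomial_prod_rev)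
    then have "(fact i * ((of_int k :: complex) gchoose i) * (of_int k - of_nat i)) * z powi (k - int i - 1)
        = (fact (Suc i) * (of_int k gchoose Suc i)) * z powi (k - int i - 1)" by (rule arg_cong)
    moreover have "k - int (Suc i) = k - int i - 1" by simp
    ultimately show ?thesis by (simp only: mult.assoc of_int_diff of_int_of_nat_eq)
  qed
  finally show ?case .
qed simp

text \<open>Cauchy's formula writes the derivative as an integral over a fixed circle whose
  integrand is jointly continuous in the parameter and the point. This carries continuity over to
  amplitudes that are known only as derivatives of others.\<close>

lemma continuous_on_partial_derivative:
  fixes f f' :: "'p::metric_space \<times> complex \<Rightarrow> complex"
  assumes S: "open S" and f: "continuous_on S f"
    and der: "\<And>p x. (p, x) \<in> S \<Longrightarrow> ((\<lambda>x. f (p, x)) has_field_derivative f' (p, x)) (at x)"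
  shows "continuous_on S f'"
proof -
  have "continuous (at q within S) f'" if q: "q \<in> S" for q
  proof -
    obtain p0 x0 where q0: "q = (p0, x0)" by (cases q)
    from S q obtain A B where AB: "open A" "open B" "p0 \<in> A" "x0 \<in> B" "A \<times> B \<subseteq> S"
      unfolding q0 by (auto elim: open_prod_elim)
    from AB obtain e where e: "e > 0" "cball x0 e \<subseteq> B" by (meson open_contains_cball)
    let ?U = "A \<times> ball x0 e"
    have sub: "(p, x) \<in> S" if "p \<in> A" "x \<in> cball x0 e" for p x
      using that AB e by auto
    have fx: "f' (p, x) = 1 / (2 * of_real pi * \<i>) * contour_integral (circlepath x0 e) (\<lambda>u. f (p, u) / (u - x)^2)"
      if "p \<in> A" "x \<in> ball x0 e" for p x
    proof -
      have h: "(\<lambda>x. f (p, x)) field_differentiable (at x)" if "x \<in> cball x0 e" for x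
        using der[OF sub[OF \<open>p \<in> A\<close> that]] by (auto simp: field_differentiable_def)
      have "((\<lambda>x. f (p, x)) has_field_derivative (1 / (2 * of_real pi * \<i>) * contour_integral(circlepath x0 e) (\<lambda>u. f (p, u) / (u-x)^2))) (at x)"
        by (rule Cauchy_derivative_integral_circlepath(2))
           (use h that in \<open>auto intro!: continuous_at_imp_continuous_on field_differentiable_imp_continuous_at
              simp: holomorphic_on_def field_differentiable_at_within\<close>)
      with der[OF sub, of p x] that show ?thesis
        by (metis DERIV_unique ball_subset_cball subsetD)
    qed
    have cont: "continuous_on ?U (\<lambda>(p, x). integral (cbox 0 1) (\<lambda>t. f (p, circlepath x0 e t) / (circlepath x0 e t - x)^2
         * (2 * of_real pi * \<i> * of_real e * exp (2 * of_real pi * \<i> * of_real t))))"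
      unfolding case_prod_beta
    proof (rule integral_continuous_on_param)
      have c: "circlepath x0 e t \<in> sphere x0 e" for t
        unfolding circlepath_def using e
        by (auto simp: part_circlepath_def linepath_def dist_norm norm_mult)
      have cc: "continuous_on UNIV (\<lambda>t. circlepath x0 e t)"
        unfolding circlepath by (intro continuous_intros)
      have "continuous_on (?U \<times> cbox 0 1) (\<lambda>z. f (fst (fst z), circlepath x0 e (snd z)))"
      proof (rule continuous_on_compose2[OF f])
        show "continuous_on (?U \<times> cbox 0 1) (\<lambda>z. (fst (fst z), circlepath x0 e (snd z)))"
          by (intro continuous_intros continuous_on_compose2[OF cc]) auto
        show "(\<lambda>z. (fst (fst z), circlepath x0 e (snd z))) ` (?U \<times> cbox 0 1) \<subseteq> S"
          using c by (force intro: sub)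
      qed
      moreover have "circlepath x0 e (snd z) - snd (fst z) \<noteq> 0" if "z \<in> ?U \<times> cbox 0 1" for z
        using c[of "snd z"] that by (auto simp: dist_norm)
      ultimately show "continuous_on (?U \<times> cbox 0 1)
        (\<lambda>(z, t). f (fst z, circlepath x0 e t) / (circlepath x0 e t - snd z)^2
         * (2 * of_real pi * \<i> * of_real e * exp (2 * of_real pi * \<i> * of_real t)))"
        unfolding case_prod_beta
        by (intro continuous_intros continuous_on_compose2[OF cc]) auto
    qed
    have "continuous_on ?U f'"
    proof (rule continuous_on_eq)
      show "continuous_on ?U (\<lambda>z. 1 / (2 * of_real pi * \<i>) * (case z of (p, x) \<Rightarrow> integral (cbox 0 1) (\<lambda>t. f (p, circlepath x0 e t) / (circlepath x0 e t - x)^2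
         * (2 * of_real pi * \<i> * of_real e * exp (2 * of_real pi * \<i> * of_real t)))))"
        by (intro continuous_on_mult_left cont)
      fix z assume "z \<in> ?U"
      then obtain p x where z: "z = (p, x)" "p \<in> A" "x \<in> ball x0 e" by auto
      show "1 / (2 * of_real pi * \<i>) * (case z of (p, x) \<Rightarrow> integral (cbox 0 1) (\<lambda>t. f (p, circlepath x0 e t) / (circlepath x0 e t - x)^2
         * (2 * of_real pi * \<i> * of_real e * exp (2 * of_real pi * \<i> * of_real t)))) = f' z"
        unfolding z(1) fx[OF z(2,3)] contour_integral_integral vector_derivative_circlepath
        by (simp add: cbox_interval)
    qed
    then have "continuous (at q) f'"
      using AB e unfolding q0
      by (subst (asm) continuous_on_eq_continuous_at) (auto intro: open_Times)
    then show ?thesis by (rule continuous_at_imp_continuous_at_within)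
  qed
  then show ?thesis by (simp add: continuous_on_eq_continuous_within)
qed

section \<open>The commutator formula from amplitudes\<close>

context chiral_theory
begin

text \<open>Reads off one Laurent coefficient of \<open>ope\<close>. Identities between modes become
  identities between contour integrals of amplitudes.\<close>

lemma mode_amp:
  assumes \<phi>: "\<phi> \<in> weight_space T h" and d: "distinct (w # map snd ys)"
    and r: "0 < r" "\<And>x. x \<in> snd ` set ys \<Longrightarrow> r < cmod (x - w)"
  shows "contour_integral (circlepath w r) (\<lambda>z. amp T ((\<phi>, z) # (\<omega>, w) # ys) * (z - w) powi (n + h - 1))
      = 2 * of_real pi * \<i> * amp T ((mode T \<phi> n \<omega>, w) # ys)"
proof -
  have "contour_integral (circlepath w r) (\<lambda>z. amp T ((\<phi>, z) # (\<omega>, w) # ys) * (z - w) powi (- (- n - h) - 1))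
      = 2 * of_real pi * \<i> * amp T ((mode T \<phi> (- (- n - h) - h) \<omega>, w) # ys)"
  proof (rule laurent_coefficient[OF r(1)])
    fix z assume z: "cmod (z - w) = r"
    have "distinct (z # w # map snd ys)" using d z r by force
    then show "((\<lambda>n. (z - w) powi n * amp T ((mode T \<phi> (- n - h) \<omega>, w) # ys)) has_sum
        amp T ((\<phi>, z) # (\<omega>, w) # ys)) UNIV"
      using z r by (intro ope[OF \<phi>]) auto
  qed
  moreover have "- (- n - h) - 1 = n + h - 1" "- (- n - h) - h = n" by simp_all
  ultimately show ?thesis by (simp only:)
qed

lemma amp_zero: "distinct (z # map snd xs) \<Longrightarrow> amp T ((0, z) # xs) = 0"
  using amp_scale[of z xs 0 0] by simp

lemma amp_minus: "distinct (z # map snd xs) \<Longrightarrow> amp T ((- \<xi>, z) # xs) = - amp T ((\<xi>, z) # xs)"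
  using amp_add[of z xs \<xi> "-\<xi>"] amp_zero[of z xs] by (simp add: add_eq_0_iff)

lemma amp_sum: "distinct (z # map snd xs) \<Longrightarrow> amp T ((\<Sum>i\<in>I. f i, z) # xs) = (\<Sum>i\<in>I. amp T ((f i, z) # xs))"
  by (induction I rule: infinite_finite_induct) (simp_all add: amp_zero amp_add del: distinct.simps)

text \<open>The insertions against which \<open>separating\<close> tests a state placed at
  \<open>0\<close>.\<close>

definition probe :: "('a \<times> complex) list \<Rightarrow> bool" where
  "probe ys \<longleftrightarrow> (\<exists>xs. insertions T xs \<and> (\<forall>(h, \<psi>, z)\<in>set xs. z \<noteq> 0) \<and> ys = map (\<lambda>(h, \<psi>, z). (\<psi>, z)) xs)"

lemma probe_distinct: "probe ys \<Longrightarrow> distinct (0 # map snd ys)"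
proof -
  assume "probe ys"
  then obtain xs where xs: "insertions T xs" "\<forall>(h, \<psi>, z)\<in>set xs. z \<noteq> 0" "ys = map (\<lambda>(h, \<psi>, z). (\<psi>, z)) xs"
    by (auto simp: probe_def)
  have "map snd ys = map (\<lambda>(h, \<psi>, z). z) xs" unfolding xs(3) by auto
  then show ?thesis using xs(1,2) by (auto simp: insertions_def)
qed

lemma probe_gen: "probe ys \<Longrightarrow> fst ` set ys \<subseteq> (\<Union>h. gen T h)"
  by (force simp: probe_def insertions_def)

lemma probe_eqI:
  assumes "\<And>ys. probe ys \<Longrightarrow> amp T ((\<xi>, 0) # ys) = amp T ((\<xi>', 0) # ys)"
  shows "\<xi> = \<xi>'"
proof -
  have "\<xi> + - \<xi>' = 0"
  proof (rule separating)
    fix xs assume xs: "insertions T xs" "\<forall>(h, \<psi>, z)\<in>set xs. z \<noteq> 0"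
    define ys where "ys = map (\<lambda>(h, \<psi>, z). (\<psi>, z)) xs"
    have p: "probe ys" unfolding probe_def ys_def using xs by blast
    have "amp T ((\<xi> + - \<xi>', 0) # ys) = 0"
      using assms[OF p] amp_add[OF probe_distinct[OF p]] amp_minus[OF probe_distinct[OF p]]
      by (simp del: add_uminus_conv_diff)
    then show "amp T ((\<xi> + - \<xi>', 0) # map (\<lambda>(h, \<psi>, z). (\<psi>, z)) xs) = 0"
      unfolding ys_def .
  qed
  then show ?thesis by (simp add: add_eq_0_iff2)
qed

lemma distinct_radius:
  assumes "distinct (w # map snd (ys :: ('a \<times> complex) list))"
  obtains r where "0 < r" "\<And>x. x \<in> snd ` set ys \<Longrightarrow> r < cmod (x - w)"
proof -
  let ?S = "insert 1 ((\<lambda>x. cmod (x - w)) ` snd ` set ys)"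
  have pos: "0 < Min ?S" using assms by (subst Min_gr_iff) auto
  show ?thesis
  proof (rule that[of "Min ?S / 2"])
    show "0 < Min ?S / 2" using pos by simp
    fix x assume "x \<in> snd ` set ys"
    then have "Min ?S \<le> cmod (x - w)" by (intro Min_le) auto
    with pos show "Min ?S / 2 < cmod (x - w)" by linarith
  qed
qed

lemma mode_eqI:
  assumes "\<And>ys r. probe ys \<Longrightarrow> 0 < r \<Longrightarrow> (\<And>x. x \<in> snd ` set ys \<Longrightarrow> r < cmod x) \<Longrightarrow>
     2 * of_real pi * \<i> * amp T ((\<xi>, 0) # ys) = 2 * of_real pi * \<i> * amp T ((\<xi>', 0) # ys)"
  shows "\<xi> = \<xi>'"
proof (rule probe_eqI)
  fix ys assume p: "probe ys"
  from distinct_radius[OF probe_distinct[OF p]] obtain r where "0 < r" "\<And>x. x \<in> snd ` set ys \<Longrightarrow> r < cmod (x - 0)"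
    by blast
  with assms[OF p, of r] show "amp T ((\<xi>, 0) # ys) = amp T ((\<xi>', 0) # ys)" by simp
qed

lemma amp_circle_continuous:
  assumes \<phi>: "\<phi> \<in> weight_space T h" and d: "distinct (w # map snd ys)"
    and r: "0 < r" "\<And>x. x \<in> snd ` set ys \<Longrightarrow> r < cmod (x - w)"
  shows "continuous_on (sphere w r) (\<lambda>z. amp T ((\<phi>, z) # (\<omega>, w) # ys))"
proof (intro continuous_at_imp_continuous_on ballI)
  fix z assume z: "z \<in> sphere w r"
  have "distinct (z # map snd ((\<omega>, w) # ys))" using d z r by (force simp: dist_norm norm_minus_commute)
  from translation[OF \<phi> this] show "isCont (\<lambda>z. amp T ((\<phi>, z) # (\<omega>, w) # ys)) z"
    by (rule DERIV_isCont)
qed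

lemma amp_circle_integrable:
  assumes "\<phi> \<in> weight_space T h" "distinct (w # map snd ys)"
    and "0 < r" "\<And>x. x \<in> snd ` set ys \<Longrightarrow> r < cmod (x - w)"
  shows "(\<lambda>z. amp T ((\<phi>, z) # (\<omega>, w) # ys) * (z - w) powi n) contour_integrable_on circlepath w r"
  by (rule contour_integrable_continuous_circlepath)
     (use assms in \<open>auto intro!: continuous_intros amp_circle_continuous\<close>)

text \<open>\<open>mode_linear\<close> concerns the vector acted on. Additivity in the state itself
  comes from additivity of amplitudes under the integral of \<open>mode_amp\<close>; the weights
  must agree, since they enter the exponent there.\<close>

lemma mode_add_state:
  assumes "\<phi> \<in> weight_space T h" "\<phi>' \<in> weight_space T h"
  shows "mode T (\<phi> + \<phi>') n \<omega> = mode T \<phi> n \<omega> + mode T \<phi>' n \<omega>"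
proof (rule mode_eqI)
  fix ys r assume p: "probe ys" and r: "0 < r" "\<And>x. x \<in> snd ` set ys \<Longrightarrow> r < cmod x"
  have r': "\<And>x. x \<in> snd ` set ys \<Longrightarrow> r < cmod (x - 0)" using r by simp
  note d = probe_distinct[OF p]
  have "2 * of_real pi * \<i> * amp T ((mode T (\<phi> + \<phi>') n \<omega>, 0) # ys)
    = contour_integral (circlepath 0 r) (\<lambda>z. amp T ((\<phi> + \<phi>', z) # (\<omega>, 0) # ys) * (z - 0) powi (n + h - 1))"
    using mode_amp[OF weight_add[OF assms] d r(1) r'] by simp
  also have "\<dots> = contour_integral (circlepath 0 r) (\<lambda>z. amp T ((\<phi>, z) # (\<omega>, 0) # ys) * (z - 0) powi (n + h - 1)
       + amp T ((\<phi>', z) # (\<omega>, 0) # ys) * (z - 0) powi (n + h - 1))"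
  proof (rule contour_integral_eq)
    fix z assume "z \<in> path_image (circlepath 0 r)"
    then have "distinct (z # map snd ((\<omega>, 0) # ys))" using d r by force
    then show "amp T ((\<phi> + \<phi>', z) # (\<omega>, 0) # ys) * (z - 0) powi (n + h - 1)
      = amp T ((\<phi>, z) # (\<omega>, 0) # ys) * (z - 0) powi (n + h - 1)
       + amp T ((\<phi>', z) # (\<omega>, 0) # ys) * (z - 0) powi (n + h - 1)"
      by (simp add: amp_add algebra_simps del: distinct.simps)
  qed
  also have "\<dots> = 2 * of_real pi * \<i> * amp T ((mode T \<phi> n \<omega>, 0) # ys) + 2 * of_real pi * \<i> * amp T ((mode T \<phi>' n \<omega>, 0) # ys)"
    by (subst contour_integral_add) (use mode_amp[OF _ d r(1) r'] amp_circle_integrable[OF _ d r(1) r'] assms in simp_all)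
  finally show "2 * of_real pi * \<i> * amp T ((mode T (\<phi> + \<phi>') n \<omega>, 0) # ys)
      = 2 * of_real pi * \<i> * amp T ((mode T \<phi> n \<omega> + mode T \<phi>' n \<omega>, 0) # ys)"
    using d by (simp add: amp_add ring_distribs del: distinct.simps)
qed

lemma mode_scale_state:
  assumes "\<phi> \<in> weight_space T h"
  shows "mode T (c \<cdot> \<phi>) n \<omega> = c \<cdot> mode T \<phi> n \<omega>"
proof (rule mode_eqI)
  fix ys r assume p: "probe ys" and r: "0 < r" "\<And>x. x \<in> snd ` set ys \<Longrightarrow> r < cmod x"
  have r': "\<And>x. x \<in> snd ` set ys \<Longrightarrow> r < cmod (x - 0)" using r by simp
  note d = probe_distinct[OF p]
  have "2 * of_real pi * \<i> * amp T ((mode T (c \<cdot> \<phi>) n \<omega>, 0) # ys)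
    = contour_integral (circlepath 0 r) (\<lambda>z. amp T ((c \<cdot> \<phi>, z) # (\<omega>, 0) # ys) * (z - 0) powi (n + h - 1))"
    using mode_amp[OF weight_scale[OF assms] d r(1) r'] by simp
  also have "\<dots> = contour_integral (circlepath 0 r) (\<lambda>z. c * (amp T ((\<phi>, z) # (\<omega>, 0) # ys) * (z - 0) powi (n + h - 1)))"
  proof (rule contour_integral_eq)
    fix z assume "z \<in> path_image (circlepath 0 r)"
    then have "distinct (z # map snd ((\<omega>, 0) # ys))" using d r by force
    then show "amp T ((c \<cdot> \<phi>, z) # (\<omega>, 0) # ys) * (z - 0) powi (n + h - 1)
      = c * (amp T ((\<phi>, z) # (\<omega>, 0) # ys) * (z - 0) powi (n + h - 1))"
      by (simp add: amp_scale del: distinct.simps)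
  qed
  also have "\<dots> = c * (2 * of_real pi * \<i> * amp T ((mode T \<phi> n \<omega>, 0) # ys))"
    by (subst contour_integral_lmul) (use mode_amp[OF _ d r(1) r'] amp_circle_integrable[OF _ d r(1) r'] assms in simp_all)
  finally show "2 * of_real pi * \<i> * amp T ((mode T (c \<cdot> \<phi>) n \<omega>, 0) # ys)
      = 2 * of_real pi * \<i> * amp T ((c \<cdot> mode T \<phi> n \<omega>, 0) # ys)"
    using d by (simp add: amp_scale del: distinct.simps)
qed

lemma mode_zero_state: "mode T 0 n \<omega> = 0"
  using mode_scale_state[OF weight_0, of 0 n \<omega>] by simp

text \<open>Integration by parts: by \<open>translation\<close> the amplitude of
  \<open>L_(-1) \<phi>\<close> is a derivative, and the integral of the derivative of a
  single-valued function over the circle vanishes.\<close>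

lemma mode_derivative_state:
  assumes \<phi>: "\<phi> \<in> weight_space T h"
  shows "mode T (Lmode T (-1) \<phi>) n \<omega> = (- of_int (n + h)) \<cdot> mode T \<phi> n \<omega>"
proof (rule mode_eqI)
  fix ys r assume p: "probe ys" and r: "0 < r" "\<And>x. x \<in> snd ` set ys \<Longrightarrow> r < cmod x"
  have r': "\<And>x. x \<in> snd ` set ys \<Longrightarrow> r < cmod (x - 0)" using r by simp
  note d = probe_distinct[OF p]
  have L: "Lmode T (-1) \<phi> \<in> weight_space T (h + 1)" using L_weight[OF \<phi>, of "-1"] by simp
  let ?A = "\<lambda>z. amp T ((\<phi>, z) # (\<omega>, 0) # ys)" and ?A' = "\<lambda>z. amp T ((Lmode T (-1) \<phi>, z) # (\<omega>, 0) # ys)"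
  have "((\<lambda>z. ?A' z * (z - 0) powi (n + h) + of_int (n + h) * (?A z * (z - 0) powi (n + h - 1)))
          has_contour_integral 0) (circlepath 0 r)"
  proof (rule Cauchy_theorem_primitive[where S = "sphere 0 r" and f = "\<lambda>z. ?A z * z powi (n + h)"])
    fix z :: complex assume z: "z \<in> sphere 0 r"
    have dz: "distinct (z # map snd ((\<omega>, 0) # ys))" using d z r by force
    have z0: "z \<noteq> 0" using z r by auto
    have "((\<lambda>z. ?A z * z powi (n + h)) has_field_derivative
        ?A z * (of_int (n + h) * z powi (n + h - 1)) + ?A' z * z powi (n + h)) (at z)"
      by (rule DERIV_mult' translation[OF \<phi> dz])+ (use z0 in \<open>auto intro!: derivative_eq_intros\<close>)
    then show "((\<lambda>z. ?A z * z powi (n + h)) has_field_derivative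
        ?A' z * (z - 0) powi (n + h) + of_int (n + h) * (?A z * (z - 0) powi (n + h - 1))) (at z within sphere 0 r)"
      by (rule has_field_derivative_at_within[THEN DERIV_cong]) (simp add: algebra_simps)
  qed (use r in auto)
  then have "contour_integral (circlepath 0 r)
      (\<lambda>z. ?A' z * (z - 0) powi (n + h) + of_int (n + h) * (?A z * (z - 0) powi (n + h - 1))) = 0"
    by (rule contour_integral_unique)
  moreover have "contour_integral (circlepath 0 r)
      (\<lambda>z. ?A' z * (z - 0) powi (n + h) + of_int (n + h) * (?A z * (z - 0) powi (n + h - 1)))
      = contour_integral (circlepath 0 r) (\<lambda>z. ?A' z * (z - 0) powi (n + h))
        + of_int (n + h) * contour_integral (circlepath 0 r) (\<lambda>z. ?A z * (z - 0) powi (n + h - 1))"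
    using amp_circle_integrable[OF L d r(1) r'] amp_circle_integrable[OF \<phi> d r(1) r']
    by (simp only: contour_integral_add contour_integral_lmul contour_integrable_lmul)
  moreover have "contour_integral (circlepath 0 r) (\<lambda>z. ?A' z * (z - 0) powi (n + h))
      = 2 * of_real pi * \<i> * amp T ((mode T (Lmode T (-1) \<phi>) n \<omega>, 0) # ys)"
    using mode_amp[OF L d r(1) r', of \<omega> n] by simp
  moreover note mode_amp[OF \<phi> d r(1) r', of \<omega> n]
  ultimately have "2 * of_real pi * \<i> * (amp T ((mode T (Lmode T (-1) \<phi>) n \<omega>, 0) # ys)
     + of_int (n + h) * amp T ((mode T \<phi> n \<omega>, 0) # ys)) = 0"
    by (simp only: ring_distribs mult_ac)
  then have "amp T ((mode T (Lmode T (-1) \<phi>) n \<omega>, 0) # ys) + of_int (n + h) * amp T ((mode T \<phi> n \<omega>, 0) # ys) = 0"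
    by (simp del: of_int_add)
  then have "amp T ((mode T (Lmode T (-1) \<phi>) n \<omega>, 0) # ys) = - of_int (n + h) * amp T ((mode T \<phi> n \<omega>, 0) # ys)"
    by (simp add: add_eq_0_iff2 del: of_int_add)
  then show "2 * of_real pi * \<i> * amp T ((mode T (Lmode T (-1) \<phi>) n \<omega>, 0) # ys)
     = 2 * of_real pi * \<i> * amp T (((- of_int (n + h)) \<cdot> mode T \<phi> n \<omega>, 0) # ys)"
    by (simp only: amp_scale[OF d])
qed


text \<open>For \<open>n = 0\<close> the assumption \<open>meromorphic\<close> exhibits the
  amplitude as a continuous function divided by differences of distinct points. Each further
  \<open>L_(-1)\<close> is a derivative in the position of the third state, to which
  \<open>continuous_on_partial_derivative\<close> applies.\<close>

lemma amp_gen_continuous: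
  assumes g: "\<alpha> \<in> gen T h1" "\<beta> \<in> gen T h2" "\<gamma> \<in> gen T h3" and p: "probe ys"
  shows "continuous_on {q :: (complex \<times> complex) \<times> complex. distinct (snd q # fst (fst q) # snd (fst q) # map snd ys)}
    (\<lambda>q. amp T (((Lmode T (-1) ^^ n) \<gamma>, snd q) # (\<alpha>, fst (fst q)) # (\<beta>, snd (fst q)) # ys))"
proof (induction n)
  case 0
  let ?S = "{q :: (complex \<times> complex) \<times> complex. distinct (snd q # fst (fst q) # snd (fst q) # map snd ys)}"
  define \<psi>s where "\<psi>s = \<gamma> # \<alpha> # \<beta> # map fst ys"
  define m where "m = length \<psi>s"
  define zz where "zz q i = (case i of 0 \<Rightarrow> snd q | Suc 0 \<Rightarrow> fst (fst q) | Suc (Suc 0) \<Rightarrow> snd (fst q)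
     | Suc (Suc (Suc j)) \<Rightarrow> snd (ys ! j))" for q :: "(complex \<times> complex) \<times> complex" and i
  have upt: "[0..<m] = 0 # Suc 0 # Suc (Suc 0) # map (\<lambda>j. Suc (Suc (Suc j))) [0..<length ys]"
    unfolding m_def \<psi>s_def by (simp add: upt_conv_Cons map_Suc_upt[symmetric] del: upt_Suc)
  have mz: "map (zz q) [0..<m] = snd q # fst (fst q) # snd (fst q) # map snd ys" for q
  proof -
    have "map (\<lambda>j. snd (ys ! j)) [0..<length ys] = map snd ys"
      by (rule nth_equalityI) auto
    then show ?thesis unfolding upt by (simp add: zz_def o_def)
  qed
  have zip: "zip \<psi>s (map (zz q) [0..<m]) = (\<gamma>, snd q) # (\<alpha>, fst (fst q)) # (\<beta>, snd (fst q)) # ys" for q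
    unfolding mz \<psi>s_def by (simp add: zip_map_fst_snd)
  have inj: "inj_on (zz q) {..<m}" if "q \<in> ?S" for q
    using that unfolding mem_Collect_eq mz[symmetric] by (simp add: distinct_map lessThan_atLeast0)
  have "set \<psi>s \<subseteq> (\<Union>h. gen T h)"
    unfolding \<psi>s_def using g probe_gen[OF p] by auto
  from meromorphic[OF this] obtain N G where G: "holo_several UNIV G"
    and eq: "\<And>z. inj_on z {..<m} \<Longrightarrow> amp T (zip \<psi>s (map z [0..<m])) * (\<Prod>b<m. \<Prod>a<b. (z a - z b) ^ N) = G z"
    unfolding m_def by blast
  have contG: "continuous_on UNIV G" using G by (simp add: holo_several_def)
  have contz: "continuous_on ?S (\<lambda>q. zz q i)" for i
  proof -
    consider "i = 0" | "i = Suc 0" | "i = Suc (Suc 0)" | j where "i = Suc (Suc (Suc j))"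
      by (metis not0_implies_Suc)
    then show ?thesis
      by cases (simp_all add: zz_def continuous_on_snd continuous_on_fst continuous_on_id)
  qed
  have nz: "(\<Prod>b<m. \<Prod>a<b. (zz q a - zz q b) ^ N) \<noteq> 0" if "q \<in> ?S" for q
    using inj[OF that] by (auto simp: inj_on_def)
  have c: "continuous_on ?S (\<lambda>q. G (zz q) / (\<Prod>b<m. \<Prod>a<b. (zz q a - zz q b) ^ N))"
    using nz by (intro continuous_intros continuous_on_compose2[OF contG] continuous_on_coordinatewise_then_product contz) auto
  have e: "G (zz q) / (\<Prod>b<m. \<Prod>a<b. (zz q a - zz q b) ^ N)
     = amp T ((\<gamma>, snd q) # (\<alpha>, fst (fst q)) # (\<beta>, snd (fst q)) # ys)" if "q \<in> ?S" for q
    using eq[OF inj[OF that]] nz[OF that] unfolding zip by (simp add: field_simps)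
  have "continuous_on ?S (\<lambda>q. amp T ((\<gamma>, snd q) # (\<alpha>, fst (fst q)) # (\<beta>, snd (fst q)) # ys))"
    by (rule continuous_on_eq[OF c]) (rule e)
  then show ?case by (simp only: funpow_0)
next
  case (Suc n)
  let ?S = "{q :: (complex \<times> complex) \<times> complex. distinct (snd q # fst (fst q) # snd (fst q) # map snd ys)}"
  show ?case
  proof (rule continuous_on_partial_derivative[OF _ Suc.IH])
    have "?S = {q. snd q \<noteq> fst (fst q)} \<inter> {q. snd q \<noteq> snd (fst q)} \<inter> {q. fst (fst q) \<noteq> snd (fst q)}
       \<inter> (\<Inter>y\<in>set ys. {q. snd q \<noteq> snd y} \<inter> {q. fst (fst q) \<noteq> snd y} \<inter> {q. snd (fst q) \<noteq> snd y})"
      using probe_distinct[OF p] by auto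
    also have "open \<dots>"
      by (intro open_Int open_INT ballI finite_set open_Collect_neq continuous_intros)
    finally show "open ?S" .
  next
    fix pq :: "complex \<times> complex" and x assume "(pq, x) \<in> ?S"
    then have d: "distinct (x # map snd ((\<alpha>, fst pq) # (\<beta>, snd pq) # ys))" by simp
    show "((\<lambda>x. amp T (((Lmode T (-1) ^^ n) \<gamma>, snd (pq, x)) # (\<alpha>, fst (fst (pq, x))) # (\<beta>, snd (fst (pq, x))) # ys))
      has_field_derivative amp T (((Lmode T (-1) ^^ Suc n) \<gamma>, snd (pq, x)) # (\<alpha>, fst (fst (pq, x))) # (\<beta>, snd (fst (pq, x))) # ys)) (at x)"
      using translation[OF L_power_weight[OF gen_weight[OF g(3)]] d, of n] by simp
  qed
qed

lemma amp_swap: "distinct (map snd (x # y # zs)) \<Longrightarrow> amp T (x # y # zs) = amp T (y # x # zs)"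
  by (rule amp_perm) auto

lemma amp_rotate: "distinct (map snd (x # y # z # zs)) \<Longrightarrow> amp T (x # y # z # zs) = amp T (y # z # x # zs)"
  by (rule amp_perm) auto

text \<open>The two orders of the modes correspond to \<open>|z| > |w|\<close> and
  \<open>|z| < |w|\<close>; their difference is the residue at \<open>z = w\<close>. The third state
  is a descendant of a generating state because joint continuity of the amplitude is available for
  these.\<close>

lemma gen_commutator_quasiprimary:
  assumes \<phi>: "\<phi> \<in> gen T h1" and \<psi>: "\<psi> \<in> gen T h2" and \<gamma>: "\<gamma> \<in> gen T h3"
  shows "mode T \<phi> n (mode T \<psi> m ((Lmode T (-1) ^^ N) \<gamma>)) - mode T \<psi> m (mode T \<phi> n ((Lmode T (-1) ^^ N) \<gamma>))
    = (\<Sum>i<h1 + h2. (of_int (n + int h1 - 1) gchoose i) \<cdot>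
         mode T (mode T \<phi> (int i + 1 - int h1) \<psi>) (m + n) ((Lmode T (-1) ^^ N) \<gamma>))"
proof (rule probe_eqI)
  fix ys assume p: "probe ys"
  define \<omega> where "\<omega> = (Lmode T (-1) ^^ N) \<gamma>"
  define k where "k = n + int h1 - 1"
  define l where "l = m + int h2 - 1"
  note d = probe_distinct[OF p]
  note W = gen_weight[OF \<phi>] gen_weight[OF \<psi>]
  from distinct_radius[OF d] obtain R where R: "0 < R" "\<And>x. x \<in> snd ` set ys \<Longrightarrow> R < cmod (x - 0)"
    by blast
  define r where "r = R / 2"
  define r1 where "r1 = R / 4"
  define r2 where "r2 = 3 * R / 4"
  have r: "0 < r1" "r1 < r" "r < r2" "r2 < R" "0 < r" "0 < r2" using R by (auto simp: r_def r1_def r2_def)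
  define A where "A z w = amp T ((\<phi>, z) # (\<psi>, w) # (\<omega>, 0) # ys)" for z w
  let ?c = "2 * of_real pi * \<i> :: complex"
  have dd: "distinct (map snd ((\<phi>, z) # (\<psi>, w) # (\<omega>, 0) # ys))"
    if "cmod z < R" "cmod w < R" "z \<noteq> w" "z \<noteq> 0" "w \<noteq> 0" for z w
    using that d R(2) by force
  have dd1: "distinct (0 # map snd ((\<alpha>, z) # ys))" if "cmod z < R" "z \<noteq> 0" for z and \<alpha> :: 'a
  proof -
    have "z \<notin> snd ` set ys" using R(2)[of z] that(1) by auto
    then show ?thesis using d that(2) by simp
  qed
  have Ri: "\<And>x. x \<in> snd ` set ys \<Longrightarrow> s < cmod (x - 0)" if "s < R" for s
    using R(2) that by force

  have contA: "continuous_on (path_image (circlepath 0 r2) \<times> path_image (circlepath 0 r)) (\<lambda>(z, w). A z w)"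
  proof -
    have "continuous_on (path_image (circlepath 0 r2) \<times> path_image (circlepath 0 r))
      (\<lambda>x. amp T (((Lmode T (-1) ^^ N) \<gamma>, snd (x, 0::complex)) # (\<phi>, fst (fst (x, 0::complex))) # (\<psi>, snd (fst (x, 0::complex))) # ys))"
    proof (rule continuous_on_compose2[OF amp_gen_continuous[OF \<phi> \<psi> \<gamma> p, of N]])
      show "continuous_on (path_image (circlepath 0 r2) \<times> path_image (circlepath 0 r)) (\<lambda>x. (x, 0::complex))"
        by (intro continuous_intros)
      show "(\<lambda>x. (x, 0::complex)) ` (path_image (circlepath 0 r2) \<times> path_image (circlepath 0 r))
        \<subseteq> {q. distinct (snd q # fst (fst q) # snd (fst q) # map snd ys)}"
      proof safe
        fix z w assume "z \<in> path_image (circlepath 0 r2)" "w \<in> path_image (circlepath 0 r)"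
        then have "cmod z = r2" "cmod w = r" using r by auto
        then have "distinct (map snd ((\<phi>, z) # (\<psi>, w) # (\<omega>, 0) # ys))"
          by (intro dd) (use r in auto)
        then show "distinct (snd ((z, w), 0) # fst (fst ((z, w), 0)) # snd (fst ((z, w), 0)) # map snd ys)"
          by auto
      qed
    qed
    then show ?thesis
    proof (rule continuous_on_eq)
      fix x assume "x \<in> path_image (circlepath 0 r2) \<times> path_image (circlepath 0 r)"
      then obtain z w where x: "x = (z, w)" "cmod z = r2" "cmod w = r" using r by auto
      have "distinct (map snd ((\<phi>, z) # (\<psi>, w) # (\<omega>, 0) # ys))"
        by (rule dd) (use x r in auto)
      then have "distinct (map snd ((\<omega>, 0) # (\<phi>, z) # (\<psi>, w) # ys))" by auto
      from amp_rotate[OF this]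
      show "amp T (((Lmode T (-1) ^^ N) \<gamma>, snd (x, 0::complex)) # (\<phi>, fst (fst (x, 0::complex))) # (\<psi>, snd (fst (x, 0::complex))) # ys)
        = (case x of (z, w) \<Rightarrow> A z w)"
        unfolding A_def \<omega>_def x by simp
    qed
  qed

  \<comment> \<open>Here \<open>|z| = r2 > |w| = r\<close>. After the exchange of the integrals, the
    one over \<open>w\<close> produces \<open>V_m(\<psi>) \<omega>\<close> at \<open>0\<close>, and
    the one over \<open>z\<close> then applies \<open>V_n(\<phi>)\<close>.\<close>
  have outer: "contour_integral (circlepath 0 r) (\<lambda>w. w powi l * contour_integral (circlepath 0 r2) (\<lambda>z. A z w * z powi k))
     = ?c * (?c * amp T ((mode T \<phi> n (mode T \<psi> m \<omega>), 0) # ys))"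
  proof -
    have "contour_integral (circlepath 0 r) (\<lambda>w. w powi l * contour_integral (circlepath 0 r2) (\<lambda>z. A z w * z powi k))
      = contour_integral (circlepath 0 r) (\<lambda>w. contour_integral (circlepath 0 r2) (\<lambda>z. w powi l * (A z w * z powi k)))"
    proof (rule contour_integral_eq)
      fix w assume w: "w \<in> path_image (circlepath 0 r)"
      have "(\<lambda>z. A z w * z powi k) contour_integrable_on circlepath 0 r2"
      proof (rule contour_integrable_continuous_circlepath)
        have "continuous_on (path_image (circlepath 0 r2)) (\<lambda>z. (\<lambda>(z, w). A z w) (z, w))"
          by (rule continuous_on_compose2[OF contA]) (use w in \<open>auto intro!: continuous_intros\<close>)
        then show "continuous_on (path_image (circlepath 0 r2)) (\<lambda>z. A z w * z powi k)"
          using r by (auto intro!: continuous_intros)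
      qed
      then show "w powi l * contour_integral (circlepath 0 r2) (\<lambda>z. A z w * z powi k)
        = contour_integral (circlepath 0 r2) (\<lambda>z. w powi l * (A z w * z powi k))"
        by (simp add: contour_integral_lmul)
    qed
    also have "\<dots> = contour_integral (circlepath 0 r2) (\<lambda>z. contour_integral (circlepath 0 r) (\<lambda>w. w powi l * (A z w * z powi k)))"
    proof (rule contour_integral_swap[symmetric])
      show "continuous_on (path_image (circlepath 0 r2) \<times> path_image (circlepath 0 r)) (\<lambda>(z, w). w powi l * (A z w * z powi k))"
        using contA r unfolding case_prod_beta by (intro continuous_intros) auto
    qed (auto simp: vector_derivative_circlepath intro!: continuous_intros)
    also have "\<dots> = contour_integral (circlepath 0 r2) (\<lambda>z. ?c * (amp T ((\<phi>, z) # (mode T \<psi> m \<omega>, 0) # ys) * (z - 0) powi (n + int h1 - 1)))"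
    proof (rule contour_integral_eq)
      fix z assume "z \<in> path_image (circlepath 0 r2)"
      then have z: "cmod z = r2" using r by auto
      have dz: "distinct (0 # map snd ((\<phi>, z) # ys))" by (rule dd1) (use z r in auto)
      have "contour_integral (circlepath 0 r) (\<lambda>w. w powi l * (A z w * z powi k))
        = contour_integral (circlepath 0 r) (\<lambda>w. (amp T ((\<psi>, w) # (\<omega>, 0) # (\<phi>, z) # ys) * (w - 0) powi (m + int h2 - 1)) * z powi k)"
      proof (rule contour_integral_eq)
        fix w assume "w \<in> path_image (circlepath 0 r)"
        then have "cmod w = r" using r by auto
        then have "distinct (map snd ((\<phi>, z) # (\<psi>, w) # (\<omega>, 0) # ys))"
          by (intro dd) (use z r in auto)
        from amp_rotate[OF this] show "w powi l * (A z w * z powi k)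
          = (amp T ((\<psi>, w) # (\<omega>, 0) # (\<phi>, z) # ys) * (w - 0) powi (m + int h2 - 1)) * z powi k"
          by (simp add: A_def l_def)
      qed
      also have "\<dots> = ?c * amp T ((mode T \<psi> m \<omega>, 0) # (\<phi>, z) # ys) * z powi k"
      proof -
        have rz: "\<And>x. x \<in> snd ` set ((\<phi>, z) # ys) \<Longrightarrow> r < cmod (x - 0)"
          using z r Ri[of r] by auto
        show ?thesis
          using mode_amp[OF W(2) dz r(5) rz, of \<omega> m] amp_circle_integrable[OF W(2) dz r(5) rz, of \<omega> "m + int h2 - 1"]
          by (simp add: contour_integral_rmul)
      qed
      also have "amp T ((mode T \<psi> m \<omega>, 0) # (\<phi>, z) # ys) = amp T ((\<phi>, z) # (mode T \<psi> m \<omega>, 0) # ys)"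
        using dz by (intro amp_swap) auto
      finally show "contour_integral (circlepath 0 r) (\<lambda>w. w powi l * (A z w * z powi k))
         = ?c * (amp T ((\<phi>, z) # (mode T \<psi> m \<omega>, 0) # ys) * (z - 0) powi (n + int h1 - 1))"
        by (simp add: k_def mult_ac)
    qed
    also have "\<dots> = ?c * (?c * amp T ((mode T \<phi> n (mode T \<psi> m \<omega>), 0) # ys))"
      using mode_amp[OF W(1) d r(6) Ri[OF r(4)], of "mode T \<psi> m \<omega>" n]
        amp_circle_integrable[OF W(1) d r(6) Ri[OF r(4)], of "mode T \<psi> m \<omega>" "n + int h1 - 1"]
      by (simp add: contour_integral_lmul)
    finally show ?thesis .
  qed

  \<comment> \<open>With \<open>|z| = r1 < |w|\<close> the mode of \<open>\<phi>\<close> acts on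
    \<open>\<omega>\<close> first.\<close>
  have inner: "contour_integral (circlepath 0 r1) (\<lambda>z. A z w * z powi k) = ?c * amp T ((\<psi>, w) # (mode T \<phi> n \<omega>, 0) # ys)"
    if w: "cmod w = r" for w
  proof -
    have dw: "distinct (0 # map snd ((\<psi>, w) # ys))" by (rule dd1) (use w r in auto)
    have rw: "\<And>x. x \<in> snd ` set ((\<psi>, w) # ys) \<Longrightarrow> r1 < cmod (x - 0)"
      using w r Ri[of r1] by auto
    have "contour_integral (circlepath 0 r1) (\<lambda>z. A z w * z powi k)
      = contour_integral (circlepath 0 r1) (\<lambda>z. amp T ((\<phi>, z) # (\<omega>, 0) # (\<psi>, w) # ys) * (z - 0) powi (n + int h1 - 1))"
    proof (rule contour_integral_eq)
      fix z assume "z \<in> path_image (circlepath 0 r1)"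
      then have "cmod z = r1" using r by auto
      then have "distinct (map snd ((\<phi>, z) # (\<psi>, w) # (\<omega>, 0) # ys))"
        by (intro dd) (use w r in auto)
      then have "amp T ((\<phi>, z) # (\<psi>, w) # (\<omega>, 0) # ys) = amp T ((\<phi>, z) # (\<omega>, 0) # (\<psi>, w) # ys)"
        by (intro amp_perm) auto
      then show "A z w * z powi k = amp T ((\<phi>, z) # (\<omega>, 0) # (\<psi>, w) # ys) * (z - 0) powi (n + int h1 - 1)"
        by (simp add: A_def k_def)
    qed
    also have "\<dots> = ?c * amp T ((mode T \<phi> n \<omega>, 0) # (\<psi>, w) # ys)"
      by (rule mode_amp[OF W(1) dw r(1) rw])
    also have "amp T ((mode T \<phi> n \<omega>, 0) # (\<psi>, w) # ys) = amp T ((\<psi>, w) # (mode T \<phi> n \<omega>, 0) # ys)"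
      using dw by (intro amp_swap) auto
    finally show ?thesis .
  qed

  define B where "B i w = amp T ((mode T \<phi> (int i + 1 - int h1) \<psi>, w) # (\<omega>, 0) # ys)" for i w
  \<comment> \<open>Widening the contour from \<open>r1\<close> to \<open>r2\<close> picks up the
    singularity at \<open>z = w\<close>, where the integrand is expanded by
    \<open>ope\<close>.\<close>
  have middle: "contour_integral (circlepath 0 r2) (\<lambda>z. A z w * z powi k)
      = contour_integral (circlepath 0 r1) (\<lambda>z. A z w * z powi k)
        + ?c * (\<Sum>i<h1 + h2. (of_int k gchoose i) * (B i w * w powi (k - int i)))"
    if w: "cmod w = r" for w
  proof -
    let ?F = "\<lambda>z. A z w * z powi k"
    have w0: "w \<noteq> 0" using w r by auto
    have holo: "?F holomorphic_on ball 0 R - {0, w}"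
    proof (intro holomorphic_intros)
      show "(\<lambda>z. A z w) holomorphic_on ball 0 R - {0, w}"
        unfolding holomorphic_on_def
      proof
        fix z assume "z \<in> ball 0 R - {0, w}"
        then have "distinct (map snd ((\<phi>, z) # (\<psi>, w) # (\<omega>, 0) # ys))"
          by (intro dd) (use w r in auto)
        then have "distinct (z # map snd ((\<psi>, w) # (\<omega>, 0) # ys))" by simp
        from translation[OF W(1) this]
        show "(\<lambda>z. A z w) field_differentiable at z within ball 0 R - {0, w}"
          unfolding A_def by (meson field_differentiable_def field_differentiable_at_within)
      qed
    qed auto
    have out: "\<forall>z. z \<notin> ball 0 R \<longrightarrow> winding_number (circlepath 0 s) z = 0" if "s < R" "0 < s" for s
      using that by (intro allI impI winding_number_zero_outside[where s = "cball 0 s"]) (auto simp: path_image_circlepath)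
    have I2: "contour_integral (circlepath 0 r2) ?F = ?c * (residue ?F 0 + residue ?F w)"
    proof -
      have "contour_integral (circlepath 0 r2) ?F = 2 * pi * \<i> * (\<Sum>q\<in>{0, w}. winding_number (circlepath 0 r2) q * residue ?F q)"
        by (rule Residue_theorem[OF _ _ _ holo]) (use r w out[of r2] in \<open>auto simp: path_image_circlepath\<close>)
      also have "(\<Sum>q\<in>{0, w}. winding_number (circlepath 0 r2) q * residue ?F q) = residue ?F 0 + residue ?F w"
        using w0 w r by (simp add: winding_number_circlepath)
      finally show ?thesis by simp
    qed
    have I1: "contour_integral (circlepath 0 r1) ?F = ?c * residue ?F 0"
    proof -
      have "contour_integral (circlepath 0 r1) ?F = 2 * pi * \<i> * (\<Sum>q\<in>{0, w}. winding_number (circlepath 0 r1) q * residue ?F q)"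
        by (rule Residue_theorem[OF _ _ _ holo]) (use r w out[of r1] in \<open>auto simp: path_image_circlepath\<close>)
      also have "winding_number (circlepath 0 r1) w = 0"
        by (rule winding_number_zero_outside[where s = "cball 0 r1"]) (use r w in \<open>auto simp: path_image_circlepath\<close>)
      then have "(\<Sum>q\<in>{0, w}. winding_number (circlepath 0 r1) q * residue ?F q) = residue ?F 0"
        using w0 w r by (simp add: winding_number_circlepath)
      finally show ?thesis by simp
    qed
    have dw: "distinct (w # map snd ((\<omega>, 0) # ys))"
      using dd1[of w \<psi>] w w0 r by auto
    from distinct_radius[OF this] obtain e0 where e0: "0 < e0" "\<And>x. x \<in> snd ` set ((\<omega>, 0) # ys) \<Longrightarrow> e0 < cmod (x - w)"
      by blast
    define e where "e = min e0 ((R - r) / 2)"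
    have e: "0 < e" "\<And>x. x \<in> snd ` set ((\<omega>, 0) # ys) \<Longrightarrow> e < cmod (x - w)" "e < R - r"
      using e0 r by (auto simp: e_def min_less_iff_disj)
    have e_w: "e < cmod w" using e(2)[of 0] by simp
    have "(?F has_contour_integral 2 * pi * \<i> * residue ?F w) (circlepath w e)"
    proof (rule base_residue)
      show "open (ball 0 R - {0})" by (intro open_Diff) auto
      show "?F holomorphic_on ball 0 R - {0} - {w}" using holo by (simp add: Diff_insert2[symmetric] insert_commute)
      show "cball w e \<subseteq> ball 0 R - {0}"
      proof
        fix z assume "z \<in> cball w e"
        then have "cmod (z - w) \<le> e" by (simp add: dist_norm norm_minus_commute)
        moreover have "cmod z \<le> cmod (z - w) + cmod w" by (metis diff_add_cancel norm_triangle_ineq)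
        ultimately show "z \<in> ball 0 R - {0}" using e e_w w by auto
      qed
    qed (use e w w0 r in auto)
    then have I3: "contour_integral (circlepath w e) ?F = ?c * residue ?F w"
      by (simp add: contour_integral_unique)
    have I4: "((\<lambda>q. amp T ((mode T \<phi> (- q - int h1) \<psi>, w) # (\<omega>, 0) # ys)
          * contour_integral (circlepath w e) (\<lambda>z. (z - w) powi q * z powi k)) has_sum
        contour_integral (circlepath w e) ?F) UNIV"
    proof (rule contour_integral_circlepath_has_sum[OF e(1), where P = "\<lambda>z. z powi k"])
      fix z assume z: "cmod (z - w) = e"
      have lt: "\<forall>x\<in>snd ` set ((\<omega>, 0) # ys). cmod (z - w) < cmod (x - w)"
        using e(2) z by blast
      then have "z \<notin> snd ` set ((\<omega>, 0) # ys)" by blast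
      moreover have "z \<noteq> w" using z e(1) by auto
      ultimately have "distinct (z # w # map snd ((\<omega>, 0) # ys))" using dw by simp
      from ope[OF W(1) this lt]
      show "((\<lambda>q. (z - w) powi q * amp T ((mode T \<phi> (- q - int h1) \<psi>, w) # (\<omega>, 0) # ys)) has_sum A z w) UNIV"
        unfolding A_def .
    next
      have "z \<noteq> 0" if "z \<in> sphere w e" for z using that e_w by auto
      then show "continuous_on (sphere w e) (\<lambda>z. z powi k)"
        by (intro continuous_on_power_int continuous_on_id) blast
    qed
    have holk: "(\<lambda>z. z powi k) holomorphic_on cball w e"
    proof -
      have "z \<noteq> 0" if "z \<in> cball w e" for z using that e_w by (auto simp: dist_norm)
      then show ?thesis
        unfolding holomorphic_on_def
        using DERIV_power_int[OF DERIV_ident] field_differentiable_def by blast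
    qed
    \<comment> \<open>A pole of order \<open>i + 1\<close> extracts the Taylor coefficient of index
      \<open>i\<close> of \<open>z powi k\<close> at \<open>w\<close>; this is the source of the
      binomials.\<close>
    have neg: "contour_integral (circlepath w e) (\<lambda>z. (z - w) powi (- int (Suc i)) * z powi k)
         = ?c * ((of_int k gchoose i) * w powi (k - int i))" for i
    proof -
      have "((\<lambda>u. u powi k / (u - w) ^ (Suc i)) has_contour_integral ((2 * pi * \<i>) / (fact i) * (deriv ^^ i) (\<lambda>z. z powi k) w)) (circlepath w e)"
        by (rule Cauchy_has_contour_integral_higher_derivative_circlepath)
           (use holk e in \<open>auto intro!: holomorphic_on_imp_continuous_on elim: holomorphic_on_subset\<close>)
      then have "contour_integral (circlepath w e) (\<lambda>u. u powi k / (u - w) ^ (Suc i)) = ?c * ((of_int k gchoose i) * w powi (k - int i))"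
        by (simp add: contour_integral_unique higher_deriv_power_int[OF w0])
      moreover have "(\<lambda>u. u powi k / (u - w) ^ (Suc i)) = (\<lambda>z. (z - w) powi (- int (Suc i)) * z powi k)"
        by (simp add: power_int_minus field_simps power_int_def nat_add_distrib fun_eq_iff)
      ultimately show ?thesis by simp
    qed
    have pos: "contour_integral (circlepath w e) (\<lambda>z. (z - w) powi q * z powi k) = 0" if "q \<ge> 0" for q
    proof -
      have "((\<lambda>z. (z - w) powi q * z powi k) has_contour_integral 0) (circlepath w e)"
        by (rule Cauchy_theorem_convex_simple[where S = "cball w e"])
           (use holk that e in \<open>auto intro!: holomorphic_intros simp: power_int_def\<close>)
      then show ?thesis by (rule contour_integral_unique)
    qed
    have "contour_integral (circlepath w e) ?F = (\<Sum>q\<in>(\<lambda>i. - int (Suc i)) ` {..<h1 + h2}. amp T ((mode T \<phi> (- q - int h1) \<psi>, w) # (\<omega>, 0) # ys)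
          * contour_integral (circlepath w e) (\<lambda>z. (z - w) powi q * z powi k))"
    proof (rule has_sum_unique[OF I4 has_sum_finite_neutralI])
      fix q assume q: "q \<in> UNIV - (\<lambda>i. - int (Suc i)) ` {..<h1 + h2}"
      show "amp T ((mode T \<phi> (- q - int h1) \<psi>, w) # (\<omega>, 0) # ys)
          * contour_integral (circlepath w e) (\<lambda>z. (z - w) powi q * z powi k) = 0"
      proof (cases "q \<ge> 0")
        case False
        have "- q - 1 \<ge> int (h1 + h2)"
        proof (rule ccontr)
          assume "\<not> - q - 1 \<ge> int (h1 + h2)"
          then have "q = - int (Suc (nat (- q - 1)))" "nat (- q - 1) < h1 + h2" using False by auto
          then show False using q by blast
        qed
        \<comment> \<open>Its weight would be \<open>h1 + h2 + q\<close>, which is negative. This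
          bounds the pole order and makes the sum finite.\<close>
        then have "mode T \<phi> (- q - int h1) \<psi> = 0"
          by (intro weight_neg[OF mode_weight[OF W]]) auto
        then show ?thesis using amp_zero[of w "(\<omega>, 0) # ys"] dw by simp
      qed (simp add: pos)
    qed auto
    also have "\<dots> = (\<Sum>i<h1 + h2. B i w * (?c * ((of_int k gchoose i) * w powi (k - int i))))"
    proof (subst sum.reindex)
      have "- (- int (Suc i)) - int h1 = int i + 1 - int h1" for i by simp
      then show "sum ((\<lambda>q. amp T ((mode T \<phi> (- q - int h1) \<psi>, w) # (\<omega>, 0) # ys)
          * contour_integral (circlepath w e) (\<lambda>z. (z - w) powi q * z powi k)) \<circ> (\<lambda>i. - int (Suc i))) {..<h1 + h2}
        = (\<Sum>i<h1 + h2. B i w * (?c * ((of_int k gchoose i) * w powi (k - int i))))"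
        unfolding o_def neg B_def by (simp only:)
    qed (auto simp: inj_on_def)
    also have "\<dots> = ?c * (\<Sum>i<h1 + h2. (of_int k gchoose i) * (B i w * w powi (k - int i)))"
      by (simp add: sum_distrib_left mult_ac)
    finally show ?thesis
      using I1 I2 I3 by (simp add: distrib_left)
  qed

  have BW: "mode T \<phi> (int i + 1 - int h1) \<psi> \<in> weight_space T (int h2 - (int i + 1 - int h1))" for i
    by (rule mode_weight[OF W])
  have "contour_integral (circlepath 0 r) (\<lambda>w. w powi l * contour_integral (circlepath 0 r2) (\<lambda>z. A z w * z powi k))
     = contour_integral (circlepath 0 r) (\<lambda>w. ?c * (amp T ((\<psi>, w) # (mode T \<phi> n \<omega>, 0) # ys) * (w - 0) powi (m + int h2 - 1))
        + (\<Sum>i<h1 + h2. ?c * (of_int k gchoose i) * (amp T ((mode T \<phi> (int i + 1 - int h1) \<psi>, w) # (\<omega>, 0) # ys)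
            * (w - 0) powi ((m + n) + (int h2 - (int i + 1 - int h1)) - 1))))"
  proof (rule contour_integral_eq)
    fix w assume "w \<in> path_image (circlepath 0 r)"
    then have w: "cmod w = r" using r by auto
    have w0: "w \<noteq> 0" using w r by auto
    have pw: "w powi l * w powi (k - int i) = w powi ((m + n) + (int h2 - (int i + 1 - int h1)) - 1)" for i
      using w0 by (simp add: power_int_add[symmetric] l_def k_def algebra_simps)
    show "w powi l * contour_integral (circlepath 0 r2) (\<lambda>z. A z w * z powi k)
      = ?c * (amp T ((\<psi>, w) # (mode T \<phi> n \<omega>, 0) # ys) * (w - 0) powi (m + int h2 - 1))
        + (\<Sum>i<h1 + h2. ?c * (of_int k gchoose i) * (amp T ((mode T \<phi> (int i + 1 - int h1) \<psi>, w) # (\<omega>, 0) # ys)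
            * (w - 0) powi ((m + n) + (int h2 - (int i + 1 - int h1)) - 1)))"
      unfolding middle[OF w] inner[OF w] diff_zero pw[symmetric] l_def[symmetric] B_def
      by (simp add: distrib_left sum_distrib_left mult_ac)
  qed
  also have "\<dots> = ?c * (?c * amp T ((mode T \<psi> m (mode T \<phi> n \<omega>), 0) # ys))
     + (\<Sum>i<h1 + h2. ?c * (of_int k gchoose i) * (?c * amp T ((mode T (mode T \<phi> (int i + 1 - int h1) \<psi>) (m + n) \<omega>, 0) # ys)))"
  proof -
    have Rr: "\<And>x. x \<in> snd ` set ys \<Longrightarrow> r < cmod (x - 0)" using r by (intro Ri) auto
    have X: "((\<lambda>w. amp T ((\<psi>, w) # (mode T \<phi> n \<omega>, 0) # ys) * (w - 0) powi (m + int h2 - 1)) has_contour_integral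
        ?c * amp T ((mode T \<psi> m (mode T \<phi> n \<omega>), 0) # ys)) (circlepath 0 r)"
      by (subst mode_amp[OF W(2) d r(5) Rr, symmetric], assumption,
          intro has_contour_integral_integral amp_circle_integrable[OF W(2) d r(5) Rr])
    have Y: "((\<lambda>w. amp T ((mode T \<phi> (int i + 1 - int h1) \<psi>, w) # (\<omega>, 0) # ys)
            * (w - 0) powi ((m + n) + (int h2 - (int i + 1 - int h1)) - 1)) has_contour_integral
        ?c * amp T ((mode T (mode T \<phi> (int i + 1 - int h1) \<psi>) (m + n) \<omega>, 0) # ys)) (circlepath 0 r)" for i
      by (subst mode_amp[OF BW d r(5) Rr, symmetric], assumption,
          intro has_contour_integral_integral amp_circle_integrable[OF BW d r(5) Rr])
    show ?thesis
      by (intro contour_integral_unique has_contour_integral_add has_contour_integral_lmul X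
          has_contour_integral_sum Y finite_lessThan)
  qed
  finally have "?c * ?c * amp T ((mode T \<phi> n (mode T \<psi> m \<omega>), 0) # ys) = ?c * ?c * (amp T ((mode T \<psi> m (mode T \<phi> n \<omega>), 0) # ys)
     + (\<Sum>i<h1 + h2. (of_int k gchoose i) * amp T ((mode T (mode T \<phi> (int i + 1 - int h1) \<psi>) (m + n) \<omega>, 0) # ys)))"
    unfolding outer by (simp add: distrib_left sum_distrib_left mult_ac)
  then have "amp T ((mode T \<phi> n (mode T \<psi> m \<omega>), 0) # ys) = amp T ((mode T \<psi> m (mode T \<phi> n \<omega>), 0) # ys)
     + (\<Sum>i<h1 + h2. (of_int k gchoose i) * amp T ((mode T (mode T \<phi> (int i + 1 - int h1) \<psi>) (m + n) \<omega>, 0) # ys))"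
    by simp
  moreover have "amp T ((mode T \<phi> n (mode T \<psi> m \<omega>) + - mode T \<psi> m (mode T \<phi> n \<omega>), 0) # ys)
    = amp T ((mode T \<phi> n (mode T \<psi> m \<omega>), 0) # ys) - amp T ((mode T \<psi> m (mode T \<phi> n \<omega>), 0) # ys)"
    unfolding amp_add[OF d] amp_minus[OF d] by simp
  ultimately show "amp T ((mode T \<phi> n (mode T \<psi> m ((Lmode T (-1) ^^ N) \<gamma>)) - mode T \<psi> m (mode T \<phi> n ((Lmode T (-1) ^^ N) \<gamma>)), 0) # ys)
    = amp T ((\<Sum>i<h1 + h2. (of_int (n + int h1 - 1) gchoose i) \<cdot>
         mode T (mode T \<phi> (int i + 1 - int h1) \<psi>) (m + n) ((Lmode T (-1) ^^ N) \<gamma>), 0) # ys)"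
    unfolding amp_sum[OF d] amp_scale[OF d] \<omega>_def[symmetric] k_def[symmetric] by simp
qed

text \<open>Both sides are linear in \<open>\<omega>\<close>, so the descendants handled above
  suffice by \<open>quasiprimary_span\<close>.\<close>

lemma gen_commutator:
  assumes \<phi>: "\<phi> \<in> gen T h1" and \<psi>: "\<psi> \<in> gen T h2"
  shows "mode T \<phi> n (mode T \<psi> m \<omega>) - mode T \<psi> m (mode T \<phi> n \<omega>)
    = (\<Sum>i<h1 + h2. (of_int (n + int h1 - 1) gchoose i) \<cdot>
         mode T (mode T \<phi> (int i + 1 - int h1) \<psi>) (m + n) \<omega>)"
proof -
  note W = gen_weight[OF \<phi>] gen_weight[OF \<psi>]
  note BW = mode_weight[OF W]
  have "\<omega> \<in> vs.span {(Lmode T (-1) ^^ n) \<psi> | n \<psi> h. \<psi> \<in> gen T h}" using quasiprimary_span by simp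
  then show ?thesis
  proof (induction rule: vs.span_induct_alt)
    case base
    show ?case by (simp add: mode_0[OF W(1)] mode_0[OF W(2)] mode_0[OF BW])
  next
    case (step c x y)
    then obtain N \<gamma> h where x: "x = (Lmode T (-1) ^^ N) \<gamma>" "\<gamma> \<in> gen T h" by auto
    have "mode T \<phi> n (mode T \<psi> m (c \<cdot> x + y)) - mode T \<psi> m (mode T \<phi> n (c \<cdot> x + y))
      = c \<cdot> (mode T \<phi> n (mode T \<psi> m x) - mode T \<psi> m (mode T \<phi> n x))
        + (mode T \<phi> n (mode T \<psi> m y) - mode T \<psi> m (mode T \<phi> n y))"
      by (simp add: mode_add[OF W(1)] mode_add[OF W(2)] mode_scale[OF W(1)] mode_scale[OF W(2)] vs.scale_right_diff_distrib)
    also have "\<dots> = (\<Sum>i<h1 + h2. (of_int (n + int h1 - 1) gchoose i) \<cdot>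
         mode T (mode T \<phi> (int i + 1 - int h1) \<psi>) (m + n) (c \<cdot> x + y))"
      unfolding step.IH x(1) gen_commutator_quasiprimary[OF \<phi> \<psi> x(2)]
      by (simp add: mode_add[OF BW] mode_scale[OF BW] vs.scale_right_distrib sum.distrib vs.scale_sum_right mult.commute)
    finally show ?case .
  qed
qed

end

section \<open>Laurent polynomials with rational coefficients\<close>

text \<open>Rational functions of \<open>u\<close> are kept as expressions, so that they can be differentiated formally;
  \<open>pd x\<close> is the derivative in the direction \<open>x\<close>.\<close>

datatype 'k rexp = Const complex | Var 'k | InvVar 'k | InvDiff 'k 'k
  | Add "'k rexp" "'k rexp" | Mul "'k rexp" "'k rexp"

fun rval :: "'k rexp \<Rightarrow> ('k \<Rightarrow> complex) \<Rightarrow> complex" where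
  "rval (Const c) u = c"
| "rval (Var i) u = u i"
| "rval (InvVar i) u = inverse (u i)"
| "rval (InvDiff i j) u = inverse (u i - u j)"
| "rval (Add a b) u = rval a u + rval b u"
| "rval (Mul a b) u = rval a u * rval b u"

fun pd :: "('k \<Rightarrow> complex) \<Rightarrow> 'k rexp \<Rightarrow> 'k rexp" where
  "pd x (Const c) = Const 0"
| "pd x (Var i) = Const (x i)"
| "pd x (InvVar i) = Mul (Const (- x i)) (Mul (InvVar i) (InvVar i))"
| "pd x (InvDiff i j) = Mul (Const (x j - x i)) (Mul (InvDiff i j) (InvDiff i j))"
| "pd x (Add a b) = Add (pd x a) (pd x b)"
| "pd x (Mul a b) = Add (Mul (pd x a) b) (Mul a (pd x b))"

text \<open>The configurations in \<open>config_space\<close> all of whose points are finite, in the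
  coordinate \<open>z\<close>.\<close>

definition conf :: "('k \<Rightarrow> complex) set" where
  "conf = {u. inj u \<and> (\<forall>i. u i \<noteq> 0)}"

definition line :: "('k \<Rightarrow> complex) \<Rightarrow> ('k \<Rightarrow> complex) \<Rightarrow> complex \<Rightarrow> 'k \<Rightarrow> complex" where
  "line u x t = (\<lambda>i. u i + t * x i)"

lemma line_0 [simp]: "line u x 0 = u"
  by (simp add: line_def)

lemma line_apply: "line u x t i = u i + t * x i"
  by (simp add: line_def)

lemma rval_deriv:
  assumes "line u x t \<in> conf"
  shows "((\<lambda>t. rval e (line u x t)) has_field_derivative rval (pd x e) (line u x t)) (at t)"
proof (induction e)
  case (InvVar i)
  have "line u x t i \<noteq> 0" using assms by (auto simp: conf_def)
  then show ?case
    by (auto simp: line_apply power2_eq_square intro!: derivative_eq_intros)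
next
  case (InvDiff i j)
  show ?case
  \<comment> \<open>For \<open>i = j\<close> the expression is constantly
    \<open>inverse 0 = 0\<close>, and the factor \<open>x j - x i\<close> in its formal derivative
    vanishes as well.\<close>
  proof (cases "i = j")
    case False
    then have "line u x t i - line u x t j \<noteq> 0" using assms by (auto simp: conf_def inj_def)
    then show ?thesis
      by (auto simp: line_apply power2_eq_square algebra_simps intro!: derivative_eq_intros)
  qed simp
qed (auto simp: line_apply intro!: derivative_eq_intros)

lemma pd_commute: "rval (pd x (pd y e)) u = rval (pd y (pd x e)) u"
  by (induction e) (auto simp: algebra_simps)

definition unit_dir :: "'k \<Rightarrow> 'k \<Rightarrow> complex" where
  "unit_dir i = (\<lambda>j. if j = i then 1 else 0)"

lemma sum_unit_dir: "(\<Sum>i\<in>UNIV. x i * unit_dir i j) = (x j :: complex)" for j :: "'k::finite"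
  by (simp add: unit_dir_def if_distrib cong: if_cong)

lemma pd_sum: "rval (pd x e) u = (\<Sum>i\<in>UNIV. x i * rval (pd (unit_dir i) e) u)" for e :: "'k::finite rexp"
proof (induction e)
  case (Mul a b)
  show ?case
    by (simp add: Mul.IH sum_distrib_left sum_distrib_right distrib_left sum.distrib mult_ac)
next
  case (InvVar i)
  show ?case using sum_unit_dir[of "\<lambda>l. x l * (inverse (u i) * inverse (u i))" i]
    by (simp add: sum_negf mult_ac)
next
  case (InvDiff i j)
  show ?case using sum_unit_dir[of "\<lambda>l. x l * (inverse (u i - u j) * inverse (u i - u j))" i]
    sum_unit_dir[of "\<lambda>l. x l * (inverse (u i - u j) * inverse (u i - u j))" j]
    by (simp add: sum_subtractf left_diff_distrib right_diff_distrib mult_ac)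
qed (simp_all add: sum_unit_dir distrib_left sum.distrib)

lemma conf_line_eventually:
  fixes u :: "'k::finite \<Rightarrow> complex"
  assumes "line u x t \<in> conf"
  shows "\<forall>\<^sub>F s in nhds t. line u x s \<in> conf"
proof -
  have 1: "\<forall>\<^sub>F s in nhds t. \<forall>i\<in>UNIV. line u x s i \<noteq> 0"
  proof (subst eventually_ball_finite_distrib, simp, rule ballI)
    fix i :: 'k
    have "open {s. line u x s i \<noteq> 0}"
      unfolding line_apply by (intro open_Collect_neq continuous_intros)
    then show "\<forall>\<^sub>F s in nhds t. line u x s i \<noteq> 0"
      using assms eventually_nhds_in_open[of "{s. line u x s i \<noteq> 0}" t] by (auto simp: conf_def)
  qed
  have 2: "\<forall>\<^sub>F s in nhds t. \<forall>p\<in>{(i, j). i \<noteq> j}. line u x s (fst p) \<noteq> line u x s (snd p)"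
  proof (subst eventually_ball_finite_distrib, simp, rule ballI)
    fix p :: "'k \<times> 'k" assume p: "p \<in> {(i, j). i \<noteq> j}"
    have "open {s. line u x s (fst p) \<noteq> line u x s (snd p)}"
      unfolding line_apply by (intro open_Collect_neq continuous_intros)
    then show "\<forall>\<^sub>F s in nhds t. line u x s (fst p) \<noteq> line u x s (snd p)"
    proof (rule eventually_nhds_in_open[of "{s. line u x s (fst p) \<noteq> line u x s (snd p)}", unfolded mem_Collect_eq])
      show "line u x t (fst p) \<noteq> line u x t (snd p)" using assms p by (auto simp: conf_def inj_def)
    qed
  qed
  from eventually_conj[OF 1 2] show ?thesis
    by (rule eventually_mono) (auto simp: conf_def inj_def)
qed

text \<open>A list of pairs \<open>(j, e)\<close> stands for \<open>\<Sum> e(u) z\<^sup>j\<close>.\<close>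

type_synonym 'k lexp = "(int \<times> 'k rexp) list"

definition lval :: "('k \<Rightarrow> complex) \<Rightarrow> 'k lexp \<Rightarrow> complex \<Rightarrow> complex" where
  "lval u G z = (\<Sum>(j, e)\<leftarrow>G. rval e u * z powi j)"

definition dz :: "'k lexp \<Rightarrow> 'k lexp" where
  "dz G = map (\<lambda>(j, e). (j - 1, Mul (Const (of_int j)) e)) G"

definition lpd :: "('k \<Rightarrow> complex) \<Rightarrow> 'k lexp \<Rightarrow> 'k lexp" where
  "lpd x G = map (\<lambda>(j, e). (j, pd x e)) G"

definition lscale :: "'k rexp \<Rightarrow> 'k lexp \<Rightarrow> 'k lexp" where
  "lscale c G = map (\<lambda>(j, e). (j, Mul c e)) G"

definition lmul :: "'k lexp \<Rightarrow> 'k lexp \<Rightarrow> 'k lexp" where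
  "lmul F G = concat (map (\<lambda>(j, e). map (\<lambda>(k, f). (j + k, Mul e f)) G) F)"

definition ldeg_le :: "int \<Rightarrow> 'k lexp \<Rightarrow> bool" where
  "ldeg_le d G \<longleftrightarrow> (\<forall>(j, e)\<in>set G. j \<le> d)"

lemma lval_Nil [simp]: "lval u [] z = 0"
  and lval_Cons [simp]: "lval u ((j, e) # G) z = rval e u * z powi j + lval u G z"
  and lval_append [simp]: "lval u (F @ G) z = lval u F z + lval u G z"
  by (simp_all add: lval_def)

lemma dz_Nil [simp]: "dz [] = []"
  and dz_Cons [simp]: "dz ((j, e) # G) = (j - 1, Mul (Const (of_int j)) e) # dz G"
  and dz_append [simp]: "dz (F @ G) = dz F @ dz G"
  by (simp_all add: dz_def)

lemma lpd_Nil [simp]: "lpd x [] = []"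
  and lpd_Cons [simp]: "lpd x ((j, e) # G) = (j, pd x e) # lpd x G"
  and lpd_append [simp]: "lpd x (F @ G) = lpd x F @ lpd x G"
  by (simp_all add: lpd_def)

lemma lscale_Nil [simp]: "lscale c [] = []"
  and lscale_Cons [simp]: "lscale c ((j, e) # G) = (j, Mul c e) # lscale c G"
  and lscale_append [simp]: "lscale c (F @ G) = lscale c F @ lscale c G"
  by (simp_all add: lscale_def)

lemma lmul_Nil [simp]: "lmul [] G = []"
  and lmul_Cons: "lmul ((j, e) # F) G = map (\<lambda>(k, f). (j + k, Mul e f)) G @ lmul F G"
  by (simp_all add: lmul_def)

lemma ldeg_le_Nil [simp]: "ldeg_le d []"
  and ldeg_le_Cons [simp]: "ldeg_le d ((j, e) # G) \<longleftrightarrow> j \<le> d \<and> ldeg_le d G"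
  and ldeg_le_append [simp]: "ldeg_le d (F @ G) \<longleftrightarrow> ldeg_le d F \<and> ldeg_le d G"
  by (auto simp: ldeg_le_def)

lemma ldeg_le_mono: "ldeg_le d G \<Longrightarrow> d \<le> d' \<Longrightarrow> ldeg_le d' G"
  by (force simp: ldeg_le_def)

lemma ldeg_le_dz: "ldeg_le d G \<Longrightarrow> ldeg_le (d - 1) (dz G)"
  and ldeg_le_lpd: "ldeg_le d G \<Longrightarrow> ldeg_le d (lpd x G)"
  and ldeg_le_lscale: "ldeg_le d G \<Longrightarrow> ldeg_le d (lscale c G)"
  by (force simp: ldeg_le_def dz_def lpd_def lscale_def)+

lemma ldeg_le_lmul: "ldeg_le a F \<Longrightarrow> ldeg_le b G \<Longrightarrow> ldeg_le (a + b) (lmul F G)"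
  by (fastforce simp: ldeg_le_def lmul_def intro: add_mono)

lemma lval_lscale [simp]: "lval u (lscale c G) z = rval c u * lval u G z"
  by (induction G) (auto simp: algebra_simps)

lemma lval_lmul: "z \<noteq> 0 \<Longrightarrow> lval u (lmul F G) z = lval u F z * lval u G z"
proof (induction F)
  case (Cons a F)
  obtain j e where a: "a = (j, e)" by (cases a)
  have "lval u (map (\<lambda>(k, f). (j + k, Mul e f)) G) z = rval e u * z powi j * lval u G z"
    by (induction G) (use Cons.prems in \<open>auto simp: algebra_simps power_int_add\<close>)
  then show ?case using Cons unfolding a by (simp add: lmul_Cons algebra_simps)
qed simp

lemma lval_deriv_joint:
  assumes "line u x t \<in> conf" "a + t * c \<noteq> 0"
  shows "((\<lambda>t. lval (line u x t) G (a + t * c)) has_field_derivative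
     lval (line u x t) (lpd x G) (a + t * c) + c * lval (line u x t) (dz G) (a + t * c)) (at t)"
proof (induction G)
  case (Cons b G)
  obtain j e where b: "b = (j, e)" by (cases b)
  have "((\<lambda>t. rval e (line u x t) * (a + t * c) powi j) has_field_derivative
      rval (pd x e) (line u x t) * (a + t * c) powi j
      + c * (of_int j * rval e (line u x t) * (a + t * c) powi (j - 1))) (at t)"
    by (rule derivative_eq_intros rval_deriv assms refl | use assms in simp)+
  from DERIV_add[OF this Cons.IH] show ?case
    unfolding b by (simp add: algebra_simps)
qed simp

lemma lval_deriv: "z \<noteq> 0 \<Longrightarrow> ((lval u G) has_field_derivative lval u (dz G) z) (at z)"
proof (induction G)
  case Nil
  then show ?case by (simp add: lval_def[abs_def])
next
  case (Cons b G)
  obtain j e where b: "b = (j, e)" by (cases b)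
  have eq: "lval u (b # G) = (\<lambda>z. rval e u * z powi j + lval u G z)"
    by (simp add: b fun_eq_iff)
  show ?case unfolding eq
    by (rule derivative_eq_intros Cons refl | use Cons.prems in \<open>simp add: b\<close>)+
qed

text \<open>The formal \<open>dz\<close> computes an actual derivative and hence depends only on the
  function, not on the expression representing it.\<close>

lemma lval_dz_eqI:
  assumes "\<And>z. z \<noteq> 0 \<Longrightarrow> lval u G z = lval u G' z" "z \<noteq> 0"
  shows "lval u (dz G) z = lval u (dz G') z"
proof (rule DERIV_unique)
  show "((lval u G') has_field_derivative lval u (dz G') z) (at z)" by (rule lval_deriv) fact
  show "((lval u G') has_field_derivative lval u (dz G) z) (at z)"
  proof (rule has_field_derivative_transform_within_open[OF lval_deriv])
    show "open (-{0::complex})" by (intro open_Compl closed_singleton)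
  qed (use assms in auto)
qed

lemma lval_dz_lmul:
  assumes "z \<noteq> 0"
  shows "lval u (dz (lmul F G)) z = lval u (dz F) z * lval u G z + lval u F z * lval u (dz G) z"
proof (rule DERIV_unique)
  show "((lval u (lmul F G)) has_field_derivative lval u (dz (lmul F G)) z) (at z)" by (rule lval_deriv) fact
  show "((lval u (lmul F G)) has_field_derivative lval u (dz F) z * lval u G z + lval u F z * lval u (dz G) z) (at z)"
  proof (rule has_field_derivative_transform_within_open)
    show "((\<lambda>z. lval u F z * lval u G z) has_field_derivative lval u (dz F) z * lval u G z + lval u F z * lval u (dz G) z) (at z)"
      using DERIV_mult[OF lval_deriv[OF assms] lval_deriv[OF assms], of u F u G] by (simp add: mult.commute)
    show "open (-{0::complex})" by (intro open_Compl closed_singleton)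
  qed (use assms in \<open>auto simp: lval_lmul\<close>)
qed

section \<open>Vanishing at the moving points \<open>u i\<close>\<close>

definition lequiv :: "'k lexp \<Rightarrow> 'k lexp \<Rightarrow> bool" where
  "lequiv G G' \<longleftrightarrow> (\<forall>u\<in>conf. \<forall>z. z \<noteq> 0 \<longrightarrow> lval u G z = lval u G' z)"

lemma lequiv_dz: "lequiv G G' \<Longrightarrow> lequiv (dz G) (dz G')"
  by (auto simp: lequiv_def intro: lval_dz_eqI)

text \<open>The condition is an identity in \<open>u\<close>, not a condition at one configuration,
  so that it can itself be differentiated with respect to \<open>u\<close>.\<close>

definition van :: "'k \<Rightarrow> nat \<Rightarrow> 'k lexp \<Rightarrow> bool" where
  "van i h G \<longleftrightarrow> (\<forall>u\<in>conf. \<forall>a<h. lval u ((dz ^^ a) G) (u i) = 0)"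

lemma van_0 [simp]: "van i 0 G"
  by (simp add: van_def)

lemma van_Suc: "van i (Suc h) G \<longleftrightarrow> (\<forall>u\<in>conf. lval u G (u i) = 0) \<and> van i h (dz G)"
  unfolding van_def All_less_Suc2 by (auto simp: funpow_Suc_right simp del: funpow.simps(2))

lemma van_dz: "van i h G \<Longrightarrow> van i (h - 1) (dz G)"
  by (cases h) (auto simp: van_Suc)

lemma van_dz_funpow: "van i h G \<Longrightarrow> van i (h - n) ((dz ^^ n) G)"
proof (induction n)
  case (Suc n)
  from van_dz[OF Suc.IH[OF Suc.prems]] show ?case by simp
qed simp

lemma conf_nz: "u \<in> conf \<Longrightarrow> u i \<noteq> 0"
  by (simp add: conf_def)

lemma van_lequiv: "van i h G \<Longrightarrow> lequiv G G' \<Longrightarrow> van i h G'"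
proof (induction h arbitrary: G G')
  case (Suc h)
  then show ?case using lequiv_dz[OF Suc.prems(2)]
    by (auto simp: van_Suc lequiv_def[of G] conf_nz)
qed simp

lemma van_append: "van i h F \<Longrightarrow> van i h G \<Longrightarrow> van i h (F @ G)"
  by (induction h arbitrary: F G) (auto simp: van_Suc)

lemma lequiv_dz_lmul: "lequiv (lmul (dz F) G @ lmul F (dz G)) (dz (lmul F G))"
  by (auto simp: lequiv_def lval_dz_lmul lval_lmul)

text \<open>Induction on the order by the Leibniz rule: each term of the derivative loses one order
  in one factor only.\<close>

lemma van_lmul: "van i a F \<Longrightarrow> van i b G \<Longrightarrow> n \<le> a + b \<Longrightarrow> van i n (lmul F G)"
proof (induction n arbitrary: a b F G)
  case (Suc n)
  have "lval u (lmul F G) (u i) = 0" if "u \<in> conf" for u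
    using Suc.prems that by (cases a; cases b) (auto simp: van_Suc lval_lmul conf_nz)
  moreover have "van i n (lmul (dz F) G @ lmul F (dz G))"
    by (intro van_append Suc.IH[OF van_dz[OF Suc.prems(1)] Suc.prems(2)]
        Suc.IH[OF Suc.prems(1) van_dz[OF Suc.prems(2)]]) (use Suc.prems(3) in auto)
  ultimately show ?case
    unfolding van_Suc by (blast intro: van_lequiv[OF _ lequiv_dz_lmul])
qed simp

lemma lval_dz_lscale [simp]: "lval u (dz (lscale c G)) z = rval c u * lval u (dz G) z"
  by (induction G) (auto simp: algebra_simps)

lemma van_lscale: "van i h G \<Longrightarrow> van i h (lscale c G)"
proof (induction h arbitrary: G)
  case (Suc h)
  then have "van i h (lscale c (dz G))" by (auto simp: van_Suc)
  then have "van i h (dz (lscale c G))"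
    by (rule van_lequiv) (simp add: lequiv_def)
  then show ?case using Suc.prems by (auto simp: van_Suc)
qed simp

lemma lval_dz_lpd: "lval u (dz (lpd x G)) z = lval u (lpd x (dz G)) z"
  by (induction G) (auto simp: algebra_simps)

text \<open>Differentiate the identity \<open>G(u, u\<^sub>i) = 0\<close> with respect to \<open>u\<close>.\<close>

lemma van_lpd:
  fixes G :: "'k::finite lexp"
  shows "van i h G \<Longrightarrow> van i h (lpd x G @ lscale (Const (x i)) (dz G))"
proof (induction h arbitrary: G)
  case (Suc h)
  have "lval u (lpd x G @ lscale (Const (x i)) (dz G)) (u i) = 0" if u: "u \<in> conf" for u
  proof -
    have "((\<lambda>t. lval (line u x t) G (u i + t * x i)) has_field_derivative
       lval (line u x 0) (lpd x G) (u i + 0 * x i) + x i * lval (line u x 0) (dz G) (u i + 0 * x i)) (at 0)"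
      by (rule lval_deriv_joint) (use u conf_nz[OF u] in auto)
    moreover have "\<forall>\<^sub>F t in nhds 0. lval (line u x t) G (u i + t * x i) = 0"
      using conf_line_eventually[of u x 0] u Suc.prems
      by (auto elim!: eventually_mono simp: van_Suc line_apply[symmetric])
    then have "((\<lambda>t. lval (line u x t) G (u i + t * x i)) has_field_derivative 0) (at 0)"
      by (subst DERIV_cong_ev[OF refl _ refl, where g = "\<lambda>_. 0"]) auto
    ultimately show ?thesis using DERIV_unique by fastforce
  qed
  moreover have "van i h (dz (lpd x G @ lscale (Const (x i)) (dz G)))"
  proof (rule van_lequiv)
    show "van i h (lpd x (dz G) @ lscale (Const (x i)) (dz (dz G)))"
      using Suc by (auto simp: van_Suc)
  qed (simp add: lequiv_def lval_dz_lpd)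
  ultimately show ?case unfolding van_Suc by blast
qed simp

section \<open>Interpolation and the vector fields of the connection\<close>

fun rpow :: "'k rexp \<Rightarrow> nat \<Rightarrow> 'k rexp" where
  "rpow e 0 = Const 1"
| "rpow e (Suc n) = Mul e (rpow e n)"

lemma rval_rpow [simp]: "rval (rpow e n) u = rval e u ^ n"
  by (induction n) auto

lemma interpolation_exists:
  fixes l :: "'k::finite"
  shows "\<exists>P. ldeg_le (- int M) P \<and> (\<forall>u\<in>conf. \<forall>i. lval u P (u i) = (if i = l then 1 else 0))"
proof -
  have "\<exists>Q. ldeg_le (int (card J)) Q \<and> (\<forall>u\<in>conf. lval u Q (u l) = 1 \<and> (\<forall>j\<in>J. lval u Q (u j) = 0))"
    if "finite J" "l \<notin> J" for J
    using that
  proof (induction J rule: finite_induct)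
    case empty
    show ?case by (rule exI[of _ "[(0, Const 1)]"]) simp
  next
    case (insert j J)
    then obtain Q where Q: "ldeg_le (int (card J)) Q"
      "\<And>u. u \<in> conf \<Longrightarrow> lval u Q (u l) = 1" "\<And>u j. u \<in> conf \<Longrightarrow> j \<in> J \<Longrightarrow> lval u Q (u j) = 0"
      by auto
    \<comment> \<open>The Lagrange factor \<open>(z - u_j) / (u_l - u_j)\<close>.\<close>
    let ?f = "[(1, InvDiff l j), (0, Mul (Const (-1)) (Mul (Var j) (InvDiff l j)))]"
    have "ldeg_le (1 + int (card J)) (lmul ?f Q)"
      by (rule ldeg_le_lmul[OF _ Q(1)]) simp
    moreover have "lval u (lmul ?f Q) (u l) = 1 \<and> (\<forall>i\<in>insert j J. lval u (lmul ?f Q) (u i) = 0)"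
      if u: "u \<in> conf" for u
    proof -
      have "u l - u j \<noteq> 0" using u insert.prems by (auto simp: conf_def inj_def)
      then have "inverse (u l - u j) * u l - u j * inverse (u l - u j) = 1"
        by (metis left_inverse mult.commute right_diff_distrib)
      then show ?thesis
        using Q(2,3)[OF u] by (auto simp: lval_lmul conf_nz[OF u])
    qed
    ultimately show ?case using insert.hyps by (intro exI[of _ "lmul ?f Q"]) auto
  qed
  from this[of "UNIV - {l}"] obtain Q where Q: "ldeg_le (int (card (UNIV - {l}))) Q"
    "\<And>u. u \<in> conf \<Longrightarrow> lval u Q (u l) = 1" "\<And>u j. u \<in> conf \<Longrightarrow> j \<noteq> l \<Longrightarrow> lval u Q (u j) = 0"
    by auto
  \<comment> \<open>The factor \<open>(u_l / z)^m\<close> is \<open>1\<close> at \<open>u_l\<close>,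
    keeps the zeros at the other points, and lowers the degree to \<open>- M\<close>. The pole it
    creates at \<open>0\<close> is allowed.\<close>
  define m where "m = M + card (UNIV - {l})"
  let ?P = "lmul [(- int m, rpow (Var l) m)] Q"
  have "ldeg_le (- int m + int (card (UNIV - {l}))) ?P"
    by (rule ldeg_le_lmul[OF _ Q(1)]) simp
  then have "ldeg_le (- int M) ?P"
    by (rule ldeg_le_mono) (simp only: m_def of_nat_add)
  moreover have "lval u ?P (u i) = (if i = l then 1 else 0)" if "u \<in> conf" for u i
    using Q(2,3)[OF that] that by (auto simp: lval_lmul conf_nz power_int_minus)
  ultimately show ?thesis by blast
qed

text \<open>If \<open>P\<close> takes the values \<open>0\<close> and \<open>1\<close> at the points \<open>u\<^sub>j\<close>, then \<open>3 P\<^sup>2 - 2 P\<^sup>3\<close> takes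
  the same values, with vanishing derivative.\<close>

lemma hermite_exists:
  fixes l :: "'k::finite"
  shows "\<exists>f. ldeg_le (- int M) f \<and> (\<forall>i. van i 2 (f @ [(0, Const (if i = l then -1 else 0))]))"
proof -
  obtain P where P: "ldeg_le (- int M) P" "\<And>u i. u \<in> conf \<Longrightarrow> lval u P (u i) = (if i = l then 1 else 0)"
    using interpolation_exists[of M l] by blast
  let ?Q = "(0, Const 3) # lscale (Const (-2)) P"
  let ?f = "lmul (lmul P P) ?Q"
  have "ldeg_le 0 ?Q" using ldeg_le_mono[OF P(1), of 0] by (simp add: ldeg_le_lscale)
  from ldeg_le_lmul[OF ldeg_le_lmul[OF P(1) P(1)] this]
  have "ldeg_le (- int M) ?f" by (rule ldeg_le_mono) simp
  moreover have "van i 2 (?f @ [(0, Const (if i = l then -1 else 0))])" for i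
    unfolding numeral_2_eq_2 van_Suc
    by (auto simp: lval_lmul lval_dz_lmul conf_nz P(2))
  ultimately show ?thesis by blast
qed

definition index_list :: "'k::finite list" where
  "index_list = (SOME xs. distinct xs \<and> set xs = UNIV)"

lemma index_list: "distinct (index_list :: 'k::finite list)" "set (index_list :: 'k list) = UNIV"
proof -
  have "\<exists>xs. distinct xs \<and> set xs = (UNIV :: 'k set)"
    using finite_distinct_list[OF finite[of "UNIV :: 'k set"]] by blast
  from someI_ex[OF this] show "distinct (index_list :: 'k list)" "set (index_list :: 'k list) = UNIV"
    unfolding index_list_def by blast+
qed

lemma sum_index_list: "(\<Sum>l\<leftarrow>index_list. g l) = (\<Sum>l\<in>UNIV. g l)" for g :: "'k::finite \<Rightarrow> 'b::comm_monoid_add"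
  using sum_list_distinct_conv_sum_set[OF index_list(1), of g] index_list(2)[where ?'k = 'k] by simp

text \<open>The functions \<open>f^l_u\<close> as one family in \<open>u\<close>. \<open>M\<close>
  is a prescribed decay at infinity: the connection itself uses \<open>M = 0\<close>, while the
  proof that it preserves \<open>O\<close> compares it with faster decaying choices.\<close>

definition conn_fun :: "nat \<Rightarrow> 'k::finite \<Rightarrow> 'k lexp" where
  "conn_fun M l = (SOME f. ldeg_le (- int M) f \<and> (\<forall>i. van i 2 (f @ [(0, Const (if i = l then -1 else 0))])))"

lemma conn_fun:
  "ldeg_le (- int M) (conn_fun M l)" "van i 2 (conn_fun M l @ [(0, Const (if i = l then -1 else 0))])"
  using someI_ex[OF hermite_exists[of M l]] unfolding conn_fun_def by blast+

definition conn_field :: "nat \<Rightarrow> ('k::finite \<Rightarrow> complex) \<Rightarrow> 'k lexp" where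
  "conn_field M x = concat (map (\<lambda>l. lscale (Const (x l)) (conn_fun M l)) index_list)"

lemma lval_concat: "lval u (concat Gs) z = (\<Sum>G\<leftarrow>Gs. lval u G z)"
  by (induction Gs) auto

lemma lval_conn_field: "lval u (conn_field M x) z = (\<Sum>l\<in>UNIV. x l * lval u (conn_fun M l) z)"
  unfolding conn_field_def lval_concat map_map o_def lval_lscale rval.simps by (rule sum_index_list)

lemma conn_field_deg: "ldeg_le (- int M) (conn_field M x)"
  using ldeg_le_lscale[OF conn_fun(1)] unfolding conn_field_def ldeg_le_def by fastforce

lemma van_concat: "(\<And>G. G \<in> set Gs \<Longrightarrow> van i h G) \<Longrightarrow> van i h (concat Gs)"
proof (induction Gs)
  case Nil
  have "(dz ^^ a) ([] :: 'a lexp) = []" for a by (induction a) auto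
  then show ?case by (simp add: van_def)
qed (auto intro: van_append)

text \<open>To second order at \<open>u i\<close> the field is the constant \<open>x i\<close>: it
  moves each point with the velocity given by \<open>x\<close>. This matches the term
  \<open>x i\<close> times \<open>dz G\<close> in \<open>van_lpd\<close>.\<close>

lemma conn_field_van:
  fixes x :: "'k::finite \<Rightarrow> complex"
  shows "van i 2 (conn_field M x @ [(0, Const (- x i))])"
proof (rule van_lequiv)
  show "van i 2 (concat (map (\<lambda>l. lscale (Const (x l)) (conn_fun M l @ [(0, Const (if i = l then -1 else 0))])) index_list))"
    by (intro van_concat) (use van_lscale[OF conn_fun(2)] in auto)
  have "(\<Sum>l\<in>UNIV. x l * (if i = l then -1 else 0)) = - x i"
    by (simp add: if_distrib cong: if_cong)
  then show "lequiv (concat (map (\<lambda>l. lscale (Const (x l)) (conn_fun M l @ [(0, Const (if i = l then -1 else 0))])) index_list))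
     (conn_field M x @ [(0, Const (- x i))])"
    unfolding lequiv_def lval_append lval_conn_field lval_concat map_map o_def lval_lscale sum_index_list
    by (simp add: distrib_left sum.distrib)
qed

text \<open>The vanishing condition puts \<open>V(\<psi>; G)\<close> into \<open>O\<^sub>u\<close>, so that the mode of \<open>\<psi>\<close> belonging to \<open>z\<^sup>d\<close> is
  expressed, modulo \<open>O\<^sub>u\<close>, by modes that lead to smaller weights.\<close>

lemma leading_exists:
  "\<exists>e G. ldeg_le (d + int h * int CARD('k)) ((d, e) # G) \<and> (\<forall>i :: 'k::finite. van i h ((d, e) # G))
     \<and> (\<forall>u\<in>conf. rval e u = 1) \<and> (\<forall>(j, f)\<in>set G. d < j)"
proof -
  let ?P = "\<lambda>J n e G. ldeg_le (d + int n) ((d, e) # G) \<and> (\<forall>u\<in>conf. rval e u = 1) \<and> (\<forall>(j, f)\<in>set G. d < j)"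
  have step: "\<exists>e G. ?P J (n + k) e G \<and> van i k ((d, e) # G) \<and> (\<forall>i\<in>J. van i h ((d, e) # G))"
    if "\<exists>e G. ?P J n e G \<and> (\<forall>i\<in>J. van i h ((d, e) # G))" for J n i k
    using that
  proof (induction k)
    case (Suc k)
    then obtain e G where IH: "?P J (n + k) e G" "van i k ((d, e) # G)" "\<forall>i\<in>J. van i h ((d, e) # G)"
      by auto
    \<comment> \<open>The factor \<open>1 - z / u_i\<close> adds one order of vanishing at
      \<open>u_i\<close>. Its constant term \<open>1\<close> leaves the lowest exponent
      \<open>d\<close> and the value \<open>1\<close> of its coefficient unchanged.\<close>
    let ?f = "[(0, Const 1), (1, Mul (Const (-1)) (InvVar i))]"
    have f: "van i 1 ?f" unfolding One_nat_def van_Suc by (auto simp: conf_nz)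
    define e' where "e' = Mul (Const 1) e"
    define G' where "G' = map (\<lambda>(k, f). (k, Mul (Const 1) f)) G
      @ lmul [(1, Mul (Const (-1)) (InvVar i))] ((d, e) # G)"
    have eG: "lmul ?f ((d, e) # G) = (d, e') # G'"
      by (simp add: lmul_def e'_def G'_def)
    have G': "\<forall>(j, f)\<in>set G'. d < j"
      using IH(1) by (force simp: G'_def lmul_def)
    note e' = e'_def
    have "ldeg_le (1 + (d + int (n + k))) (lmul ?f ((d, e) # G))"
      by (rule ldeg_le_lmul) (use IH(1) in auto)
    then have "?P J (n + Suc k) e' G'" using eG e' G' IH(1) by (simp add: algebra_simps)
    moreover have "van i (Suc k) ((d, e') # G')"
      unfolding eG[symmetric] by (rule van_lmul[OF f IH(2)]) simp
    moreover have "van i h ((d, e') # G')" if "i \<in> J" for i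
      unfolding eG[symmetric] by (rule van_lmul[of i 0 _ h]) (use IH(3) that in auto)
    ultimately show ?case by blast
  qed simp
  have "\<exists>e G. ?P J (h * card J) e G \<and> (\<forall>i\<in>J. van i h ((d, e) # G))" if "finite J" for J :: "'k set"
    using that
  proof (induction J rule: finite_induct)
    case empty
    show ?case by (rule exI[of _ "Const 1"], rule exI[of _ "[]"]) simp
  next
    case (insert i J)
    from step[OF insert.IH, of h i] insert.hyps show ?case by (auto simp: algebra_simps)
  qed
  from this[OF finite[of "UNIV :: 'k set"]] show ?thesis
    unfolding of_nat_mult by blast
qed

text \<open>The divided derivative of order \<open>i\<close>, that is the \<open>i\<close>-th
  derivative in \<open>z\<close> over \<open>i!\<close>.\<close>

definition ddz :: "nat \<Rightarrow> 'k lexp \<Rightarrow> 'k lexp" where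
  "ddz i F = map (\<lambda>(j, e). (j - int i, Mul (Const (of_int j gchoose i)) e)) F"

lemma ldeg_le_ddz: "ldeg_le d F \<Longrightarrow> ldeg_le (d - int i) (ddz i F)"
  by (force simp: ldeg_le_def ddz_def)

section \<open>The connection\<close>

type_synonym ('k, 'h) hsection = "('k rexp \<times> 'h) list"

definition pdsec :: "('k \<Rightarrow> complex) \<Rightarrow> ('k, 'h) hsection \<Rightarrow> ('k, 'h) hsection" where
  "pdsec x s = map (\<lambda>(e, \<xi>). (pd x e, \<xi>)) s"

definition scsec :: "'k rexp \<Rightarrow> ('k, 'h) hsection \<Rightarrow> ('k, 'h) hsection" where
  "scsec c s = map (\<lambda>(e, \<xi>). (Mul c e, \<xi>)) s"

lemma pdsec_Nil [simp]: "pdsec x [] = []"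
  and pdsec_Cons [simp]: "pdsec x ((e, \<xi>) # s) = (pd x e, \<xi>) # pdsec x s"
  and pdsec_append [simp]: "pdsec x (s @ s') = pdsec x s @ pdsec x s'"
  by (simp_all add: pdsec_def)

lemma scsec_Nil [simp]: "scsec c [] = []"
  and scsec_Cons [simp]: "scsec c ((e, \<xi>) # s) = (Mul c e, \<xi>) # scsec c s"
  and scsec_append [simp]: "scsec c (s @ s') = scsec c s @ scsec c s'"
  by (simp_all add: scsec_def)

context chiral_theory
begin

definition sval :: "('k, 'a) hsection \<Rightarrow> ('k \<Rightarrow> complex) \<Rightarrow> 'a" where
  "sval s u = (\<Sum>(e, \<xi>)\<leftarrow>s. rval e u \<cdot> \<xi>)"

text \<open>Minus the contour integral of \<open>F(z) L(z)\<close>, coefficient by coefficient: the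
  residue of \<open>z^j z^(-n-2)\<close> selects \<open>n = j - 1\<close>.\<close>

definition Lsec :: "'k lexp \<Rightarrow> ('k, 'a) hsection \<Rightarrow> ('k, 'a) hsection" where
  "Lsec F s = concat (map (\<lambda>(e, \<xi>). map (\<lambda>(j, c). (Mul (Mul (Const (-1)) c) e, Lmode T (j - 1) \<xi>)) F) s)"

definition Dsec :: "('k::finite \<Rightarrow> complex) \<Rightarrow> ('k, 'a) hsection \<Rightarrow> ('k, 'a) hsection" where
  "Dsec x s = pdsec x s @ Lsec (conn_field 0 x) s"

definition csec :: "int \<Rightarrow> 'a \<Rightarrow> 'k lexp \<Rightarrow> 'a \<Rightarrow> ('k, 'a) hsection" where
  "csec h \<psi> G \<omega> = map (\<lambda>(j, e). (e, mode T \<psi> (j - h + 1) \<omega>)) G"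

text \<open>For \<open>\<psi>\<close> of weight \<open>h\<close> this is the contour integral of
  \<open>G(z) V(\<psi>, z) \<omega>\<close>. The index shift \<open>h\<close> is a separate integer
  argument: descendants need other weights, and multiplying \<open>G\<close> by \<open>z^j\<close>
  is absorbed by lowering \<open>h\<close>.\<close>

definition cval :: "int \<Rightarrow> 'a \<Rightarrow> 'k lexp \<Rightarrow> ('k \<Rightarrow> complex) \<Rightarrow> 'a \<Rightarrow> 'a" where
  "cval h \<psi> G u \<omega> = (\<Sum>(j, e)\<leftarrow>G. rval e u \<cdot> mode T \<psi> (j - h + 1) \<omega>)"

abbreviation Lval :: "'k lexp \<Rightarrow> ('k \<Rightarrow> complex) \<Rightarrow> 'a \<Rightarrow> 'a" where
  "Lval F u \<omega> \<equiv> cval 2 (vir T) F u \<omega>"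

lemma sval_Nil [simp]: "sval [] u = 0"
  and sval_Cons [simp]: "sval ((e, \<xi>) # s) u = rval e u \<cdot> \<xi> + sval s u"
  and sval_append [simp]: "sval (s @ s') u = sval s u + sval s' u"
  by (simp_all add: sval_def)

lemma Lsec_Nil [simp]: "Lsec F [] = []"
  and Lsec_Cons: "Lsec F ((e, \<xi>) # s) = map (\<lambda>(j, c). (Mul (Mul (Const (-1)) c) e, Lmode T (j - 1) \<xi>)) F @ Lsec F s"
  and Lsec_append [simp]: "Lsec F (s @ s') = Lsec F s @ Lsec F s'"
  by (simp_all add: Lsec_def)

lemma cval_Nil [simp]: "cval h \<psi> [] u \<omega> = 0"
  and cval_Cons [simp]: "cval h \<psi> ((j, e) # G) u \<omega> = rval e u \<cdot> mode T \<psi> (j - h + 1) \<omega> + cval h \<psi> G u \<omega>"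
  and cval_append [simp]: "cval h \<psi> (F @ G) u \<omega> = cval h \<psi> F u \<omega> + cval h \<psi> G u \<omega>"
  by (simp_all add: cval_def)

lemma csec_Nil [simp]: "csec h \<psi> [] \<omega> = []"
  and csec_Cons [simp]: "csec h \<psi> ((j, e) # G) \<omega> = (e, mode T \<psi> (j - h + 1) \<omega>) # csec h \<psi> G \<omega>"
  and csec_append [simp]: "csec h \<psi> (F @ G) \<omega> = csec h \<psi> F \<omega> @ csec h \<psi> G \<omega>"
  by (simp_all add: csec_def)

lemma sval_csec [simp]: "sval (csec h \<psi> G \<omega>) u = cval h \<psi> G u \<omega>"
  by (induction G) auto

lemma sval_scsec [simp]: "sval (scsec c s) u = rval c u \<cdot> sval s u"
  by (induction s) (auto simp: vs.scale_right_distrib)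

lemma cval_lscale [simp]: "cval h \<psi> (lscale c G) u \<omega> = rval c u \<cdot> cval h \<psi> G u \<omega>"
  by (induction G) (auto simp: vs.scale_right_distrib)

lemma sval_concat: "sval (concat ss) u = (\<Sum>s\<leftarrow>ss. sval s u)"
  by (induction ss) auto

lemma cval_add:
  assumes "\<psi> \<in> weight_space T w"
  shows "cval h \<psi> G u (x + y) = cval h \<psi> G u x + cval h \<psi> G u y"
  by (induction G) (auto simp: mode_add[OF assms] vs.scale_right_distrib algebra_simps)

lemma cval_scale:
  assumes "\<psi> \<in> weight_space T w"
  shows "cval h \<psi> G u (c \<cdot> x) = c \<cdot> cval h \<psi> G u x"
  by (induction G) (auto simp: mode_scale[OF assms] vs.scale_right_distrib mult.commute)

lemma cval_zero:
  assumes "\<psi> \<in> weight_space T w"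
  shows "cval h \<psi> G u 0 = 0"
  using cval_scale[OF assms, of h G u 0 0] by simp

lemmas Lval_add = cval_add[OF vir_weight] and Lval_scale = cval_scale[OF vir_weight]
  and Lval_zero = cval_zero[OF vir_weight]

lemma sval_Lsec: "sval (Lsec F s) u = - Lval F u (sval s u)"
proof (induction s)
  case Nil
  then show ?case by (simp add: Lval_zero)
next
  case (Cons a s)
  obtain e \<xi> where a: "a = (e, \<xi>)" by (cases a)
  have "sval (map (\<lambda>(j, c). (Mul (Mul (Const (-1)) c) e, Lmode T (j - 1) \<xi>)) F) u = - (rval e u \<cdot> Lval F u \<xi>)"
    by (induction F) (auto simp: vs.scale_right_distrib mult_ac)
  then show ?case by (simp add: a Lsec_Cons Cons Lval_add Lval_scale)
qed

lemma sval_Dsec: "sval (Dsec x s) u = sval (pdsec x s) u - Lval (conn_field 0 x) u (sval s u)"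
  by (simp add: Dsec_def sval_Lsec)

definition functional :: "('a \<Rightarrow> complex) \<Rightarrow> bool" where
  "functional f \<longleftrightarrow> (\<forall>x y. f (x + y) = f x + f y) \<and> (\<forall>c x. f (c \<cdot> x) = c * f x)"

lemma functional_iff: "Vector_Spaces.linear (smult T) (*) f \<longleftrightarrow> functional f"
proof -
  have "vector_space ((*) :: complex \<Rightarrow> complex \<Rightarrow> complex)"
    by unfold_locales (auto simp: algebra_simps)
  then show ?thesis
    unfolding functional_def Vector_Spaces.linear_iff using vector_space by auto
qed

lemma
  assumes "functional f"
  shows functional_add: "f (x + y) = f x + f y" and functional_scale: "f (c \<cdot> x) = c * f x"
    and functional_0: "f 0 = 0" and functional_minus: "f (- x) = - f x"
    and functional_diff: "f (x - y) = f x - f y"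
proof -
  show a: "f (x + y) = f x + f y" for x y using assms by (simp add: functional_def)
  show s: "f (c \<cdot> x) = c * f x" for c x using assms by (simp add: functional_def)
  show z: "f 0 = 0" using s[of 0 0] by simp
  show m: "f (- x) = - f x" for x using a[of x "-x"] z by (simp add: eq_neg_iff_add_eq_0 add.commute)
  show "f (x - y) = f x - f y" using a[of x "-y"] m[of y] by simp
qed

lemma functional_separates:
  assumes "\<And>f. functional f \<Longrightarrow> f x = f y" shows "x = y"
proof (rule ccontr)
  assume "x \<noteq> y"
  then obtain f where "functional f" "f (x - y) \<noteq> 0"
    using linear_functional_separates[of "x - y"] by (auto simp: functional_iff)
  then show False using assms[of f] by (simp add: functional_diff)
qed

lemma functional_sval_deriv:
  assumes f: "functional f" and u: "line u x t \<in> conf"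
  shows "((\<lambda>t. f (sval s (line u x t))) has_field_derivative f (sval (pdsec x s) (line u x t))) (at t)"
proof (induction s)
  case (Cons a s)
  obtain e \<xi> where a: "a = (e, \<xi>)" by (cases a)
  from DERIV_add[OF DERIV_cmult_right[OF rval_deriv[OF u, of e], of "f \<xi>"] Cons]
  show ?case by (simp add: a functional_add[OF f] functional_scale[OF f])
qed (simp add: functional_0[OF f])

definition sequiv :: "('k, 'a) hsection \<Rightarrow> ('k, 'a) hsection \<Rightarrow> bool" where
  "sequiv s s' \<longleftrightarrow> (\<forall>u\<in>conf. sval s u = sval s' u)"

text \<open>Under a functional, \<open>pdsec x\<close> becomes an actual derivative along a line
  that stays in \<open>conf\<close> for small times, so it depends only on the values of the
  section.\<close>

lemma sequiv_pdsec:
  fixes s :: "('k::finite, 'a) hsection"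
  assumes "sequiv s s'"
  shows "sequiv (pdsec x s) (pdsec x s')"
  unfolding sequiv_def
proof
  fix u :: "'k \<Rightarrow> complex" assume u: "u \<in> conf"
  show "sval (pdsec x s) u = sval (pdsec x s') u"
  proof (rule functional_separates)
    fix f assume f: "functional f"
    have a: "((\<lambda>t. f (sval s' (line u x t))) has_field_derivative f (sval (pdsec x s') (line u x 0))) (at 0)"
      by (rule functional_sval_deriv[OF f]) (use u in simp)
    have b: "((\<lambda>t. f (sval s (line u x t))) has_field_derivative f (sval (pdsec x s) (line u x 0))) (at 0)"
      by (rule functional_sval_deriv[OF f]) (use u in simp)
    have "\<forall>\<^sub>F t in nhds 0. f (sval s (line u x t)) = f (sval s' (line u x t))"
      using conf_line_eventually[of u x 0] u assms by (auto elim!: eventually_mono simp: sequiv_def)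
    from DERIV_unique[OF b[unfolded DERIV_cong_ev[OF refl this refl]] a]
    show "f (sval (pdsec x s) u) = f (sval (pdsec x s') u)" by simp
  qed
qed

lemma sequiv_Dsec: "sequiv s s' \<Longrightarrow> sequiv (Dsec x s) (Dsec x s')"
  using sequiv_pdsec[of s s' x] by (auto simp: sequiv_def sval_Dsec)

text \<open>The sections of \<open>O\<close> generated by those \<open>G\<close> that satisfy the divisor condition for all \<open>u\<close> at
  once.\<close>

inductive osec :: "('k, 'a) hsection \<Rightarrow> bool" where
  osec_Nil: "osec []"
| osec_append: "osec s \<Longrightarrow> osec s' \<Longrightarrow> osec (s @ s')"
| osec_gen: "\<psi> \<in> gen T h \<Longrightarrow> (\<forall>i. van i h G) \<Longrightarrow> ldeg_le (2 * int h - 2) G \<Longrightarrow> osec (csec (int h) \<psi> G \<omega>)"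
| osec_sequiv: "osec s \<Longrightarrow> sequiv s s' \<Longrightarrow> osec s'"

lemma osec_eqI: "osec s \<Longrightarrow> (\<And>u. u \<in> conf \<Longrightarrow> sval s u = sval s' u) \<Longrightarrow> osec s'"
  by (rule osec_sequiv) (auto simp: sequiv_def)

lemma csec_lscale: "csec h \<psi> (lscale c G) \<omega> = scsec c (csec h \<psi> G \<omega>)"
  by (induction G) auto

lemma osec_scale: "osec s \<Longrightarrow> osec (scsec c s)"
proof (induction rule: osec.induct)
  case (osec_gen \<psi> h G \<omega>)
  have "osec (csec (int h) \<psi> (lscale c G) \<omega>)"
    by (rule osec.osec_gen) (use osec_gen in \<open>auto intro: van_lscale ldeg_le_lscale\<close>)
  then show ?case by (simp add: csec_lscale)
next
  case (osec_sequiv s s')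
  from osec_sequiv(3) show ?case
    by (rule osec_eqI) (use osec_sequiv(2) in \<open>auto simp: sequiv_def\<close>)
qed (auto intro: osec.intros)

lemma osec_concat: "(\<And>s. s \<in> set ss \<Longrightarrow> osec s) \<Longrightarrow> osec (concat ss)"
  by (induction ss) (auto intro: osec_Nil osec_append)

text \<open>The Virasoro state is a generating state of weight 2, so \<open>L\<close> of a field
  with double zeros at all \<open>u i\<close> and degree at most 2 is trivial modulo
  \<open>O\<close>. All comparisons of vector fields rest on this.\<close>

lemma osec_Lsec:
  assumes "\<And>i. van i 2 K" "ldeg_le 2 K"
  shows "osec (Lsec K s)"
proof (induction s)
  case Nil show ?case by (simp add: osec_Nil)
next
  case (Cons a s)
  obtain e \<xi> where a: "a = (e, \<xi>)" by (cases a)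
  have "osec (csec (int 2) (vir T) K \<xi>)"
    by (rule osec_gen) (use assms vir_gen in auto)
  from osec_append[OF osec_scale[OF this, of "Mul (Const (-1)) e"] Cons]
  show ?case by (rule osec_eqI) (simp add: a sval_Lsec Lval_add Lval_scale)
qed

text \<open>For \<open>\<xi> = L_(-1)^n \<psi>\<close> with \<open>\<psi>\<close> of weight
  \<open>h = w - n\<close>, integrating by parts \<open>n\<close> times pairs \<open>\<psi>\<close>
  with the \<open>n\<close>-th derivative of \<open>G\<close>. The order of vanishing falls from
  \<open>w\<close> to \<open>h\<close> and the degree from \<open>w - 2\<close> to
  \<open>h - 2\<close>, which is at most \<open>2 h - 2\<close> for every \<open>h\<close>.\<close>

lemma osec_descendant:
  fixes G :: "'k lexp"
  assumes \<xi>: "\<xi> \<in> weight_space T w" and G: "\<And>i. van i (nat w) G" "ldeg_le (w - 2) G"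
  shows "osec (csec w \<xi> G \<omega>)"
proof -
  have "\<xi> \<in> vs.span {(Lmode T (-1) ^^ n) \<psi> | n \<psi> h. \<psi> \<in> gen T h \<and> int h + int n = w}"
    by (rule weight_space_span_quasiprimary[OF \<xi>])
  then have "\<xi> \<in> weight_space T w \<and> osec (csec w \<xi> G \<omega>)"
  proof (induction rule: vs.span_induct_alt)
    case base
    have "osec (csec w 0 G \<omega>)"
      by (rule osec_eqI[OF osec_Nil]) (induction G; simp add: cval_def mode_zero_state case_prod_beta)
    then show ?case by (simp add: weight_0)
  next
    case (step c x y)
    then obtain n \<psi> h where x: "x = (Lmode T (-1) ^^ n) \<psi>" "\<psi> \<in> gen T h" and w: "int h + int n = w"
      by auto
    have xw: "x \<in> weight_space T w" unfolding x(1) w[symmetric] by (intro L_power_weight gen_weight x)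
    have desc: "cval (int h + int n) ((Lmode T (-1) ^^ n) \<psi>) K u \<omega> = (-1) ^ n \<cdot> cval (int h) \<psi> ((dz ^^ n) K) u \<omega>"
      for K :: "'k lexp" and u
    proof (induction n arbitrary: K)
      case (Suc n)
      have m: "mode T (Lmode T (-1) ((Lmode T (-1) ^^ n) \<psi>)) m \<omega>
          = (- of_int (m + (int h + int n))) \<cdot> mode T ((Lmode T (-1) ^^ n) \<psi>) m \<omega>" for m
        by (rule mode_derivative_state[OF L_power_weight[OF gen_weight[OF x(2)]]])
      have "cval (int h + int (Suc n)) ((Lmode T (-1) ^^ Suc n) \<psi>) K u \<omega>
          = - cval (int h + int n) ((Lmode T (-1) ^^ n) \<psi>) (dz K) u \<omega>"
      proof (induction K)
        case (Cons a K)
        obtain j e where a: "a = (j, e)" by (cases a)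
        have idx: "j - (int h + int (Suc n)) + 1 = j - 1 - (int h + int n) + 1" by simp
        have cf: "j - 1 - (int h + int n) + 1 + (int h + int n) = j" by simp
        have "rval e u \<cdot> mode T ((Lmode T (-1) ^^ Suc n) \<psi>) (j - (int h + int (Suc n)) + 1) \<omega>
          = - ((of_int j * rval e u) \<cdot> mode T ((Lmode T (-1) ^^ n) \<psi>) (j - 1 - (int h + int n) + 1) \<omega>)"
          unfolding idx funpow.simps o_def m cf by (simp add: mult.commute)
        then show ?case unfolding a by (simp only: cval_Cons dz_Cons Cons rval.simps minus_add_distrib)
      qed simp
      also have "\<dots> = (-1) ^ Suc n \<cdot> cval (int h) \<psi> ((dz ^^ Suc n) K) u \<omega>"
        unfolding Suc.IH by (simp add: funpow_swap1)
      finally show ?case .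
    qed simp
    have "osec (csec (int h) \<psi> ((dz ^^ n) G) \<omega>)"
    proof (rule osec_gen[OF x(2)])
      have hw: "nat w - n = h" using w by auto
      show "\<forall>i. van i h ((dz ^^ n) G)" using van_dz_funpow[OF G(1), of _ n] unfolding hw by blast
      have "ldeg_le (w - 2 - int m) ((dz ^^ m) G)" for m
        by (induction m) (use G(2) ldeg_le_dz in \<open>fastforce simp: algebra_simps\<close>)+
      from this[of n] show "ldeg_le (2 * int h - 2) ((dz ^^ n) G)"
        by (rule ldeg_le_mono) (use w in simp)
    qed
    from osec_scale[OF this, of "Const (c * (-1) ^ n)"]
    have "osec (scsec (Const (c * (-1) ^ n)) (csec (int h) \<psi> ((dz ^^ n) G) \<omega>) @ csec w y G \<omega>)"
      using step.IH by (blast intro: osec_append)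
    moreover have "cval w (c \<cdot> x + y) G u \<omega> = c \<cdot> cval w x G u \<omega> + cval w y G u \<omega>" for u
    proof -
      have mm: "mode T (c \<cdot> x + y) m \<omega> = c \<cdot> mode T x m \<omega> + mode T y m \<omega>" for m
        using step.IH mode_add_state[OF weight_scale[OF xw]] mode_scale_state[OF xw] by simp
      show ?thesis
      proof (induction G)
        case (Cons a G)
        obtain j e where a: "a = (j, e)" by (cases a)
        show ?case unfolding a cval_Cons Cons mm vs.scale_right_distrib by (simp add: algebra_simps)
      qed simp
    qed
    ultimately have "osec (csec w (c \<cdot> x + y) G \<omega>)"
      by (elim osec_eqI) (simp add: x(1) desc[symmetric] w vs.scale_scale[symmetric] del: vs.scale_scale)
    then show ?case using xw step.IH by (auto intro: weight_add weight_scale)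
  qed
  then show ?thesis ..
qed


section \<open>The connection preserves \<open>O\<close> and is flat modulo \<open>O\<close>\<close>

lemma L_gen_commutator:
  assumes "\<psi> \<in> gen T h"
  shows "Lmode T (j - 1) (mode T \<psi> (k - int h + 1) \<omega>) - mode T \<psi> (k - int h + 1) (Lmode T (j - 1) \<omega>)
     = (\<Sum>i<2 + h. (of_int j gchoose i) \<cdot> mode T (Lmode T (int i - 1) \<psi>) (j + k - int h) \<omega>)"
proof -
  have "j - 1 + int 2 - 1 = j" "k - int h + 1 + (j - 1) = j + k - int h" by simp_all
  moreover have "int i + 1 - int 2 = int i - 1" for i by simp
  ultimately show ?thesis
    using gen_commutator[OF vir_gen assms, of "j - 1" "k - int h + 1" \<omega>] by (simp only:)
qed

lemma cval_lmul_Cons_map: "cval h \<psi> (map (\<lambda>(k, f). (j + k, Mul e f)) G) u \<omega> = rval e u \<cdot> cval (h - j) \<psi> G u \<omega>"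
proof (induction G)
  case (Cons a G)
  obtain k f where a: "a = (k, f)" by (cases a)
  have idx: "j + k - h + 1 = k - (h - j) + 1" by simp
  show ?case unfolding a list.map prod.case cval_Cons idx by (simp add: Cons vs.scale_right_distrib)
qed simp

text \<open>Taylor expansion of \<open>F\<close> at the position of \<open>\<psi>\<close>: the
  binomials of the commutator formula turn \<open>F\<close> into its divided derivatives, and
  \<open>ddz i F\<close> is paired with \<open>L_(i-1) \<psi>\<close>, a state of weight
  \<open>h - i + 1\<close>.\<close>

lemma cval_commutator:
  assumes \<psi>: "\<psi> \<in> gen T h"
  shows "Lval F u (cval (int h) \<psi> G u \<omega>) - cval (int h) \<psi> G u (Lval F u \<omega>)
    = (\<Sum>i<2 + h. cval (int h - int i + 1) (Lmode T (int i - 1) \<psi>) (lmul (ddz i F) G) u \<omega>)"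
proof (induction F)
  case Nil
  show ?case by (simp add: ddz_def cval_zero[OF gen_weight[OF \<psi>]])
next
  case (Cons a F)
  obtain j c where a: "a = (j, c)" by (cases a)
  note add = cval_add[OF gen_weight[OF \<psi>]] and scale = cval_scale[OF gen_weight[OF \<psi>]]
  have one: "Lmode T (j - 1) (cval (int h) \<psi> G u \<omega>) - cval (int h) \<psi> G u (Lmode T (j - 1) \<omega>)
    = (\<Sum>i<2 + h. (of_int j gchoose i) \<cdot> cval (int h - int i + 1 - (j - int i)) (Lmode T (int i - 1) \<psi>) G u \<omega>)"
  proof (induction G)
    case Nil
    show ?case by (simp add: L_0)
  next
    case (Cons b G)
    obtain k e where b: "b = (k, e)" by (cases b)
    have idx: "k - (int h - int i + 1 - (j - int i)) + 1 = j + k - int h" for i by simp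
    have "Lmode T (j - 1) (cval (int h) \<psi> (b # G) u \<omega>) - cval (int h) \<psi> (b # G) u (Lmode T (j - 1) \<omega>)
      = rval e u \<cdot> (Lmode T (j - 1) (mode T \<psi> (k - int h + 1) \<omega>) - mode T \<psi> (k - int h + 1) (Lmode T (j - 1) \<omega>))
        + (Lmode T (j - 1) (cval (int h) \<psi> G u \<omega>) - cval (int h) \<psi> G u (Lmode T (j - 1) \<omega>))"
      by (simp add: b L_add L_scale vs.scale_right_diff_distrib)
    also have "\<dots> = (\<Sum>i<2 + h. (of_int j gchoose i) \<cdot> cval (int h - int i + 1 - (j - int i)) (Lmode T (int i - 1) \<psi>) (b # G) u \<omega>)"
      unfolding Cons L_gen_commutator[OF \<psi>] b cval_Cons idx
      by (simp add: vs.scale_right_distrib sum.distrib vs.scale_sum_right mult.commute)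
    finally show ?case .
  qed
  have "Lval (a # F) u (cval (int h) \<psi> G u \<omega>) - cval (int h) \<psi> G u (Lval (a # F) u \<omega>)
    = rval c u \<cdot> (Lmode T (j - 1) (cval (int h) \<psi> G u \<omega>) - cval (int h) \<psi> G u (Lmode T (j - 1) \<omega>))
      + (Lval F u (cval (int h) \<psi> G u \<omega>) - cval (int h) \<psi> G u (Lval F u \<omega>))"
    by (simp add: a add scale vs.scale_right_diff_distrib)
  also have "\<dots> = (\<Sum>i<2 + h. cval (int h - int i + 1) (Lmode T (int i - 1) \<psi>) (lmul (ddz i (a # F)) G) u \<omega>)"
    unfolding Cons one
    by (simp add: a ddz_def lmul_Cons cval_lmul_Cons_map vs.scale_right_distrib sum.distrib vs.scale_sum_right mult.commute)
  finally show ?case .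
qed

lemma cval_derivative_state:
  assumes "\<psi> \<in> weight_space T h"
  shows "cval (h + 1) (Lmode T (-1) \<psi>) K u \<omega> = - cval h \<psi> (dz K) u \<omega>"
proof (induction K)
  case (Cons a K)
  obtain j e where a: "a = (j, e)" by (cases a)
  have idx: "j - (h + 1) + 1 = j - 1 - h + 1" by simp
  have cf: "j - 1 - h + 1 + h = j" by simp
  have "rval e u \<cdot> mode T (Lmode T (-1) \<psi>) (j - (h + 1) + 1) \<omega>
    = - ((of_int j * rval e u) \<cdot> mode T \<psi> (j - 1 - h + 1) \<omega>)"
    unfolding idx mode_derivative_state[OF assms] cf by (simp add: mult.commute)
  then show ?case unfolding a by (simp only: cval_Cons dz_Cons Cons rval.simps minus_add_distrib)
qed simp

lemma pdsec_csec: "pdsec x (csec h \<psi> G \<omega>) = csec h \<psi> (lpd x G) \<omega>"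
  by (induction G) auto

text \<open>The bilinear terms of \<open>[L(F), V(\<psi>; G)]\<close> with at least three derivatives of \<open>F\<close> satisfy the
  degree bound at infinity only if \<open>F\<close> decays fast enough; hence the field \<open>conn_field h x\<close>.\<close>

lemma osec_deriv_gen:
  fixes G :: "'k::finite lexp"
  assumes \<psi>: "\<psi> \<in> gen T h" and G: "\<And>i. van i h G" "ldeg_le (2 * int h - 2) G"
  shows "osec (pdsec x (csec (int h) \<psi> G \<omega>) @ Lsec (conn_field h x) (csec (int h) \<psi> G \<omega>))"
proof -
  define F where "F = conn_field h x"
  \<comment> \<open>\<open>G\<close> differentiated in \<open>u\<close>, together with the terms
    \<open>i = 0\<close> and \<open>i = 1\<close> of the commutator: \<open>L_(-1) \<psi>\<close>
    gives \<open>(F G)'\<close> by parts, and \<open>L_0 \<psi> = h \<psi>\<close> gives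
    \<open>- h F' G\<close>. The sum \<open>\<partial>_x G + F G' + (1 - h) F' G\<close> is the Lie
    derivative of \<open>G dz^(1-h)\<close>.\<close>
  define Gt where "Gt = lpd x G @ dz (lmul F G) @ lscale (Const (- of_nat h)) (lmul (dz F) G)"
  define R where "R = csec (int h) \<psi> Gt \<omega>
    @ concat (map (\<lambda>(j, c). csec (int h) \<psi> (lscale (Mul (Const (-1)) c) G) (Lmode T (j - 1) \<omega>)) F)
    @ concat (map (\<lambda>i. scsec (Const (-1)) (csec (int h - int i + 1) (Lmode T (int i - 1) \<psi>) (lmul (ddz i F) G) \<omega>)) [2..<2 + h])"
  note W = gen_weight[OF \<psi>]
  have F: "ldeg_le (- int h) F" "\<And>i. van i 2 (F @ [(0, Const (- x i))])"
    unfolding F_def by (rule conn_field_deg conn_field_van)+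
  have "osec (csec (int h) \<psi> Gt \<omega>)"
  proof (rule osec_gen[OF \<psi>])
    show "\<forall>i. van i h Gt"
    proof
      fix i
      \<comment> \<open>\<open>F\<close> is split into \<open>x i\<close> and a remainder with a
        double zero at \<open>u i\<close>. The constant part is covered by \<open>van_lpd\<close>;
        in the rest the double zero outweighs the order lost in \<open>dz G\<close>.\<close>
      have "van i h ((lpd x G @ lscale (Const (x i)) (dz G)) @ lmul (F @ [(0, Const (- x i))]) (dz G)
          @ lscale (Const (1 - of_nat h)) (lmul (dz F) G))"
        by (intro van_append van_lpd van_lscale van_lmul[OF F(2) van_dz[OF G(1)]] van_lmul[OF van_0 G(1)] G(1)) auto
      then show "van i h Gt"
        by (rule van_lequiv)
           (simp add: lequiv_def Gt_def lval_lmul lval_dz_lmul algebra_simps)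
    qed
    have "ldeg_le (- int h + (2 * int h - 2)) (lmul F G)"
      by (intro ldeg_le_lmul F G)
    moreover have "ldeg_le (- int h - 1 + (2 * int h - 2)) (lmul (dz F) G)"
      by (intro ldeg_le_lmul ldeg_le_dz F G)
    ultimately show "ldeg_le (2 * int h - 2) Gt"
      using ldeg_le_dz[of "- int h + (2 * int h - 2)" "lmul F G"] ldeg_le_lpd[OF G(2), of x]
      by (auto simp: Gt_def intro!: ldeg_le_lscale intro: ldeg_le_mono)
  qed
  moreover have "osec (csec (int h) \<psi> (lscale c G) \<omega>')" for c \<omega>'
    by (rule osec_gen[OF \<psi>]) (use G in \<open>auto intro: van_lscale ldeg_le_lscale\<close>)
  moreover have "osec (csec (int h - int i + 1) (Lmode T (int i - 1) \<psi>) (lmul (ddz i F) G) \<omega>)"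
    if "i \<ge> 2" for i
  proof (rule osec_descendant)
    show "Lmode T (int i - 1) \<psi> \<in> weight_space T (int h - int i + 1)"
      using L_weight[OF W, of "int i - 1"] by (simp add: algebra_simps)
    show "van l (nat (int h - int i + 1)) (lmul (ddz i F) G)" for l
      by (rule van_lmul[OF van_0 G(1)]) (use that in auto)
    have "ldeg_le (- int h - int i + (2 * int h - 2)) (lmul (ddz i F) G)"
      by (intro ldeg_le_lmul ldeg_le_ddz F G)
    then show "ldeg_le (int h - int i + 1 - 2) (lmul (ddz i F) G)"
      by (rule ldeg_le_mono) simp
  qed
  ultimately have "osec R"
    unfolding R_def by (intro osec_append osec_concat) (auto intro!: osec_scale simp del: upt_Suc)
  then show ?thesis
  proof (rule osec_eqI)
    fix u :: "'k \<Rightarrow> complex"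
    let ?g = "\<lambda>i. cval (int h - int i + 1) (Lmode T (int i - 1) \<psi>) (lmul (ddz i F) G) u \<omega>"
    have g0: "?g 0 = - cval (int h) \<psi> (dz (lmul F G)) u \<omega>"
    proof -
      have "?g 0 = cval (int h + 1) (Lmode T (-1) \<psi>) (lmul F G) u \<omega>"
        by (induction F) (auto simp: ddz_def lmul_Cons cval_lmul_Cons_map)
      then show ?thesis using cval_derivative_state[OF W, of "lmul F G" u \<omega>] by simp
    qed
    have g1: "?g 1 = of_nat h \<cdot> cval (int h) \<psi> (lmul (dz F) G) u \<omega>"
    proof -
      have L0: "Lmode T 0 \<psi> = of_nat h \<cdot> \<psi>" using W by (simp add: weight_space_def)
      have "cval w (of_nat h \<cdot> \<psi>) K u \<omega> = of_nat h \<cdot> cval w \<psi> K u \<omega>" for K :: "'k lexp" and w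
        by (induction K) (auto simp: mode_scale_state[OF W] vs.scale_right_distrib mult.commute)
      moreover have "?g 1 = cval (int h) (Lmode T 0 \<psi>) (lmul (dz F) G) u \<omega>"
        by (induction F) (auto simp: ddz_def lmul_Cons cval_lmul_Cons_map)
      ultimately show ?thesis unfolding L0 by simp
    qed
    have "(\<Sum>i<2 + h. ?g i) = ?g 0 + ?g 1 + (\<Sum>i\<in>{2..<2 + h}. ?g i)"
    proof -
      have "{..<2 + h} = {0, 1} \<union> {2..<2 + h}" by auto
      then show ?thesis by (simp add: sum.union_disjoint)
    qed
    then have comm: "Lval F u (cval (int h) \<psi> G u \<omega>)
       = cval (int h) \<psi> G u (Lval F u \<omega>) + (?g 0 + ?g 1 + (\<Sum>i\<in>{2..<2 + h}. ?g i))"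
      using cval_commutator[OF \<psi>, of F u G \<omega>] by (simp add: algebra_simps)
    have 2: "sval (concat (map (\<lambda>(j, c). csec (int h) \<psi> (lscale (Mul (Const (-1)) c) G) (Lmode T (j - 1) \<omega>)) F)) u
      = - cval (int h) \<psi> G u (Lval F u \<omega>)"
      by (induction F) (auto simp: cval_zero[OF W] cval_add[OF W] cval_scale[OF W])
    have 3: "sval (concat (map (\<lambda>i. scsec (Const (-1)) (csec (int h - int i + 1) (Lmode T (int i - 1) \<psi>) (lmul (ddz i F) G) \<omega>)) [2..<2 + h])) u
      = - (\<Sum>i\<in>{2..<2 + h}. ?g i)"
      unfolding sval_concat map_map o_def interv_sum_list_conv_sum_set_nat
      by (simp add: sum_negf del: upt_Suc)
    show "sval R u = sval (pdsec x (csec (int h) \<psi> G \<omega>) @ Lsec (conn_field h x) (csec (int h) \<psi> G \<omega>)) u"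
      unfolding R_def sval_append 2 3 sval_Lsec F_def[symmetric] pdsec_csec sval_csec comm g0 g1 Gt_def
      by (simp add: algebra_simps)
  qed
qed

lemma van_conn_field_diff: "van i 2 (conn_field M x @ lscale (Const (-1)) (conn_field N x))"
proof -
  have "van i 2 ((conn_field M x @ [(0, Const (- x i))]) @ lscale (Const (-1)) (conn_field N x @ [(0, Const (- x i))]))"
    by (intro van_append van_lscale conn_field_van)
  then show ?thesis by (rule van_lequiv) (simp add: lequiv_def)
qed

text \<open>On a generator of weight \<open>h\<close> the decaying field
  \<open>conn_field h x\<close> is used first. It differs from \<open>conn_field 0 x\<close> by a
  field with double zeros at all points, so passing to the latter costs only an element covered by
  \<open>osec_Lsec\<close>.\<close>

lemma osec_Dsec:
  assumes "osec s" shows "osec (Dsec x s)"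
  using assms
proof (induction rule: osec.induct)
  case osec_Nil
  show ?case by (simp add: Dsec_def osec.osec_Nil)
next
  case (osec_append s s')
  from osec.osec_append[OF osec_append(3,4)] show ?case
    by (rule osec_eqI) (simp add: Dsec_def)
next
  case (osec_gen \<psi> h G \<omega>)
  let ?s = "csec (int h) \<psi> G \<omega>"
  have "ldeg_le 2 (conn_field 0 x @ lscale (Const (-1)) (conn_field h x))"
    using ldeg_le_mono[OF conn_field_deg, of 0 2 x] ldeg_le_mono[OF conn_field_deg, of h 2 x]
    by (simp add: ldeg_le_lscale)
  then have "osec ((pdsec x ?s @ Lsec (conn_field h x) ?s)
      @ Lsec (conn_field 0 x @ lscale (Const (-1)) (conn_field h x)) ?s)"
    by (intro osec.osec_append osec_deriv_gen osec_Lsec van_conn_field_diff) (use osec_gen in auto)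
  then show ?case
    by (rule osec_eqI) (simp add: Dsec_def sval_Lsec algebra_simps)
next
  case (osec_sequiv s s')
  then show ?case by (metis osec.osec_sequiv sequiv_Dsec)
qed

lemma pdsec_Lsec: "sval (pdsec x (Lsec F s)) u = sval (Lsec (lpd x F) s) u + sval (Lsec F (pdsec x s)) u"
proof (induction s)
  case (Cons a s)
  obtain e \<xi> where a: "a = (e, \<xi>)" by (cases a)
  let ?m = "\<lambda>F e. map (\<lambda>(j, c). (Mul (Mul (Const (-1)) c) e, Lmode T (j - 1) \<xi>)) F"
  have "sval (pdsec x (?m F e)) u = sval (?m (lpd x F) e) u + sval (?m F (pd x e)) u"
    by (induction F) (auto simp: vs.scale_left_distrib vs.scale_left_diff_distrib algebra_simps)
  then show ?case by (simp add: a Lsec_Cons Cons algebra_simps)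
qed simp

lemma pdsec_commute: "sval (pdsec x (pdsec y s)) u = sval (pdsec y (pdsec x s)) u"
  by (induction s) (auto simp: pd_commute[of x y])

text \<open>No central term occurs, because \<open>L(F)\<close> and \<open>L(G)\<close> only involve the modes \<open>L\<^sub>n\<close> with \<open>n < 0\<close>.\<close>

lemma Lval_commutator:
  assumes "ldeg_le 0 F" "ldeg_le 0 G"
  shows "Lval F u (Lval G u \<omega>) - Lval G u (Lval F u \<omega>) = Lval (lmul (dz F) G) u \<omega> - Lval (lmul F (dz G)) u \<omega>"
  using assms(1)
proof (induction F)
  case Nil
  then show ?case by (simp add: Lval_zero)
next
  case (Cons a F)
  obtain j c where a: "a = (j, c)" by (cases a)
  have j: "j \<le> 0" using Cons.prems by (simp add: a)
  have one: "Lmode T (j - 1) (Lval G u \<omega>) - Lval G u (Lmode T (j - 1) \<omega>)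
     = of_int j \<cdot> cval (2 - (j - 1)) (vir T) G u \<omega> - cval (2 - j) (vir T) (dz G) u \<omega>"
    using assms(2)
  proof (induction G)
    case Nil
    show ?case by (simp add: L_0)
  next
    case (Cons b G)
    obtain k e where b: "b = (k, e)" by (cases b)
    have k: "k \<le> 0" using Cons.prems by (simp add: b)
    have "Lmode T (j - 1) (Lmode T (k - 1) \<omega>) - Lmode T (k - 1) (Lmode T (j - 1) \<omega>)
        = of_int (j - k) \<cdot> Lmode T (j + k - 2) \<omega>"
      using virasoro[of "j - 1" "k - 1" \<omega>] j k by (simp add: algebra_simps)
    then have com: "Lmode T (j - 1) (Lmode T (k - 1) \<omega>) = Lmode T (k - 1) (Lmode T (j - 1) \<omega>)
        + of_int (j - k) \<cdot> Lmode T (j + k - 2) \<omega>"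
      by (simp add: algebra_simps)
    have idx: "k - 2 + 1 = k - 1" "k - (2 - (j - 1)) + 1 = j + k - 2" "k - 1 - (2 - j) + 1 = j + k - 2"
      by simp_all
    have IH: "Lmode T (j - 1) (Lval G u \<omega>) = Lval G u (Lmode T (j - 1) \<omega>)
     + (of_int j \<cdot> cval (2 - (j - 1)) (vir T) G u \<omega> - cval (2 - j) (vir T) (dz G) u \<omega>)"
      using Cons by (simp add: b algebra_simps)
    show ?case
      unfolding b cval_Cons dz_Cons idx L_add L_scale com IH
      by (simp add: vs.scale_right_distrib vs.scale_right_diff_distrib vs.scale_left_diff_distrib algebra_simps)
  qed
  have "Lval (a # F) u (Lval G u \<omega>) - Lval G u (Lval (a # F) u \<omega>)
    = rval c u \<cdot> (Lmode T (j - 1) (Lval G u \<omega>) - Lval G u (Lmode T (j - 1) \<omega>))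
      + (Lval F u (Lval G u \<omega>) - Lval G u (Lval F u \<omega>))"
    by (simp add: a Lval_add Lval_scale vs.scale_right_diff_distrib)
  also have "\<dots> = Lval (lmul (dz (a # F)) G) u \<omega> - Lval (lmul (a # F) (dz G)) u \<omega>"
  proof -
    have 1: "Lval (lmul (dz (a # F)) G) u \<omega>
       = (of_int j * rval c u) \<cdot> cval (2 - (j - 1)) (vir T) G u \<omega> + Lval (lmul (dz F) G) u \<omega>"
      by (simp only: a dz_Cons lmul_Cons cval_append cval_lmul_Cons_map rval.simps)
    have 2: "Lval (lmul (a # F) (dz G)) u \<omega>
       = rval c u \<cdot> cval (2 - j) (vir T) (dz G) u \<omega> + Lval (lmul F (dz G)) u \<omega>"
      by (simp only: a lmul_Cons cval_append cval_lmul_Cons_map)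
    show ?thesis
      unfolding one 1 2 using Cons
      by (simp add: a vs.scale_right_diff_distrib mult.commute algebra_simps del: diff_diff_eq2)
  qed
  finally show ?case .
qed

text \<open>With \<open>F\<close> and \<open>G\<close> the fields of \<open>x\<close> and
  \<open>y\<close>, the curvature is \<open>L\<close> of the field
  \<open>\<partial>_x G - \<partial>_y F - F' G + F G'\<close>. At \<open>u i\<close> it regroups
  into \<open>van_lpd\<close> for \<open>G - y_i\<close> and \<open>F - x_i\<close>, plus products
  with one of these two factors, so it has a double zero there.\<close>

lemma osec_curvature:
  "osec (Dsec x (Dsec y s) @ scsec (Const (-1)) (Dsec y (Dsec x s)))"
proof -
  let ?F = "conn_field 0 x" and ?G = "conn_field 0 y"
  have deg: "ldeg_le 0 ?F" "ldeg_le 0 ?G" using conn_field_deg[of 0] by auto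
  let ?K = "lpd x ?G @ lscale (Const (-1)) (lpd y ?F)
     @ lscale (Const (-1)) (lmul (dz ?F) ?G) @ lmul ?F (dz ?G)"
  have "van i 2 ?K" for i
  proof -
    let ?F0 = "?F @ [(0, Const (- x i))]" and ?G0 = "?G @ [(0, Const (- y i))]"
    note F0 = conn_field_van[of i 0 x] and G0 = conn_field_van[of i 0 y]
    have "van i 2 ((lpd x ?G0 @ lscale (Const (x i)) (dz ?G0)) @ lscale (Const (-1)) (lpd y ?F0 @ lscale (Const (y i)) (dz ?F0))
      @ lmul ?F0 (dz ?G) @ lscale (Const (-1)) (lmul (dz ?F) ?G0))"
      by (intro van_append van_lscale van_lpd F0 G0 van_lmul[OF F0 van_0] van_lmul[OF van_0 G0]) auto
    then show ?thesis
      by (rule van_lequiv) (simp add: lequiv_def lval_lmul algebra_simps)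
  qed
  moreover have "ldeg_le 2 ?K"
  proof -
    have "ldeg_le (0 - 1 + 0) (lmul (dz ?F) ?G)" "ldeg_le (0 + (0 - 1)) (lmul ?F (dz ?G))"
      by (intro ldeg_le_lmul ldeg_le_dz deg)+
    then show ?thesis
      using deg by (auto intro!: ldeg_le_lscale ldeg_le_lpd intro: ldeg_le_mono)
  qed
  ultimately have "osec (Lsec ?K s)" by (rule osec_Lsec)
  then show ?thesis
  proof (rule osec_eqI)
    fix u
    let ?z = "sval s u"
    have D2: "sval (Dsec a (Dsec b s)) u = sval (pdsec a (pdsec b s)) u - Lval (lpd a (conn_field 0 b)) u ?z
       - Lval (conn_field 0 b) u (sval (pdsec a s) u) - Lval (conn_field 0 a) u (sval (pdsec b s) u)
       + Lval (conn_field 0 a) u (Lval (conn_field 0 b) u ?z)" for a b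
    proof -
      have neg: "Lval F u (\<alpha> - \<beta>) = Lval F u \<alpha> - Lval F u \<beta>" for F :: "'c lexp" and \<alpha> \<beta>
        using Lval_add[of 2 F u \<alpha> "- \<beta>"] Lval_scale[of 2 F u "-1" \<beta>] by simp
      have neg0: "Lval F u (- \<beta>) = - Lval F u \<beta>" for F :: "'c lexp" and \<beta>
        using Lval_scale[of 2 F u "-1" \<beta>] by simp
      show ?thesis
        by (simp add: sval_Dsec Dsec_def pdsec_Lsec sval_Lsec neg neg0)
    qed
    show "sval (Lsec ?K s) u = sval (Dsec x (Dsec y s) @ scsec (Const (-1)) (Dsec y (Dsec x s))) u"
      using Lval_commutator[OF deg, of u ?z] pdsec_commute[of x y s u]
      by (simp add: sval_Lsec D2 algebra_simps)
  qed
qed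


section \<open>Finitely many states span modulo \<open>O\<close>\<close>

lemma weight_part_mode:
  assumes \<phi>: "\<phi> \<in> gen T h"
  shows "weight_part j (mode T \<phi> n \<omega>) = mode T \<phi> n (weight_part (j + n) \<omega>)"
proof (rule weight_part_unique)
  note W = gen_weight[OF \<phi>]
  let ?S = "{j. weight_part j \<omega> \<noteq> 0}"
  show "mode T \<phi> n (weight_part (j + n) \<omega>) \<in> weight_space T j" for j
    using mode_weight[OF W weight_part_weight, of n "j + n" \<omega>] by simp
  show "finite ((\<lambda>i. i - n) ` ?S)" by (simp add: weight_part_finite)
  show "mode T \<phi> n (weight_part (j + n) \<omega>) = 0" if "j \<notin> (\<lambda>i. i - n) ` ?S" for j
  proof -
    have "weight_part (j + n) \<omega> = 0"
    proof (rule ccontr)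
      assume "weight_part (j + n) \<omega> \<noteq> 0"
      then have "j + n - n \<in> (\<lambda>i. i - n) ` ?S" by blast
      then show False using that by simp
    qed
    then show ?thesis by (simp add: mode_0[OF W])
  qed
  have "mode T \<phi> n \<omega> = (\<Sum>i\<in>?S. mode T \<phi> n (weight_part i \<omega>))"
    by (subst weight_part_sum[of \<omega>, symmetric]) (rule mode_sum[OF W])
  also have "\<dots> = (\<Sum>j\<in>(\<lambda>i. i - n) ` ?S. mode T \<phi> n (weight_part (j + n) \<omega>))"
    by (subst sum.reindex) (auto simp: inj_on_def)
  finally show "mode T \<phi> n \<omega> = (\<Sum>j\<in>(\<lambda>i. i - n) ` ?S. mode T \<phi> n (weight_part (j + n) \<omega>))" .
qed

definition bsec :: "'a list \<Rightarrow> ('a \<Rightarrow> 'k rexp) \<Rightarrow> ('k, 'a) hsection" where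
  "bsec es p = map (\<lambda>a. (p a, a)) es"

text \<open>\<open>rep es s p\<close>: modulo \<open>O\<close>, the section \<open>s\<close> is the combination of the states \<open>es\<close> with
  coefficients \<open>p\<close>.\<close>

definition rep :: "'a list \<Rightarrow> ('k, 'a) hsection \<Rightarrow> ('a \<Rightarrow> 'k rexp) \<Rightarrow> bool" where
  "rep es s p \<longleftrightarrow> osec (s @ scsec (Const (-1)) (bsec es p))"

lemma sval_bsec: "distinct es \<Longrightarrow> sval (bsec es p) u = (\<Sum>a\<in>set es. rval (p a) u \<cdot> a)"
  by (simp add: sval_def bsec_def o_def sum_list_distinct_conv_sum_set)

lemma rep_Nil: "rep es [] (\<lambda>_. Const 0)"
proof -
  have "sval (bsec es (\<lambda>_. Const 0)) u = 0" for u by (induction es) (auto simp: bsec_def)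
  then show ?thesis unfolding rep_def by (intro osec_eqI[OF osec_Nil]) simp
qed

lemma rep_osec:
  assumes "osec s" shows "rep es s (\<lambda>_. Const 0)"
  using osec_append[OF assms rep_Nil[of es, unfolded rep_def]] by (simp add: rep_def)

lemma rep_append:
  assumes "rep es s p" "rep es s' p'"
  shows "rep es (s @ s') (\<lambda>a. Add (p a) (p' a))"
proof -
  have "sval (bsec es (\<lambda>a. Add (p a) (p' a))) u = sval (bsec es p) u + sval (bsec es p') u" for u
    by (induction es) (auto simp: bsec_def vs.scale_left_distrib algebra_simps)
  then show ?thesis
    using osec_append[OF assms[unfolded rep_def]] unfolding rep_def
    by (elim osec_eqI) (simp add: algebra_simps)
qed

lemma rep_scale:
  assumes "rep es s p"
  shows "rep es (scsec c s) (\<lambda>a. Mul c (p a))"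
proof -
  have "sval (bsec es (\<lambda>a. Mul c (p a))) u = rval c u \<cdot> sval (bsec es p) u" for u
    by (induction es) (auto simp: bsec_def vs.scale_right_distrib)
  then show ?thesis
    using osec_scale[OF assms[unfolded rep_def], of c] unfolding rep_def
    by (elim osec_eqI) (simp add: vs.scale_right_diff_distrib)
qed

lemma rep_eqI:
  assumes "rep es s p" "\<And>u. u \<in> conf \<Longrightarrow> sval s u = sval s' u"
  shows "rep es s' p"
  using assms(1) unfolding rep_def by (rule osec_eqI) (use assms(2) in simp)

lemma rep_base:
  assumes "distinct es" "a \<in> set es"
  shows "rep es [(Const 1 :: 'k rexp, a)] (\<lambda>b. Const (if b = a then 1 else 0))"
proof -
  have "(\<Sum>b\<in>set es. (if b = a then 1 else 0) \<cdot> b) = (\<Sum>b\<in>set es. if b = a then a else 0)"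
    by (rule sum.cong) auto
  then have "sval (bsec es (\<lambda>b. Const (if b = a then 1 else 0))) u = a" for u :: "'k \<Rightarrow> complex"
    using assms by (simp add: sval_bsec)
  then show ?thesis
    unfolding rep_def by (intro osec_eqI[OF osec_Nil]) simp
qed

lemma rep_section:
  fixes s :: "('k, 'a) hsection"
  assumes "\<And>e \<xi>. (e, \<xi>) \<in> set s \<Longrightarrow> \<exists>p. rep es [(Const 1 :: 'k rexp, \<xi>)] p"
  shows "\<exists>p. rep es s p"
  using assms
proof (induction s)
  case Nil
  show ?case using rep_Nil by blast
next
  case (Cons b s)
  obtain e \<xi> where b: "b = (e, \<xi>)" by (cases b)
  have "\<exists>p. rep es [(Const 1 :: 'k rexp, \<xi>)] p" by (rule Cons.prems[of e]) (simp add: b)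
  moreover have "\<exists>p'. rep es s p'" by (rule Cons.IH) (meson Cons.prems list.set_intros(2))
  ultimately obtain p p' where "rep es [(Const 1 :: 'k rexp, \<xi>)] p" "rep es s p'" by blast
  from rep_append[OF rep_scale[OF this(1), of e] this(2)]
  have "rep es (b # s) (\<lambda>a. Add (Mul e (p a)) (p' a))"
    by (rule rep_eqI) (simp add: b)
  then show ?case by blast
qed

lemma finite_spanning_exists:
  fixes dummy :: "'k::finite itself"
  assumes "finite_codim T (C_space T CARD('k))"
  shows "\<exists>es. distinct es \<and> (\<forall>\<xi>. \<exists>p. rep es [(Const 1 :: 'k rexp, \<xi>)] p)"
proof -
  let ?k = "CARD('k)"
  obtain B where B: "finite B" "vs.span (C_space T ?k \<union> B) = UNIV"
    using assms by (auto simp: finite_codim_def)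
  \<comment> \<open>The complement is replaced by the homogeneous components of its elements, so
    that the induction can proceed one weight at a time.\<close>
  define E where "E = (\<Union>b\<in>B. (\<lambda>j. weight_part j b) ` {j. weight_part j b \<noteq> 0})"
  have "finite E" unfolding E_def using B(1) by (auto simp: weight_part_finite)
  then obtain es where es: "distinct es" "set es = E" using finite_distinct_list by blast
  define P where "P \<xi> \<longleftrightarrow> (\<exists>p. rep es [(Const 1 :: 'k rexp, \<xi>)] p)" for \<xi>
  have P0: "P 0"
    unfolding P_def by (rule exI, rule rep_eqI[OF rep_Nil]) simp
  have Plin: "P (c \<cdot> x + y)" if xy: "P x" "P y" for c x y
  proof -
    obtain p q where "rep es [(Const 1 :: 'k rexp, x)] p" "rep es [(Const 1 :: 'k rexp, y)] q"
      using xy unfolding P_def by blast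
    from rep_append[OF rep_scale[OF this(1), of "Const c"] this(2)]
    have "rep es [(Const 1, c \<cdot> x + y)] (\<lambda>a. Add (Mul (Const c) (p a)) (q a))"
      by (rule rep_eqI) simp
    then show ?thesis unfolding P_def by blast
  qed
  have Pspan: "P x" if "x \<in> vs.span S" "\<And>s. s \<in> S \<Longrightarrow> P s" for x S
    using that(1) by (induction rule: vs.span_induct_alt) (auto intro: P0 Plin that(2))
  have PE: "P a" if "a \<in> E" for a
    unfolding P_def using rep_base[OF es(1)] that es(2) by blast
  have hom: "P \<xi>" if "\<xi> \<in> weight_space T w" for \<xi> w
    using that
  proof (induction "nat w" arbitrary: w \<xi> rule: less_induct)
    case less
    show ?case
    proof (cases "w < 0")
      case True
      then show ?thesis using weight_neg[OF less.prems] P0 by simp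
    next
      case False
      define C where "C = {mode T \<psi> (- int N - (int ?k - 1) * int h) \<omega> | N h \<psi> \<omega>. \<psi> \<in> gen T h \<and> N \<ge> 1}"
      let ?R = "{mode T \<psi> n \<omega> | N h \<psi> n \<omega>. \<psi> \<in> gen T h \<and> N \<ge> 1 \<and> n = - int N - (int ?k - 1) * int h
           \<and> \<omega> \<in> weight_space T (w + n)} \<union> E"
      have "\<xi> \<in> vs.span (C \<union> B)"
      proof -
        have "C_space T ?k \<subseteq> vs.span (C \<union> B)"
          unfolding C_space_def C_def by (rule vs.span_mono) auto
        moreover have "B \<subseteq> vs.span (C \<union> B)" using vs.span_superset by blast
        ultimately have "vs.span (C_space T ?k \<union> B) \<subseteq> vs.span (C \<union> B)"
          by (intro vs.span_minimal vs.subspace_span) auto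
        then show ?thesis using B(2) by auto
      qed
      then have "weight_part w \<xi> \<in> vs.span ?R"
      proof (rule weight_part_in_span)
        fix s assume "s \<in> C \<union> B"
        then show "weight_part w s \<in> vs.span ?R"
        proof
          assume "s \<in> C"
          then obtain N h \<psi> \<omega> where s: "s = mode T \<psi> (- int N - (int ?k - 1) * int h) \<omega>" "\<psi> \<in> gen T h" "N \<ge> 1"
            unfolding C_def by auto
          have "weight_part w s \<in> ?R"
            unfolding s(1) weight_part_mode[OF s(2)] using s(2,3) weight_part_weight by blast
          then show ?thesis by (rule vs.span_base)
        next
          assume "s \<in> B"
          show ?thesis
          proof (cases "weight_part w s = 0")
            case True
            then show ?thesis by (simp only: vs.span_zero)
          next
            case False
            then have "weight_part w s \<in> E" using \<open>s \<in> B\<close> unfolding E_def by blast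
            then show ?thesis by (intro vs.span_base) blast
          qed
        qed
      qed
      then have "\<xi> \<in> vs.span ?R" using weight_part_homogeneous[OF less.prems, of w] by simp
      then show ?thesis
      proof (rule Pspan)
        fix s assume "s \<in> ?R"
        then show "P s"
        proof
          assume "s \<in> E" then show ?thesis by (rule PE)
        next
          assume "s \<in> {mode T \<psi> n \<omega> | N h \<psi> n \<omega>. \<psi> \<in> gen T h \<and> N \<ge> 1 \<and> n = - int N - (int ?k - 1) * int h
           \<and> \<omega> \<in> weight_space T (w + n)}"
          then obtain N h \<psi> n \<omega> where s: "s = mode T \<psi> n \<omega>" "\<psi> \<in> gen T h" "N \<ge> 1"
            "n = - int N - (int ?k - 1) * int h" "\<omega> \<in> weight_space T (w + n)"
            by auto
          \<comment> \<open>The exponent whose coefficient multiplies \<open>V_n(\<psi>)\<close>.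
            The degree \<open>d + h k\<close> of the family below equals \<open>2 h - 1 - N\<close>,
            so \<open>N \<ge> 1\<close> is exactly the bound \<open>2 h - 2\<close>.\<close>
          define d where "d = n + int h - 1"
          obtain e :: "'k rexp" and G where G: "ldeg_le (d + int h * int ?k) ((d, e) # G)"
            "\<forall>i. van i h ((d, e) # G)" "\<forall>u\<in>conf. rval e u = 1" "\<forall>(j, f)\<in>set G. d < j"
            using leading_exists[of d h] by blast
          have "osec (csec (int h) \<psi> ((d, e) # G) \<omega>)"
          proof (rule osec_gen[OF s(2) G(2)])
            show "ldeg_le (2 * int h - 2) ((d, e) # G)"
              by (rule ldeg_le_mono[OF G(1)]) (use s(3) in \<open>simp add: d_def s(4) algebra_simps\<close>)
          qed
          then have 1: "rep es (csec (int h) \<psi> ((d, e) # G) \<omega>) (\<lambda>_. Const 0)" by (rule rep_osec)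
          have "\<exists>p. rep es (csec (int h) \<psi> G \<omega>) p"
          proof (rule rep_section)
            fix f \<zeta> assume "(f, \<zeta>) \<in> set (csec (int h) \<psi> G \<omega>)"
            then obtain j where j: "(j, f) \<in> set G" "\<zeta> = mode T \<psi> (j - int h + 1) \<omega>"
              by (auto simp: csec_def)
            have "d < j" using G(4) j(1) by auto
            \<comment> \<open>This weight is \<open>w - (j - d)\<close>, smaller than
              \<open>w\<close> because \<open>j > d\<close>.\<close>
            have wt: "\<zeta> \<in> weight_space T (w + n - (j - int h + 1))"
              unfolding j(2) by (rule mode_weight[OF gen_weight[OF s(2)] s(5)])
            have "P \<zeta>"
            proof (cases "w + n - (j - int h + 1) < 0")
              case True
              then show ?thesis using weight_neg[OF wt] P0 by simp
            next
              case nonneg: False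
              show ?thesis
                by (rule less.hyps[OF _ wt]) (use \<open>d < j\<close> nonneg in \<open>simp add: d_def\<close>)
            qed
            then show "\<exists>p. rep es [(Const 1 :: 'k rexp, \<zeta>)] p" unfolding P_def .
          qed
          then obtain p where "rep es (csec (int h) \<psi> G \<omega>) p" by blast
          from rep_append[OF 1 rep_scale[OF this, of "Const (-1)"]]
          have "rep es [(Const 1, s)] (\<lambda>a. Add (Const 0) (Mul (Const (-1)) (p a)))"
            by (rule rep_eqI) (use G(3) in \<open>simp add: s(1) d_def\<close>)
          then show ?thesis unfolding P_def by blast
        qed
      qed
    qed
  qed
  have "P \<xi>" for \<xi>
    by (rule Pspan[of \<xi> "\<Union>j::nat. weight_space T (int j)"]) (use weight_graded hom in auto)
  then show ?thesis using es(1) unfolding P_def by blast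
qed

end

section \<open>Convergence and local solutions\<close>

text \<open>A single term of the exponential series at \<open>n\<close> is at most the whole
  sum.\<close>

lemma power_le_fact_exp: "real n ^ n \<le> fact n * exp 1 ^ n"
proof -
  have "(\<lambda>k. real n ^ k / fact k) sums exp (real n)"
    using exp_converges[of "real n"] by (simp add: field_simps)
  then have "(\<Sum>k\<in>{n}. real n ^ k / fact k) \<le> exp (real n)"
    by (intro sum_le_suminf[of "\<lambda>k. real n ^ k / fact k", unfolded sums_unique[symmetric], THEN order_trans])
       (auto simp: sums_iff)
  then have "real n ^ n \<le> fact n * exp (real n)" by (simp add: field_simps)
  then show ?thesis using exp_of_nat_mult[of n "1::real"] by simp
qed

text \<open>The \<open>n\<close>-th step is estimated on the disc of radius \<open>\<rho>(1 - m/n)\<close> after \<open>m\<close> of the \<open>n\<close>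
  iterations, so that each differentiation costs a factor \<open>n/\<rho>\<close>.\<close>

lemma iterated_derivative_bound:
  fixes \<phi> :: "nat \<Rightarrow> 'b \<Rightarrow> complex \<Rightarrow> complex" and K M \<rho> :: real
  assumes S: "finite S" and \<rho>: "0 < \<rho>" "open D" "cball 0 \<rho> \<subseteq> D"
    and holo: "\<And>n b. b \<in> S \<Longrightarrow> \<phi> n b holomorphic_on D"
    and base: "\<And>b t. b \<in> S \<Longrightarrow> t \<in> cball 0 \<rho> \<Longrightarrow> cmod (\<phi> 0 b t) \<le> M"
    and step: "\<And>n b t. b \<in> S \<Longrightarrow> t \<in> D \<Longrightarrow> \<phi> (Suc n) b t = deriv (\<phi> n b) t + (\<Sum>a\<in>S. \<phi> n a t * A a b t)"
    and A: "\<And>a b t. a \<in> S \<Longrightarrow> b \<in> S \<Longrightarrow> t \<in> cball 0 \<rho> \<Longrightarrow> cmod (A a b t) \<le> K"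
    and K: "0 \<le> K" and M: "0 \<le> M" and b: "b \<in> S"
  shows "cmod (\<phi> n b 0) \<le> M * (fact n * (exp 1 * (1 / \<rho> + card S * K)) ^ n)"
proof (cases "n = 0")
  case True
  then show ?thesis using base[OF b, of 0] \<rho> by simp
next
  case False
  then have n: "0 < real n" by simp
  define q where "q = n / \<rho> + card S * K"
  have q: "0 \<le> q" using \<rho> K by (simp add: q_def)
  have bound: "cmod (\<phi> m b t) \<le> M * q ^ m" if "m \<le> n" "b \<in> S" "cmod t \<le> \<rho> * (1 - m / n)" for m b t
    using that
  proof (induction m arbitrary: b t)
    case 0
    then show ?case using base[of b t] by simp
  next
    case (Suc m)
    have r: "\<rho> * (1 - Suc m / n) + \<rho> / n = \<rho> * (1 - m / n)"
      using n by (simp add: field_simps)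
    have le: "\<rho> * (1 - m / n) \<le> \<rho>" using n \<rho> by (simp add: field_simps)
    have rn: "0 < \<rho> / n" using \<rho> n by simp
    have inD: "x \<in> D" "cmod x \<le> \<rho> * (1 - m / n)" if "x \<in> cball t (\<rho> / n)" for x
    proof -
      have "cmod x \<le> cmod t + cmod (x - t)" by (metis add.commute diff_add_cancel norm_triangle_ineq)
      then show "cmod x \<le> \<rho> * (1 - m / n)"
        using that Suc.prems(3) r by (simp add: dist_norm norm_minus_commute)
      then show "x \<in> D" using \<rho>(3) le by auto
    qed
    have cb: "cball t (\<rho> / n) \<subseteq> D" using inD by blast
    have tin: "t \<in> D" "cmod t \<le> \<rho> * (1 - m / n)" using inD[of t] rn by auto
    have "norm ((deriv ^^ 1) (\<phi> m b) t) \<le> fact 1 * (M * q ^ m) / (\<rho> / n) ^ 1"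
    proof (rule Cauchy_inequality)
      show "\<phi> m b holomorphic_on ball t (\<rho> / n)"
        using holo[OF Suc.prems(2)] by (rule holomorphic_on_subset) (use cb in auto)
      show "continuous_on (cball t (\<rho> / n)) (\<phi> m b)"
        using holomorphic_on_imp_continuous_on[OF holo[OF Suc.prems(2)]] cb by (rule continuous_on_subset)
      show "cmod (\<phi> m b x) \<le> M * q ^ m" if "cmod (t - x) = \<rho> / n" for x
        by (rule Suc.IH) (use Suc.prems inD[of x] that in \<open>auto simp: dist_norm\<close>)
    qed (use rn in auto)
    then have d: "cmod (deriv (\<phi> m b) t) \<le> (M * q ^ m) * (n / \<rho>)" by (simp add: field_simps)
    have "cmod (\<Sum>a\<in>S. \<phi> m a t * A a b t) \<le> (\<Sum>a\<in>S. (M * q ^ m) * K)"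
    proof (rule sum_norm_le)
      fix a assume a: "a \<in> S"
      have "t \<in> cball 0 \<rho>" using tin(2) le by auto
      then show "cmod (\<phi> m a t * A a b t) \<le> (M * q ^ m) * K"
        unfolding norm_mult
        by (intro mult_mono A a Suc.prems Suc.IH) (use Suc.prems tin M q in auto)
    qed
    then have s: "cmod (\<Sum>a\<in>S. \<phi> m a t * A a b t) \<le> (M * q ^ m) * (card S * K)"
      by (simp add: mult_ac)
    have "cmod (\<phi> (Suc m) b t) \<le> (M * q ^ m) * (n / \<rho>) + (M * q ^ m) * (card S * K)"
      unfolding step[OF Suc.prems(2) tin(1)] using norm_triangle_mono[OF d s] .
    also have "\<dots> = M * q ^ Suc m" by (simp add: q_def algebra_simps)
    finally show ?case .
  qed
  have "cmod (\<phi> n b 0) \<le> M * q ^ n" using bound[of n b 0] b n by simp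
  also have "q \<le> n * (1 / \<rho> + card S * K)"
  proof -
    have "card S * K \<le> n * (card S * K)"
      using mult_right_mono[of 1 "real n" "card S * K"] n K by simp
    then show ?thesis by (simp add: q_def distrib_left)
  qed
  then have "q ^ n \<le> (n * (1 / \<rho> + card S * K)) ^ n" by (rule power_mono) (rule q)
  \<comment> \<open>The factor \<open>n\<close> paid in each of the \<open>n\<close> steps costs
    only \<open>n! e^n\<close>, and this \<open>n!\<close> cancels against the factorial in the
    series.\<close>
  also have "\<dots> \<le> fact n * exp 1 ^ n * (1 / \<rho> + card S * K) ^ n"
    unfolding power_mult_distrib using \<rho> K by (intro mult_right_mono power_le_fact_exp) auto
  also have "\<dots> = fact n * (exp 1 * (1 / \<rho> + card S * K)) ^ n"
    by (simp add: power_mult_distrib)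
  finally show ?thesis using M by (simp add: mult_left_mono)
qed

section \<open>Polydiscs and Taylor series of the coefficients\<close>

definition pbox :: "('k \<Rightarrow> complex) \<Rightarrow> real \<Rightarrow> ('k \<Rightarrow> complex) set" where
  "pbox w r = {u. \<forall>i. cmod (u i - w i) < r}"

lemma conf_pbox:
  fixes w :: "'k::finite \<Rightarrow> complex"
  assumes w: "w \<in> conf"
  shows "\<exists>r>0. pbox w r \<subseteq> conf \<and> (\<forall>e. \<exists>B\<ge>0. \<forall>u\<in>pbox w r. cmod (rval e u) \<le> B)"
proof -
  let ?S = "insert 1 (range (\<lambda>i. cmod (w i)) \<union> (\<lambda>p. cmod (w (fst p) - w (snd p))) ` {(i, j). i \<noteq> j})"
  define c where "c = Min ?S"
  have "0 < c"
    unfolding c_def using w by (subst Min_gr_iff) (auto simp: conf_def inj_def)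
  have c1: "c \<le> cmod (w i)" for i unfolding c_def by (rule Min_le) auto
  have c2: "c \<le> cmod (w i - w j)" if "i \<noteq> j" for i j unfolding c_def
    by (rule Min_le) (use that in force)+
  \<comment> \<open>All points are at least \<open>c\<close> away from \<open>0\<close> and from
    each other. If each moves by less than a third of that, every denominator keeps modulus at least
    \<open>c / 3\<close>.\<close>
  define r where "r = c / 3"
  have r: "0 < r" using \<open>0 < c\<close> by (simp add: r_def)
  have u1: "r \<le> cmod (u i)" if "u \<in> pbox w r" for u i
  proof -
    have "cmod (w i) \<le> cmod (w i - u i) + cmod (u i)" by (metis diff_add_cancel norm_triangle_ineq)
    moreover have "cmod (w i - u i) < r" using that by (simp add: pbox_def norm_minus_commute)
    ultimately show ?thesis using c1[of i] \<open>0 < c\<close> unfolding r_def by linarith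
  qed
  have u2: "r \<le> cmod (u i - u j)" if "u \<in> pbox w r" "i \<noteq> j" for u i j
  proof -
    have "w i - w j = (w i - u i) + (u i - u j) + (u j - w j)" by simp
    then have "cmod (w i - w j) \<le> cmod (w i - u i) + cmod (u i - u j) + cmod (u j - w j)"
      by (metis norm_triangle_ineq norm_triangle_le add.assoc order_refl add_mono norm_triangle_mono)
    moreover have "cmod (w i - u i) < r" "cmod (u j - w j) < r"
      using that by (simp_all add: pbox_def norm_minus_commute)
    ultimately show ?thesis using c2[OF that(2)] \<open>0 < c\<close> unfolding r_def by linarith
  qed
  have "pbox w r \<subseteq> conf"
  proof
    fix u assume u: "u \<in> pbox w r"
    have "u i \<noteq> 0" for i using u1[OF u, of i] r by auto
    moreover have "i = j" if "u i = u j" for i j using u2[OF u, of i j] r that by auto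
    ultimately show "u \<in> conf" by (auto simp: conf_def inj_def)
  qed
  moreover have "\<exists>B\<ge>0. \<forall>u\<in>pbox w r. cmod (rval e u) \<le> B" for e
  proof (induction e)
    case (Const x)
    show ?case by (rule exI[of _ "cmod x"]) simp
  next
    case (Var i)
    have "cmod (u i) \<le> cmod (w i) + r" if "u \<in> pbox w r" for u
    proof -
      have "cmod (u i) \<le> cmod (u i - w i) + cmod (w i)" by (metis diff_add_cancel norm_triangle_ineq)
      moreover have "cmod (u i - w i) < r" using that by (simp add: pbox_def)
      ultimately show ?thesis by simp
    qed
    then show ?case using r by (intro exI[of _ "cmod (w i) + r"]) auto
  next
    case (InvVar i)
    have "cmod (inverse (u i)) \<le> inverse r" if "u \<in> pbox w r" for u
      unfolding norm_inverse using u1[OF that] r by (intro le_imp_inverse_le) auto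
    then show ?case using r by (intro exI[of _ "inverse r"]) auto
  next
    case (InvDiff i j)
    have "cmod (inverse (u i - u j)) \<le> inverse r" if "u \<in> pbox w r" for u
    proof (cases "i = j")
      case False
      then show ?thesis unfolding norm_inverse using u2[OF that] r by (intro le_imp_inverse_le) auto
    qed (use r in simp)
    then show ?case using r by (intro exI[of _ "inverse r"]) auto
  next
    case (Add a b)
    then obtain A B where "A \<ge> 0" "\<forall>u\<in>pbox w r. cmod (rval a u) \<le> A" "B \<ge> 0" "\<forall>u\<in>pbox w r. cmod (rval b u) \<le> B"
      by auto
    then show ?case by (intro exI[of _ "A + B"]) (auto intro: norm_triangle_mono)
  next
    case (Mul a b)
    then obtain A B where "A \<ge> 0" "\<forall>u\<in>pbox w r. cmod (rval a u) \<le> A" "B \<ge> 0" "\<forall>u\<in>pbox w r. cmod (rval b u) \<le> B"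
      by auto
    then show ?case by (intro exI[of _ "A * B"]) (auto simp: norm_mult intro: mult_mono)
  qed
  ultimately show ?thesis using r by blast
qed

lemma rval_line_holomorphic:
  assumes "\<And>t. t \<in> D \<Longrightarrow> line u x t \<in> conf"
  shows "(\<lambda>t. rval e (line u x t)) holomorphic_on D"
  unfolding holomorphic_on_def field_differentiable_def
  using rval_deriv[OF assms] has_field_derivative_at_within by blast

lemma rval_line_higher_deriv:
  fixes u :: "'k::finite \<Rightarrow> complex"
  assumes "line u x t \<in> conf"
  shows "(deriv ^^ n) (\<lambda>t. rval e (line u x t)) t = rval ((pd x ^^ n) e) (line u x t)"
  using assms
proof (induction n arbitrary: t)
  case (Suc n)
  have "(deriv ^^ Suc n) (\<lambda>t. rval e (line u x t)) t = deriv ((deriv ^^ n) (\<lambda>t. rval e (line u x t))) t" by simp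
  also have "\<dots> = deriv (\<lambda>t. rval ((pd x ^^ n) e) (line u x t)) t"
    using conf_line_eventually[OF Suc.prems] by (intro deriv_cong_ev) (auto elim!: eventually_mono simp: Suc.IH)
  also have "\<dots> = rval ((pd x ^^ Suc n) e) (line u x t)"
    using rval_deriv[OF Suc.prems] by (simp add: DERIV_imp_deriv)
  finally show ?case .
qed simp

text \<open>\<open>1 < R\<close> puts \<open>t = 1\<close> strictly inside the disc of convergence,
  whence absolute convergence there; the Cauchy product below depends on it.\<close>

lemma rval_taylor:
  fixes u :: "'k::finite \<Rightarrow> complex"
  assumes R: "1 < (R :: real)" and conf: "\<And>t. t \<in> ball 0 R \<Longrightarrow> line u x t \<in> conf"
  shows "(\<lambda>n. rval ((pd x ^^ n) e) u / fact n) sums rval e (line u x 1)"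
    and "summable (\<lambda>n. cmod (rval ((pd x ^^ n) e) u / fact n))"
proof -
  have u: "line u x 0 \<in> conf" using conf[of 0] R by simp
  have sums: "(\<lambda>n. rval ((pd x ^^ n) e) u / fact n * t ^ n) sums rval e (line u x t)" if "t \<in> ball 0 R" for t
  proof -
    have "(\<lambda>t. rval e (line u x t)) holomorphic_on ball 0 R" by (rule rval_line_holomorphic[OF conf])
    from holomorphic_power_series[OF this that] show ?thesis
      by (simp add: rval_line_higher_deriv[OF u])
  qed
  from sums[of 1] R show "(\<lambda>n. rval ((pd x ^^ n) e) u / fact n) sums rval e (line u x 1)" by simp
  define t where "t = (1 + R) / 2"
  have "summable (\<lambda>n. rval ((pd x ^^ n) e) u / fact n * of_real t ^ n)"
  proof (rule sums_summable[OF sums])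
    have "0 < t" "t < R" using R by (auto simp: t_def)
    then show "of_real t \<in> ball (0 :: complex) R" by simp
  qed
  moreover have "cmod 1 < cmod (of_real t)"
  proof -
    have "1 < t" using R by (simp add: t_def)
    then show ?thesis by simp
  qed
  ultimately have "summable (\<lambda>n. cmod (rval ((pd x ^^ n) e) u / fact n * 1 ^ n))"
    by (rule powser_insidea)
  then show "summable (\<lambda>n. cmod (rval ((pd x ^^ n) e) u / fact n))"
    by simp
qed

section \<open>The connection in a finite spanning set and its convergence\<close>

context chiral_theory
begin

lemma rep_sum_list:
  assumes "\<And>j. j \<in> set J \<Longrightarrow> rep es (S j) (P j)"
  shows "\<exists>q. rep es (concat (map S J)) q \<and> (\<forall>b u. rval (q b) u = (\<Sum>j\<leftarrow>J. rval (P j b) u))"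
  using assms
proof (induction J)
  case Nil
  show ?case by (rule exI[of _ "\<lambda>_. Const 0"]) (simp add: rep_Nil)
next
  case (Cons j J)
  then obtain q where q: "rep es (concat (map S J)) q" "\<forall>b u. rval (q b) u = (\<Sum>j\<leftarrow>J. rval (P j b) u)"
    by fastforce
  show ?case
    by (rule exI[of _ "\<lambda>b. Add (P j b) (q b)"]) (use q rep_append[OF Cons.prems[of j] q(1)] in simp)
qed

lemma cval_concat: "cval h \<psi> (concat Gs) u \<omega> = (\<Sum>G\<leftarrow>Gs. cval h \<psi> G u \<omega>)"
  by (induction Gs) auto

lemma Lval_conn_field: "Lval (conn_field M x) u \<omega> = (\<Sum>l\<in>UNIV. x l \<cdot> Lval (conn_fun M l) u \<omega>)"
  unfolding conn_field_def cval_concat map_map o_def cval_lscale rval.simps by (rule sum_index_list)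

lemma Lval_conn_field_unit: "Lval (conn_field M (unit_dir i)) u \<omega> = Lval (conn_fun M i) u \<omega>"
proof -
  have "(\<Sum>l\<in>UNIV. unit_dir i l \<cdot> Lval (conn_fun M l) u \<omega>) = (\<Sum>l\<in>UNIV. if l = i then Lval (conn_fun M l) u \<omega> else 0)"
    by (rule sum.cong) (auto simp: unit_dir_def)
  then show ?thesis by (simp add: Lval_conn_field)
qed

lemma sval_pdsec_scsec: "sval (pdsec x (scsec c s)) u = rval (pd x c) u \<cdot> sval s u + rval c u \<cdot> sval (pdsec x s) u"
  by (induction s) (auto simp: vs.scale_right_distrib vs.scale_left_distrib)

lemma sval_Dsec_scsec: "sval (Dsec x (scsec c s)) u = rval (pd x c) u \<cdot> sval s u + rval c u \<cdot> sval (Dsec x s) u"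
  by (simp add: sval_Dsec sval_pdsec_scsec Lval_scale vs.scale_right_diff_distrib)

lemma sval_Dsec_append: "sval (Dsec x (s @ s')) u = sval (Dsec x s) u + sval (Dsec x s') u"
  by (simp add: sval_Dsec Lval_add)

lemma sval_pdsec_sum:
  fixes x :: "'k::finite \<Rightarrow> complex"
  shows "sval (pdsec x s) u = (\<Sum>i\<in>UNIV. x i \<cdot> sval (pdsec (unit_dir i) s) u)"
proof (induction s)
  case (Cons a s)
  obtain e \<xi> where a: "a = (e, \<xi>)" by (cases a)
  show ?case
    by (simp add: a Cons vs.scale_right_distrib sum.distrib pd_sum[of x] vs.scale_sum_left)
qed simp

lemma sval_Dsec_sum: "sval (Dsec x s) u = (\<Sum>i\<in>UNIV. x i \<cdot> sval (Dsec (unit_dir i) s) u)"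
  by (simp add: sval_Dsec sval_pdsec_sum[of x] Lval_conn_field[of 0 x] Lval_conn_field_unit
      vs.scale_right_diff_distrib sum_subtractf)

lemma sval_Dsec_line: "sval (Dsec (line x y h) s) u = sval (Dsec x s) u + h \<cdot> sval (Dsec y s) u"
  by (simp add: sval_Dsec_sum[of "line x y h"] sval_Dsec_sum[of x] sval_Dsec_sum[of y] line_apply
      vs.scale_left_distrib sum.distrib vs.scale_sum_right)

text \<open>In the spanning states \<open>es\<close> the connection reads
  \<open>\<partial>_x + A\<close>, with \<open>A\<close> the matrix of \<open>Dsec\<close> on the
  constant states. Since \<open>es\<close> may be dependent modulo \<open>O\<close>, coefficients
  are not determined, and a representation with this particular recursion has to be
  selected.\<close>

lemma rep_Dsec_bsec:
  fixes A :: "'k::finite \<Rightarrow> 'a \<Rightarrow> 'a \<Rightarrow> 'k rexp"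
  assumes es: "distinct es"
    and A: "\<And>i a. a \<in> set es \<Longrightarrow> rep es (Dsec (unit_dir i) [(Const 1, a)]) (A i a)"
  shows "\<exists>q. rep es (Dsec x (bsec es p)) q \<and> (\<forall>b\<in>set es. \<forall>u. rval (q b) u
     = rval (pd x (p b)) u + (\<Sum>a\<in>set es. rval (p a) u * (\<Sum>i\<in>UNIV. x i * rval (A i a b) u)))"
proof -
  define S where "S a = scsec (pd x (p a)) [(Const 1, a)]
     @ scsec (p a) (concat (map (\<lambda>i. scsec (Const (x i)) (Dsec (unit_dir i) [(Const 1, a)])) index_list))" for a
  have "\<exists>q. rep es (S a) q \<and> (\<forall>b u. rval (q b) u = rval (pd x (p a)) u * (if b = a then 1 else 0)
     + rval (p a) u * (\<Sum>i\<in>UNIV. x i * rval (A i a b) u))" if a: "a \<in> set es" for a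
  proof -
    obtain q where q: "rep es (concat (map (\<lambda>i. scsec (Const (x i)) (Dsec (unit_dir i) [(Const 1, a)])) index_list)) q"
      "\<And>b u. rval (q b) u = (\<Sum>i\<leftarrow>index_list. rval (Mul (Const (x i)) (A i a b)) u)"
      using rep_sum_list[of index_list es "\<lambda>i. scsec (Const (x i)) (Dsec (unit_dir i) [(Const 1, a)])"
          "\<lambda>i b. Mul (Const (x i)) (A i a b)"] rep_scale[OF A[OF a]] by blast
    show ?thesis
      using rep_append[OF rep_scale[OF rep_base[OF es a], of "pd x (p a)"] rep_scale[OF q(1), of "p a"]]
      unfolding S_def by (intro exI conjI) (auto simp: q(2) sum_index_list)
  qed
  then have "\<forall>a\<in>set es. \<exists>q. rep es (S a) q \<and> (\<forall>b u. rval (q b) u = rval (pd x (p a)) u * (if b = a then 1 else 0)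
     + rval (p a) u * (\<Sum>i\<in>UNIV. x i * rval (A i a b) u))" by blast
  from bchoice[OF this] obtain Q where "\<forall>a\<in>set es. rep es (S a) (Q a) \<and> (\<forall>b u. rval (Q a b) u = rval (pd x (p a)) u * (if b = a then 1 else 0)
     + rval (p a) u * (\<Sum>i\<in>UNIV. x i * rval (A i a b) u))" ..
  then have Q: "\<And>a. a \<in> set es \<Longrightarrow> rep es (S a) (Q a)"
    "\<And>a b u. a \<in> set es \<Longrightarrow> rval (Q a b) u = rval (pd x (p a)) u * (if b = a then 1 else 0)
     + rval (p a) u * (\<Sum>i\<in>UNIV. x i * rval (A i a b) u)"
    by blast+
  obtain q where q: "rep es (concat (map S es)) q" "\<And>b u. rval (q b) u = (\<Sum>a\<leftarrow>es. rval (Q a b) u)"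
    using rep_sum_list[of es es S Q] Q(1) by blast
  have "sval (concat (map S es')) u = sval (Dsec x (bsec es' p)) u" for es' u
  proof (induction es')
    case Nil
    show ?case by (simp add: bsec_def Dsec_def)
  next
    case (Cons a es')
    have "sval (S a) u = rval (pd x (p a)) u \<cdot> a - rval (p a) u \<cdot> Lval (conn_field 0 x) u a"
    proof -
      have "sval (concat (map (\<lambda>i. scsec (Const (x i)) (Dsec (unit_dir i) [(Const 1, a)])) index_list)) u
         = sval (Dsec x [(Const 1, a)]) u"
        unfolding sval_concat map_map o_def sum_index_list sval_scsec rval.simps
        by (rule sval_Dsec_sum[symmetric])
      then show ?thesis by (simp add: S_def sval_Dsec)
    qed
    moreover have "sval (Dsec x (bsec (a # es') p)) u
       = rval (pd x (p a)) u \<cdot> a - rval (p a) u \<cdot> Lval (conn_field 0 x) u a + sval (Dsec x (bsec es' p)) u"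
      by (simp add: bsec_def sval_Dsec Lval_add Lval_scale)
    ultimately show ?case by (simp add: Cons)
  qed
  then have "rep es (Dsec x (bsec es p)) q" using q(1) by (auto intro: rep_eqI)
  moreover have "rval (q b) u
     = rval (pd x (p b)) u + (\<Sum>a\<in>set es. rval (p a) u * (\<Sum>i\<in>UNIV. x i * rval (A i a b) u))" if "b \<in> set es" for b u
  proof -
    have "rval (q b) u = (\<Sum>a\<in>set es. rval (Q a b) u)"
      by (simp add: q(2) sum_list_distinct_conv_sum_set es)
    also have "\<dots> = (\<Sum>a\<in>set es. rval (pd x (p a)) u * (if b = a then 1 else 0))
       + (\<Sum>a\<in>set es. rval (p a) u * (\<Sum>i\<in>UNIV. x i * rval (A i a b) u))"
      unfolding sum.distrib[symmetric] by (rule sum.cong) (simp_all add: Q(2))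
    also have "(\<Sum>a\<in>set es. rval (pd x (p a)) u * (if b = a then 1 else 0)) = rval (pd x (p b)) u"
      using that by (simp add: if_distrib cong: if_cong)
    finally show ?thesis .
  qed
  ultimately show ?thesis by blast
qed

lemma rep_Dsec:
  assumes "rep es s p" "rep es (Dsec x (bsec es p)) q"
  shows "rep es (Dsec x s) q"
proof -
  have "osec (Dsec x (s @ scsec (Const (-1)) (bsec es p)))"
    using assms(1) unfolding rep_def by (rule osec_Dsec)
  from osec_append[OF this assms(2)[unfolded rep_def]] show ?thesis
    unfolding rep_def by (rule osec_eqI) (simp add: sval_Dsec_append sval_Dsec_scsec)
qed

text \<open>The dual fibre tested on values of families; \<open>dual_fibre_eq_dual\<close>
  identifies it with \<open>dual_fibre\<close> at a point of \<open>conf\<close>.\<close>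

definition dual_conf :: "('k::finite \<Rightarrow> complex) \<Rightarrow> ('a \<Rightarrow> complex) set" where
  "dual_conf u = {\<eta>. functional \<eta> \<and> (\<forall>s. osec s \<longrightarrow> \<eta> (sval s u) = 0)}"

text \<open>The radius \<open>2\<close> leaves room beyond \<open>t = 1\<close>, the end of the
  transport, for \<open>rval_taylor\<close>. \<open>M\<close> may depend on \<open>\<eta>\<close>
  and \<open>s\<close> but not on the direction \<open>x\<close>, which yields uniform convergence
  and hence continuity and termwise differentiation.\<close>

definition converges :: "real \<Rightarrow> ('k::finite \<Rightarrow> complex) \<Rightarrow> bool" where
  "converges \<delta> w \<longleftrightarrow> (\<forall>x. (\<forall>i. cmod (x i) < \<delta>) \<longrightarrow> (\<forall>t\<in>ball 0 2. line w x t \<in> conf)) \<and>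
     (\<forall>\<eta>\<in>dual_conf w. \<forall>s. \<exists>M. \<forall>x. (\<forall>i. cmod (x i) < \<delta>) \<longrightarrow>
        (\<forall>n. cmod (\<eta> (sval ((Dsec x ^^ n) s) w) / fact n) \<le> M * (1/2) ^ n))"

lemma converges_locally:
  fixes w0 :: "'k::finite \<Rightarrow> complex"
  assumes w0: "w0 \<in> conf"
    and spans: "\<exists>es. distinct es \<and> (\<forall>\<xi>. \<exists>p. rep es [(Const 1 :: 'k rexp, \<xi>)] p)"
  shows "\<exists>\<delta>>0. \<forall>w\<in>pbox w0 \<delta>. converges \<delta> w"
proof -
  obtain es where es: "distinct es" and ex: "\<And>\<xi>. \<exists>p. rep es [(Const 1 :: 'k rexp, \<xi>)] p"
    using spans by blast
  obtain r where r: "r > 0" "pbox w0 r \<subseteq> conf"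
    and bnd: "\<And>e. \<exists>B\<ge>0. \<forall>u\<in>pbox w0 r. cmod (rval e u) \<le> B"
    using conf_pbox[OF w0] by blast
  from bnd have "\<forall>e. \<exists>B\<ge>0. \<forall>u\<in>pbox w0 r. cmod (rval e u) \<le> B" by blast
  from choice[OF this] obtain B where B: "\<And>e. B e \<ge> 0" "\<And>e u. u \<in> pbox w0 r \<Longrightarrow> cmod (rval e u) \<le> B e"
    by blast
  have exr: "\<exists>p. rep es s p" for s :: "('k, 'a) hsection"
    by (rule rep_section) (rule ex)
  define A :: "'k \<Rightarrow> 'a \<Rightarrow> 'a \<Rightarrow> 'k rexp" where
    "A i a = (SOME p. rep es (Dsec (unit_dir i) [(Const 1, a)]) p)" for i a
  have A: "rep es (Dsec (unit_dir i) [(Const 1, a)]) (A i a)" for i a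
    unfolding A_def by (rule someI_ex[OF exr])
  define TT where "TT = (\<lambda>(i, a, b). A i a b) ` (UNIV \<times> set es \<times> set es)"
  define K' where "K' = (\<Sum>e\<in>TT. B e)"
  have K': "0 \<le> K'" unfolding K'_def by (intro sum_nonneg B)
  have AK: "cmod (rval (A i a b) u) \<le> K'" if "a \<in> set es" "b \<in> set es" "u \<in> pbox w0 r" for i a b u
  proof -
    have "A i a b \<in> TT" unfolding TT_def using that by force
    then have "B (A i a b) \<le> K'"
      unfolding K'_def by (intro member_le_sum) (auto simp: TT_def B)
    then show ?thesis using B(2)[OF that(3), of "A i a b"] by simp
  qed
  define k where "k = real CARD('k)"
  \<comment> \<open>The geometric rate per unit of \<open>\<delta>\<close> in
    \<open>iterated_derivative_bound\<close>: \<open>2 / r\<close> is \<open>1 / R\<close> over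
    \<open>\<delta>\<close> for the radius \<open>R\<close> below, and \<open>k K'\<close> bounds
    the connection matrix for directions with coordinates of modulus at most 1.\<close>
  define \<Lambda> where "\<Lambda> = exp 1 * (2 / r + card (set es) * (k * K'))"
  have "0 < \<Lambda>" unfolding \<Lambda>_def using r K' by (auto simp: k_def intro!: mult_pos_pos add_pos_nonneg)
  define \<delta> where "\<delta> = min (r / 8) (1 / (4 * \<Lambda>))"
  have \<delta>: "0 < \<delta>" "\<delta> \<le> r / 8" "\<delta> * \<Lambda> \<le> 1 / 2"
  proof -
    show "0 < \<delta>" using r \<open>0 < \<Lambda>\<close> by (simp add: \<delta>_def)
    show "\<delta> \<le> r / 8" by (simp add: \<delta>_def)
    have "\<delta> * \<Lambda> \<le> 1 / (4 * \<Lambda>) * \<Lambda>" using \<open>0 < \<Lambda>\<close> by (intro mult_right_mono) (auto simp: \<delta>_def)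
    then show "\<delta> * \<Lambda> \<le> 1 / 2" using \<open>0 < \<Lambda>\<close> by simp
  qed
  \<comment> \<open>For \<open>|t| < 3 R / 2\<close> and coordinates of \<open>x\<close> below
    \<open>\<delta>\<close>, each point moves by at most \<open>3 r / 4\<close>. Starting within
    \<open>\<delta> \<le> r / 8\<close> of \<open>w0\<close>, it stays in the polydisc of radius
    \<open>r\<close>.\<close>
  define R where "R = (r / 2) / \<delta>"
  have R: "4 \<le> R" "R * \<delta> = r / 2"
    using \<delta> by (auto simp: R_def field_simps)
  have inbox: "line w x t \<in> pbox w0 r" if "w \<in> pbox w0 \<delta>" "\<And>i. cmod (x i) < \<delta>" "t \<in> ball 0 (3/2 * R)" for w x t
    unfolding pbox_def mem_Collect_eq
  proof
    fix i
    have "cmod (line w x t i - w0 i) = cmod ((w i - w0 i) + t * x i)"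
      by (simp add: line_apply algebra_simps)
    also have "\<dots> \<le> cmod (w i - w0 i) + cmod t * cmod (x i)"
      by (metis norm_mult norm_triangle_ineq)
    also have "\<dots> < r / 8 + 3/2 * R * \<delta>"
    proof (rule add_less_le_mono)
      show "cmod (w i - w0 i) < r / 8" using that(1) \<delta>(2) unfolding pbox_def by (auto dest: spec[of _ i])
      show "cmod t * cmod (x i) \<le> 3/2 * R * \<delta>"
        by (rule mult_mono) (use that(2)[of i] that(3) R in auto)
    qed
    also have "\<dots> = r / 8 + 3/2 * (r / 2)" using R(2) by simp
    also have "\<dots> < r" using r by simp
    finally show "cmod (line w x t i - w0 i) < r" .
  qed
  have "converges \<delta> w" if w: "w \<in> pbox w0 \<delta>" for w
    unfolding converges_def
  proof (intro conjI allI impI ballI)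
    fix x :: "'k \<Rightarrow> complex" and t :: complex assume "\<forall>i. cmod (x i) < \<delta>" "t \<in> ball 0 2"
    then show "line w x t \<in> conf" using inbox[OF w, of x t] r(2) R(1) by auto
  next
    fix \<eta> :: "'a \<Rightarrow> complex" and s :: "('k, 'a) hsection" assume \<eta>: "\<eta> \<in> dual_conf w"
    obtain p0 where p0: "rep es s p0" using exr by blast
    define M0 where "M0 = (\<Sum>b\<in>set es. B (p0 b))"
    have M0: "0 \<le> M0" unfolding M0_def by (intro sum_nonneg B)
    have "cmod (\<eta> (sval ((Dsec x ^^ n) s) w) / fact n) \<le> (\<Sum>b\<in>set es. M0 * cmod (\<eta> b)) * (1/2) ^ n"
      if x: "\<forall>i. cmod (x i) < \<delta>" for x n
    proof -
      define Q where "Q p q \<longleftrightarrow> rep es (Dsec x (bsec es p)) q \<and> (\<forall>b\<in>set es. \<forall>u. rval (q b) u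
     = rval (pd x (p b)) u + (\<Sum>a\<in>set es. rval (p a) u * (\<Sum>i\<in>UNIV. x i * rval (A i a b) u)))"
        for p q :: "'a \<Rightarrow> 'k rexp"
      have "\<exists>q. Q p q" for p unfolding Q_def by (rule rep_Dsec_bsec[OF es A])
      then have "\<forall>p. \<exists>q. Q p q" by blast
      from choice[OF this] obtain nx where nx: "\<And>p. Q p (nx p)" by blast
      define ps where "ps n = (nx ^^ n) p0" for n
      have ps: "rep es ((Dsec x ^^ n) s) (ps n)" for n
      proof (induction n)
        case (Suc n)
        from rep_Dsec[OF this, of x "ps (Suc n)"] nx[of "ps n"] show ?case
          by (simp add: ps_def Q_def)
      qed (simp add: ps_def p0)
      define \<phi> where "\<phi> n b t = rval (ps n b) (line w x t)" for n b t
      define D where "D = ball (0::complex) (3/2 * R)"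
      have Dconf: "line w x t \<in> conf" "line w x t \<in> pbox w0 r" if "t \<in> D" for t
        using inbox[OF w, of x t] x that r(2) by (auto simp: D_def)
      have cD: "cball 0 R \<subseteq> D" unfolding D_def using R(1) by auto
      have est: "cmod (\<phi> n b 0) \<le> M0 * (fact n * (exp 1 * (1 / R + card (set es) * (k * \<delta> * K'))) ^ n)"
        if b: "b \<in> set es" for b
      proof (rule iterated_derivative_bound[where D = D and A = "\<lambda>a b t. \<Sum>i\<in>UNIV. x i * rval (A i a b) (line w x t)"])
        show "\<phi> n b holomorphic_on D" for n b
          unfolding \<phi>_def by (rule rval_line_holomorphic) (rule Dconf)
        show "cmod (\<phi> 0 b t) \<le> M0" if "b \<in> set es" "t \<in> cball 0 R" for b t
        proof -
          have "cmod (\<phi> 0 b t) \<le> B (p0 b)"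
            unfolding \<phi>_def ps_def using B(2)[OF Dconf(2)] cD that(2) by auto
          also have "\<dots> \<le> M0" unfolding M0_def by (rule member_le_sum) (use that B in auto)
          finally show ?thesis .
        qed
        show "\<phi> (Suc n) b t = deriv (\<phi> n b) t + (\<Sum>a\<in>set es. \<phi> n a t * (\<Sum>i\<in>UNIV. x i * rval (A i a b) (line w x t)))"
          if "b \<in> set es" "t \<in> D" for n b t
        proof -
          have "deriv (\<phi> n b) t = rval (pd x (ps n b)) (line w x t)"
            unfolding \<phi>_def by (rule DERIV_imp_deriv[OF rval_deriv[OF Dconf(1)[OF that(2)]]])
          then show ?thesis
            using nx[of "ps n"] that(1) by (simp add: \<phi>_def Q_def ps_def)
        qed
        show "cmod (\<Sum>i\<in>UNIV. x i * rval (A i a b) (line w x t)) \<le> k * \<delta> * K'"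
          if "a \<in> set es" "b \<in> set es" "t \<in> cball 0 R" for a b t
        proof -
          have "cmod (\<Sum>i\<in>UNIV. x i * rval (A i a b) (line w x t)) \<le> (\<Sum>i\<in>(UNIV :: 'k set). \<delta> * K')"
          proof (rule sum_norm_le)
            fix i :: 'k
            show "cmod (x i * rval (A i a b) (line w x t)) \<le> \<delta> * K'"
              unfolding norm_mult
              by (intro mult_mono AK that Dconf(2)) (use x cD that(3) \<delta> in \<open>auto intro: less_imp_le\<close>)
          qed
          then show ?thesis by (simp add: k_def)
        qed
      qed (use R cD M0 K' \<delta> b in \<open>auto simp: D_def k_def\<close>)
      have rate: "exp 1 * (1 / R + card (set es) * (k * \<delta> * K')) = \<delta> * \<Lambda>"
        using \<delta>(1) r(1) by (simp add: R_def \<Lambda>_def field_simps)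
      have est': "cmod (rval (ps n b) w / fact n) \<le> M0 * (1/2) ^ n" if b: "b \<in> set es" for b
      proof -
        have "cmod (rval (ps n b) w) \<le> M0 * (fact n * (\<delta> * \<Lambda>) ^ n)"
          using est[OF b] unfolding rate by (simp add: \<phi>_def)
        also have "\<dots> \<le> M0 * (fact n * (1/2) ^ n)"
          using \<delta> \<open>0 < \<Lambda>\<close> M0 by (intro mult_left_mono power_mono) auto
        finally show ?thesis by (simp add: norm_divide field_simps)
      qed
      have f: "functional \<eta>" using \<eta> by (simp add: dual_conf_def)
      have "\<eta> (sval ((Dsec x ^^ n) s @ scsec (Const (-1)) (bsec es (ps n))) w) = 0"
        using \<eta> ps[of n] unfolding dual_conf_def rep_def by blast
      then have "\<eta> (sval ((Dsec x ^^ n) s) w) = \<eta> (sval (bsec es (ps n)) w)"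
        by (simp add: functional_add[OF f] functional_minus[OF f] functional_diff[OF f])
      also have "\<dots> = (\<Sum>b\<in>set es. rval (ps n b) w * \<eta> b)"
      proof -
        have "\<eta> (\<Sum>b\<in>S. g b) = (\<Sum>b\<in>S. \<eta> (g b))" for S :: "'a set" and g
          by (induction S rule: infinite_finite_induct) (auto simp: functional_0[OF f] functional_add[OF f])
        then show ?thesis by (simp add: sval_bsec[OF es] functional_scale[OF f])
      qed
      finally have "\<eta> (sval ((Dsec x ^^ n) s) w) / fact n = (\<Sum>b\<in>set es. rval (ps n b) w / fact n * \<eta> b)"
        by (simp add: sum_divide_distrib)
      also have "cmod \<dots> \<le> (\<Sum>b\<in>set es. M0 * (1/2) ^ n * cmod (\<eta> b))"
      proof (rule sum_norm_le)
        fix b assume "b \<in> set es"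
        from mult_right_mono[OF est'[OF this] norm_ge_zero]
        show "cmod (rval (ps n b) w / fact n * \<eta> b) \<le> M0 * (1/2) ^ n * cmod (\<eta> b)"
          by (simp only: norm_mult)
      qed
      also have "\<dots> = (\<Sum>b\<in>set es. M0 * cmod (\<eta> b)) * (1/2) ^ n"
        by (simp only: sum_distrib_right) (simp only: mult_ac)
      finally show ?thesis .
    qed
    then show "\<exists>M. \<forall>x. (\<forall>i. cmod (x i) < \<delta>) \<longrightarrow>
        (\<forall>n. cmod (\<eta> (sval ((Dsec x ^^ n) s) w) / fact n) \<le> M * (1/2) ^ n)"
      by blast
  qed
  then show ?thesis using \<delta>(1) by blast
qed


section \<open>The transport series\<close>

lemma sequiv_refl: "sequiv s s"
  and sequiv_trans: "sequiv a b \<Longrightarrow> sequiv b c \<Longrightarrow> sequiv a c"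
  by (auto simp: sequiv_def)

lemma funpow_sequiv: "sequiv s s' \<Longrightarrow> sequiv ((Dsec x ^^ n) s) ((Dsec x ^^ n) s')"
  by (induction n) (auto intro: sequiv_Dsec)

lemma funpow_osec: "osec s \<Longrightarrow> osec ((Dsec x ^^ n) s)"
  by (induction n) (auto intro: osec_Dsec)

lemma funpow_append: "sequiv ((Dsec x ^^ n) (s @ s')) ((Dsec x ^^ n) s @ (Dsec x ^^ n) s')"
proof (induction n)
  case (Suc n)
  have "sequiv (Dsec x ((Dsec x ^^ n) s @ (Dsec x ^^ n) s')) ((Dsec x ^^ Suc n) s @ (Dsec x ^^ Suc n) s')"
    by (simp add: sequiv_def sval_Dsec_append)
  then show ?case using sequiv_trans[OF sequiv_Dsec[OF Suc]] by simp
qed (simp add: sequiv_refl)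

lemma funpow_const: "sequiv ((Dsec x ^^ n) (scsec (Const c) s)) (scsec (Const c) ((Dsec x ^^ n) s))"
proof (induction n)
  case (Suc n)
  have "sequiv (Dsec x (scsec (Const c) ((Dsec x ^^ n) s))) (scsec (Const c) ((Dsec x ^^ Suc n) s))"
    by (simp add: sequiv_def sval_Dsec_scsec)
  then show ?case using sequiv_trans[OF sequiv_Dsec[OF Suc]] by simp
qed (simp add: sequiv_refl)

definition ser :: "('k::finite \<Rightarrow> complex) \<Rightarrow> ('a \<Rightarrow> complex) \<Rightarrow> ('k \<Rightarrow> complex) \<Rightarrow> ('k, 'a) hsection \<Rightarrow> nat \<Rightarrow> complex" where
  "ser w \<eta> x s n = \<eta> (sval ((Dsec x ^^ n) s) w) / fact n"

definition transport :: "('k::finite \<Rightarrow> complex) \<Rightarrow> ('k \<Rightarrow> complex) \<Rightarrow> ('a \<Rightarrow> complex) \<Rightarrow> 'a \<Rightarrow> complex" where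
  "transport w w' \<eta> \<xi> = (\<Sum>n. ser w \<eta> (\<lambda>i. w' i - w i) [(Const 1, \<xi>)] n)"

lemma dual_conf_functional: "\<eta> \<in> dual_conf w \<Longrightarrow> functional \<eta>"
  and dual_conf_osec: "\<eta> \<in> dual_conf w \<Longrightarrow> osec s \<Longrightarrow> \<eta> (sval s w) = 0"
  by (auto simp: dual_conf_def)

context
  fixes w :: "'k::finite \<Rightarrow> complex" and \<eta> :: "'a \<Rightarrow> complex"
  assumes w: "w \<in> conf" and \<eta>: "\<eta> \<in> dual_conf w"
begin

lemma ser_sequiv: "sequiv s s' \<Longrightarrow> ser w \<eta> x s n = ser w \<eta> x s' n"
  using funpow_sequiv[of s s' n x] w by (simp add: ser_def sequiv_def)

lemma ser_append: "ser w \<eta> x (s @ s') n = ser w \<eta> x s n + ser w \<eta> x s' n"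
  using funpow_append[of n x s s'] w functional_add[OF dual_conf_functional[OF \<eta>]]
  by (simp add: ser_def sequiv_def add_divide_distrib)

lemma ser_osec: "osec s \<Longrightarrow> ser w \<eta> x s n = 0"
  using dual_conf_osec[OF \<eta> funpow_osec] by (simp add: ser_def)

lemma ser_Suc: "of_nat (Suc n) * ser w \<eta> x s (Suc n) = ser w \<eta> x (Dsec x s) n"
  by (simp add: ser_def funpow_swap1 del: of_nat_Suc)

text \<open>The Leibniz rule for iterated \<open>Dsec x\<close>, as an identity of formal power
  series: differentiating the series of \<open>s\<close> gives that of \<open>Dsec x s\<close>, so
  the product rule for \<open>fps_deriv\<close> supplies the induction.\<close>

lemma ser_scsec:
  "ser w \<eta> x (scsec e s) n = (Abs_fps (\<lambda>n. rval ((pd x ^^ n) e) w / fact n) * Abs_fps (ser w \<eta> x s)) $ n"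
proof (induction n arbitrary: e s)
  case 0
  show ?case using functional_scale[OF dual_conf_functional[OF \<eta>]] by (simp add: ser_def)
next
  case (Suc n)
  let ?F = "\<lambda>e. Abs_fps (\<lambda>n. rval ((pd x ^^ n) e) w / fact n)" and ?C = "\<lambda>s. Abs_fps (ser w \<eta> x s)"
  have F: "fps_deriv (?F e) = ?F (pd x e)"
    by (rule fps_ext) (simp add: funpow_swap1 field_simps del: of_nat_Suc)
  have C: "fps_deriv (?C s) = ?C (Dsec x s)"
    by (rule fps_ext) (use ser_Suc in \<open>simp del: of_nat_Suc\<close>)
  have "of_nat (Suc n) * ser w \<eta> x (scsec e s) (Suc n) = ser w \<eta> x (Dsec x (scsec e s)) n"
    by (rule ser_Suc)
  also have "\<dots> = ser w \<eta> x (scsec (pd x e) s @ scsec e (Dsec x s)) n"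
    by (rule ser_sequiv) (simp add: sequiv_def sval_Dsec_scsec)
  also have "\<dots> = (?F (pd x e) * ?C s + ?F e * ?C (Dsec x s)) $ n"
    by (simp add: ser_append Suc)
  also have "?F (pd x e) * ?C s + ?F e * ?C (Dsec x s) = fps_deriv (?F e * ?C s)"
    unfolding fps_deriv_mult F C by (simp add: add.commute)
  also have "fps_deriv (?F e * ?C s) $ n = of_nat (Suc n) * (?F e * ?C s) $ Suc n"
    by (simp only: fps_deriv_nth Suc_eq_plus1)
  finally show ?case by (simp del: of_nat_Suc)
qed

text \<open>The derivative of an \<open>n\<close>-fold power of \<open>Dsec\<close> in its direction
  is a sum of \<open>n\<close> words with one factor \<open>Dsec y\<close>. By
  \<open>osec_curvature\<close> this factor may be moved so as to act first; the errors stay in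
  \<open>O\<close> under further steps and are killed by \<open>\<eta>\<close>.\<close>

lemma ser_direction_deriv:
  "((\<lambda>h. \<eta> (sval ((Dsec (line x y h) ^^ n) s) w)) has_field_derivative
     of_nat n * \<eta> (sval ((Dsec (line x y h) ^^ (n - 1)) (Dsec y s)) w)) (at h)"
proof (induction n arbitrary: s)
  case (Suc n)
  note f = dual_conf_functional[OF \<eta>]
  let ?P = "\<lambda>h n s. \<eta> (sval ((Dsec (line x y h) ^^ n) s) w)"
  have eqv: "?P h n s = ?P h n s'" if "sequiv s s'" for h n and s s' :: "('k, 'a) hsection"
    using funpow_sequiv[OF that, of n "line x y h"] w by (simp add: sequiv_def)
  have split: "?P h n (Dsec (line x y h) s) = ?P h n (Dsec x s) + h * ?P h n (Dsec y s)" for h n s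
  proof -
    have "?P h n (Dsec (line x y h) s) = ?P h n (Dsec x s @ scsec (Const h) (Dsec y s))"
      by (rule eqv) (simp add: sequiv_def sval_Dsec_line)
    also have "\<dots> = ?P h n (Dsec x s) + h * ?P h n (Dsec y s)"
      using funpow_append[of n "line x y h"] funpow_const[of n "line x y h" h] w
      by (simp add: sequiv_def functional_add[OF f] functional_scale[OF f])
    finally show ?thesis .
  qed
  have swap: "of_nat n * ?P h (n - 1) (Dsec y (Dsec (line x y h) s)) = of_nat n * ?P h n (Dsec y s)"
  proof (cases n)
    case (Suc m)
    let ?z = "line x y h"
    have "osec ((Dsec ?z ^^ m) (Dsec y (Dsec ?z s) @ scsec (Const (-1)) (Dsec ?z (Dsec y s))))"
      by (intro funpow_osec osec_curvature)
    then have "\<eta> (sval ((Dsec ?z ^^ m) (Dsec y (Dsec ?z s) @ scsec (Const (-1)) (Dsec ?z (Dsec y s)))) w) = 0"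
      by (rule dual_conf_osec[OF \<eta>])
    then have "?P h m (Dsec y (Dsec ?z s)) = ?P h m (Dsec ?z (Dsec y s))"
      using funpow_append[of m ?z] funpow_const[of m ?z "-1"] w
      by (simp add: sequiv_def functional_add[OF f] functional_scale[OF f] functional_minus[OF f] functional_diff[OF f])
    then show ?thesis by (simp add: Suc funpow_swap1)
  qed simp
  have "((\<lambda>h. ?P h n (Dsec x s) + h * ?P h n (Dsec y s)) has_field_derivative
      of_nat n * ?P h (n - 1) (Dsec y (Dsec x s)) + (1 * ?P h n (Dsec y s) + of_nat n * ?P h (n - 1) (Dsec y (Dsec y s)) * h)) (at h)"
    by (intro DERIV_add DERIV_mult Suc DERIV_ident)
  also have "of_nat n * ?P h (n - 1) (Dsec y (Dsec x s)) + (1 * ?P h n (Dsec y s) + of_nat n * ?P h (n - 1) (Dsec y (Dsec y s)) * h)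
     = ?P h n (Dsec y s) + of_nat n * ?P h (n - 1) (Dsec y (Dsec (line x y h) s))"
  proof -
    have "?P h (n - 1) (Dsec y (Dsec (line x y h) s)) = ?P h (n - 1) (Dsec y (Dsec x s @ scsec (Const h) (Dsec y s)))"
      by (intro eqv sequiv_Dsec) (simp add: sequiv_def sval_Dsec_line)
    also have "\<dots> = ?P h (n - 1) (Dsec y (Dsec x s) @ scsec (Const h) (Dsec y (Dsec y s)))"
      by (rule eqv) (simp add: sequiv_def sval_Dsec_append sval_Dsec_scsec)
    also have "\<dots> = ?P h (n - 1) (Dsec y (Dsec x s)) + h * ?P h (n - 1) (Dsec y (Dsec y s))"
      using funpow_append[of "n - 1" "line x y h"] funpow_const[of "n - 1" "line x y h" h] w
      by (simp add: sequiv_def functional_add[OF f] functional_scale[OF f])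
    finally show ?thesis by (simp add: algebra_simps)
  qed
  also have "\<dots> = of_nat (Suc n) * ?P h (Suc n - 1) (Dsec y s)"
    unfolding swap by (simp add: algebra_simps)
  finally show ?case by (simp only: funpow.simps funpow_swap1 o_apply split)
qed simp

text \<open>\<open>Dsec x\<close> is linear in \<open>x\<close> up to \<open>sequiv\<close>, so this
  is a polynomial in the coordinates of \<open>x\<close>.\<close>

lemma ser_direction_continuous: "continuous_on UNIV (\<lambda>x. \<eta> (sval ((Dsec x ^^ n) s) w))"
proof (induction n arbitrary: s)
  case (Suc n)
  note f = dual_conf_functional[OF \<eta>]
  have "\<eta> (sval ((Dsec x ^^ Suc n) s) w) = (\<Sum>i\<in>UNIV. x i * \<eta> (sval ((Dsec x ^^ n) (Dsec (unit_dir i) s)) w))" for x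
  proof -
    have concat: "\<eta> (sval ((Dsec x ^^ n) (concat (map (\<lambda>i. scsec (Const (x i)) (Dsec (unit_dir i) s)) J))) w)
      = (\<Sum>i\<leftarrow>J. x i * \<eta> (sval ((Dsec x ^^ n) (Dsec (unit_dir i) s)) w))" for J
    proof (induction J)
      case Nil
      show ?case using dual_conf_osec[OF \<eta> funpow_osec[OF osec_Nil]] by simp
    next
      case (Cons i J)
      then show ?case
        using funpow_append[of n x] funpow_const[of n x "x i"] w
        by (simp add: sequiv_def functional_add[OF f] functional_scale[OF f])
    qed
    have "sequiv (Dsec x s) (concat (map (\<lambda>i. scsec (Const (x i)) (Dsec (unit_dir i) s)) index_list))"
      unfolding sequiv_def sval_concat map_map o_def sum_index_list sval_scsec rval.simps
      using sval_Dsec_sum by blast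
    from funpow_sequiv[OF this, of n x] w concat[of index_list] show ?thesis
      by (simp add: sequiv_def funpow_swap1 sum_index_list)
  qed
  then show ?case
    by (simp only:) (intro continuous_on_sum continuous_on_mult Suc continuous_on_product_coordinates)
qed simp

context
  fixes \<delta> :: real
  assumes \<delta>: "converges \<delta> w"
begin

lemma ser_bound: "\<exists>M. \<forall>x. (\<forall>i. cmod (x i) < \<delta>) \<longrightarrow> (\<forall>n. cmod (ser w \<eta> x s n) \<le> M * (1/2) ^ n)"
  using \<delta> \<eta> unfolding converges_def ser_def by blast

lemma ser_summable:
  assumes "\<And>i. cmod (x i) < \<delta>"
  shows "summable (\<lambda>n. cmod (ser w \<eta> x s n))"
proof -
  obtain M where "\<And>n. cmod (ser w \<eta> x s n) \<le> M * (1/2) ^ n" using ser_bound assms by blast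
  then show ?thesis
    by (intro summable_comparison_test[of "\<lambda>n. cmod (ser w \<eta> x s n)" "\<lambda>n. M * (1/2) ^ n"])
       (auto intro: summable_mult summable_geometric)
qed

text \<open>The Cauchy product of the absolutely convergent series of \<open>e\<close> and of
  \<open>s\<close> splits the sum, and the Taylor series of \<open>e\<close> adds up to its value at
  the end of the segment.\<close>

lemma ser_sum_scsec:
  assumes x: "\<And>i. cmod (x i) < \<delta>"
  shows "(\<Sum>n. ser w \<eta> x (scsec e s) n) = rval e (line w x 1) * (\<Sum>n. ser w \<eta> x s n)"
proof -
  have conf: "line w x t \<in> conf" if "t \<in> ball 0 2" for t using \<delta> x that by (auto simp: converges_def)
  note T = rval_taylor[of 2 w x e, OF _ conf]
  from Cauchy_product_sums[OF T(2) ser_summable[of x s, OF x]]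
  have "(\<lambda>n. ser w \<eta> x (scsec e s) n) sums
     ((\<Sum>n. rval ((pd x ^^ n) e) w / fact n) * (\<Sum>n. ser w \<eta> x s n))"
    by (simp add: ser_scsec fps_mult_nth atLeast0AtMost)
  then show ?thesis using T(1) by (simp add: sums_iff)
qed

context
  fixes w' :: "'k \<Rightarrow> complex"
  assumes w': "\<And>i. cmod (w' i - w i) < \<delta>"
begin

abbreviation (input) ssum :: "('k, 'a) hsection \<Rightarrow> complex" where
  "ssum s \<equiv> (\<Sum>n. ser w \<eta> (\<lambda>i. w' i - w i) s n)"

lemma ssum_append: "ssum (s @ s') = ssum s + ssum s'"
proof -
  have "summable (ser w \<eta> (\<lambda>i. w' i - w i) s)" for s
    by (rule summable_norm_cancel, rule ser_summable, rule w')
  from suminf_add[OF this[of s] this[of s']] show ?thesis unfolding ser_append ..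
qed

lemma ssum_sequiv: "sequiv s s' \<Longrightarrow> ssum s = ssum s'"
  using ser_sequiv[of s s'] by simp

lemma line_end: "line w (\<lambda>i. w' i - w i) 1 = w'"
  by (simp add: line_def)

lemma ssum_scsec: "ssum (scsec e s) = rval e w' * ssum s"
  using ser_sum_scsec[of "\<lambda>i. w' i - w i" e s] w' by (simp only: line_end)

lemma transport_functional: "functional (transport w w' \<eta>)"
proof -
  have "ssum [(Const 1, x + y)] = ssum ([(Const 1, x)] @ [(Const 1, y)])" for x y
    by (rule ssum_sequiv) (simp add: sequiv_def)
  moreover have "ssum [(Const 1, c \<cdot> x)] = ssum (scsec (Const c) [(Const 1, x)])" for c x
    by (rule ssum_sequiv) (simp add: sequiv_def)
  ultimately show ?thesis
    unfolding functional_def transport_def by (simp only: ssum_append ssum_scsec rval.simps) simp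
qed

text \<open>The series of a section sees only its value at \<open>w'\<close>, although its terms are
  computed at \<open>w\<close>. As all terms vanish for sections of \<open>O\<close>, the
  transported functional annihilates \<open>O\<close> at \<open>w'\<close>.\<close>

lemma ssum_eq_transport: "ssum s = transport w w' \<eta> (sval s w')"
proof (induction s)
  case Nil
  show ?case using ser_osec[OF osec_Nil] by (simp add: functional_0[OF transport_functional])
next
  case (Cons a s)
  obtain e \<xi> where a: "a = (e, \<xi>)" by (cases a)
  have "ssum (a # s) = ssum (scsec e [(Const 1, \<xi>)] @ s)"
    by (rule ssum_sequiv) (simp add: sequiv_def a)
  also have "\<dots> = rval e w' * transport w w' \<eta> \<xi> + transport w w' \<eta> (sval s w')"
    unfolding ssum_append ssum_scsec Cons transport_def ..
  also have "\<dots> = transport w w' \<eta> (sval (a # s) w')"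
    by (simp add: a functional_add[OF transport_functional] functional_scale[OF transport_functional])
  finally show ?case .
qed

lemma transport_dual: "transport w w' \<eta> \<in> dual_conf w'"
  unfolding dual_conf_def
  using transport_functional ser_osec ssum_eq_transport[symmetric] by simp

text \<open>Changing \<open>w' i\<close> moves the direction \<open>w' - w\<close> along
  \<open>unit_dir i\<close>. Termwise differentiation gives the series of
  \<open>Dsec (unit_dir i)\<close> applied to \<open>\<xi>\<close>, which
  \<open>ssum_eq_transport\<close> evaluates.\<close>

lemma transport_deriv:
  "((\<lambda>c. transport w (w'(i := c)) \<eta> \<xi>) has_field_derivative
      transport w w' \<eta> (sval (Dsec (unit_dir i) [(Const 1, \<xi>)]) w')) (at (w' i))"
proof -
  let ?x = "\<lambda>i. w' i - w i" and ?y = "unit_dir i"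
  define s :: "('k, 'a) hsection" where "s = [(Const 1, \<xi>)]"
  have xeq: "(\<lambda>j. (w'(i := c)) j - w j) = line ?x ?y (c - w' i)" for c
    by (rule ext) (simp add: line_def unit_dir_def)
  define e where "e = \<delta> - cmod (?x i)"
  have e: "e > 0" using w'[of i] by (simp add: e_def)
  have small: "cmod (line ?x ?y h j) < \<delta>" if "h \<in> ball 0 e" for h j
  proof (cases "j = i")
    case True
    have "cmod (?x i + h) \<le> cmod (?x i) + cmod h" by (rule norm_triangle_ineq)
    then show ?thesis using that True by (simp add: line_def unit_dir_def e_def)
  next
    case False
    then show ?thesis using w'[of j] by (simp add: line_def unit_dir_def)
  qed
  \<comment> \<open>The factor \<open>n\<close> from the derivative turns \<open>1 / n!\<close> into
    \<open>1 / (n - 1)!\<close>, hence the shifted index; the term of index 0 does not depend on the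
    direction.\<close>
  define f' where "f' n h = (case n of 0 \<Rightarrow> 0 | Suc m \<Rightarrow> ser w \<eta> (line ?x ?y h) (Dsec ?y s) m)" for n h
  obtain M where M: "\<And>x n. (\<And>i. cmod (x i) < \<delta>) \<Longrightarrow> cmod (ser w \<eta> x (Dsec ?y s) n) \<le> M * (1/2) ^ n"
    using ser_bound[of "Dsec ?y s"] by blast
  have "cmod (ser w \<eta> ?x (Dsec ?y s) 0) \<le> M" using M[of ?x 0] w' by simp
  then have M0: "0 \<le> M" using norm_ge_zero order_trans by blast
  have "((\<lambda>h. \<Sum>n. ser w \<eta> (line ?x ?y h) s n) has_field_derivative (\<Sum>n. f' n 0)) (at 0)"
  proof (rule has_field_derivative_series'(2)[where S = "ball 0 e" and x0 = 0])
    fix n and h :: complex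
    have "((\<lambda>h. ser w \<eta> (line ?x ?y h) s n) has_field_derivative
       of_nat n * \<eta> (sval ((Dsec (line ?x ?y h) ^^ (n - 1)) (Dsec ?y s)) w) / fact n) (at h)"
      unfolding ser_def by (intro DERIV_cdivide ser_direction_deriv)
    moreover have "of_nat n * \<eta> (sval ((Dsec (line ?x ?y h) ^^ (n - 1)) (Dsec ?y s)) w) / fact n = f' n h"
      by (cases n) (simp_all add: f'_def ser_def field_simps del: of_nat_Suc)
    ultimately show "((\<lambda>h. ser w \<eta> (line ?x ?y h) s n) has_field_derivative f' n h) (at h within ball 0 e)"
      by (simp add: has_field_derivative_at_within)
  next
    show "uniformly_convergent_on (ball 0 e) (\<lambda>n h. \<Sum>i<n. f' i h)"
    proof (rule Weierstrass_m_test')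
      fix n and h :: complex assume h: "h \<in> ball 0 e"
      show "cmod (f' n h) \<le> 2 * M * (1/2) ^ n"
      proof (cases n)
        case (Suc m)
        then show ?thesis using M[of "line ?x ?y h" m] small[OF h] by (simp add: f'_def)
      qed (simp add: f'_def M0)
    qed (intro summable_mult summable_geometric, simp)
    show "summable (\<lambda>n. ser w \<eta> (line ?x ?y 0) s n)"
      by (rule summable_norm_cancel[OF ser_summable]) (use w' in simp)
  qed (use e in auto)
  also have "(\<Sum>n. f' n 0) = ssum (Dsec ?y s)"
  proof -
    have "summable (\<lambda>n. f' (Suc n) 0)"
      unfolding f'_def using summable_norm_cancel[OF ser_summable[of ?x "Dsec ?y s"]] w' by simp
    then have "summable (\<lambda>n. f' n 0)" by (subst (asm) summable_Suc_iff)
    from suminf_split_head[OF this] have "(\<Sum>n. f' (Suc n) 0) = (\<Sum>n. f' n 0) - f' 0 0" .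
    moreover have "f' 0 0 = 0" "f' (Suc n) 0 = ser w \<eta> ?x (Dsec ?y s) n" for n
      by (simp_all add: f'_def)
    ultimately show ?thesis by simp
  qed
  also have "\<dots> = transport w w' \<eta> (sval (Dsec ?y s) w')" by (rule ssum_eq_transport)
  finally have d: "((\<lambda>h. \<Sum>n. ser w \<eta> (line ?x ?y h) s n) has_field_derivative
      transport w w' \<eta> (sval (Dsec ?y s) w')) (at (w' i - w' i))" by simp
  have "((\<lambda>c. c - w' i) has_field_derivative 1) (at (w' i))"
    by (auto intro!: derivative_eq_intros)
  from DERIV_chain2[where g = "\<lambda>c. c - w' i" and x = "w' i", OF d this]
  show ?thesis unfolding transport_def xeq s_def by simp
qed

end

lemma transport_continuous:
  "continuous_on {w'. \<forall>i. cmod (w' i - w i) < \<delta>} (\<lambda>w'. transport w w' \<eta> \<xi>)"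
proof -
  let ?S = "{w'. \<forall>i. cmod (w' i - w i) < \<delta>}"
  obtain M where M: "\<And>x n. (\<And>i. cmod (x i) < \<delta>) \<Longrightarrow> cmod (ser w \<eta> x [(Const 1, \<xi>)] n) \<le> M * (1/2) ^ n"
    using ser_bound by blast
  have c: "continuous_on ?S (\<lambda>w' i. w' i - w i)"
    by (intro continuous_on_coordinatewise_then_product continuous_intros continuous_on_product_coordinates[THEN continuous_on_subset]) auto
  have ul: "uniform_limit ?S (\<lambda>n w'. \<Sum>m<n. ser w \<eta> (\<lambda>i. w' i - w i) [(Const 1, \<xi>)] m) (\<lambda>w'. transport w w' \<eta> \<xi>) sequentially"
    unfolding transport_def
    by (rule Weierstrass_m_test[where M = "\<lambda>n. M * (1/2) ^ n"]) (auto intro!: M summable_mult summable_geometric)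
  have "continuous_on ?S (\<lambda>w'. \<Sum>m<n. ser w \<eta> (\<lambda>i. w' i - w i) [(Const 1, \<xi>)] m)" for n
    unfolding ser_def
    by (intro continuous_on_sum continuous_on_divide continuous_on_compose2[OF ser_direction_continuous c]) auto
  then have "\<forall>\<^sub>F n in sequentially. continuous_on ?S (\<lambda>w'. \<Sum>m<n. ser w \<eta> (\<lambda>i. w' i - w i) [(Const 1, \<xi>)] m)"
    by simp
  from uniform_limit_theorem[OF this ul] show ?thesis by simp
qed

end

lemma transport_self: "transport w w \<eta> = \<eta>"
proof
  fix \<xi>
  have "ser w \<eta> (\<lambda>i. w i - w i) s (Suc n) = 0" for s n
  proof -
    have "ser w \<eta> (\<lambda>i. w i - w i) (Dsec (\<lambda>i. w i - w i) s) n = ser w \<eta> (\<lambda>i. w i - w i) [] n"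
      by (rule ser_sequiv) (simp add: sequiv_def sval_Dsec_sum[of "\<lambda>i. 0"])
    also have "\<dots> = 0" by (rule ser_osec[OF osec_Nil])
    finally show ?thesis using ser_Suc[of n "\<lambda>i. w i - w i" s] by (simp del: of_nat_Suc)
  qed
  then have "(\<lambda>n. ser w \<eta> (\<lambda>i. w i - w i) [(Const 1, \<xi>)] n) sums (\<Sum>n\<in>{0}. ser w \<eta> (\<lambda>i. w i - w i) [(Const 1, \<xi>)] n)"
    by (intro sums_finite) (auto simp: gr0_conv_Suc)
  then show "transport w w \<eta> \<xi> = \<eta> \<xi>"
    by (simp add: transport_def sums_iff ser_def)
qed

end

section \<open>Uniqueness of solutions on a polydisc\<close>

definition parallel_on :: "('k::finite \<Rightarrow> complex) set \<Rightarrow> (('k \<Rightarrow> complex) \<Rightarrow> 'a \<Rightarrow> complex) \<Rightarrow> bool" where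
  "parallel_on S \<sigma> \<longleftrightarrow> (\<forall>u\<in>S. \<sigma> u \<in> dual_conf u \<and> (\<forall>i \<xi>.
      ((\<lambda>c. \<sigma> (u(i := c)) \<xi>) has_field_derivative \<sigma> u (sval (Dsec (unit_dir i) [(Const 1, \<xi>)]) u)) (at (u i))))"

lemma parallel_on_transport:
  assumes "converges \<delta> w" "w \<in> conf" "\<eta> \<in> dual_conf w" "\<And>u i. u \<in> S \<Longrightarrow> cmod (u i - w i) < \<delta>"
  shows "parallel_on S (\<lambda>u. transport w u \<eta>)"
  unfolding parallel_on_def
  using transport_dual[OF assms(2,3,1)] transport_deriv[OF assms(2,3,1)] assms(4) by blast

lemma parallel_on_diff:
  assumes "parallel_on S \<sigma>" "parallel_on S \<tau>"
  shows "parallel_on S (\<lambda>u \<xi>. \<sigma> u \<xi> - \<tau> u \<xi>)"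
  using assms unfolding parallel_on_def dual_conf_def functional_def
  by (auto simp: algebra_simps intro!: derivative_eq_intros)

lemma fun_upd_line: "u(i := c) = line (u(i := 0)) (unit_dir i) c"
  by (rule ext) (simp add: line_def unit_dir_def)

text \<open>\<open>parallel_on\<close> concerns constant states; the product rule extends it to
  sections depending on \<open>u\<close>, which is what repeated differentiation requires.\<close>

lemma parallel_on_section_deriv:
  assumes p: "parallel_on S \<sigma>" and u: "u(i := c) \<in> S" and S: "S \<subseteq> conf"
    and ev: "\<forall>\<^sub>F c' in nhds c. u(i := c') \<in> S"
  shows "((\<lambda>c. \<sigma> (u(i := c)) (sval s (u(i := c)))) has_field_derivative
     \<sigma> (u(i := c)) (sval (Dsec (unit_dir i) s) (u(i := c)))) (at c)"
proof -
  let ?u = "u(i := c)"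
  have conf: "line (u(i := 0)) (unit_dir i) c \<in> conf" unfolding fun_upd_line[symmetric] using u S by auto
  have f: "functional (\<sigma> ?u)" using p u by (auto simp: parallel_on_def dual_conf_def)
  have single: "((\<lambda>c. rval e (u(i := c)) * \<sigma> (u(i := c)) \<xi>) has_field_derivative
     rval (pd (unit_dir i) e) ?u * \<sigma> ?u \<xi> + rval e ?u * \<sigma> ?u (sval (Dsec (unit_dir i) [(Const 1, \<xi>)]) ?u)) (at c)" for e \<xi>
  proof -
    have 1: "((\<lambda>c. rval e (u(i := c))) has_field_derivative rval (pd (unit_dir i) e) ?u) (at c)"
      using rval_deriv[OF conf, of e] by (simp only: fun_upd_line[symmetric])
    have 2: "((\<lambda>c. \<sigma> (u(i := c)) \<xi>) has_field_derivative \<sigma> ?u (sval (Dsec (unit_dir i) [(Const 1, \<xi>)]) ?u)) (at c)"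
    proof -
      have "((\<lambda>c'. \<sigma> (?u(i := c')) \<xi>) has_field_derivative \<sigma> ?u (sval (Dsec (unit_dir i) [(Const 1, \<xi>)]) ?u)) (at (?u i))"
        using p u unfolding parallel_on_def by blast
      then show ?thesis by simp
    qed
    show ?thesis using DERIV_mult[OF 1 2] by (simp add: algebra_simps)
  qed
  have "((\<lambda>c. \<Sum>(e, \<xi>)\<leftarrow>s. rval e (u(i := c)) * \<sigma> (u(i := c)) \<xi>) has_field_derivative
     \<sigma> ?u (sval (Dsec (unit_dir i) s) ?u)) (at c)"
  proof (induction s)
    case Nil
    have "sval (Dsec (unit_dir i) []) ?u = 0" by (simp add: Dsec_def)
    then have "\<sigma> ?u (sval (Dsec (unit_dir i) []) ?u) = 0" by (simp only: functional_0[OF f])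
    then show ?case by (simp only: list.map sum_list.Nil DERIV_const)
  next
    case (Cons a s)
    obtain e \<xi> where a: "a = (e, \<xi>)" by (cases a)
    have "sval (Dsec (unit_dir i) (a # s)) ?u = rval (pd (unit_dir i) e) ?u \<cdot> \<xi>
        + rval e ?u \<cdot> sval (Dsec (unit_dir i) [(Const 1, \<xi>)]) ?u + sval (Dsec (unit_dir i) s) ?u"
      using sval_Dsec_append[of "unit_dir i" "[(e, \<xi>)]" s ?u]
        sval_Dsec_scsec[of "unit_dir i" e "[(Const 1, \<xi>)]" ?u]
      by (simp add: a sval_Dsec)
    then have "\<sigma> ?u (sval (Dsec (unit_dir i) (a # s)) ?u)
        = (rval (pd (unit_dir i) e) ?u * \<sigma> ?u \<xi> + rval e ?u * \<sigma> ?u (sval (Dsec (unit_dir i) [(Const 1, \<xi>)]) ?u))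
          + \<sigma> ?u (sval (Dsec (unit_dir i) s) ?u)"
      by (simp only: functional_add[OF f] functional_scale[OF f])
    then show ?case
      using DERIV_add[OF single[of e \<xi>] Cons] by (simp only: a list.map sum_list.Cons prod.case)
  qed
  moreover have "\<forall>\<^sub>F c in nhds c. \<sigma> (u(i := c)) (sval s (u(i := c))) = (\<Sum>(e, \<xi>)\<leftarrow>s. rval e (u(i := c)) * \<sigma> (u(i := c)) \<xi>)"
    using ev
  proof (rule eventually_mono)
    fix c assume "u(i := c) \<in> S"
    then have f: "functional (\<sigma> (u(i := c)))" using p by (auto simp: parallel_on_def dual_conf_def)
    have "g (sval s w) = (\<Sum>(e, \<xi>)\<leftarrow>s. rval e w * g \<xi>)" if f: "functional g" for g w
      by (induction s) (auto simp: functional_0[OF f] functional_add[OF f] functional_scale[OF f])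
    from this[OF f] show "\<sigma> (u(i := c)) (sval s (u(i := c))) = (\<Sum>(e, \<xi>)\<leftarrow>s. rval e (u(i := c)) * \<sigma> (u(i := c)) \<xi>)" .
  qed
  ultimately show ?thesis by (subst DERIV_cong_ev[OF refl _ refl])
qed

text \<open>As functions of the one coordinate \<open>u i\<close>, all derivatives at the starting
  point are values of \<open>\<sigma> u = 0\<close> on iterated \<open>Dsec\<close>. The identity
  theorem on the disc then applies.\<close>

lemma parallel_zero_step:
  assumes p: "parallel_on (pbox w0 r) \<sigma>" and sub: "pbox w0 r \<subseteq> conf"
    and u: "u \<in> pbox w0 r" "u(i := c) \<in> pbox w0 r" and zero: "\<sigma> u = (\<lambda>_. 0)"
  shows "\<sigma> (u(i := c)) = (\<lambda>_. 0)"
proof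
  fix \<xi>
  let ?B = "ball (w0 i) r"
  define \<Phi> where "\<Phi> s c = \<sigma> (u(i := c)) (sval s (u(i := c)))" for s c
  have inS: "u(i := c) \<in> pbox w0 r" if "c \<in> ?B" for c
    using u(1) that by (auto simp: pbox_def dist_norm norm_minus_commute)
  have der: "(\<Phi> s has_field_derivative \<Phi> (Dsec (unit_dir i) s) c) (at c)" if "c \<in> ?B" for s c
    unfolding \<Phi>_def
    by (rule parallel_on_section_deriv[OF p inS[OF that] sub])
       (rule eventually_mono[OF eventually_nhds_in_open[of ?B c]], use that inS in auto)
  have higher: "(deriv ^^ n) (\<Phi> s) c = \<Phi> ((Dsec (unit_dir i) ^^ n) s) c" if "c \<in> ?B" for n s c
    using that
  proof (induction n arbitrary: c)
    case (Suc n)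
    have "(deriv ^^ Suc n) (\<Phi> s) c = deriv ((deriv ^^ n) (\<Phi> s)) c" by simp
    also have "\<dots> = deriv (\<Phi> ((Dsec (unit_dir i) ^^ n) s)) c"
      by (intro deriv_cong_ev refl eventually_mono[OF eventually_nhds_in_open[of ?B c]]) (use Suc in auto)
    also have "\<dots> = \<Phi> ((Dsec (unit_dir i) ^^ Suc n) s) c"
      using DERIV_imp_deriv[OF der[OF Suc.prems]] by simp
    finally show ?case .
  qed simp
  have ui: "u i \<in> ?B" using u(1) by (auto simp: pbox_def dist_norm norm_minus_commute)
  have ci: "c \<in> ?B" using u(2) by (auto simp: pbox_def dist_norm norm_minus_commute dest: spec[of _ i])
  have "\<Phi> [(Const 1, \<xi>)] c = 0"
  proof (rule holomorphic_fun_eq_0_on_connected[where S = ?B and z = "u i" and f = "\<Phi> [(Const 1, \<xi>)]" and w = c])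
    show "\<Phi> [(Const 1, \<xi>)] holomorphic_on ?B"
      unfolding holomorphic_on_def field_differentiable_def
      using der has_field_derivative_at_within by blast
    show "(deriv ^^ n) (\<Phi> [(Const 1, \<xi>)]) (u i) = 0" for n
      unfolding higher[OF ui] by (simp add: \<Phi>_def zero)
  qed (use ui ci in auto)
  then show "\<sigma> (u(i := c)) \<xi> = 0" by (simp add: \<Phi>_def)
qed

text \<open>Coordinates are changed one at a time; all intermediate points stay in the box because
  it is a product of discs.\<close>

lemma parallel_zero:
  fixes w0 :: "'k::finite \<Rightarrow> complex"
  assumes p: "parallel_on (pbox w0 r) \<sigma>" and sub: "pbox w0 r \<subseteq> conf"
    and a: "a \<in> pbox w0 r" and b: "b \<in> pbox w0 r" and zero: "\<sigma> a = (\<lambda>_. 0)"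
  shows "\<sigma> b = (\<lambda>_. 0)"
proof -
  have "\<sigma> (\<lambda>i. if i \<in> J then b i else a i) = (\<lambda>_. 0)" if "finite J" for J
    using that
  proof (induction J rule: finite_induct)
    case empty
    show ?case using zero by simp
  next
    case (insert i J)
    let ?u = "\<lambda>i. if i \<in> J then b i else a i"
    have eq: "(\<lambda>l. if l \<in> insert i J then b l else a l) = ?u(i := b i)" by auto
    show ?case unfolding eq
      by (rule parallel_zero_step[OF p sub _ _ insert.IH]) (use a b in \<open>auto simp: pbox_def\<close>)
  qed
  from this[of UNIV] show ?thesis by simp
qed

lemma parallel_unique:
  assumes "parallel_on (pbox w0 r) \<sigma>" "parallel_on (pbox w0 r) \<tau>" "pbox w0 r \<subseteq> conf"
    and "a \<in> pbox w0 r" "b \<in> pbox w0 r" "\<sigma> a = \<tau> a"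
  shows "\<sigma> b = \<tau> b"
proof -
  have "(\<lambda>\<xi>. \<sigma> b \<xi> - \<tau> b \<xi>) = (\<lambda>_. 0)"
    by (rule parallel_zero[OF parallel_on_diff[OF assms(1,2)] assms(3,4,5)]) (simp add: assms(6))
  then show ?thesis by (simp add: fun_eq_iff)
qed

end

section \<open>Divisors and Laurent polynomials\<close>

text \<open>Together with its converse below, this replaces the case distinction of
  \<open>diff_order_ge\<close> (zero function or \<open>zorder\<close>) by one
  factorization.\<close>

lemma order_ge_imp_factor:
  assumes f: "f meromorphic_on {p}" and ord: "(\<forall>\<^sub>F z in at p. f z = 0) \<or> zorder f p \<ge> n"
  shows "\<exists>h. h analytic_on {p} \<and> (\<forall>\<^sub>F z in at p. f z = h z * (z - p) powi n)"
proof (cases "\<forall>\<^sub>F z in at p. f z = 0")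
  case True
  then show ?thesis by (intro exI[of _ "\<lambda>_. 0"]) (auto intro: analytic_on_const elim: eventually_mono)
next
  case False
  then have ord: "zorder f p \<ge> n" using assms by auto
  have "isolated_singularity_at f p" "not_essential f p"
    using f by (auto simp: meromorphic_at_iff)
  moreover have "\<exists>\<^sub>F w in at p. f w \<noteq> 0" using False by (simp add: frequently_def)
  ultimately obtain g r where r: "r > 0" "g holomorphic_on cball p r"
    "\<And>w. w \<in> cball p r - {p} \<Longrightarrow> f w = g w * (w - p) powi zorder f p"
    using zorder_exist[of f p] by blast
  define h where "h z = g z * (z - p) ^ nat (zorder f p - n)" for z
  have "h holomorphic_on ball p r"
    unfolding h_def using r(2) by (auto intro!: holomorphic_intros elim: holomorphic_on_subset)
  then have "h analytic_on {p}" using r(1) by (auto simp: analytic_at intro!: exI[of _ "ball p r"])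
  moreover have "\<forall>\<^sub>F z in at p. f z = h z * (z - p) powi n"
  proof (rule eventually_mono[OF eventually_at_in_open[of "ball p r" p]])
    fix z assume z: "z \<in> ball p r - {p}"
    have "(z - p) ^ nat (zorder f p - n) = (z - p) powi (zorder f p - n)"
      using ord by (simp add: power_int_def)
    moreover have "(z - p) powi (zorder f p - n) * (z - p) powi n = (z - p) powi zorder f p"
      using z by (subst power_int_add[symmetric]) auto
    ultimately show "f z = h z * (z - p) powi n"
      using r(3)[of z] z by (simp add: h_def mult.assoc)
  qed (use r in auto)
  ultimately show ?thesis by blast
qed

lemma factor_imp_order_ge:
  assumes h: "h analytic_on {p}" and f: "\<forall>\<^sub>F z in at p. f z = h z * (z - p) powi n"
  shows "(\<forall>\<^sub>F z in at p. f z = 0) \<or> zorder f p \<ge> n"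
proof (cases "\<forall>\<^sub>F z in at p. h z = 0")
  case True
  then have "\<forall>\<^sub>F z in at p. f z = 0" using f by eventually_elim simp
  then show ?thesis ..
next
  case False
  then have fr: "\<exists>\<^sub>F z in at p. h z \<noteq> 0" by (simp add: frequently_def)
  have lin: "(\<lambda>z. z - p) meromorphic_on {p}" by (intro meromorphic_intros)
  have nz: "\<forall>\<^sub>F z in at p. z - p \<noteq> 0" by (auto simp: eventually_at intro: exI[of _ 1])
  have z1: "zorder (\<lambda>z. z - p) p = 1"
    by (rule zorder_eqI[of UNIV p "\<lambda>_. 1"]) (auto intro: holomorphic_intros)
  have pw: "(\<lambda>z. (z - p) powi n) meromorphic_on {p}" by (intro meromorphic_intros)
  have pnz: "\<exists>\<^sub>F z in at p. (z - p) powi n \<noteq> 0"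
  proof (rule eventually_frequently[OF at_neq_bot])
    show "\<forall>\<^sub>F z in at p. (z - p) powi n \<noteq> 0" using nz by eventually_elim simp
  qed
  have "zorder f p = zorder (\<lambda>z. h z * (z - p) powi n) p"
    by (rule zorder_cong) (use f in auto)
  also have "\<dots> = zorder h p + zorder (\<lambda>z. (z - p) powi n) p"
    by (rule zorder_mult) (use h fr pw pnz in \<open>auto intro: analytic_on_imp_meromorphic_on\<close>)
  also have "zorder (\<lambda>z. (z - p) powi n) p = n"
    using zorder_power_int[OF lin eventually_frequently[OF at_neq_bot nz], of n] z1 by simp
  finally show ?thesis using zorder_ge_0[OF h fr] by simp
qed

text \<open>A power of \<open>z\<close> clears the pole at \<open>0\<close>; what remains is entire
  of polynomial growth, so Liouville's theorem applies. Equality can be claimed only near points, as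
  isolated values of \<open>q\<close> are arbitrary.\<close>

lemma laurent_polynomial_representation:
  assumes mero: "q meromorphic_on UNIV"
    and reg: "\<And>p. p \<noteq> 0 \<Longrightarrow> \<exists>h. h analytic_on {p} \<and> (\<forall>\<^sub>F z in at p. q z = h z)"
    and inf: "\<exists>h. h analytic_on {0} \<and> (\<forall>\<^sub>F w in at 0. q (1 / w) = h w * w powi d)"
  shows "\<exists>N n a. int n - int N = - d \<and> (\<forall>p. \<forall>\<^sub>F z in at p. q z = (\<Sum>k\<le>n. a k * z powi (int k - int N)))"
proof -
  have mero0: "q meromorphic_on {0}" by (rule meromorphic_on_subset[OF mero]) auto
  \<comment> \<open>\<open>N\<close> has to clear the pole at \<open>0\<close> and to be at least
    \<open>d\<close>, so that the degree bound \<open>n = N - d\<close> is a natural number.\<close>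
  define N where "N = nat (max (max 0 d) (- zorder q 0))"
  define n where "n = nat (int N - d)"
  have iN: "int N = max (max 0 d) (- zorder q 0)" unfolding N_def by simp
  then have dN: "d \<le> int N" by simp
  have n: "int n - int N = - d" using dN by (simp add: n_def)
  have "zorder q 0 \<ge> - int N" unfolding iN by (simp add: minus_le_iff)
  from order_ge_imp_factor[OF mero0 disjI2[OF this]]
  obtain h0 where h0: "h0 analytic_on {0}" "\<forall>\<^sub>F z in at 0. q z = h0 z * (z - 0) powi - int N" by blast
  define F where "F z = z ^ N * q z" for z
  have Freg: "\<exists>h. h analytic_on {p} \<and> (\<forall>\<^sub>F z in at p. F z = h z)" for p
  proof (cases "p = 0")
    case True
    have "\<forall>\<^sub>F z in at (0::complex). z \<noteq> 0" by (auto simp: eventually_at intro: exI[of _ 1])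
    with h0(2) have "\<forall>\<^sub>F z in at 0. F z = h0 z"
      by eventually_elim (simp add: F_def power_int_minus field_simps)
    then show ?thesis using h0(1) True by blast
  next
    case False
    from reg[OF this] obtain h where h: "h analytic_on {p}" "\<forall>\<^sub>F z in at p. q z = h z" by blast
    have "(\<lambda>z. z ^ N * h z) analytic_on {p}" by (intro analytic_intros h)
    moreover have "\<forall>\<^sub>F z in at p. F z = z ^ N * h z"
      using h(2) by eventually_elim (simp add: F_def)
    ultimately show ?thesis by (intro exI[of _ "\<lambda>z. z ^ N * h z"]) simp
  qed
  have meroF: "F meromorphic_on UNIV"
    unfolding F_def by (intro meromorphic_intros mero)
  have isoF: "isolated_singularity_at F p" for p
    using meromorphic_on_subset[OF meroF, of "{p}"] by (simp add: meromorphic_at_iff)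
  \<comment> \<open>The entire function that agrees with \<open>F\<close> on a punctured
    neighbourhood of every point.\<close>
  define e where "e = remove_sings F"
  have e_ana: "e analytic_on {p}" for p
  proof -
    obtain h where h: "h analytic_on {p}" "\<forall>\<^sub>F z in at p. F z = h z" using Freg by blast
    have "h \<midarrow>p\<rightarrow> h p"
      using h(1) by (meson analytic_at_imp_isCont isContD)
    then have "F \<midarrow>p\<rightarrow> h p" using h(2) by (simp add: tendsto_cong)
    then show ?thesis unfolding e_def by (rule remove_sings_analytic_at[OF isoF])
  qed
  have e_holo: "e holomorphic_on UNIV"
    using e_ana analytic_imp_holomorphic analytic_on_analytic_at by blast
  have e_eq: "\<forall>\<^sub>F z in at p. e z = F z" for p
    unfolding e_def by (rule eventually_remove_sings_eq_at[OF isoF])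
  obtain h where h: "h analytic_on {0}" "\<forall>\<^sub>F w in at 0. q (1 / w) = h w * w powi d" using inf by blast
  from h(1) obtain S where S: "open S" "0 \<in> S" "h holomorphic_on S" by (auto simp: analytic_at)
  from h(2) obtain r1 where r1: "r1 > 0" "\<And>w. w \<noteq> 0 \<Longrightarrow> cmod w < r1 \<Longrightarrow> q (1 / w) = h w * w powi d"
    by (auto simp: eventually_at dist_norm)
  obtain r2 where r2: "r2 > 0" "cball 0 r2 \<subseteq> S" using S open_contains_cball by metis
  define r where "r = min (r1 / 2) r2"
  have r: "r > 0" "r < r1" "cball 0 r \<subseteq> S" using r1(1) r2 by (auto simp: r_def)
  have "compact (h ` cball 0 r)"
    using S(3) r(3) by (intro compact_continuous_image holomorphic_on_imp_continuous_on) (auto elim: holomorphic_on_subset)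
  from compact_imp_bounded[OF this] obtain B where "\<forall>x\<in>h ` cball 0 r. cmod x \<le> B"
    unfolding bounded_iff ..
  then have B: "\<And>w. w \<in> cball 0 r \<Longrightarrow> cmod (h w) \<le> B" by blast
  have big: "cmod (e z) \<le> B * cmod z ^ n" if z: "1 / r + 1 \<le> cmod z" for z
  proof -
    have "0 < 1 / r" using r(1) by simp
    then have zr: "1 / r < cmod z" "0 < cmod z" using z by linarith+
    then have "z \<noteq> 0" by auto
    note zr = zr(1) this
    define V where "V = {z. 1 / r < cmod z}"
    have V: "open V" unfolding V_def by (intro open_Collect_less continuous_intros)
    have inv: "1 / v \<in> cball 0 r" "v \<noteq> 0" "cmod (1 / v) < r1" if "v \<in> V" for v
    proof -
      have "1 / r < cmod v" using that by (simp add: V_def)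
      moreover have "0 < 1 / r" using r by simp
      ultimately have pos: "0 < cmod v" by linarith
      then show "v \<noteq> 0" by auto
      have "1 / cmod v < r" using \<open>1 / r < cmod v\<close> pos r(1) by (simp add: field_simps)
      then show "1 / v \<in> cball 0 r" "cmod (1 / v) < r1" using r(2) by (auto simp: norm_divide)
    qed
    have Fv: "F v = h (1 / v) * v powi (int N - d)" if "v \<in> V" for v
    proof -
      have "F v = v ^ N * (h (1 / v) * (1 / v) powi d)"
        using r1(2)[of "1 / v"] inv[OF that] by (simp add: F_def)
      also have "v ^ N * (1 / v) powi d = v powi (int N - d)"
        using inv(2)[OF that] by (simp add: power_int_diff power_int_divide_distrib field_simps)
      then have "v ^ N * (h (1 / v) * (1 / v) powi d) = h (1 / v) * v powi (int N - d)"
        by (simp add: mult_ac)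
      finally show ?thesis .
    qed
    have "(\<lambda>v. h (1 / v) * v powi (int N - d)) holomorphic_on V"
    proof (intro holomorphic_intros)
      show "(\<lambda>v. h (1 / v)) holomorphic_on V"
      proof -
        have "(\<lambda>v. 1 / v) holomorphic_on V" by (intro holomorphic_intros) (use inv in auto)
        moreover have "(\<lambda>v. 1 / v) ` V \<subseteq> S" using inv(1) r(3) by blast
        ultimately have "h \<circ> (\<lambda>v. 1 / v) holomorphic_on V"
          using S(3) by (intro holomorphic_on_compose_gen)
        then show ?thesis by (simp add: o_def)
      qed
    qed (use inv in auto)
    then have "F holomorphic_on V" using Fv by (simp cong: holomorphic_cong)
    then have "F analytic_on {z}" using V zr by (auto simp: analytic_at V_def)
    then have "e z = F z" unfolding e_def by (rule remove_sings_at_analytic)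
    also have "F z = h (1 / z) * z ^ n"
      using Fv[of z] zr dN by (simp add: V_def n_def power_int_def)
    finally show ?thesis
      using B[OF inv(1), of z] zr by (auto simp: V_def norm_mult norm_power intro: mult_right_mono)
  qed
  define a where "a k = (deriv ^^ k) e 0 / fact k" for k
  have poly: "e z = (\<Sum>k\<le>n. a k * z ^ k)" for z
    unfolding a_def by (rule Liouville_polynomial[OF e_holo big])
  have "\<forall>\<^sub>F z in at p. q z = (\<Sum>k\<le>n. a k * z powi (int k - int N))" for p
  proof -
    have "\<forall>\<^sub>F z in at p. z \<noteq> 0"
      by (cases "p = 0") (auto simp: eventually_at intro: exI[of _ 1] exI[of _ "cmod p"])
    with e_eq[of p] show ?thesis
    proof eventually_elim
      case (elim z)
      then have "q z = (\<Sum>k\<le>n. a k * z ^ k) * z powi (- int N)"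
        unfolding poly[symmetric] by (simp add: F_def power_int_minus field_simps)
      also have "\<dots> = (\<Sum>k\<le>n. a k * z powi (int k - int N))"
        using elim by (simp add: sum_distrib_right power_int_diff power_int_minus divide_inverse mult.assoc)
      finally show ?case .
    qed
  qed
  then show ?thesis using n by blast
qed

lemma product_exists:
  "\<exists>G. ldeg_le (int h * int CARD('k)) G \<and> (\<forall>i :: 'k::finite. van i h G)
     \<and> (\<forall>u z. z \<noteq> 0 \<longrightarrow> lval u G z = (\<Prod>i\<in>UNIV. (z - u i) ^ h))"
proof -
  let ?f = "\<lambda>i. [(1, Const 1), (0, Mul (Const (-1)) (Var i))] :: 'k lexp"
  have pow: "\<exists>G. ldeg_le (int n) G \<and> van i n G \<and> (\<forall>u z. z \<noteq> 0 \<longrightarrow> lval u G z = (z - u i) ^ n)" for i :: 'k and n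
  proof (induction n)
    case 0
    show ?case by (rule exI[of _ "[(0, Const 1)]"]) simp
  next
    case (Suc n)
    then obtain G where G: "ldeg_le (int n) G" "van i n G" "\<forall>u z. z \<noteq> 0 \<longrightarrow> lval u G z = (z - u i) ^ n" by blast
    have "van i 1 (?f i)" unfolding One_nat_def van_Suc by simp
    then have "van i (Suc n) (lmul (?f i) G)" by (rule van_lmul[OF _ G(2)]) simp
    moreover have "ldeg_le (1 + int n) (lmul (?f i) G)" by (rule ldeg_le_lmul[OF _ G(1)]) simp
    ultimately show ?case using G(3) by (intro exI[of _ "lmul (?f i) G"]) (auto simp: lval_lmul)
  qed
  have "\<exists>G. ldeg_le (int h * int (card J)) G \<and> (\<forall>i\<in>J. van i h G)
     \<and> (\<forall>u z. z \<noteq> 0 \<longrightarrow> lval u G z = (\<Prod>i\<in>J. (z - u i) ^ h))" if "finite J" for J :: "'k set"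
    using that
  proof (induction J rule: finite_induct)
    case empty
    show ?case by (rule exI[of _ "[(0, Const 1)]"]) simp
  next
    case (insert i J)
    then obtain G where G: "ldeg_le (int h * int (card J)) G" "\<forall>i\<in>J. van i h G"
      "\<forall>u z. z \<noteq> 0 \<longrightarrow> lval u G z = (\<Prod>i\<in>J. (z - u i) ^ h)" by blast
    obtain H where H: "ldeg_le (int h) H" "van i h H" "\<forall>u z. z \<noteq> 0 \<longrightarrow> lval u H z = (z - u i) ^ h"
      using pow by blast
    have "ldeg_le (int h * int (card (insert i J))) (lmul H G)"
      using ldeg_le_lmul[OF H(1) G(1)] insert.hyps by (simp add: algebra_simps)
    moreover have "van l h (lmul H G)" if "l \<in> insert i J" for l
      using that van_lmul[OF H(2) van_0] van_lmul[OF van_0, of l h G h H] G(2) by auto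
    ultimately show ?case
      using G(3) H(3) insert.hyps by (intro exI[of _ "lmul H G"]) (auto simp: lval_lmul)
  qed
  from this[OF finite[of "UNIV :: 'k set"]] show ?thesis by blast
qed

lemma lval_higher_deriv: "z \<noteq> 0 \<Longrightarrow> (deriv ^^ n) (lval u G) z = lval u ((dz ^^ n) G) z"
proof (induction n arbitrary: z)
  case (Suc n)
  have "(deriv ^^ Suc n) (lval u G) z = deriv ((deriv ^^ n) (lval u G)) z" by simp
  also have "\<dots> = deriv (lval u ((dz ^^ n) G)) z"
  proof (rule deriv_cong_ev)
    have "\<forall>\<^sub>F w in nhds z. w \<in> -{0}"
      by (rule eventually_nhds_in_open) (use Suc.prems in auto)
    then show "\<forall>\<^sub>F w in nhds z. (deriv ^^ n) (lval u G) w = lval u ((dz ^^ n) G) w"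
      by eventually_elim (simp add: Suc.IH)
  qed simp
  also have "\<dots> = lval u ((dz ^^ Suc n) G) z"
    by (simp add: DERIV_imp_deriv[OF lval_deriv[OF Suc.prems]])
  finally show ?case .
qed simp

lemma lval_holomorphic: "lval u G holomorphic_on -{0}"
  unfolding holomorphic_on_def field_differentiable_def
  using lval_deriv has_field_derivative_at_within by blast

lemma lval_meromorphic: "lval u G meromorphic_on A"
proof (induction G)
  case Nil
  show ?case by (simp add: lval_def[abs_def] meromorphic_on_const)
next
  case (Cons a G)
  obtain j e where a: "a = (j, e)" by (cases a)
  have "lval u (a # G) = (\<lambda>z. rval e u * z powi j + lval u G z)" by (simp add: a fun_eq_iff)
  then show ?case using Cons by (auto intro!: meromorphic_intros)
qed

lemma lval_at_infinity:
  assumes "ldeg_le d G"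
  shows "\<exists>h. h analytic_on {0} \<and> (\<forall>w. w \<noteq> 0 \<longrightarrow> lval u G (1 / w) = h w * w powi (- d))"
  using assms
proof (induction G)
  case Nil
  show ?case by (rule exI[of _ "\<lambda>_. 0"]) simp
next
  case (Cons a G)
  obtain j e where a: "a = (j, e)" by (cases a)
  from Cons obtain h where h: "h analytic_on {0}" "\<forall>w. w \<noteq> 0 \<longrightarrow> lval u G (1 / w) = h w * w powi (- d)"
    by (auto simp: a)
  have "rval e u * (1 / w) powi j = rval e u * w ^ nat (d - j) * w powi (- d)" if "w \<noteq> 0" for w
  proof -
    have "w ^ nat (d - j) = w powi (d - j)" using Cons.prems by (simp add: a power_int_def)
    then show ?thesis
      using that by (simp add: power_int_add[symmetric] power_int_divide_distrib power_int_minus[symmetric] divide_inverse mult.assoc)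
         (simp add: power_int_minus power_int_inverse)
  qed
  then show ?case
    by (intro exI[of _ "\<lambda>w. rval e u * w ^ nat (d - j) + h w"])
       (use h in \<open>auto simp: a distrib_right intro!: analytic_intros\<close>)
qed

lemma residue_lval:
  "residue (\<lambda>z. lval u G z * z powi k) 0 = (\<Sum>(j, e)\<leftarrow>G. if j = - k - 1 then rval e u else 0)"
proof (induction G)
  case Nil
  have "residue (\<lambda>z. 0) 0 = 0" by (rule residue_holo[of UNIV]) auto
  then show ?case by simp
next
  case (Cons a G)
  obtain j e where a: "a = (j, e)" by (cases a)
  have pw: "(\<lambda>z. z powi m) holomorphic_on UNIV - {0}" for m
    unfolding holomorphic_on_def using DERIV_power_int[OF DERIV_ident] field_differentiable_def by blast
  have "residue (\<lambda>z. lval u (a # G) z * z powi k) 0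
     = residue (\<lambda>z. rval e u * z powi (j + k) + lval u G z * z powi k) 0"
  proof (rule residue_cong)
    have "\<forall>\<^sub>F z in at (0::complex). z \<noteq> 0" by (auto simp: eventually_at intro: exI[of _ 1])
    then show "\<forall>\<^sub>F z in at 0. lval u (a # G) z * z powi k = rval e u * z powi (j + k) + lval u G z * z powi k"
      by eventually_elim (simp add: a power_int_add algebra_simps)
  qed simp
  also have "\<dots> = residue (\<lambda>z. rval e u * z powi (j + k)) 0 + residue (\<lambda>z. lval u G z * z powi k) 0"
    using lval_holomorphic[of u G]
    by (intro residue_add[of UNIV] holomorphic_intros pw) (auto simp: Compl_eq_Diff_UNIV)
  also have "residue (\<lambda>z. rval e u * z powi (j + k)) 0 = rval e u * residue (\<lambda>z. z powi (j + k)) 0"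
    by (rule residue_lmul[of UNIV]) (auto intro: pw)
  also have "residue (\<lambda>z. z powi (j + k)) 0 = (if j = - k - 1 then 1 else 0)"
  proof (cases "j + k \<ge> 0")
    case True
    have "(\<lambda>z. z powi (j + k)) holomorphic_on UNIV"
      using True by (auto simp: power_int_def intro!: holomorphic_intros)
    then show ?thesis using True by (auto intro: residue_holo[of UNIV])
  next
    case False
    define n where "n = nat (- (j + k) - 1)"
    have n: "j + k = - int (Suc n)" using False by (simp add: n_def)
    have "residue (\<lambda>z. 1 / z ^ Suc n) 0 = (deriv ^^ n) (\<lambda>_. 1) 0 / fact n"
      by (rule residue_holomorphic_over_power'[of UNIV]) auto
    moreover have "(\<lambda>z::complex. 1 / z ^ Suc n) = (\<lambda>z. z powi (j + k))"
      unfolding n by (simp add: fun_eq_iff power_int_minus power_int_def divide_inverse nat_add_distrib power_inverse)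
    moreover have "(deriv ^^ n) (\<lambda>_. 1 :: complex) 0 = (if n = 0 then 1 else 0)"
      by simp
    moreover have "n = 0 \<longleftrightarrow> j = - k - 1" using n by auto
    ultimately show ?thesis by (cases "n = 0") simp_all
  qed
  finally show ?case by (simp add: a Cons)
qed

abbreviation pt_conf :: "('k \<Rightarrow> complex) \<Rightarrow> 'k \<Rightarrow> rsphere" where
  "pt_conf u \<equiv> (\<lambda>i. Pt (u i))"

lemma card_pt_conf:
  fixes u :: "'k::finite \<Rightarrow> complex"
  assumes "u \<in> conf"
  shows "card {i. pt_conf u i = Infty} = 0" "card {l. pt_conf u l = Pt (u i)} = 1"
    "(\<And>i. p \<noteq> u i) \<Longrightarrow> card {i. pt_conf u i = Pt p} = 0"
proof -
  have "{l. pt_conf u l = Pt (u i)} = {i}" using assms by (auto simp: conf_def inj_def)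
  then show "card {l. pt_conf u l = Pt (u i)} = 1" by simp
qed auto

lemma lval_diff_order:
  fixes u :: "'k::finite \<Rightarrow> complex"
  assumes u: "u \<in> conf" and van: "\<And>i a. a < h \<Longrightarrow> lval u ((dz ^^ a) G) (u i) = 0"
    and deg: "ldeg_le (2 * int h - 2) G"
  shows "\<exists>N::nat. \<forall>P. diff_order_ge (lval u G) (1 - int h) P
           ((if P = Pt 0 then - int N else 0) + int h * int (card {i. pt_conf u i = P}))"
proof (intro exI[of _ "nat (- zorder (lval u G) 0)"] allI)
  fix P
  show "diff_order_ge (lval u G) (1 - int h) P
           ((if P = Pt 0 then - int (nat (- zorder (lval u G) 0)) else 0) + int h * int (card {i. pt_conf u i = P}))"
  proof (cases P)
    case (Pt p)
    show ?thesis
    proof (cases "p = 0")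
      case True
      have "card {i. pt_conf u i = Pt p} = 0" by (rule card_pt_conf(3)[OF u]) (use True u in \<open>auto simp: conf_def\<close>)
      then show ?thesis using Pt True by simp
    next
      case False
      define n where "n = h * card {i. pt_conf u i = Pt p}"
      have der: "(deriv ^^ k) (lval u G) p = 0" if "k < n" for k
      proof -
        obtain i where i: "p = u i"
        proof (rule ccontr)
          assume "\<not> thesis"
          then have "p \<noteq> u i" for i using that by blast
          then show False using card_pt_conf(3)[OF u, of p] \<open>k < n\<close> by (simp add: n_def)
        qed
        then have "k < h" using that card_pt_conf(2)[OF u, of i] by (simp add: n_def)
        then show ?thesis using van[OF \<open>k < h\<close>, of i] lval_higher_deriv[OF False, of k u G] i by simp
      qed
      have "(\<forall>\<^sub>F z in at p. lval u G z = 0) \<or> zorder (lval u G) p \<ge> int n"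
      proof (cases "\<exists>z\<in>-{0}. lval u G z \<noteq> 0")
        case True
        then obtain z where z: "z \<in> -{0}" "lval u G z \<noteq> 0" by blast
        have "zorder (lval u G) p \<ge> int n"
        proof (rule zorder_geI[where A = "-{0}"])
          show "lval u G holomorphic_on -{0}" by (rule lval_holomorphic)
          show op: "open (-{0::complex})" by (intro open_Compl closed_singleton)
          show "lval u G analytic_on {p}"
            unfolding analytic_at using op lval_holomorphic False by blast
          show "connected (-{0::complex})" by (rule connected_punctured_universe) simp
        qed (use z False der in auto)
        then show ?thesis ..
      next
        case all0: False
        have "\<forall>\<^sub>F z in at p. z \<noteq> 0"
          using False by (auto simp: eventually_at intro!: exI[of _ "cmod p"])
        then have "\<forall>\<^sub>F z in at p. lval u G z = 0" by eventually_elim (use all0 in auto)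
        then show ?thesis ..
      qed
      then show ?thesis using Pt False by (simp add: n_def)
    qed
  next
    case Infty
    obtain f where f: "f analytic_on {0}" "\<forall>w. w \<noteq> 0 \<longrightarrow> lval u G (1 / w) = f w * w powi (- (2 * int h - 2))"
      using lval_at_infinity[OF deg] by blast
    have "\<forall>\<^sub>F w in at (0::complex). w \<noteq> 0" by (auto simp: eventually_at intro: exI[of _ 1])
    then have "\<forall>\<^sub>F w in at 0. lval u G (1 / w) = f w * (w - 0) powi (2 - 2 * int h)"
      by eventually_elim (use f(2) in simp)
    from factor_imp_order_ge[OF f(1) this] show ?thesis
      using Infty card_pt_conf(1)[OF u] by auto
  qed
qed

lemma lval_meromorphic_sphere: "meromorphic_sphere (lval u G)"
  unfolding meromorphic_sphere_def
proof
  show "lval u G meromorphic_on UNIV" by (rule lval_meromorphic)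
  show "(\<lambda>w. lval u G (1 / w)) meromorphic_on {0}"
  proof (induction G)
    case (Cons a G)
    obtain j e where a: "a = (j, e)" by (cases a)
    show ?case unfolding a lval_Cons by (intro meromorphic_intros Cons)
  qed (simp add: meromorphic_on_const)
qed

definition const_lexp :: "nat \<Rightarrow> nat \<Rightarrow> (nat \<Rightarrow> complex) \<Rightarrow> 'k lexp" where
  "const_lexp N n a = map (\<lambda>k. (int k - int N, Const (a k))) [0..<Suc n]"

lemma lval_const_lexp: "lval u (const_lexp N n a) z = (\<Sum>k\<le>n. a k * z powi (int k - int N))"
  unfolding lval_def const_lexp_def map_map o_def prod.case rval.simps interv_sum_list_conv_sum_set_nat
  by (simp only: set_upt atLeast0LessThan lessThan_Suc_atMost)

lemma ldeg_const_lexp: "int n - int N = d \<Longrightarrow> ldeg_le d (const_lexp N n a)"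
  by (auto simp: ldeg_le_def const_lexp_def)

lemma mero_at: "f meromorphic_on UNIV \<Longrightarrow> f meromorphic_on {p}"
  by (rule meromorphic_on_subset) auto

text \<open>Extends a function admissible at one configuration to a family admissible at all of
  them: the quotient by the product of the \<open>(z - u_i)^h\<close> is a Laurent polynomial, whose
  coefficients are then kept constant while the product varies with \<open>u\<close>.\<close>

lemma sphere_function_representation:
  fixes u :: "'k::finite \<Rightarrow> complex"
  assumes u: "u \<in> conf" and g: "meromorphic_sphere g"
    and ord: "\<And>P. P \<noteq> Pt 0 \<Longrightarrow> diff_order_ge g (1 - int h) P (int h * int (card {i. pt_conf u i = P}))"
  shows "\<exists>G :: 'k lexp. (\<forall>i. van i h G) \<and> ldeg_le (2 * int h - 2) G \<and> (\<forall>\<^sub>F z in at 0. g z = lval u G z)"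
proof -
  let ?p = "\<lambda>z. \<Prod>i\<in>UNIV. (z - u i) ^ h"
  \<comment> \<open>The order of the quotient at infinity: \<open>2 (1 - h)\<close> from the
    condition on \<open>g\<close>, and \<open>h\<close> for each of the factors divided out.\<close>
  let ?d = "2 * (1 - int h) + int h * int CARD('k)"
  have mero: "g meromorphic_on UNIV" and mero_inf: "(\<lambda>w. g (1 / w)) meromorphic_on {0}"
    using g by (auto simp: meromorphic_sphere_def)
  have "\<exists>N n a. int n - int N = - ?d \<and> (\<forall>p. \<forall>\<^sub>F z in at p. g z / ?p z = (\<Sum>k\<le>n. a k * z powi (int k - int N)))"
  proof (rule laurent_polynomial_representation)
    show "(\<lambda>z. g z / ?p z) meromorphic_on UNIV"
      by (intro meromorphic_intros mero)
  next
    fix p :: complex assume p: "p \<noteq> 0"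
    show "\<exists>f. f analytic_on {p} \<and> (\<forall>\<^sub>F z in at p. g z / ?p z = f z)"
    proof (cases "\<exists>i. p = u i")
      case True
      then obtain i where i: "p = u i" by blast
      have "(\<forall>\<^sub>F z in at p. g z = 0) \<or> zorder g p \<ge> int h"
        using ord[of "Pt p"] p i card_pt_conf(2)[OF u, of i] by simp
      from order_ge_imp_factor[OF mero_at[OF mero] this]
      obtain f where f: "f analytic_on {p}" "\<forall>\<^sub>F z in at p. g z = f z * (z - p) powi int h" by blast
      let ?q = "\<lambda>z. \<Prod>l\<in>UNIV - {i}. (z - u l) ^ h"
      have "?q p \<noteq> 0" using u i by (auto simp: conf_def inj_def)
      then have "(\<lambda>z. f z / ?q z) analytic_on {p}"
        by (intro analytic_on_divide f analytic_on_prod analytic_intros) auto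
      moreover have "\<forall>\<^sub>F z in at p. g z / ?p z = f z / ?q z"
      proof -
        have "\<forall>\<^sub>F z in at p. z \<noteq> p" by (auto simp: eventually_at intro: exI[of _ 1])
        with f(2) show ?thesis
        proof eventually_elim
          case (elim z)
          have "?p z = (z - p) ^ h * ?q z" unfolding i by (rule prod.remove) auto
          then show ?case using elim by simp
        qed
      qed
      ultimately show ?thesis by (intro exI[of _ "\<lambda>z. f z / ?q z"]) simp
    next
      case False
      have "(\<forall>\<^sub>F z in at p. g z = 0) \<or> zorder g p \<ge> 0"
        using ord[of "Pt p"] p card_pt_conf(3)[OF u, of p] False by auto
      from order_ge_imp_factor[OF mero_at[OF mero] this]
      obtain f where f: "f analytic_on {p}" "\<forall>\<^sub>F z in at p. g z = f z * (z - p) powi 0" by blast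
      have "?p p \<noteq> 0" using False by auto
      then have "(\<lambda>z. f z / ?p z) analytic_on {p}"
        by (intro analytic_on_divide f analytic_on_prod analytic_intros) auto
      moreover have "\<forall>\<^sub>F z in at p. g z / ?p z = f z / ?p z"
        using f(2) by eventually_elim simp
      ultimately show ?thesis by (intro exI[of _ "\<lambda>z. f z / ?p z"]) simp
    qed
  next
    have "(\<forall>\<^sub>F w in at 0. g (1 / w) = 0) \<or> zorder (\<lambda>w. g (1 / w)) 0 \<ge> 2 * (1 - int h)"
      using ord[of Infty] card_pt_conf(1)[OF u] by auto
    from order_ge_imp_factor[OF mero_inf this]
    obtain f where f: "f analytic_on {0}" "\<forall>\<^sub>F w in at 0. g (1 / w) = f w * (w - 0) powi (2 * (1 - int h))" by blast
    let ?q = "\<lambda>w. \<Prod>i\<in>UNIV. (1 - u i * w) ^ h"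
    have "(\<lambda>w. f w / ?q w) analytic_on {0}"
      by (intro analytic_on_divide f analytic_on_prod analytic_intros) auto
    moreover have "\<forall>\<^sub>F w in at 0. g (1 / w) / ?p (1 / w) = f w / ?q w * w powi ?d"
    proof -
      have "\<forall>\<^sub>F w in at (0::complex). w \<noteq> 0" by (auto simp: eventually_at intro: exI[of _ 1])
      with f(2) show ?thesis
      proof eventually_elim
        case (elim w)
        have "?q w = (\<Prod>i\<in>UNIV. (1 / w - u i) ^ h * w ^ h)"
          unfolding power_mult_distrib[symmetric] using elim by (simp add: left_diff_distrib)
        also have "\<dots> = ?p (1 / w) * w ^ (h * CARD('k))"
          by (simp add: prod.distrib power_mult)
        finally have q: "?q w = ?p (1 / w) * w ^ (h * CARD('k))" .
        have "w powi ?d = w powi (2 * (1 - int h)) * w ^ (h * CARD('k))"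
          using elim by (simp add: power_int_add power_int_def[of w "int h * int CARD('k)"] nat_mult_distrib)
        then show ?case using elim unfolding q by simp
      qed
    qed
    ultimately show "\<exists>f. f analytic_on {0} \<and> (\<forall>\<^sub>F w in at 0. g (1 / w) / ?p (1 / w) = f w * w powi ?d)"
      by (intro exI[of _ "\<lambda>w. f w / ?q w"]) simp
  qed
  then obtain N n a where a: "int n - int N = - ?d"
    "\<And>p. \<forall>\<^sub>F z in at p. g z / ?p z = (\<Sum>k\<le>n. a k * z powi (int k - int N))" by blast
  obtain H :: "'k lexp" where H: "ldeg_le (int h * int CARD('k)) H" "\<And>i. van i h H"
    "\<And>u z. z \<noteq> 0 \<Longrightarrow> lval u H z = (\<Prod>i\<in>UNIV. (z - u i) ^ h)"
    using product_exists by blast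
  let ?G = "lmul H (const_lexp N n a)"
  have "\<forall>i. van i h ?G" using van_lmul[OF H(2) van_0] by simp
  moreover have "ldeg_le (2 * int h - 2) ?G"
    using ldeg_le_lmul[OF H(1) ldeg_const_lexp[OF a(1), of a]] by (simp add: algebra_simps)
  moreover have "\<forall>\<^sub>F z in at 0. g z = lval u ?G z"
  proof -
    have nz0: "\<forall>\<^sub>F z in at (0::complex). z \<noteq> 0" by (auto simp: eventually_at intro: exI[of _ 1])
    have "open {z. ?p z \<noteq> 0}" by (intro open_Collect_neq continuous_intros)
    moreover have "?p 0 \<noteq> 0" using u by (auto simp: conf_def)
    ultimately have "\<forall>\<^sub>F z in at 0. ?p z \<noteq> 0"
      using eventually_nhds_in_open[of "{z. ?p z \<noteq> 0}" 0] by (auto simp: eventually_at_filter elim: eventually_mono)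
    with a(2)[of 0] nz0 show ?thesis
      by eventually_elim (simp add: lval_lmul H(3) lval_const_lexp field_simps)
  qed
  ultimately show ?thesis by blast
qed

section \<open>\<open>O_space\<close>, \<open>dual_fibre\<close> and \<open>L_op\<close> in terms of
  families\<close>

context chiral_theory
begin

lemma contour_eq_cval:
  assumes "\<forall>\<^sub>F z in at 0. g z = lval u G z"
  shows "contour T h \<psi> g \<omega> = cval (int h) \<psi> G u \<omega>"
proof -
  define c where "c n = (\<Sum>(j, e)\<leftarrow>G. if j = n + int h - 1 then rval e u else 0)" for n
  have res: "residue (\<lambda>z. g z * z powi (- n - int h)) 0 = c n" for n
  proof -
    have "residue (\<lambda>z. g z * z powi (- n - int h)) 0 = residue (\<lambda>z. lval u G z * z powi (- n - int h)) 0"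
      by (rule residue_cong) (use assms in \<open>auto elim: eventually_mono\<close>)
    then show ?thesis unfolding residue_lval c_def by (simp add: algebra_simps)
  qed
  define S where "S = (\<lambda>(j, e). j - int h + 1) ` set G"
  have S: "finite S" by (simp add: S_def)
  have c0: "c n = 0" if "n \<notin> S" for n
  proof -
    have "c n = (\<Sum>x\<leftarrow>G. 0)"
      unfolding c_def
      by (rule arg_cong[where f = sum_list], rule map_cong) (use that in \<open>force simp: S_def\<close>)+
    then show ?thesis by simp
  qed
  have "contour T h \<psi> g \<omega> = (\<Sum>n\<in>S. c n \<cdot> mode T \<psi> n \<omega>)"
    unfolding contour_def res
    by (rule sum.mono_neutral_left) (use S c0 in auto)
  also have "\<dots> = (\<Sum>(j, e)\<leftarrow>G. \<Sum>n\<in>S. (if j = n + int h - 1 then rval e u else 0) \<cdot> mode T \<psi> n \<omega>)"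
    unfolding c_def
    by (induction G) (auto simp: vs.scale_left_distrib sum.distrib)
  also have "\<dots> = (\<Sum>(j, e)\<leftarrow>G. rval e u \<cdot> mode T \<psi> (j - int h + 1) \<omega>)"
  proof (rule arg_cong[where f = sum_list], rule map_cong[OF refl], clarify)
    fix j e assume "(j, e) \<in> set G"
    then have "j - int h + 1 \<in> S" by (force simp: S_def)
    have "(\<Sum>n\<in>S. (if j = n + int h - 1 then rval e u else 0) \<cdot> mode T \<psi> n \<omega>)
       = (\<Sum>n\<in>S. if n = j - int h + 1 then rval e u \<cdot> mode T \<psi> (j - int h + 1) \<omega> else 0)"
      by (rule sum.cong) auto
    also have "\<dots> = rval e u \<cdot> mode T \<psi> (j - int h + 1) \<omega>"
      using S \<open>j - int h + 1 \<in> S\<close> by simp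
    finally show "(\<Sum>n\<in>S. (if j = n + int h - 1 then rval e u else 0) \<cdot> mode T \<psi> n \<omega>)
       = rval e u \<cdot> mode T \<psi> (j - int h + 1) \<omega>" .
  qed
  finally show ?thesis by (simp add: cval_def)
qed

text \<open>Vanishing is required at the given \<open>u\<close> alone. This also covers Laurent
  polynomials obtained from a function prescribed at a single configuration.\<close>

lemma cval_in_O_space:
  fixes u :: "'k::finite \<Rightarrow> complex"
  assumes \<psi>: "\<psi> \<in> gen T h" and u: "u \<in> conf" and van: "\<And>i a. a < h \<Longrightarrow> lval u ((dz ^^ a) G) (u i) = 0"
    and deg: "ldeg_le (2 * int h - 2) G"
  shows "cval (int h) \<psi> G u \<omega> \<in> O_space T (pt_conf u)"
proof -
  have "cval (int h) \<psi> G u \<omega> = contour T h \<psi> (lval u G) \<omega>"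
    by (rule contour_eq_cval[symmetric]) simp
  then show ?thesis
    unfolding O_space_def
    using \<psi> lval_meromorphic_sphere lval_diff_order[OF u van deg] by (intro vs.span_base) blast
qed

lemma osec_in_O_space:
  fixes u :: "'k::finite \<Rightarrow> complex"
  assumes u: "u \<in> conf" and "osec s"
  shows "sval s u \<in> O_space T (pt_conf u)"
  using assms(2)
proof (induction rule: osec.induct)
  case osec_Nil
  show ?case by (simp add: O_space_def vs.span_zero)
next
  case (osec_append s s')
  then show ?case by (simp add: O_space_def vs.span_add)
next
  case (osec_gen \<psi> h G \<omega>)
  have "lval u ((dz ^^ a) G) (u i) = 0" if "a < h" for i a
    using osec_gen(2) that u by (auto simp: van_def)
  from cval_in_O_space[OF osec_gen(1) u this osec_gen(3)] show ?case by simp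
next
  case (osec_sequiv s s')
  then show ?case using u by (simp add: sequiv_def)
qed

text \<open>Together with \<open>osec_in_O_space\<close>, \<open>O_u\<close> is exactly the set of
  values at \<open>u\<close> of the families in \<open>osec\<close>, so working with families loses
  nothing pointwise.\<close>

lemma O_space_osec:
  fixes u :: "'k::finite \<Rightarrow> complex"
  assumes u: "u \<in> conf" and x: "x \<in> O_space T (pt_conf u)"
  shows "\<exists>s :: ('k, 'a) hsection. osec s \<and> sval s u = x"
  using x unfolding O_space_def
proof (induction rule: vs.span_induct_alt)
  case base
  show ?case using osec_Nil by (intro exI[of _ "[]"]) simp
next
  case (step c x y)
  then obtain h \<psi> g \<xi> N where x: "x = contour T h \<psi> g \<xi>" "\<psi> \<in> gen T h" "meromorphic_sphere g"
    "\<And>P. diff_order_ge g (1 - int h) P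
           ((if P = Pt 0 then - int N else 0) + int h * int (card {i. pt_conf u i = P}))"
    by blast
  obtain s where s: "osec s" "sval s u = y" using step by blast
  have "diff_order_ge g (1 - int h) P (int h * int (card {i. pt_conf u i = P}))" if "P \<noteq> Pt 0" for P
    using x(4)[of P] that by simp
  from sphere_function_representation[OF u x(3) this]
  obtain G :: "'k lexp" where G: "\<forall>i. van i h G" "ldeg_le (2 * int h - 2) G" "\<forall>\<^sub>F z in at 0. g z = lval u G z"
    by blast
  have "osec (scsec (Const c) (csec (int h) \<psi> G \<xi>) @ s)"
    by (intro osec_append osec_scale osec_gen x G s)
  moreover have "sval (scsec (Const c) (csec (int h) \<psi> G \<xi>) @ s) u = c \<cdot> x + y"
    unfolding x(1) contour_eq_cval[OF G(3)] by (simp add: s(2))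
  ultimately show ?case by blast
qed

lemma dual_fibre_eq_dual:
  fixes u :: "'k::finite \<Rightarrow> complex"
  assumes "u \<in> conf"
  shows "\<eta> \<in> dual_fibre T (pt_conf u) \<longleftrightarrow>
     functional \<eta> \<and> (\<forall>s :: ('k, 'a) hsection. osec s \<longrightarrow> \<eta> (sval s u) = 0)"
  unfolding dual_fibre_def mem_Collect_eq functional_iff
  using osec_in_O_space[OF assms] O_space_osec[OF assms] by blast

text \<open>Near \<open>0\<close> any admissible \<open>f\<close> is a Laurent polynomial of degree
  at most 2, as \<open>dz^(-1)\<close> has order 2 at infinity. It differs from
  \<open>conn_fun 0 i\<close> by a field with double zeros at the points of \<open>u\<close>, and
  \<open>L\<close> of such a field maps into \<open>O_u\<close>.\<close>

lemma connection_fun_L_op: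
  fixes u :: "'k::finite \<Rightarrow> complex"
  assumes u: "u \<in> conf" and f: "connection_fun (pt_conf u) i f" and \<eta>: "\<eta> \<in> dual_fibre T (pt_conf u)"
  shows "\<eta> (L_op T f \<xi>) = \<eta> (- Lval (conn_fun 0 i) u \<xi>)"
proof -
  have mero: "meromorphic_sphere f" and ord0: "\<And>P. P \<noteq> Pt 0 \<Longrightarrow> diff_order_ge f (-1) P 0"
    and ord2: "\<And>j. diff_order_ge (\<lambda>z. f z - (if i = j then 1 else 0)) (-1) (pt_conf u j) 2"
    using f unfolding connection_fun_def by auto
  have "\<exists>N n a. int n - int N = - (-2) \<and> (\<forall>p. \<forall>\<^sub>F z in at p. f z = (\<Sum>k\<le>n. a k * z powi (int k - int N)))"
  proof (rule laurent_polynomial_representation)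
    show merof: "f meromorphic_on UNIV" using mero by (simp add: meromorphic_sphere_def)
    show "\<exists>h. h analytic_on {p} \<and> (\<forall>\<^sub>F z in at p. f z = h z)" if p: "p \<noteq> 0" for p
    proof -
      have "(\<forall>\<^sub>F z in at p. f z = 0) \<or> zorder f p \<ge> 0" using ord0[of "Pt p"] p by simp
      from order_ge_imp_factor[OF mero_at[OF merof] this] show ?thesis by simp
    qed
    have "(\<forall>\<^sub>F w in at 0. f (1 / w) = 0) \<or> zorder (\<lambda>w. f (1 / w)) 0 \<ge> - 2" using ord0[of Infty] by auto
    from order_ge_imp_factor[OF _ this] mero
    show "\<exists>h. h analytic_on {0} \<and> (\<forall>\<^sub>F w in at 0. f (1 / w) = h w * w powi - 2)"
      by (simp add: meromorphic_sphere_def)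
  qed
  then obtain N n a where a: "int n - int N = - (-2)"
    "\<And>p. \<forall>\<^sub>F z in at p. f z = (\<Sum>k\<le>n. a k * z powi (int k - int N))" by blast
  define K :: "'k lexp" where "K = const_lexp N n a"
  have K: "ldeg_le 2 K" "\<And>p. \<forall>\<^sub>F z in at p. f z = lval u K z"
    using a ldeg_const_lexp[OF a(1), of a] by (simp_all add: K_def lval_const_lexp)
  let ?G = "K @ lscale (Const (-1)) (conn_fun 0 i)"
  have Kvan: "lval u K (u j) = (if i = j then 1 else 0)" "lval u (dz K) (u j) = 0" for j
  proof -
    define \<delta> :: complex where "\<delta> = (if i = j then 1 else 0)"
    have uj: "u j \<noteq> 0" using u by (rule conf_nz)
    have "(\<forall>\<^sub>F z in at (u j). f z - \<delta> = 0) \<or> zorder (\<lambda>z. f z - \<delta>) (u j) \<ge> 2"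
      using ord2[of j] by (simp add: \<delta>_def)
    moreover have "(\<lambda>z. f z - \<delta>) meromorphic_on {u j}"
      using mero by (intro meromorphic_intros mero_at) (auto simp: meromorphic_sphere_def)
    ultimately obtain h where h: "h analytic_on {u j}" "\<forall>\<^sub>F z in at (u j). f z - \<delta> = h z * (z - u j) powi 2"
      using order_ge_imp_factor by blast
    define F where "F z = \<delta> + h z * (z - u j)^2" for z
    from h(1) obtain h' where h': "(h has_field_derivative h') (at (u j))"
      using analytic_on_imp_differentiable_at[of h "{u j}" "u j"] by (auto simp: field_differentiable_def)
    have F': "(F has_field_derivative 0) (at (u j))"
      unfolding F_def by (rule derivative_eq_intros h' refl | simp)+
    have K': "(lval u K has_field_derivative lval u (dz K) (u j)) (at (u j))" by (rule lval_deriv[OF uj])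
    have ev: "\<forall>\<^sub>F z in at (u j). lval u K z = F z"
      using h(2) K(2)[of "u j"] by eventually_elim (simp add: F_def algebra_simps)
    \<comment> \<open>\<open>f\<close> determines \<open>lval u K\<close> only off the point
      \<open>u j\<close>; the value at the point follows by continuity.\<close>
    have "(lval u K \<longlongrightarrow> lval u K (u j)) (at (u j))" "(F \<longlongrightarrow> F (u j)) (at (u j))"
      using DERIV_isCont[OF K'] DERIV_isCont[OF F'] by (auto simp: isCont_def)
    then have eq: "lval u K (u j) = F (u j)"
      using ev tendsto_unique[OF at_neq_bot] tendsto_cong[OF ev] by blast
    then show "lval u K (u j) = (if i = j then 1 else 0)" by (simp add: F_def \<delta>_def)
    have "\<forall>\<^sub>F z in nhds (u j). lval u K z = F z"
      using ev eq by (simp add: eventually_nhds_conv_at)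
    from DERIV_cong_ev[OF refl this refl] F' K' show "lval u (dz K) (u j) = 0"
      using DERIV_unique by blast
  qed
  have "lval u ((dz ^^ b) ?G) (u j) = 0" if "b < 2" for j b
  proof -
    have "van j (Suc (Suc 0)) (conn_fun 0 i @ [(0, Const (if j = i then -1 else 0))])"
      using conn_fun(2)[of j 0 i] by (simp add: numeral_2_eq_2)
    then have "lval u (conn_fun 0 i) (u j) = (if j = i then 1 else 0)" "lval u (dz (conn_fun 0 i)) (u j) = 0"
      using u by (auto simp: van_Suc add_eq_0_iff split: if_splits)
    moreover have "b = 0 \<or> b = 1" using that by auto
    ultimately show ?thesis using Kvan[of j] by auto
  qed
  moreover have "ldeg_le (2 * int 2 - 2) ?G"
    using K(1) ldeg_le_mono[OF conn_fun(1)[of 0 i], of 2] by (simp add: ldeg_le_lscale)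
  ultimately have "cval (int 2) (vir T) ?G u \<xi> \<in> O_space T (pt_conf u)"
    by (intro cval_in_O_space vir_gen u)
  then have "\<eta> (cval 2 (vir T) ?G u \<xi>) = 0" using \<eta> by (simp add: dual_fibre_def)
  moreover have "functional \<eta>" using \<eta> by (simp add: dual_fibre_def functional_iff)
  ultimately have "\<eta> (Lval K u \<xi>) = \<eta> (Lval (conn_fun 0 i) u \<xi>)"
    by (simp add: functional_diff)
  moreover have "L_op T f \<xi> = - Lval K u \<xi>"
    unfolding L_op_def using contour_eq_cval[OF K(2), of 2 "vir T" \<xi>] by simp
  ultimately show ?thesis using \<open>functional \<eta>\<close> by (simp add: functional_minus)
qed

end

section \<open>Transport along paths\<close>

text \<open>Any two loops are freely homotopic, in particular the constant loops at \<open>a\<close>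
  and \<open>b\<close>. The base point travels from \<open>a\<close> to \<open>b\<close> during the
  homotopy.\<close>

lemma simply_connected_path_between:
  fixes W :: "'c::topological_space set"
  assumes W: "simply_connected W" and ab: "a \<in> W" "b \<in> W"
  obtains \<gamma> where "path \<gamma>" "path_image \<gamma> \<subseteq> W" "pathstart \<gamma> = a" "pathfinish \<gamma> = b"
proof -
  have "homotopic_loops W (\<lambda>_. a) (\<lambda>_. b)"
    using W[unfolded simply_connected_def, rule_format, of "\<lambda>_. a" "\<lambda>_. b"] ab
    by (simp add: path_def pathstart_def pathfinish_def path_image_def image_subset_iff)
  then obtain H :: "real \<times> real \<Rightarrow> 'c" where H: "continuous_on ({0..1} \<times> {0..1}) H" "H \<in> {0..1} \<times> {0..1} \<rightarrow> W"
    "\<forall>t\<in>{0..1}. H (0, t) = a" "\<forall>t\<in>{0..1}. H (1, t) = b"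
    unfolding homotopic_loops by blast
  show ?thesis
  proof
    show "path (\<lambda>s. H (s, 0))"
      unfolding path_def by (rule continuous_on_compose2[OF H(1)]) (auto intro!: continuous_intros)
  qed (use H in \<open>auto simp: path_image_def pathstart_def pathfinish_def\<close>)
qed

text \<open>The fibres are bare sets: the monodromy argument uses only that \<open>tr\<close> is
  consistent on each good set.\<close>

locale flat_transport =
  fixes U :: "'a::topological_space set" and \<G> :: "'a set set"
    and F :: "'a \<Rightarrow> 'b set" and tr :: "'a \<Rightarrow> 'a \<Rightarrow> 'b \<Rightarrow> 'b"
  assumes good: "\<And>G. G \<in> \<G> \<Longrightarrow> open G \<and> path_connected G \<and> G \<subseteq> U"
    and cover: "\<And>u. u \<in> U \<Longrightarrow> \<exists>G\<in>\<G>. u \<in> G"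
    and tr_F: "\<And>G w w' x. G \<in> \<G> \<Longrightarrow> w \<in> G \<Longrightarrow> w' \<in> G \<Longrightarrow> x \<in> F w \<Longrightarrow> tr w w' x \<in> F w'"
    and tr_id: "\<And>w x. w \<in> U \<Longrightarrow> x \<in> F w \<Longrightarrow> tr w w x = x"
    and tr_comp: "\<And>G w w' w'' x. G \<in> \<G> \<Longrightarrow> w \<in> G \<Longrightarrow> w' \<in> G \<Longrightarrow> w'' \<in> G \<Longrightarrow> x \<in> F w \<Longrightarrow>
           tr w' w'' (tr w w' x) = tr w w'' x"
begin

text \<open>Lifts along paths and over homotopies are the same notion, for \<open>D\<close> an
  interval or a square. A uniform \<open>\<delta>\<close> takes the place of continuity, as the
  fibres have no topology.\<close>

definition flat :: "'d::real_normed_vector set \<Rightarrow> ('d \<Rightarrow> 'a) \<Rightarrow> ('d \<Rightarrow> 'b) \<Rightarrow> bool" where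
  "flat D h e \<longleftrightarrow> (\<forall>p\<in>D. h p \<in> U \<and> e p \<in> F (h p)) \<and>
     (\<exists>\<delta>>0. \<forall>p\<in>D. \<forall>q\<in>D. dist p q < \<delta> \<longrightarrow> e q = tr (h p) (h q) (e p))"

lemma flat_at: "flat D h e \<Longrightarrow> p \<in> D \<Longrightarrow> h p \<in> U \<and> e p \<in> F (h p)"
  unfolding flat_def by blast

lemma flat_reparam:
  assumes e: "flat D h e" and \<phi>: "\<phi> ` D' \<subseteq> D" "\<And>p q. dist (\<phi> p) (\<phi> q) \<le> dist p q"
    and h': "\<And>p. p \<in> D' \<Longrightarrow> h' p = h (\<phi> p)"
  shows "flat D' h' (\<lambda>p. e (\<phi> p))"
proof -
  obtain \<delta> where \<delta>: "\<delta> > 0" "\<And>p q. p \<in> D \<Longrightarrow> q \<in> D \<Longrightarrow> dist p q < \<delta> \<Longrightarrow> e q = tr (h p) (h q) (e p)"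
    using e unfolding flat_def by blast
  have "e (\<phi> q) = tr (h' p) (h' q) (e (\<phi> p))" if "p \<in> D'" "q \<in> D'" "dist p q < \<delta>" for p q
    unfolding h'[OF that(1)] h'[OF that(2)]
    by (rule \<delta>(2)) (use \<phi>(1) \<phi>(2)[of p q] that in auto)
  then show ?thesis
    using e \<phi>(1) h' \<delta>(1) unfolding flat_def by (metis image_subset_iff)
qed

lemma flat_const:
  assumes "w \<in> U" "x \<in> F w" shows "flat D (\<lambda>_. w) (\<lambda>_. x)"
  unfolding flat_def using assms tr_id by (auto intro: exI[of _ 1])

lemma flat_in_good:
  assumes "G \<in> \<G>" "w \<in> G" "x \<in> F w" "h ` D \<subseteq> G"
  shows "flat D h (\<lambda>p. tr w (h p) x)"
proof -
  have inG: "h p \<in> G" if "p \<in> D" for p using assms(4) that by blast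
  have "\<forall>p\<in>D. h p \<in> U \<and> tr w (h p) x \<in> F (h p)"
    using inG good[OF assms(1)] tr_F[OF assms(1,2) _ assms(3)] by blast
  moreover have "\<forall>p\<in>D. \<forall>q\<in>D. dist p q < 1 \<longrightarrow> tr w (h q) x = tr (h p) (h q) (tr w (h p) x)"
    using tr_comp[OF assms(1,2) inG inG assms(3)] by simp
  ultimately show ?thesis unfolding flat_def using zero_less_one by blast
qed

definition step_point :: "'d::real_normed_vector \<Rightarrow> 'd \<Rightarrow> nat \<Rightarrow> nat \<Rightarrow> 'd" where
  "step_point p0 p N i = p0 + (real i / real N) *\<^sub>R (p - p0)"

lemma step_point:
  assumes "convex D" "p0 \<in> D" "p \<in> D" "i \<le> N" "N > 0"
  shows "step_point p0 p N i \<in> D"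
proof -
  have "(1 - real i / real N) *\<^sub>R p0 + (real i / real N) *\<^sub>R p \<in> D"
    by (rule convexD[OF assms(1,2,3)]) (use assms in auto)
  then show ?thesis by (simp add: step_point_def algebra_simps)
qed

lemma step_point_dist: "N > 0 \<Longrightarrow> dist (step_point p0 p N i) (step_point p0 p N (Suc i)) = norm (p - p0) / N"
proof -
  assume N: "N > 0"
  have "step_point p0 p N (Suc i) - step_point p0 p N i = (1 / real N) *\<^sub>R (p - p0)"
    by (simp add: step_point_def scaleR_left_diff_distrib[symmetric] add_divide_distrib)
  then show ?thesis by (simp add: dist_norm norm_minus_commute[of "step_point p0 p N i"])
qed

lemma step_point_dist': "i \<le> N \<Longrightarrow> N > 0 \<Longrightarrow> dist (step_point p0 p N i) (step_point p0 q N i) \<le> dist p q"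
proof -
  assume N: "i \<le> N" "N > 0"
  have "step_point p0 p N i - step_point p0 q N i = (real i / real N) *\<^sub>R (p - q)"
    by (simp add: step_point_def scaleR_right_diff_distrib)
  then have "dist (step_point p0 p N i) (step_point p0 q N i) = (real i / real N) * dist p q"
    by (simp add: dist_norm)
  also have "\<dots> \<le> 1 * dist p q" using N by (intro mult_right_mono) auto
  finally show ?thesis by simp
qed

lemma step_point_ends: "N > 0 \<Longrightarrow> step_point p0 p N 0 = p0" "N > 0 \<Longrightarrow> step_point p0 p N N = p"
  by (simp_all add: step_point_def)

lemma small_steps:
  assumes "\<epsilon> > 0" obtains N where "N > 0" "B / real N < \<epsilon>"
proof -
  obtain N where N: "B / \<epsilon> < real N" using reals_Archimedean2 by blast
  have "B / real (Suc N) < \<epsilon>" using N assms by (simp add: field_simps)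
  then show ?thesis by (rule that[rotated]) simp
qed

text \<open>Finitely many steps shorter than both constants \<open>\<delta>\<close> lead from
  \<open>p0\<close> to \<open>p\<close> along the segment, and each step is prescribed by
  \<open>tr\<close>.\<close>

lemma flat_unique:
  assumes D: "convex D" "p0 \<in> D" "p \<in> D" and e: "flat D h e" "flat D h e'" and eq: "e p0 = e' p0"
  shows "e p = e' p"
proof -
  obtain \<delta>1 where \<delta>1: "\<delta>1 > 0" "\<And>p q. p \<in> D \<Longrightarrow> q \<in> D \<Longrightarrow> dist p q < \<delta>1 \<Longrightarrow> e q = tr (h p) (h q) (e p)"
    using e(1) unfolding flat_def by blast
  obtain \<delta>2 where \<delta>2: "\<delta>2 > 0" "\<And>p q. p \<in> D \<Longrightarrow> q \<in> D \<Longrightarrow> dist p q < \<delta>2 \<Longrightarrow> e' q = tr (h p) (h q) (e' p)"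
    using e(2) unfolding flat_def by blast
  obtain N where N: "N > 0" "norm (p - p0) / real N < min \<delta>1 \<delta>2"
    using small_steps[of "min \<delta>1 \<delta>2" "norm (p - p0)"] \<delta>1(1) \<delta>2(1) by auto
  have "e (step_point p0 p N i) = e' (step_point p0 p N i)" if "i \<le> N" for i
    using that
  proof (induction i)
    case 0
    then show ?case using eq N by (simp add: step_point_ends)
  next
    case (Suc i)
    have "step_point p0 p N i \<in> D" "step_point p0 p N (Suc i) \<in> D"
      using Suc.prems by (auto intro!: step_point D N)
    then show ?case
      using \<delta>1(2)[of "step_point p0 p N i" "step_point p0 p N (Suc i)"]
        \<delta>2(2)[of "step_point p0 p N i" "step_point p0 p N (Suc i)"] step_point_dist[OF N(1), of p0 p i] N(2) Suc
      by simp
  qed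
  from this[of N] N(1) show ?thesis by (simp add: step_point_ends)
qed

text \<open>The value at \<open>p\<close> is obtained by transport along \<open>N\<close> equal steps on the segment from \<open>p0\<close> to
  \<open>p\<close>; if the steps are short, neighbouring segments stay in common good sets.\<close>

lemma flat_exists:
  fixes h :: "'d::euclidean_space \<Rightarrow> 'a"
  assumes D: "convex D" "compact D" "p0 \<in> D" and h: "continuous_on D h" "h ` D \<subseteq> U" and x: "x \<in> F (h p0)"
  shows "\<exists>e. flat D h e \<and> e p0 = x"
proof -
  \<comment> \<open>The \<open>\<epsilon>\<close> obtained below is a Lebesgue number of this cover:
    \<open>h\<close> maps every \<open>\<epsilon>\<close>-ball of \<open>D\<close> into one good
    set.\<close>
  define \<C> where "\<C> = {A. open A \<and> (\<exists>G\<in>\<G>. h ` (A \<inter> D) \<subseteq> G)}"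
  have "D \<subseteq> \<Union>\<C>"
  proof
    fix p assume p: "p \<in> D"
    then obtain G where G: "G \<in> \<G>" "h p \<in> G" using cover h(2) by blast
    then have "open G" using good by blast
    with h(1) obtain A where A: "open A" "A \<inter> D = h -` G \<inter> D"
      unfolding continuous_on_open_invariant by blast
    have "p \<in> A" using A(2) p G(2) by blast
    moreover have "A \<in> \<C>" unfolding \<C>_def using A G(1) by blast
    ultimately show "p \<in> \<Union>\<C>" by blast
  qed
  then obtain \<epsilon> where \<epsilon>: "\<epsilon> > 0" "\<And>p. p \<in> D \<Longrightarrow> \<exists>A\<in>\<C>. ball p \<epsilon> \<subseteq> A"
    using Heine_Borel_lemma[OF D(2), of \<C>] unfolding \<C>_def by blast
  have near: "\<exists>G\<in>\<G>. h ` (ball p \<epsilon> \<inter> D) \<subseteq> G" if "p \<in> D" for p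
    using \<epsilon>(2)[OF that] unfolding \<C>_def by blast
  obtain B where B: "\<And>p. p \<in> D \<Longrightarrow> norm (p - p0) \<le> B"
    using compact_imp_bounded[OF D(2)] unfolding bounded_any_center[of D p0]
    by (auto simp: dist_norm norm_minus_commute)
  obtain N where N: "N > 0" "B / real N < \<epsilon> / 2"
    using small_steps[of "\<epsilon> / 2" B] \<epsilon>(1) by auto
  let ?q = "\<lambda>p i. step_point p0 p N i"
  define E where "E p i = rec_nat x (\<lambda>i y. tr (h (?q p i)) (h (?q p (Suc i))) y) i" for p i
  have E0: "E p 0 = x" and ESuc: "E p (Suc i) = tr (h (?q p i)) (h (?q p (Suc i))) (E p i)" for p i
    by (simp_all add: E_def)
  have qD: "?q p i \<in> D" if "p \<in> D" "i \<le> N" for p i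
    using step_point[OF D(1,3)] that N(1) by blast
  have step: "dist (?q p i) (?q p (Suc i)) < \<epsilon> / 2" if "p \<in> D" for p i
  proof -
    have "norm (p - p0) / real N \<le> B / real N" using B[OF that] N(1) by (simp add: divide_right_mono)
    then show ?thesis unfolding step_point_dist[OF N(1), of p0 p i] using N(2) by linarith
  qed
  have EF: "E p i \<in> F (h (?q p i))" if pD: "p \<in> D" and iN: "i \<le> N" for p i
    using iN
  proof (induction i)
    case 0
    then show ?case using x N(1) by (simp add: E0 step_point_ends)
  next
    case (Suc i)
    obtain G where G: "G \<in> \<G>" "h ` (ball (?q p i) \<epsilon> \<inter> D) \<subseteq> G" using near[OF qD[OF pD Suc_leD[OF Suc.prems]]] by blast
    have "?q p i \<in> ball (?q p i) \<epsilon> \<inter> D" "?q p (Suc i) \<in> ball (?q p i) \<epsilon> \<inter> D"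
      using qD[OF pD] step[OF pD, of i] \<epsilon>(1) Suc.prems by auto
    then show ?case unfolding ESuc using tr_F[OF G(1)] G(2) Suc by (simp add: image_subset_iff)
  qed
  \<comment> \<open>Two neighbouring chains form a ladder. The corners of each cell lie within
    \<open>\<epsilon>\<close> of its first corner, hence in one good set, where
    \<open>tr_comp\<close> makes the cell commute.\<close>
  have close: "E q i = tr (h (?q p i)) (h (?q q i)) (E p i)"
    if pq: "p \<in> D" "q \<in> D" "dist p q < \<epsilon> / 2" and i: "i \<le> N" for p q i
    using i
  proof (induction i)
    case 0
    then show ?case using x N(1) tr_id[of "h p0" x] h(2) D(3) by (simp add: E0 step_point_ends image_subset_iff)
  next
    case (Suc i)
    have iN: "i \<le> N" using Suc.prems by simp
    obtain G where G: "G \<in> \<G>" "h ` (ball (?q p i) \<epsilon> \<inter> D) \<subseteq> G" using near[OF qD[OF pq(1) iN]] by blast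
    have "dist (?q p i) (?q q i) < \<epsilon> / 2" using step_point_dist'[OF iN N(1), of p0 p q] pq(3) by simp
    then have "?q p i \<in> ball (?q p i) \<epsilon>" "?q p (Suc i) \<in> ball (?q p i) \<epsilon>" "?q q i \<in> ball (?q p i) \<epsilon>"
      "?q q (Suc i) \<in> ball (?q p i) \<epsilon>"
      using step[OF pq(1), of i] step[OF pq(2), of i] \<epsilon>(1)
        dist_triangle[of "?q p i" "?q q (Suc i)" "?q q i"] by auto
    then have inG: "h (?q p i) \<in> G" "h (?q p (Suc i)) \<in> G" "h (?q q i) \<in> G" "h (?q q (Suc i)) \<in> G"
      using G(2) qD[OF pq(1) iN] qD[OF pq(2) iN] qD[OF pq(1) Suc.prems] qD[OF pq(2) Suc.prems] by blast+
    note f = EF[OF pq(1) iN]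
    have "E q (Suc i) = tr (h (?q p i)) (h (?q q (Suc i))) (E p i)"
      unfolding ESuc Suc.IH[OF iN] by (rule tr_comp[OF G(1) inG(1,3,4) f])
    also have "\<dots> = tr (h (?q p (Suc i))) (h (?q q (Suc i))) (E p (Suc i))"
      unfolding ESuc by (rule tr_comp[OF G(1) inG(1,2,4) f, symmetric])
    finally show ?case .
  qed
  have "flat D h (\<lambda>p. E p N)"
    unfolding flat_def
  proof (intro conjI ballI exI[of _ "\<epsilon> / 2"] impI)
    show "\<epsilon> / 2 > 0" using \<epsilon>(1) by simp
    show "E q N = tr (h p) (h q) (E p N)" if "p \<in> D" "q \<in> D" "dist p q < \<epsilon> / 2" for p q
      using close[OF that, of N] N(1) by (simp add: step_point_ends)
    show "h p \<in> U" "E p N \<in> F (h p)" if "p \<in> D" for p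
      using EF[OF that, of N] N(1) h(2) that by (auto simp: step_point_ends)
  qed
  moreover have "E p0 i = x" for i
  proof (induction i)
    case (Suc i)
    have "?q p0 j = p0" for j by (simp add: step_point_def)
    then show ?case unfolding ESuc Suc using tr_id[of "h p0" x] x h(2) D(3) by auto
  qed (simp add: E0)
  ultimately show ?thesis by (intro exI[of _ "\<lambda>p. E p N"]) simp
qed

definition reaches :: "'a \<Rightarrow> 'b \<Rightarrow> 'a \<Rightarrow> 'b \<Rightarrow> bool" where
  "reaches v \<eta> u y \<longleftrightarrow> (\<exists>\<gamma> e. path \<gamma> \<and> path_image \<gamma> \<subseteq> U \<and> pathstart \<gamma> = v \<and> pathfinish \<gamma> = u
     \<and> flat {0..1} \<gamma> e \<and> e (0::real) = \<eta> \<and> e 1 = y)"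

text \<open>A flat family \<open>E\<close> over a homotopy from
  \<open>\<gamma> +++ reversepath \<gamma>'\<close> to the constant loop compares the two
  transports. The homotopy is free, so the base point may move, but the edges \<open>t = 0\<close>
  and \<open>t = 1\<close> of the square follow the same path.\<close>

lemma reaches_unique:
  assumes U: "simply_connected U" and y: "reaches v \<eta> u y" "reaches v \<eta> u y'"
  shows "y = y'"
proof -
  obtain \<gamma> e where g: "path \<gamma>" "path_image \<gamma> \<subseteq> U" "pathstart \<gamma> = v" "pathfinish \<gamma> = u"
    "flat {0..1} \<gamma> e" "e (0::real) = \<eta>" "e 1 = y" using y(1) unfolding reaches_def by blast
  obtain \<gamma>' e' where g': "path \<gamma>'" "path_image \<gamma>' \<subseteq> U" "pathstart \<gamma>' = v" "pathfinish \<gamma>' = u"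
    "flat {0..1} \<gamma>' e'" "e' (0::real) = \<eta>" "e' 1 = y'" using y(2) unfolding reaches_def by blast
  have \<eta>: "\<eta> \<in> F v" and vU: "v \<in> U"
    using flat_at[OF g(5), of 0] g(3,6) by (simp_all add: pathstart_def)
  define \<kappa> where "\<kappa> = \<gamma> +++ reversepath \<gamma>'"
  have l: "path \<kappa>" "path_image \<kappa> \<subseteq> U" "pathstart \<kappa> = v" "pathfinish \<kappa> = v"
    unfolding \<kappa>_def using g g'
    by (auto intro!: path_join_imp dest!: path_image_join_subset[THEN subsetD])
  have "homotopic_loops U \<kappa> (\<lambda>_. v)"
    using U[unfolded simply_connected_def, rule_format, of \<kappa> "\<lambda>_. v"] l vU
    by (simp add: path_def pathstart_def pathfinish_def path_image_def image_subset_iff)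
  then obtain H :: "real \<times> real \<Rightarrow> 'a" where H0: "continuous_on ({0..1} \<times> {0..1}) H" "H \<in> {0..1} \<times> {0..1} \<rightarrow> U"
    "\<forall>t\<in>{0..1}. H (0, t) = \<kappa> t" "\<forall>t\<in>{0..1}. H (1, t) = v"
    "\<forall>s\<in>{0..1}. pathfinish (H \<circ> Pair s) = pathstart (H \<circ> Pair s)"
    unfolding homotopic_loops by blast
  have H: "continuous_on ({0..1} \<times> {0..1}) H" "H ` ({0..1} \<times> {0..1}) \<subseteq> U"
    "\<And>t. t \<in> {0..1} \<Longrightarrow> H (0, t) = \<kappa> t" "\<And>t. t \<in> {0..1} \<Longrightarrow> H (1, t) = v"
    "\<And>s. s \<in> {0..1} \<Longrightarrow> H (s, 1) = H (s, 0)"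
    using H0 by (simp_all add: pathstart_def pathfinish_def image_subset_iff_funcset)
  let ?D = "{0..1::real} \<times> {0..1::real}"
  have D: "convex ?D" "compact ?D" "(0, 0) \<in> ?D" by (auto intro: convex_Times compact_Times)
  have "\<eta> \<in> F (H (0, 0))" using \<eta> H(3)[of 0] l(3) by (simp add: pathstart_def)
  from flat_exists[OF D H(1,2) this] obtain E where E: "flat ?D H E" "E (0, 0) = \<eta>" by blast
  have lip: "dist (s, a) (s, b) \<le> dist a b" "dist (a, s) (b, s) \<le> dist a b" for a b s :: real
    by (simp_all add: dist_Pair_Pair)
  have I: "convex {0..1::real}" "(0::real) \<in> {0..1}" "(1::real) \<in> {0..1}" by auto
  have top: "flat {0..1} (\<lambda>_. v) (\<lambda>t. E (1, t))"
    by (rule flat_reparam[OF E(1)]) (use lip H(4) in auto)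
  have E10: "E (1, 0) \<in> F v" using flat_at[OF E(1), of "(1, 0)"] H(4)[of 0] by simp
  have const: "E (1, 1) = E (1, 0)"
    by (rule flat_unique[OF I top flat_const[OF vU E10]]) simp
  have left: "flat {0..1} (\<lambda>s. H (s, 0)) (\<lambda>s. E (s, 0))"
    and right: "flat {0..1} (\<lambda>s. H (s, 0)) (\<lambda>s. E (s, 1))"
    by (rule flat_reparam[OF E(1)]; use lip H(5) in auto)+
  \<comment> \<open>Uniqueness is used backwards, from \<open>s = 1\<close>, where the two edges
    agree by \<open>const\<close>, to \<open>s = 0\<close>.\<close>
  have loop: "E (0, 1) = E (0, 0)"
    by (rule flat_unique[OF I(1,3,2) right left]) (simp add: const)
  have bottom: "flat {0..1} \<kappa> (\<lambda>t. E (0, t))"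
    by (rule flat_reparam[OF E(1)]) (use lip H(3) in auto)
  have half: "dist (p / 2) (q / 2) \<le> dist p q" "dist (1 - p / 2) (1 - q / 2) \<le> dist p q" for p q :: real
    by (auto simp: dist_real_def)
  \<comment> \<open>The edge \<open>s = 0\<close> runs through \<open>\<gamma>\<close> on its first
    half and through \<open>\<gamma>'\<close> backwards on its second, so both end values appear at
    \<open>1 / 2\<close>.\<close>
  have "E (0, 1 / 2) = e 1"
  proof (rule flat_unique[OF I _ g(5), where e = "\<lambda>t. E (0, t / 2)"])
    show "flat {0..1} \<gamma> (\<lambda>t. E (0, t / 2))"
      by (rule flat_reparam[OF bottom _ half(1)]) (auto simp: \<kappa>_def joinpaths_def)
  qed (use E g in auto)
  moreover have "E (0, 1 - 1 / 2) = e' 1"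
  proof (rule flat_unique[OF I _ g'(5), where e = "\<lambda>t. E (0, 1 - t / 2)"])
    have "\<gamma> 1 = \<gamma>' 1" using g(4) g'(4) by (simp add: pathfinish_def)
    then show "flat {0..1} \<gamma>' (\<lambda>t. E (0, 1 - t / 2))"
      by (intro flat_reparam[OF bottom _ half(2)]) (auto simp: \<kappa>_def joinpaths_def reversepath_def)
    show "E (0, 1 - 0 / 2) = e' 0" using loop E(2) g'(6) by simp
  qed
  ultimately show ?thesis using g(7) g'(7) by simp
qed

text \<open>The path to \<open>w\<close> is prolonged by a path inside the good set. On the first
  half the lift is the old one by uniqueness, on the second it is \<open>tr w\<close> by
  \<open>flat_in_good\<close>.\<close>

lemma reaches_transport:
  assumes y: "reaches v \<eta> w y" and G: "G \<in> \<G>" "w \<in> G" "w' \<in> G"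
  shows "reaches v \<eta> w' (tr w w' y)"
proof -
  obtain \<gamma> e where g: "path \<gamma>" "path_image \<gamma> \<subseteq> U" "pathstart \<gamma> = v" "pathfinish \<gamma> = w"
    "flat {0..1} \<gamma> e" "e (0::real) = \<eta>" "e 1 = y" using y unfolding reaches_def by blast
  obtain \<sigma> where s: "path \<sigma>" "path_image \<sigma> \<subseteq> G" "pathstart \<sigma> = w" "pathfinish \<sigma> = w'"
    using good[OF G(1)] G(2,3) unfolding path_connected_def by blast
  define \<tau> where "\<tau> = \<gamma> +++ \<sigma>"
  have t: "path \<tau>" "path_image \<tau> \<subseteq> U" "pathstart \<tau> = v" "pathfinish \<tau> = w'"
    unfolding \<tau>_def using g s good[OF G(1)] by (auto intro!: path_join_imp dest!: path_image_join_subset[THEN subsetD])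
  have \<eta>: "\<eta> \<in> F (\<tau> 0)" using flat_at[OF g(5), of 0] g(3,6) t(3) by (simp add: pathstart_def)
  have "\<exists>E. flat {0..1} \<tau> E \<and> E 0 = \<eta>"
    by (rule flat_exists) (use t \<eta> in \<open>auto simp: path_def path_image_def\<close>)
  then obtain E where E: "flat {0..1} \<tau> E" "E 0 = \<eta>" by blast
  have I: "convex {0..1::real}" "(0::real) \<in> {0..1}" "(1::real) \<in> {0..1}" by auto
  have "E (1 / 2) = e 1"
  proof (rule flat_unique[OF I _ g(5), where e = "\<lambda>t. E (t / 2)"])
    show "flat {0..1} \<gamma> (\<lambda>t. E (t / 2))"
      by (rule flat_reparam[OF E(1)]) (auto simp: \<tau>_def joinpaths_def dist_real_def)
  qed (use E g in auto)
  moreover have half: "dist ((1 + p) / 2) ((1 + q) / 2) \<le> dist p q" for p q :: real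
    by (simp add: dist_real_def abs_if field_simps)
  have "E ((1 + 1) / 2) = tr w (\<sigma> 1) y"
  proof (rule flat_unique[OF I, where e = "\<lambda>t. E ((1 + t) / 2)" and e' = "\<lambda>t. tr w (\<sigma> t) y"])
    have "\<sigma> 0 = \<gamma> 1" using g(4) s(3) by (simp add: pathstart_def pathfinish_def)
    then show "flat {0..1} \<sigma> (\<lambda>t. E ((1 + t) / 2))"
      by (intro flat_reparam[OF E(1) _ half]) (auto simp: \<tau>_def joinpaths_def field_simps)
    have yF: "y \<in> F w" using flat_at[OF g(5), of 1] g(4,7) by (simp add: pathfinish_def)
    show "flat {0..1} \<sigma> (\<lambda>t. tr w (\<sigma> t) y)"
      by (rule flat_in_good[OF G(1,2) yF]) (use s(2) in \<open>simp add: path_image_def\<close>)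
    have "tr w (\<sigma> 0) y = y"
      using s(3) tr_id[OF _ yF] good[OF G(1)] G(2) by (auto simp: pathstart_def)
    then show "E ((1 + 0) / 2) = tr w (\<sigma> 0) y" using \<open>E (1 / 2) = e 1\<close> g(7) by simp
  qed
  then have "E 1 = tr w w' y" using s(4) by (simp add: pathfinish_def)
  ultimately show ?thesis unfolding reaches_def using t E by blast
qed

lemma flat_section_exists:
  assumes U: "simply_connected U" and v: "v \<in> U" "\<eta> \<in> F v"
  shows "\<exists>s. s v = \<eta> \<and> (\<forall>u\<in>U. s u \<in> F u) \<and> (\<forall>G\<in>\<G>. \<forall>w\<in>G. \<forall>w'\<in>G. s w' = tr w w' (s w))"
proof -
  have ex: "\<exists>y. reaches v \<eta> u y" if u: "u \<in> U" for u
  proof -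
    obtain \<gamma> where g: "path \<gamma>" "path_image \<gamma> \<subseteq> U" "pathstart \<gamma> = v" "pathfinish \<gamma> = u"
      using simply_connected_path_between[OF U v(1) u] by blast
    have "\<exists>E. flat {0..1} \<gamma> E \<and> E 0 = \<eta>"
      by (rule flat_exists) (use g v in \<open>auto simp: path_def path_image_def pathstart_def\<close>)
    then show ?thesis unfolding reaches_def using g by blast
  qed
  define s where "s u = (THE y. reaches v \<eta> u y)" for u
  have s: "reaches v \<eta> u y \<longleftrightarrow> y = s u" if "u \<in> U" for u y
    using ex[OF that] reaches_unique[OF U] unfolding s_def by (metis theI')
  have "reaches v \<eta> v \<eta>"
    unfolding reaches_def
  proof (intro exI conjI)
    show "path (\<lambda>_::real. v)" by (simp add: path_def)
    show "flat {0..1::real} (\<lambda>_. v) (\<lambda>_. \<eta>)" by (rule flat_const[OF v])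
  qed (use v in \<open>auto simp: path_image_def pathstart_def pathfinish_def\<close>)
  then have "s v = \<eta>" using s[OF v(1)] by simp
  moreover have "s u \<in> F u" if uU: "u \<in> U" for u
  proof -
    obtain \<gamma> e where "pathfinish \<gamma> = u" "flat {0..1} \<gamma> e" "e (1::real) = s u"
      using s[OF uU, of "s u"] unfolding reaches_def by blast
    then show ?thesis using flat_at[of "{0..1}" \<gamma> e 1] by (simp add: pathfinish_def)
  qed
  moreover have "s w' = tr w w' (s w)" if "G \<in> \<G>" "w \<in> G" "w' \<in> G" for G w w'
  proof -
    have "w \<in> U" "w' \<in> U" using good[OF that(1)] that(2,3) by auto
    then show ?thesis using reaches_transport[OF _ that, of v \<eta> "s w"] s by simp
  qed
  ultimately show ?thesis by blast
qed

end

section \<open>Existence and uniqueness\<close>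

lemma open_Pt_image: "open S \<Longrightarrow> open (Pt ` S)"
  by (simp add: open_rsphere_def image_iff)

lemma continuous_on_Pt: "continuous_on S Pt"
proof -
  have "continuous_on UNIV Pt"
    by (simp add: continuous_on_open_vimage open_rsphere_def vimage_def)
  then show ?thesis by (rule continuous_on_subset) simp
qed

fun unPt :: "rsphere \<Rightarrow> complex" where
  "unPt (Pt z) = z"
| "unPt Infty = 0"

lemma continuous_on_unPt: "continuous_on (range Pt) unPt"
proof -
  have "unPt -` B \<inter> range Pt = Pt ` B" for B by force
  then show ?thesis
    by (subst continuous_on_open_vimage) (auto intro: open_Pt_image)
qed

lemma pt_conf_upd: "pt_conf (w(i := c)) = (pt_conf w)(i := Pt c)"
  by auto

lemma unPt_pt_conf [simp]: "unPt \<circ> pt_conf w = w"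
  by auto

lemma pbox_center: "r > 0 \<Longrightarrow> w \<in> pbox w r"
  by (simp add: pbox_def)

lemma pbox_diff:
  assumes "w \<in> pbox w0 r" "w' \<in> pbox w0 r" shows "cmod (w' i - w i) < 2 * r"
proof -
  have "dist (w' i) (w i) < r + r"
    by (rule dist_triangle_less_add[where y = "w0 i"])
       (use assms in \<open>auto simp: pbox_def dist_norm norm_minus_commute\<close>)
  then show ?thesis by (simp add: dist_norm)
qed

lemma open_pt_conf_pbox:
  fixes w :: "'k::finite \<Rightarrow> complex"
  shows "open (pt_conf ` pbox w r)"
proof -
  have "pt_conf ` pbox w r = Pi\<^sub>E UNIV (\<lambda>i. Pt ` ball (w i) r)"
  proof (rule set_eqI iffI)+
    fix u assume u: "u \<in> Pi\<^sub>E UNIV (\<lambda>i. Pt ` ball (w i) r)"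
    have "\<exists>z. z \<in> ball (w i) r \<and> u i = Pt z" for i using PiE_mem[OF u, of i] by blast
    then obtain z where "\<forall>i. z i \<in> ball (w i) r \<and> u i = Pt (z i)" by metis
    then show "u \<in> pt_conf ` pbox w r"
      by (intro image_eqI[of _ _ z]) (auto simp: pbox_def dist_norm norm_minus_commute)
  qed (auto simp: pbox_def dist_norm norm_minus_commute)
  moreover have "open (Pi\<^sub>E UNIV (\<lambda>i. Pt ` ball (w i) r))"
    by (rule open_PiE) (auto intro: open_Pt_image)
  ultimately show ?thesis by simp
qed

lemma pt_conf_pbox_neighbourhood:
  fixes U :: "('k::finite \<Rightarrow> rsphere) set"
  assumes "open U" "pt_conf w \<in> U"
  shows "\<exists>r>0. pt_conf ` pbox w r \<subseteq> U"
proof -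
  have "openin (product_topology (\<lambda>i. euclidean) UNIV) U" using assms(1) by (simp add: open_fun_def)
  from product_topology_open_contains_basis[OF this assms(2)]
  obtain X where X: "pt_conf w \<in> Pi\<^sub>E UNIV X" "\<forall>i. open (X i)" "Pi\<^sub>E UNIV X \<subseteq> U" by auto
  have "\<exists>r>0. ball (w i) r \<subseteq> {z. Pt z \<in> X i}" for i
  proof -
    have "open {z. Pt z \<in> X i}" "w i \<in> {z. Pt z \<in> X i}" using X(1,2) by (auto simp: open_rsphere_def PiE_iff)
    then show ?thesis using open_contains_ball by blast
  qed
  then obtain r where r: "\<And>i. r i > 0" "\<And>i. ball (w i) (r i) \<subseteq> {z. Pt z \<in> X i}" by metis
  define m where "m = Min (range r)"
  have m: "m > 0" "m \<le> r i" for i using r(1) by (auto simp: m_def)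
  have "pt_conf u \<in> Pi\<^sub>E UNIV X" if "u \<in> pbox w m" for u
  proof -
    have "u i \<in> ball (w i) (r i)" for i
      using that m(2)[of i] by (auto simp: pbox_def dist_norm norm_minus_commute intro: order_less_le_trans)
    then have "Pt (u i) \<in> X i" for i using r(2)[of i] by blast
    then show ?thesis by (simp add: PiE_iff)
  qed
  then have "pt_conf ` pbox w m \<subseteq> U" using X(3) by (intro image_subsetI) (rule subsetD)
  then show ?thesis using m(1) by (intro exI[of _ m] conjI)
qed

lemma path_connected_pt_conf_pbox: "path_connected (pt_conf ` pbox w r)"
  unfolding path_connected_def
proof (intro ballI)
  fix a' b' assume "a' \<in> pt_conf ` pbox w r" "b' \<in> pt_conf ` pbox w r"
  then obtain a b where ab: "a' = pt_conf a" "b' = pt_conf b" "a \<in> pbox w r" "b \<in> pbox w r" by blast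
  define \<gamma> where "\<gamma> t = pt_conf (\<lambda>i. linepath (a i) (b i) t)" for t
  have "path \<gamma>"
    unfolding path_def \<gamma>_def
    by (intro continuous_on_coordinatewise_then_product continuous_on_compose2[OF continuous_on_Pt[of UNIV]]
        continuous_on_linepath) auto
  moreover have "\<gamma> t \<in> pt_conf ` pbox w r" if "t \<in> {0..1}" for t
  proof -
    have "linepath (a i) (b i) t \<in> ball (w i) r" for i
      unfolding linepath_def using ab(3,4) that
      by (intro convexD[OF convex_ball]) (auto simp: pbox_def dist_norm norm_minus_commute)
    then show ?thesis unfolding \<gamma>_def
      by (intro imageI) (auto simp: pbox_def dist_norm norm_minus_commute)
  qed
  ultimately show "\<exists>g. path g \<and> path_image g \<subseteq> pt_conf ` pbox w r \<and> pathstart g = a' \<and> pathfinish g = b'"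
    by (intro exI[of _ \<gamma>]) (auto simp: path_image_def pathstart_def pathfinish_def \<gamma>_def ab linepath_def)
qed

section \<open>Good boxes and the global section\<close>

context chiral_theory
begin

lemma converges_mono:
  fixes w :: "'k::finite \<Rightarrow> complex"
  assumes "converges \<delta> w" "\<delta>' \<le> \<delta>"
  shows "converges \<delta>' w"
proof -
  have small: "\<forall>i. cmod (x i) < \<delta>" if "\<forall>i. cmod (x i) < \<delta>'" for x :: "'k \<Rightarrow> complex"
    using that assms(2) by (auto intro: less_le_trans)
  show ?thesis
    unfolding converges_def
  proof (intro conjI ballI allI impI)
    show "line w x t \<in> conf" if "\<forall>i. cmod (x i) < \<delta>'" "t \<in> ball 0 2" for x t
      using assms(1) small[OF that(1)] that(2) by (simp add: converges_def)
    fix \<eta> and s :: "('k, 'a) hsection" assume "\<eta> \<in> dual_conf w"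
    then obtain M where "\<forall>x. (\<forall>i. cmod (x i) < \<delta>) \<longrightarrow> (\<forall>n. cmod (\<eta> (sval ((Dsec x ^^ n) s) w) / fact n) \<le> M * (1/2) ^ n)"
      using assms(1) unfolding converges_def by blast
    then show "\<exists>M. \<forall>x. (\<forall>i. cmod (x i) < \<delta>') \<longrightarrow>
        (\<forall>n. cmod (\<eta> (sval ((Dsec x ^^ n) s) w) / fact n) \<le> M * (1/2) ^ n)"
      using small by (intro exI[of _ M]) simp
  qed
qed

text \<open>Any two points of the box differ by less than \<open>2 r\<close> in each coordinate, so
  convergence of size \<open>2 r\<close> allows direct transport between them.\<close>

definition good_box :: "('k::finite \<Rightarrow> rsphere) set \<Rightarrow> ('k \<Rightarrow> complex) \<Rightarrow> real \<Rightarrow> bool" where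
  "good_box U w0 r \<longleftrightarrow> r > 0 \<and> pt_conf ` pbox w0 r \<subseteq> U \<and> pbox w0 r \<subseteq> conf \<and> (\<forall>w\<in>pbox w0 r. converges (2 * r) w)"

lemma good_box_exists:
  fixes U :: "('k::finite \<Rightarrow> rsphere) set"
  assumes codim: "finite_codim T (C_space T CARD('k))" and U: "open U" "pt_conf w0 \<in> U" and w0: "w0 \<in> conf"
  shows "\<exists>r. good_box U w0 r"
proof -
  obtain \<delta> where \<delta>: "\<delta> > 0" "\<forall>w\<in>pbox w0 \<delta>. converges \<delta> w"
    using converges_locally[OF w0 finite_spanning_exists[OF codim]] by blast
  obtain r1 where r1: "r1 > 0" "pbox w0 r1 \<subseteq> conf" using conf_pbox[OF w0] by blast
  obtain r2 where r2: "r2 > 0" "pt_conf ` pbox w0 r2 \<subseteq> U" using pt_conf_pbox_neighbourhood[OF U] by blast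
  define r where "r = min (\<delta> / 2) (min r1 r2)"
  have r: "r > 0" "2 * r \<le> \<delta>" "r \<le> \<delta>" "r \<le> r1" "r \<le> r2" using \<delta>(1) r1(1) r2(1) by (auto simp: r_def)
  have mono: "pbox w0 r \<subseteq> pbox w0 r'" if "r \<le> r'" for r' using that by (auto simp: pbox_def intro: less_le_trans)
  have "good_box U w0 r"
    unfolding good_box_def
    using r(1) mono[OF r(3)] mono[OF r(4)] mono[OF r(5)] r1(2) r2(2) \<delta>(2) converges_mono[OF _ r(2)] by blast
  then show ?thesis ..
qed

lemma good_box_parallel:
  assumes "good_box U w0 r" "w \<in> pbox w0 r" "\<eta> \<in> dual_conf w"
  shows "parallel_on (pbox w0 r) (\<lambda>u. transport w u \<eta>)"
  by (rule parallel_on_transport) (use assms pbox_diff in \<open>auto simp: good_box_def\<close>)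

text \<open>As functions of the end point both sides are parallel on the box, and they agree at
  \<open>w'\<close>; hence they agree everywhere by \<open>parallel_unique\<close>.\<close>

lemma good_box_comp:
  assumes G: "good_box U w0 r" and w: "w \<in> pbox w0 r" "w' \<in> pbox w0 r" "w'' \<in> pbox w0 r" and \<eta>: "\<eta> \<in> dual_conf w"
  shows "transport w' w'' (transport w w' \<eta>) = transport w w'' \<eta>"
proof -
  note p = good_box_parallel[OF G w(1) \<eta>]
  then have d: "transport w w' \<eta> \<in> dual_conf w'" using w(2) by (auto simp: parallel_on_def)
  have "w' \<in> conf" "converges (2 * r) w'" using G w(2) by (auto simp: good_box_def)
  then have self: "transport w' w' (transport w w' \<eta>) = transport w w' \<eta>"
    using transport_self[OF _ d] by blast
  show ?thesis
    by (rule parallel_unique[OF good_box_parallel[OF G w(2) d] p _ w(2,3) self]) (use G in \<open>simp add: good_box_def\<close>)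
qed

lemma L_op_eq_Dsec:
  fixes u :: "'k::finite \<Rightarrow> complex"
  assumes "u \<in> conf" "connection_fun (pt_conf u) i f" "\<eta> \<in> dual_fibre T (pt_conf u)"
  shows "\<eta> (L_op T f \<xi>) = \<eta> (sval (Dsec (unit_dir i) [(Const 1, \<xi>)]) u)"
  using connection_fun_L_op[OF assms, of \<xi>] by (simp add: sval_Dsec Lval_conn_field_unit)

definition horizontal :: "('k::finite \<Rightarrow> rsphere) set \<Rightarrow> ('k \<Rightarrow> ('k \<Rightarrow> rsphere) \<Rightarrow> complex \<Rightarrow> complex) \<Rightarrow>
    (('k \<Rightarrow> rsphere) \<Rightarrow> 'a \<Rightarrow> complex) \<Rightarrow> bool" where
  "horizontal U f s \<longleftrightarrow> (\<forall>\<xi>. \<forall>i. \<forall>u\<in>U. \<forall>c. u i = Pt c \<longrightarrow>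
     ((\<lambda>w. s (u(i := Pt w)) \<xi>) has_field_derivative s u (L_op T (f i u) \<xi>)) (at c))"

lemma horizontal_imp_parallel:
  fixes U :: "('k::finite \<Rightarrow> rsphere) set"
  assumes G: "good_box U w0 r" and s: "s \<in> dual_sections T U" "horizontal U f s"
    and f: "\<forall>i. \<forall>u\<in>U. connection_fun u i (f i u)"
  shows "parallel_on (pbox w0 r) (\<lambda>w. s (pt_conf w))"
  unfolding parallel_on_def
proof (intro ballI conjI allI)
  fix w i \<xi> assume w: "w \<in> pbox w0 r"
  then have wc: "w \<in> conf" and wU: "pt_conf w \<in> U" using G by (auto simp: good_box_def)
  have fib: "s (pt_conf w) \<in> dual_fibre T (pt_conf w)" using s(1) wU by (auto simp: dual_sections_def)
  then show "s (pt_conf w) \<in> dual_conf w" unfolding dual_fibre_eq_dual[OF wc] dual_conf_def by simp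
  have "((\<lambda>c. s ((pt_conf w)(i := Pt c)) \<xi>) has_field_derivative s (pt_conf w) (L_op T (f i (pt_conf w)) \<xi>)) (at (w i))"
    using s(2)[unfolded horizontal_def, THEN spec[of _ \<xi>], THEN spec[of _ i], THEN bspec[OF _ wU], THEN spec[of _ "w i"]]
    by (rule mp) simp
  then show "((\<lambda>c. s (pt_conf (w(i := c))) \<xi>) has_field_derivative
      s (pt_conf w) (sval (Dsec (unit_dir i) [(Const 1, \<xi>)]) w)) (at (w i))"
    unfolding pt_conf_upd L_op_eq_Dsec[OF wc f[rule_format, OF wU] fib] .
qed

lemma config_space_finite:
  assumes "u \<in> config_space" "\<forall>i. u i \<noteq> Infty"
  shows "unPt \<circ> u \<in> conf" "pt_conf (unPt \<circ> u) = u"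
proof -
  have P: "Pt (unPt (u i)) = u i" for i using assms(2) by (cases "u i") auto
  then show "pt_conf (unPt \<circ> u) = u" by auto
  have "inj (unPt \<circ> u)"
  proof (rule injI)
    fix x y assume "(unPt \<circ> u) x = (unPt \<circ> u) y"
    then have "Pt (unPt (u x)) = Pt (unPt (u y))" by simp
    then have "u x = u y" unfolding P .
    then show "x = y" using assms(1) unfolding config_space_def inj_def by blast
  qed
  moreover have "unPt (u i) \<noteq> 0" for i
  proof
    assume "unPt (u i) = 0"
    then have "Pt (unPt (u i)) = Pt 0" by simp
    then have "u i = Pt 0" unfolding P .
    then show False using assms(1) unfolding config_space_def by blast
  qed
  ultimately show "unPt \<circ> u \<in> conf" by (simp add: conf_def)
qed

text \<open>By \<open>parallel_unique\<close>, two solutions agree on all of a good box or nowhere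
  in it. The set of agreement and its complement in \<open>U\<close> are therefore open, and a path
  from \<open>v\<close> cannot leave the former.\<close>

lemma horizontal_unique:
  fixes U :: "('k::finite \<Rightarrow> rsphere) set"
  assumes codim: "finite_codim T (C_space T CARD('k))"
    and U: "open U" "U \<subseteq> config_space" "simply_connected U" "v \<in> U" and fin: "\<forall>u\<in>U. \<forall>i. u i \<noteq> Infty"
    and f: "\<forall>i. \<forall>u\<in>U. connection_fun u i (f i u)"
    and s: "s \<in> dual_sections T U" "horizontal U f s" and s': "s' \<in> dual_sections T U" "horizontal U f s'"
    and v: "s v = s' v"
  shows "s = s'"
proof -
  define Z where "Z = {u \<in> U. s u = s' u}"
  have local: "\<exists>B. open B \<and> u \<in> B \<and> B \<subseteq> U \<and> (B \<subseteq> Z \<or> B \<inter> Z = {})" if u: "u \<in> U" for u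
  proof -
    have w: "unPt \<circ> u \<in> conf" "pt_conf (unPt \<circ> u) = u" using config_space_finite[of u] U(2) fin u by auto
    obtain r where G: "good_box U (unPt \<circ> u) r" using good_box_exists[OF codim U(1) _ w(1)] w(2) u by auto
    let ?P = "pbox (unPt \<circ> u) r"
    have sub: "?P \<subseteq> conf" "pt_conf ` ?P \<subseteq> U" "r > 0" using G by (auto simp: good_box_def)
    have eq: "s (pt_conf b) = s' (pt_conf b)" if "a \<in> ?P" "b \<in> ?P" "s (pt_conf a) = s' (pt_conf a)" for a b
      using parallel_unique[OF horizontal_imp_parallel[OF G s f] horizontal_imp_parallel[OF G s' f] sub(1) that] .
    have "pt_conf ` ?P \<subseteq> Z \<or> pt_conf ` ?P \<inter> Z = {}"
      using eq sub(2) unfolding Z_def by blast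
    moreover have "u \<in> pt_conf ` ?P" using pbox_center[OF sub(3), of "unPt \<circ> u"] w(2) by (metis imageI)
    ultimately show ?thesis using open_pt_conf_pbox sub(2) by blast
  qed
  have "open Z" "open (U - Z)"
    by (subst open_subopen; use local in \<open>fastforce simp: Z_def\<close>)+
  have "u \<in> Z" if u: "u \<in> U" for u
  proof (rule ccontr)
    assume "u \<notin> Z"
    obtain \<gamma> where g: "path \<gamma>" "path_image \<gamma> \<subseteq> U" "pathstart \<gamma> = v" "pathfinish \<gamma> = u"
      by (rule simply_connected_path_between[OF U(3,4) u])
    have "connected (path_image \<gamma>)"
      using g(1) unfolding path_image_def path_def by (intro connected_continuous_image) auto
    moreover have "v \<in> Z \<inter> path_image \<gamma>" "u \<in> (U - Z) \<inter> path_image \<gamma>"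
      using g(3,4) v U(4) u \<open>u \<notin> Z\<close> pathstart_in_path_image[of \<gamma>] pathfinish_in_path_image[of \<gamma>] by (auto simp: Z_def)
    ultimately show False
      using connectedD[OF _ \<open>open Z\<close> \<open>open (U - Z)\<close>, of "path_image \<gamma>"] g(2) by blast
  qed
  then show ?thesis
    using s(1) s'(1) by (intro extensionalityI[of s U s']) (auto simp: dual_sections_def Z_def)
qed

text \<open>Images of good boxes serve as good sets for \<open>flat_transport\<close>. Near each
  point the resulting section is a transport series, which provides continuity and the differential
  equation.\<close>

lemma horizontal_exists:
  fixes U :: "('k::finite \<Rightarrow> rsphere) set"
  assumes codim: "finite_codim T (C_space T CARD('k))"
    and U: "open U" "U \<subseteq> config_space" "simply_connected U" "v \<in> U" and fin: "\<forall>u\<in>U. \<forall>i. u i \<noteq> Infty"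
    and f: "\<forall>i. \<forall>u\<in>U. connection_fun u i (f i u)"
    and \<eta>: "\<eta> \<in> dual_fibre T v"
  shows "\<exists>s \<in> dual_sections T U. s v = \<eta> \<and> horizontal U f s"
proof -
  define tr where "tr u u' = transport (unPt \<circ> u) (unPt \<circ> u')" for u u' :: "'k \<Rightarrow> rsphere"
  define \<G> where "\<G> = {pt_conf ` pbox w0 r | w0 r. good_box U w0 r}"
  have fin_conf: "unPt \<circ> u \<in> conf" "pt_conf (unPt \<circ> u) = u" if "u \<in> U" for u
    using config_space_finite[of u] U(2) fin that by auto
  have fibre: "dual_fibre T (pt_conf w) = dual_conf w" if "w \<in> conf" for w :: "'k \<Rightarrow> complex"
    using dual_fibre_eq_dual[OF that] unfolding dual_conf_def by blast
  have box: "\<exists>r. good_box U (unPt \<circ> u) r" if "u \<in> U" for u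
    using good_box_exists[OF codim U(1) _ fin_conf(1)[OF that]] fin_conf(2)[OF that] that by simp
  interpret flat_transport U \<G> "dual_fibre T" tr
  proof
    show "open G \<and> path_connected G \<and> G \<subseteq> U" if "G \<in> \<G>" for G
      using that open_pt_conf_pbox path_connected_pt_conf_pbox by (auto simp: \<G>_def good_box_def)
    show "\<exists>G\<in>\<G>. u \<in> G" if u: "u \<in> U" for u
    proof -
      obtain r where G: "good_box U (unPt \<circ> u) r" using box[OF u] by blast
      then have "unPt \<circ> u \<in> pbox (unPt \<circ> u) r" by (intro pbox_center) (simp add: good_box_def)
      then have "u \<in> pt_conf ` pbox (unPt \<circ> u) r" using fin_conf(2)[OF u] by (metis imageI)
      then show ?thesis using G unfolding \<G>_def by blast
    qed
    show "tr w w x = x" if wU: "w \<in> U" and xF: "x \<in> dual_fibre T w" for w x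
    proof -
      have x: "x \<in> dual_conf (unPt \<circ> w)" using xF fibre[OF fin_conf(1)[OF wU]] fin_conf(2)[OF wU] by simp
      obtain r where "good_box U (unPt \<circ> w) r" using box[OF wU] by blast
      then have "converges (2 * r) (unPt \<circ> w)" by (simp add: good_box_def pbox_center)
      then show ?thesis unfolding tr_def using transport_self[OF fin_conf(1)[OF wU] x] by blast
    qed
    fix G w w' x assume G: "G \<in> \<G>" "w \<in> G" "w' \<in> G" "x \<in> dual_fibre T w"
    then obtain w0 r a b where B: "good_box U w0 r" "G = pt_conf ` pbox w0 r"
      and ab: "w = pt_conf a" "w' = pt_conf b" "a \<in> pbox w0 r" "b \<in> pbox w0 r" unfolding \<G>_def by blast
    have conf: "a \<in> conf" "b \<in> conf" using B(1) ab(3,4) by (auto simp: good_box_def)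
    have x: "x \<in> dual_conf a" using G(4) fibre[OF conf(1)] ab(1) by simp
    show "tr w w' x \<in> dual_fibre T w'"
      using good_box_parallel[OF B(1) ab(3) x] ab(4) unfolding ab(1,2) fibre[OF conf(2)] tr_def
      by (simp add: parallel_on_def)
    show "tr w' w'' (tr w w' x) = tr w w'' x" if w3: "w'' \<in> G" for w''
    proof -
      obtain c where "w'' = pt_conf c" "c \<in> pbox w0 r" using w3 B(2) by blast
      then show ?thesis using good_box_comp[OF B(1) ab(3,4) _ x, of c] by (simp add: tr_def ab(1,2))
    qed
  qed
  obtain s0 where s0: "s0 v = \<eta>" "\<forall>u\<in>U. s0 u \<in> dual_fibre T u"
    "\<forall>G\<in>\<G>. \<forall>w\<in>G. \<forall>w'\<in>G. s0 w' = tr w w' (s0 w)"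
    using flat_section_exists[OF U(3,4) \<eta>] by blast
  define s where "s = restrict s0 U"
  have sU: "s u = s0 u" if "u \<in> U" for u using that by (simp add: s_def)
  have local: "\<exists>w0 r. u = pt_conf w0 \<and> good_box U w0 r \<and> s u \<in> dual_conf w0 \<and>
      (\<forall>w\<in>pbox w0 r. s (pt_conf w) = transport w0 w (s u))" if u: "u \<in> U" for u
  proof -
    let ?w = "unPt \<circ> u"
    obtain r where r: "good_box U ?w r" using box[OF u] by blast
    have G: "pt_conf ` pbox ?w r \<in> \<G>" using r unfolding \<G>_def by blast
    have uG: "u \<in> pt_conf ` pbox ?w r"
      using fin_conf(2)[OF u] pbox_center[of r ?w] r unfolding good_box_def by (metis imageI)
    have "s (pt_conf w) = transport ?w w (s u)" if w: "w \<in> pbox ?w r" for w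
    proof -
      have "pt_conf w \<in> U" using w r unfolding good_box_def by blast
      then show ?thesis
        using s0(3)[THEN bspec[OF _ G], THEN bspec[OF _ uG], THEN bspec[OF _ imageI[OF w]]] sU u
        by (simp add: tr_def)
    qed
    moreover have "s u \<in> dual_conf ?w"
      using s0(2)[THEN bspec[OF _ u]] fibre[OF fin_conf(1)[OF u]] fin_conf(2)[OF u] sU[OF u] by simp
    ultimately show ?thesis using fin_conf(2)[OF u] r by (intro exI[of _ ?w] exI[of _ r]) simp
  qed
  have der: "((\<lambda>w. s (u(i := Pt w)) \<xi>) has_field_derivative s u (L_op T (f i u) \<xi>)) (at c)"
    if u: "u \<in> U" and c: "u i = Pt c" for \<xi> i u c
  proof -
    obtain w0 r where w0: "u = pt_conf w0" and r: "good_box U w0 r" and d: "s u \<in> dual_conf w0"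
      and eq: "\<forall>w\<in>pbox w0 r. s (pt_conf w) = transport w0 w (s u)" using local[OF u] by blast
    have rp: "r > 0" "w0 \<in> pbox w0 r" using r pbox_center by (auto simp: good_box_def)
    have wc: "w0 \<in> conf" using r rp(2) by (auto simp: good_box_def)
    have ci: "c = w0 i" using c w0 by simp
    have self: "transport w0 w0 (s u) = s u" using eq[THEN bspec[OF _ rp(2)]] w0 by simp
    have L: "s u (L_op T (f i u) \<xi>) = s u (sval (Dsec (unit_dir i) [(Const 1, \<xi>)]) w0)"
      unfolding w0 by (rule L_op_eq_Dsec[OF wc]) (use f u d fibre[OF wc] w0 in auto)
    have "((\<lambda>c. transport w0 (w0(i := c)) (s u) \<xi>) has_field_derivative
        transport w0 w0 (s u) (sval (Dsec (unit_dir i) [(Const 1, \<xi>)]) w0)) (at (w0 i))"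
      using good_box_parallel[OF r rp(2) d] rp(2) unfolding parallel_on_def by simp
    then have D: "((\<lambda>c. transport w0 (w0(i := c)) (s u) \<xi>) has_field_derivative s u (L_op T (f i u) \<xi>)) (at (w0 i))"
      unfolding self L .
    show ?thesis
      unfolding ci
    proof (rule has_field_derivative_transform_within_open[OF D, of "ball (w0 i) r"])
      fix c assume "c \<in> ball (w0 i) r"
      then have mem: "w0(i := c) \<in> pbox w0 r" using rp(1) by (auto simp: pbox_def dist_norm norm_minus_commute)
      have "s (u(i := Pt c)) = transport w0 (w0(i := c)) (s u)"
        using eq[THEN bspec[OF _ mem]] unfolding pt_conf_upd w0[symmetric] .
      then show "transport w0 (w0(i := c)) (s u) \<xi> = s (u(i := Pt c)) \<xi>" by (simp only:)
    qed (use rp(1) in auto)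
  qed
  have cont: "continuous_on U (\<lambda>u. s u \<xi>)" for \<xi>
  proof -
    define \<B> where "\<B> = {B. open B \<and> B \<subseteq> U \<and> continuous_on B (\<lambda>u. s u \<xi>)}"
    have "u \<in> \<Union>\<B>" if u: "u \<in> U" for u
    proof -
      obtain w0 r where w0: "u = pt_conf w0" and r: "good_box U w0 r" and d: "s u \<in> dual_conf w0"
        and eq: "\<forall>w\<in>pbox w0 r. s (pt_conf w) = transport w0 w (s u)" using local[OF u] by blast
      have rp: "r > 0" "w0 \<in> pbox w0 r" using r pbox_center by (auto simp: good_box_def)
      have wc: "w0 \<in> conf" "converges (2 * r) w0" using r rp(2) by (auto simp: good_box_def)
      let ?B = "pt_conf ` pbox w0 r"
      have "continuous_on ?B (\<lambda>u'. unPt \<circ> u')"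
        unfolding o_def
        by (intro continuous_on_coordinatewise_then_product continuous_on_compose2[OF continuous_on_unPt]
            continuous_on_product_coordinates[THEN continuous_on_subset]) auto
      then have "continuous_on ?B (\<lambda>u'. transport w0 (unPt \<circ> u') (s u) \<xi>)"
        by (rule continuous_on_compose2[OF transport_continuous[OF wc(1) d wc(2), of \<xi>]])
           (use rp(1) in \<open>force simp: pbox_def o_def intro: less_trans\<close>)
      then have "continuous_on ?B (\<lambda>u. s u \<xi>)"
        by (rule continuous_on_eq) (use eq in auto)
      then have "?B \<in> \<B>" using open_pt_conf_pbox[of w0 r] r by (simp add: \<B>_def good_box_def)
      then show ?thesis using w0 rp(2) by blast
    qed
    then have "U = \<Union>\<B>" by (auto simp: \<B>_def)
    moreover have "continuous_on (\<Union>\<B>) (\<lambda>u. s u \<xi>)" by (rule continuous_on_open_Union) (auto simp: \<B>_def)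
    ultimately show ?thesis by simp
  qed
  have "holo_sphere U (\<lambda>u. s u \<xi>)" for \<xi>
    unfolding holo_sphere_def
  proof (intro conjI cont ballI allI)
    fix u i assume u: "u \<in> U"
    obtain c where c: "u i = Pt c" using fin u by (cases "u i") auto
    \<comment> \<open>At a finite point the chart is the translation by \<open>c\<close>, so its
      origin corresponds to \<open>c\<close>.\<close>
    have "((\<lambda>w. s (u(i := Pt w)) \<xi>) has_field_derivative s u (L_op T (f i u) \<xi>)) (at (0 + c))"
      using der[OF u c] by simp
    then show "(\<lambda>w. s (u(i := chart (u i) w)) \<xi>) field_differentiable at 0"
      unfolding field_differentiable_def DERIV_shift by (auto simp: c add.commute)
  qed
  moreover have "s u \<in> dual_fibre T u" if "u \<in> U" for u using s0(2) sU that by simp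
  ultimately have "s \<in> dual_sections T U" by (simp add: dual_sections_def s_def)
  moreover have "s v = \<eta>" using s0(1) sU U(4) by simp
  moreover have "horizontal U f s" unfolding horizontal_def using der by blast
  ultimately show ?thesis by blast
qed

end

theorem theorem9:
  fixes T :: "('h::ab_group_add, 'b) chiral_data_scheme"
    and U :: "('k::finite \<Rightarrow> rsphere) set"
    and v :: "'k \<Rightarrow> rsphere"
    and f :: "'k \<Rightarrow> ('k \<Rightarrow> rsphere) \<Rightarrow> complex \<Rightarrow> complex"
    and \<eta> :: "'h \<Rightarrow> complex"
  assumes "chiral_theory T"
    and "finite_codim T (C_space T CARD('k))"
    and "v \<in> config_space"
    and "open U" and "U \<subseteq> config_space" and "v \<in> U" and "simply_connected U"
    and finite_points: "\<forall>u\<in>U. \<forall>i. u i \<noteq> Infty"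
    and "\<forall>i. \<forall>u\<in>U. connection_fun u i (f i u)"
    and "\<eta> \<in> dual_fibre T v"
  shows "\<exists>!s. s \<in> dual_sections T U \<and> s v = \<eta> \<and>
           (\<forall>\<xi>. \<forall>i. \<forall>u\<in>U. \<forall>c. u i = Pt c \<longrightarrow>
              ((\<lambda>w. s (u(i := Pt w)) \<xi>) has_field_derivative s u (L_op T (f i u) \<xi>)) (at c))"
proof -
  interpret chiral_theory T by fact
  have "\<exists>!s. s \<in> dual_sections T U \<and> s v = \<eta> \<and> horizontal U f s"
  proof (rule ex_ex1I)
    show "\<exists>s. s \<in> dual_sections T U \<and> s v = \<eta> \<and> horizontal U f s"
      using horizontal_exists[OF assms(2,4,5,7,6) finite_points assms(9,10)] by blast
    show "s = s'" if "s \<in> dual_sections T U \<and> s v = \<eta> \<and> horizontal U f s"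
        "s' \<in> dual_sections T U \<and> s' v = \<eta> \<and> horizontal U f s'" for s s'
      by (rule horizontal_unique[OF assms(2,4,5,7,6) finite_points assms(9)]) (use that in auto)
  qed
  then show ?thesis unfolding horizontal_def .
qed

end
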